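(* Let $X,m,A$ be as in the context, suppose that $q_A>2$ and set $\alpha_0=\frac{2(q_A-1)}{q_A}\in(1,2)$. Let $\alpha\in(1,\alpha_0)$, $\gamma=1/\alpha$, $T>0$, and let $f\in C^1(\mathbb R)$ satisfy: $f(0)=0$ and there exist two monotone increasing real-valued functions $Q_1,Q_2\ge0$ such that $|f'(s)|\le Q_1(|s|)$ and $|f(s)|\le Q_2(|s|)$ for all $s\in\mathbb R$. Then every weak solution on $(0,T)$ of $$\mathbb D_t^\alpha u(x,t)+Au(x,t)=f(u(x,t))\ \text{ in } X\times(0,T),\qquad u(\cdot,0)=u_0,\quad\partial_tu(\cdot,0)=u_1\ \text{ in }X, \quad (\ast)$$ is a strong (energy) solution, i.e. it also satisfies $\mathbb D_t^\alpha u\in L^1((0,T);L^2(X))$ and $u\in L^1((0,T);D(A))$ (so that the equation holds pointwise a.e. in $X\times(0,T)$). If in addition $u_0\in V_\sigma$ for some $\sigma>\frac1\alpha$ and $u_1\in V_\beta$ for some $\beta>\frac{\alpha-1}\alpha$, then the strong solution also obeys $$u\in W^{2,1}((0,T);L^2(X)),$$ and the initial conditions are also satisfied in the sense $$\lim_{t\to0^+}\|u(\cdot,t)-u_0\|_{V_\gamma}=0,\qquad\lim_{t\to0^+}\|\partial_tu(\cdot,t)-u_1\|_{L^2(X)}=0.$$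
   Context: Setting. $X$ is a relatively compact metric space and $m$ is a Radon measure on $X$ with $\mathrm{supp}(m)=X$ and $m(X)<\infty$; $L^p(X)=L^p(X,m)$ (real-valued), and $(\cdot,\cdot)$ is the inner product of $L^2(X)$; "a.e. in $X$" means $m$-a.e. A Dirichlet form on $L^2(X)$ is a symmetric, non-negative, bilinear form $\mathcal E_A:V_{1/2}\times V_{1/2}\to\mathbb R$ whose domain $V_{1/2}=D(\mathcal E_A)$ is a dense linear subspace of $L^2(X)$, which is closed ($V_{1/2}$ is complete for the inner product $\mathcal E_A(u,v)+\lambda(u,v)$, $\lambda>0$) and Markovian: for each $\epsilon>0$ there is $\phi_\epsilon\in C^\infty(\mathbb R)$ with $\phi_\epsilon(t)=t$ on $[0,1]$, $-\epsilon\le\phi_\epsilon\le1+\epsilon$, $0\le\phi_\epsilon(t)-\phi_\epsilon(\tau)\le t-\tau$ for $\tau<t$, such that $u\in V_{1/2}$ implies $\phi_\epsilon(u)\in V_{1/2}$ and $\mathcal E_A(\phi_\epsilon(u),\phi_\epsilon(u))\le\mathcal E_A(u,u)$. Assumptions on $A$. $A$ is the non-negative self-adjoint operator on $L^2(X)$ associated with a Dirichlet form $\mathcal E_A$, i.e. $V_{1/2}=D(A^{1/2})$ and $\mathcal E_A(u,v)=(Au,v)$ for $u\in D(A)$, $v\in V_{1/2}$. It is assumed that $V_{1/2}$ embeds compactly in $L^2(X)$ and that $V_{1/2}\hookrightarrow L^{2q_A}(X)$ continuously for some $q_A>1$. Then $A$ has discrete spectrum $\lambda_1\le\lambda_2\le\dots\to+\infty$;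 throughout, $\lambda_1>0$. $(\varphi_n)_{n\in\mathbb N}$ is an orthonormal basis of $L^2(X)$ of eigenfunctions, $A\varphi_n=\lambda_n\varphi_n$. When $q_A>2$ and $1<\alpha<\alpha_0$, it is known that $V_{1/\alpha}\hookrightarrow L^\infty(X)$. Spaces. For $s\ge0$, $V_s:=D(A^s)=\{h\in L^2(X):\sum_n|(h,\varphi_n)|^2\lambda_n^{2s}<\infty\}$, with norm $\|h\|_{V_s}=(\sum_n|(h,\varphi_n)|^2\lambda_n^{2s})^{1/2}$. Identifying $L^2(X)$ with its dual, $V_{-s}:=(V_s)^*$, with norm $(\sum_n|\langle h,\varphi_n\rangle|^2\lambda_n^{-2s})^{1/2}$; $\langle\cdot,\cdot\rangle_{V_{-s},V_s}$ is the duality bracket. Caputo derivative: $\mathbb D_t^\alpha u(x,t)=\frac1{\Gamma(2-\alpha)}\int_0^t(t-s)^{1-\alpha}\partial_s^2u(x,s)\,ds$, which for sufficiently smooth $u$ is equivalent to the weaker form $\frac{1}{\Gamma(2-\alpha)}\partial_t^2\int_0^t(t-s)^{1-\alpha}\big(u(x,s)-u(x,0)-s\,\partial_su(x,0)\big)ds$ (which requires less smoothness of $u$). Weak solution of $(\ast)$ on $(0,T)$: a function $u$ with (1) $u\in C([0,T];V_\gamma)\cap C^1([0,T];L^2(X))$ and $\mathbb D_t^\alpha u\in C([0,T];V_{-\gamma})$; (2) $u(\cdot,0)=u_0$, $\partial_tu(\cdot,0)=u_1$ a.e. in $X$, and $\lim_{t\to0^+}\|u(\cdot,t)-u_0\|_{V_\sigma}=0$,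 $\lim_{t\to0^+}\|\partial_tu(\cdot,t)-u_1\|_{V_{-\beta}}=0$ for some $\frac1\alpha>\sigma\ge0$ and $1-\frac1\alpha\ge\beta>0$; (3) for every $\varphi\in V_\gamma$ and a.e. $t\in(0,T)$, $\langle\mathbb D_t^\alpha u(\cdot,t),\varphi\rangle_{V_{-\gamma},V_\gamma}+\mathcal E_A(u(\cdot,t),\varphi)=(f(u(\cdot,t)),\varphi)$. *)

theory Defs
  imports "HOL-Analysis.Analysis"
begin

text \<open>
  Function spaces are rendered as sets of functions carrying a seminorm: an element of
  \<open>L\<^sup>2(X)\<close> is a square integrable function, and equality in \<open>L\<^sup>2(X)\<close> is equality almost
  everywhere.  Elements of a dual space are functionals on such functions.  Both kinds of
  objects have a type of the form \<open>'b \<Rightarrow> real\<close> with pointwise vector operations, so the notions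
  of vector-valued calculus below are stated once, for a set \<open>V\<close> of functions \<open>'b \<Rightarrow> real\<close>
  with seminorm \<open>N\<close>.
\<close>

definition C0_into :: "('b \<Rightarrow> real) set \<Rightarrow> (('b \<Rightarrow> real) \<Rightarrow> real) \<Rightarrow> real \<Rightarrow> (real \<Rightarrow> 'b \<Rightarrow> real) \<Rightarrow> bool" where
  "C0_into V N T u \<longleftrightarrow>
     (\<forall>t\<in>{0..T}. u t \<in> V \<and> ((\<lambda>s. N (\<lambda>y. u s y - u t y)) \<longlongrightarrow> 0) (at t within {0..T}))"

definition has_deriv_into ::
  "('b \<Rightarrow> real) set \<Rightarrow> (('b \<Rightarrow> real) \<Rightarrow> real) \<Rightarrow> (real \<Rightarrow> 'b \<Rightarrow> real) \<Rightarrow> ('b \<Rightarrow> real) \<Rightarrow> real \<Rightarrow> real set \<Rightarrow> bool" where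
  "has_deriv_into V N u v t S \<longleftrightarrow>
     v \<in> V \<and> (\<forall>s\<in>S. u s \<in> V) \<and>
     ((\<lambda>s. N (\<lambda>y. (u s y - u t y) / (s - t) - v y)) \<longlongrightarrow> 0) (at t within S)"

text \<open>\<open>u\<close> belongs to \<open>C\<^sup>1([0,T];V)\<close> with derivative \<open>v\<close> (one-sided at the end points).\<close>

definition C1_into ::
  "('b \<Rightarrow> real) set \<Rightarrow> (('b \<Rightarrow> real) \<Rightarrow> real) \<Rightarrow> real \<Rightarrow> (real \<Rightarrow> 'b \<Rightarrow> real) \<Rightarrow> (real \<Rightarrow> 'b \<Rightarrow> real) \<Rightarrow> bool" where
  "C1_into V N T u v \<longleftrightarrow>
     C0_into V N T u \<and> C0_into V N T v \<and> (\<forall>t\<in>{0..T}. has_deriv_into V N u (v t) t {0..T})"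

definition simple_into :: "('b \<Rightarrow> real) set \<Rightarrow> real \<Rightarrow> (real \<Rightarrow> 'b \<Rightarrow> real) \<Rightarrow> bool" where
  "simple_into V T S \<longleftrightarrow>
     finite (S ` {0<..<T}) \<and> S ` {0<..<T} \<subseteq> V \<and> (\<forall>v. {t\<in>{0<..<T}. S t = v} \<in> sets lebesgue)"

text \<open>The Bochner space \<open>L\<^sup>1((0,T);V)\<close>: strong measurability and integrability of the norm.\<close>

definition L1_into :: "('b \<Rightarrow> real) set \<Rightarrow> (('b \<Rightarrow> real) \<Rightarrow> real) \<Rightarrow> real \<Rightarrow> (real \<Rightarrow> 'b \<Rightarrow> real) \<Rightarrow> bool" where
  "L1_into V N T u \<longleftrightarrow>
     (AE t in lebesgue. t \<in> {0<..<T} \<longrightarrow> u t \<in> V) \<and>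
     (\<exists>S. (\<forall>n::nat. simple_into V T (S n)) \<and>
          (AE t in lebesgue. t \<in> {0<..<T} \<longrightarrow> (\<lambda>n. N (\<lambda>y. u t y - S n t y)) \<longlonglongrightarrow> 0)) \<and>
     set_integrable lebesgue {0<..<T} (\<lambda>t. N (u t))"

definition smooth_real :: "(real \<Rightarrow> real) \<Rightarrow> bool" where
  "smooth_real g \<longleftrightarrow> (\<forall>n. (deriv ^^ n) g differentiable_on UNIV)"


definition radon_measure_on :: "'a::metric_space set \<Rightarrow> 'a measure \<Rightarrow> bool" where
  "radon_measure_on X M \<longleftrightarrow>
     space M = X \<and> sets M = sets (restrict_space borel X) \<and>
     (\<forall>K. K \<subseteq> X \<and> compact K \<longrightarrow> emeasure M K < \<infinity>) \<and>
     (\<forall>B\<in>sets M. emeasure M B = (SUP K\<in>{K. K \<subseteq> B \<and> compact K}. emeasure M K))"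

definition measure_support :: "'a::metric_space measure \<Rightarrow> 'a set" where
  "measure_support M =
     {x\<in>space M. \<forall>U. openin (top_of_set (space M)) U \<and> x \<in> U \<longrightarrow> 0 < emeasure M U}"

definition L2 :: "'a measure \<Rightarrow> ('a \<Rightarrow> real) set" where
  "L2 M = {h \<in> borel_measurable M. integrable M (\<lambda>x. (h x)\<^sup>2)}"

definition L2_inner :: "'a measure \<Rightarrow> ('a \<Rightarrow> real) \<Rightarrow> ('a \<Rightarrow> real) \<Rightarrow> real" where
  "L2_inner M g h = (\<integral>x. g x * h x \<partial>M)"

definition L2_norm :: "'a measure \<Rightarrow> ('a \<Rightarrow> real) \<Rightarrow> real" where
  "L2_norm M h = sqrt (L2_inner M h h)"

text \<open>A linear subspace of \<open>L\<^sup>2(X)\<close>, as a set of functions closed under almost everywhere equality.\<close>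

definition L2_subspace :: "'a measure \<Rightarrow> ('a \<Rightarrow> real) set \<Rightarrow> bool" where
  "L2_subspace M D \<longleftrightarrow>
     D \<subseteq> L2 M \<and> (\<lambda>x. 0) \<in> D \<and>
     (\<forall>u\<in>D. \<forall>v\<in>D. (\<lambda>x. u x + v x) \<in> D) \<and>
     (\<forall>c. \<forall>u\<in>D. (\<lambda>x. c * u x) \<in> D) \<and>
     (\<forall>u\<in>D. \<forall>v\<in>L2 M. (AE x in M. u x = v x) \<longrightarrow> v \<in> D)"

definition L2_dense :: "'a measure \<Rightarrow> ('a \<Rightarrow> real) set \<Rightarrow> bool" where
  "L2_dense M D \<longleftrightarrow> (\<forall>h\<in>L2 M. \<forall>\<epsilon>>0. \<exists>u\<in>D. L2_norm M (\<lambda>x. h x - u x) < \<epsilon>)"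


text \<open>The norm of the inner product \<open>E(u,v) + \<lambda>(u,v)\<close>.\<close>

definition form_norm :: "'a measure \<Rightarrow> (('a \<Rightarrow> real) \<Rightarrow> ('a \<Rightarrow> real) \<Rightarrow> real) \<Rightarrow> real \<Rightarrow> ('a \<Rightarrow> real) \<Rightarrow> real" where
  "form_norm M E l u = sqrt (E u u + l * L2_inner M u u)"

definition closed_form ::
  "'a measure \<Rightarrow> ('a \<Rightarrow> real) set \<Rightarrow> (('a \<Rightarrow> real) \<Rightarrow> ('a \<Rightarrow> real) \<Rightarrow> real) \<Rightarrow> bool" where
  "closed_form M D E \<longleftrightarrow>
     (\<forall>l>0. \<forall>w :: nat \<Rightarrow> 'a \<Rightarrow> real.
        (\<forall>n. w n \<in> D) \<and>
        (\<forall>\<epsilon>>0. \<exists>k. \<forall>i\<ge>k. \<forall>j\<ge>k. form_norm M E l (\<lambda>x. w i x - w j x) < \<epsilon>)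
        \<longrightarrow> (\<exists>u\<in>D. (\<lambda>n. form_norm M E l (\<lambda>x. w n x - u x)) \<longlonglongrightarrow> 0))"

definition markovian_form ::
  "('a \<Rightarrow> real) set \<Rightarrow> (('a \<Rightarrow> real) \<Rightarrow> ('a \<Rightarrow> real) \<Rightarrow> real) \<Rightarrow> bool" where
  "markovian_form D E \<longleftrightarrow>
     (\<forall>\<epsilon>>0. \<exists>\<phi>::real \<Rightarrow> real. smooth_real \<phi> \<and>
        (\<forall>t\<in>{0..1}. \<phi> t = t) \<and>
        (\<forall>t. - \<epsilon> \<le> \<phi> t \<and> \<phi> t \<le> 1 + \<epsilon>) \<and>
        (\<forall>\<tau> t. \<tau> < t \<longrightarrow> 0 \<le> \<phi> t - \<phi> \<tau> \<and> \<phi> t - \<phi> \<tau> \<le> t - \<tau>) \<and>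
        (\<forall>u\<in>D. (\<lambda>x. \<phi> (u x)) \<in> D \<and> E (\<lambda>x. \<phi> (u x)) (\<lambda>x. \<phi> (u x)) \<le> E u u))"

text \<open>The compatibility with almost everywhere equality says that \<open>E\<close> is a form on classes.\<close>

definition dirichlet_form ::
  "'a measure \<Rightarrow> ('a \<Rightarrow> real) set \<Rightarrow> (('a \<Rightarrow> real) \<Rightarrow> ('a \<Rightarrow> real) \<Rightarrow> real) \<Rightarrow> bool" where
  "dirichlet_form M D E \<longleftrightarrow>
     L2_subspace M D \<and> L2_dense M D \<and>
     (\<forall>u\<in>D. \<forall>u'\<in>D. \<forall>v\<in>D. (AE x in M. u x = u' x) \<longrightarrow> E u v = E u' v) \<and>
     (\<forall>u\<in>D. \<forall>v\<in>D. E u v = E v u) \<and>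
     (\<forall>u\<in>D. \<forall>v\<in>D. \<forall>w\<in>D. E (\<lambda>x. u x + v x) w = E u w + E v w) \<and>
     (\<forall>c. \<forall>u\<in>D. \<forall>v\<in>D. E (\<lambda>x. c * u x) v = c * E u v) \<and>
     (\<forall>u\<in>D. 0 \<le> E u u) \<and>
     closed_form M D E \<and> markovian_form D E"

definition L2_operator :: "'a measure \<Rightarrow> ('a \<Rightarrow> real) set \<Rightarrow> (('a \<Rightarrow> real) \<Rightarrow> 'a \<Rightarrow> real) \<Rightarrow> bool" where
  "L2_operator M D A \<longleftrightarrow>
     L2_subspace M D \<and> (\<forall>u\<in>D. A u \<in> L2 M) \<and>
     (\<forall>u\<in>D. \<forall>u'\<in>D. (AE x in M. u x = u' x) \<longrightarrow> (AE x in M. A u x = A u' x)) \<and>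
     (\<forall>u\<in>D. \<forall>v\<in>D. AE x in M. A (\<lambda>y. u y + v y) x = A u x + A v x) \<and>
     (\<forall>c. \<forall>u\<in>D. AE x in M. A (\<lambda>y. c * u y) x = c * A u x)"

text \<open>The last clause of self-adjointness is \<open>D(A\<^sup>*) \<subseteq> D(A)\<close>.\<close>

definition selfadjoint_operator ::
  "'a measure \<Rightarrow> ('a \<Rightarrow> real) set \<Rightarrow> (('a \<Rightarrow> real) \<Rightarrow> 'a \<Rightarrow> real) \<Rightarrow> bool" where
  "selfadjoint_operator M D A \<longleftrightarrow>
     L2_operator M D A \<and> L2_dense M D \<and>
     (\<forall>u\<in>D. \<forall>v\<in>D. L2_inner M (A u) v = L2_inner M u (A v)) \<and>
     (\<forall>v\<in>L2 M. (\<exists>w\<in>L2 M. \<forall>u\<in>D. L2_inner M (A u) v = L2_inner M u w) \<longrightarrow> v \<in> D)"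

definition nonneg_operator ::
  "'a measure \<Rightarrow> ('a \<Rightarrow> real) set \<Rightarrow> (('a \<Rightarrow> real) \<Rightarrow> 'a \<Rightarrow> real) \<Rightarrow> bool" where
  "nonneg_operator M D A \<longleftrightarrow> (\<forall>u\<in>D. 0 \<le> L2_inner M (A u) u)"

definition compactly_embedded_L2 ::
  "'a measure \<Rightarrow> ('a \<Rightarrow> real) set \<Rightarrow> (('a \<Rightarrow> real) \<Rightarrow> ('a \<Rightarrow> real) \<Rightarrow> real) \<Rightarrow> bool" where
  "compactly_embedded_L2 M D E \<longleftrightarrow>
     (\<forall>w :: nat \<Rightarrow> 'a \<Rightarrow> real. (\<forall>n. w n \<in> D) \<and> (\<exists>C. \<forall>n. form_norm M E 1 (w n) \<le> C)
        \<longrightarrow> (\<exists>r h. strict_mono r \<and> h \<in> L2 M \<and> (\<lambda>n. L2_norm M (\<lambda>x. w (r n) x - h x)) \<longlonglongrightarrow> 0))"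

definition continuously_embedded_Lp ::
  "'a measure \<Rightarrow> ('a \<Rightarrow> real) set \<Rightarrow> (('a \<Rightarrow> real) \<Rightarrow> ('a \<Rightarrow> real) \<Rightarrow> real) \<Rightarrow> real \<Rightarrow> bool" where
  "continuously_embedded_Lp M D E p \<longleftrightarrow>
     (\<exists>C. \<forall>u\<in>D. integrable M (\<lambda>x. \<bar>u x\<bar> powr p) \<and>
        (\<integral>x. \<bar>u x\<bar> powr p \<partial>M) powr (1 / p) \<le> C * form_norm M E 1 u)"

definition orthonormal_basis :: "'a measure \<Rightarrow> (nat \<Rightarrow> 'a \<Rightarrow> real) \<Rightarrow> bool" where
  "orthonormal_basis M \<phi> \<longleftrightarrow>
     (\<forall>n. \<phi> n \<in> L2 M) \<and>
     (\<forall>i j. L2_inner M (\<phi> i) (\<phi> j) = (if i = j then 1 else 0)) \<and>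
     (\<forall>h\<in>L2 M. (\<lambda>k. L2_norm M (\<lambda>x. h x - (\<Sum>n<k. L2_inner M h (\<phi> n) * \<phi> n x))) \<longlonglongrightarrow> 0)"


text \<open>The eigenfunctions \<open>\<phi>\<close> and eigenvalues \<open>lam\<close> are indexed from 0.\<close>

definition Vsp :: "'a measure \<Rightarrow> (nat \<Rightarrow> 'a \<Rightarrow> real) \<Rightarrow> (nat \<Rightarrow> real) \<Rightarrow> real \<Rightarrow> ('a \<Rightarrow> real) set" where
  "Vsp M \<phi> lam s = {h \<in> L2 M. summable (\<lambda>n. (L2_inner M h (\<phi> n))\<^sup>2 * lam n powr (2 * s))}"

definition Vnorm :: "'a measure \<Rightarrow> (nat \<Rightarrow> 'a \<Rightarrow> real) \<Rightarrow> (nat \<Rightarrow> real) \<Rightarrow> real \<Rightarrow> ('a \<Rightarrow> real) \<Rightarrow> real" where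
  "Vnorm M \<phi> lam s h = sqrt (\<Sum>n. (L2_inner M h (\<phi> n))\<^sup>2 * lam n powr (2 * s))"

text \<open>
  The dual \<open>V\<^sub>-\<^sub>s\<close> of \<open>V\<^sub>s\<close>: the bounded linear functionals on \<open>V\<^sub>s\<close> (their values outside
  \<open>V\<^sub>s\<close> are irrelevant); the duality bracket is application.
\<close>

definition Vdual ::
  "'a measure \<Rightarrow> (nat \<Rightarrow> 'a \<Rightarrow> real) \<Rightarrow> (nat \<Rightarrow> real) \<Rightarrow> real \<Rightarrow> (('a \<Rightarrow> real) \<Rightarrow> real) set" where
  "Vdual M \<phi> lam s = {F.
     (\<forall>g\<in>Vsp M \<phi> lam s. \<forall>h\<in>Vsp M \<phi> lam s. F (\<lambda>x. g x + h x) = F g + F h) \<and>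
     (\<forall>c. \<forall>h\<in>Vsp M \<phi> lam s. F (\<lambda>x. c * h x) = c * F h) \<and>
     (\<exists>C. \<forall>h\<in>Vsp M \<phi> lam s. \<bar>F h\<bar> \<le> C * Vnorm M \<phi> lam s h)}"

definition Vdual_norm ::
  "(nat \<Rightarrow> 'a \<Rightarrow> real) \<Rightarrow> (nat \<Rightarrow> real) \<Rightarrow> real \<Rightarrow> (('a \<Rightarrow> real) \<Rightarrow> real) \<Rightarrow> real" where
  "Vdual_norm \<phi> lam s F = sqrt (\<Sum>n. (F (\<phi> n))\<^sup>2 * lam n powr (- 2 * s))"

text \<open>\<open>L2_inner M h\<close>, as a functional, is the image of \<open>h\<close> under \<open>L\<^sup>2 = (L\<^sup>2)\<^sup>* \<subseteq> V\<^sub>-\<^sub>s\<close>.\<close>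


text \<open>
  The vector \<open>1/\<Gamma>(2-\<alpha>) \<integral>\<^sub>0\<^sup>t (t-s)\<^sup>1\<^sup>-\<^sup>\<alpha> (u(s) - u(0) - s u'(0)) ds\<close>, as a functional: the
  vector-valued integral is evaluated through its pairing with functions \<open>\<psi>\<close>.
\<close>

definition caputo_integral ::
  "'a measure \<Rightarrow> real \<Rightarrow> (real \<Rightarrow> 'a \<Rightarrow> real) \<Rightarrow> (real \<Rightarrow> 'a \<Rightarrow> real) \<Rightarrow> real \<Rightarrow> ('a \<Rightarrow> real) \<Rightarrow> real" where
  "caputo_integral M \<alpha> u ut t \<psi> =
     1 / Gamma (2 - \<alpha>) *
     (LINT s:{0..t}|lborel. (t - s) powr (1 - \<alpha>) * L2_inner M (\<lambda>x. u s x - u 0 x - s * ut 0 x) \<psi>)"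

text \<open>
  \<open>Du\<close> is the Caputo derivative (in its weaker form) on \<open>(0,T)\<close> of the function \<open>u\<close> with
  time derivative \<open>ut\<close>; the two time derivatives are taken in the norm of \<open>V\<^sub>-\<^sub>\<gamma>\<close>.
\<close>

definition has_caputo_deriv ::
  "'a measure \<Rightarrow> (nat \<Rightarrow> 'a \<Rightarrow> real) \<Rightarrow> (nat \<Rightarrow> real) \<Rightarrow> real \<Rightarrow> real \<Rightarrow> real \<Rightarrow>
   (real \<Rightarrow> 'a \<Rightarrow> real) \<Rightarrow> (real \<Rightarrow> 'a \<Rightarrow> real) \<Rightarrow> (real \<Rightarrow> ('a \<Rightarrow> real) \<Rightarrow> real) \<Rightarrow> bool" where
  "has_caputo_deriv M \<phi> lam \<gamma> \<alpha> T u ut Du \<longleftrightarrow>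
     (\<exists>W. \<forall>t\<in>{0<..<T}.
        has_deriv_into (Vdual M \<phi> lam \<gamma>) (Vdual_norm \<phi> lam \<gamma>)
          (caputo_integral M \<alpha> u ut) (W t) t {0<..<T} \<and>
        has_deriv_into (Vdual M \<phi> lam \<gamma>) (Vdual_norm \<phi> lam \<gamma>) W (Du t) t {0<..<T})"


text \<open>
  \<open>u\<close> is a weak solution; \<open>ut\<close> and \<open>Du\<close> are its time derivative and Caputo derivative, which
  are determined by \<open>u\<close> up to the identifications made in \<open>L\<^sup>2(X)\<close> and \<open>V\<^sub>-\<^sub>\<gamma>\<close>.
\<close>

definition weak_solution ::
  "'a measure \<Rightarrow> (('a \<Rightarrow> real) \<Rightarrow> ('a \<Rightarrow> real) \<Rightarrow> real) \<Rightarrow> (nat \<Rightarrow> 'a \<Rightarrow> real) \<Rightarrow> (nat \<Rightarrow> real) \<Rightarrow>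
   (real \<Rightarrow> real) \<Rightarrow> real \<Rightarrow> real \<Rightarrow> real \<Rightarrow> ('a \<Rightarrow> real) \<Rightarrow> ('a \<Rightarrow> real) \<Rightarrow>
   (real \<Rightarrow> 'a \<Rightarrow> real) \<Rightarrow> (real \<Rightarrow> 'a \<Rightarrow> real) \<Rightarrow> (real \<Rightarrow> ('a \<Rightarrow> real) \<Rightarrow> real) \<Rightarrow> bool" where
  "weak_solution M E \<phi> lam f \<alpha> \<gamma> T u0 u1 u ut Du \<longleftrightarrow>
     C0_into (Vsp M \<phi> lam \<gamma>) (Vnorm M \<phi> lam \<gamma>) T u \<and>
     C1_into (L2 M) (L2_norm M) T u ut \<and>
     has_caputo_deriv M \<phi> lam \<gamma> \<alpha> T u ut Du \<and>
     C0_into (Vdual M \<phi> lam \<gamma>) (Vdual_norm \<phi> lam \<gamma>) T Du \<and>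
     (AE x in M. u 0 x = u0 x) \<and> (AE x in M. ut 0 x = u1 x) \<and>
     (\<exists>\<sigma>. 0 \<le> \<sigma> \<and> \<sigma> < 1 / \<alpha> \<and>
        ((\<lambda>t. Vnorm M \<phi> lam \<sigma> (\<lambda>x. u t x - u0 x)) \<longlongrightarrow> 0) (at_right 0)) \<and>
     (\<exists>\<beta>. 0 < \<beta> \<and> \<beta> \<le> 1 - 1 / \<alpha> \<and>
        ((\<lambda>t. Vdual_norm \<phi> lam \<beta> (L2_inner M (\<lambda>x. ut t x - u1 x))) \<longlongrightarrow> 0) (at_right 0)) \<and>
     (\<forall>\<psi>\<in>Vsp M \<phi> lam \<gamma>. AE t in lborel. t \<in> {0<..<T} \<longrightarrow>
        Du t \<psi> + E (u t) \<psi> = L2_inner M (\<lambda>x. f (u t x)) \<psi>)"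

text \<open>
  A function on \<open>X \<times> (0,T)\<close>, measurable in both variables jointly, representing a function of
  time with values in \<open>L\<^sup>2(X)\<close>.
\<close>

definition joint_representative ::
  "'a measure \<Rightarrow> real \<Rightarrow> (real \<Rightarrow> 'a \<Rightarrow> real) \<Rightarrow> ('a \<Rightarrow> real \<Rightarrow> real) \<Rightarrow> bool" where
  "joint_representative M T w W \<longleftrightarrow>
     (\<lambda>(x, t). W x t) \<in> borel_measurable (M \<Otimes>\<^sub>M lborel) \<and>
     (AE t in lborel. t \<in> {0<..<T} \<longrightarrow> (AE x in M. W x t = w t x))"

text \<open>
  \<open>v\<close> is the Caputo derivative regarded as a function with values in \<open>L\<^sup>2(X)\<close>.  The last clause
  is the equation, pointwise almost everywhere in \<open>X \<times> (0,T)\<close>.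
\<close>

definition strong_solution ::
  "'a measure \<Rightarrow> (('a \<Rightarrow> real) \<Rightarrow> ('a \<Rightarrow> real) \<Rightarrow> real) \<Rightarrow> ('a \<Rightarrow> real) set \<Rightarrow> (('a \<Rightarrow> real) \<Rightarrow> 'a \<Rightarrow> real) \<Rightarrow>
   (nat \<Rightarrow> 'a \<Rightarrow> real) \<Rightarrow> (nat \<Rightarrow> real) \<Rightarrow>
   (real \<Rightarrow> real) \<Rightarrow> real \<Rightarrow> real \<Rightarrow> real \<Rightarrow> ('a \<Rightarrow> real) \<Rightarrow> ('a \<Rightarrow> real) \<Rightarrow>
   (real \<Rightarrow> 'a \<Rightarrow> real) \<Rightarrow> (real \<Rightarrow> 'a \<Rightarrow> real) \<Rightarrow> (real \<Rightarrow> ('a \<Rightarrow> real) \<Rightarrow> real) \<Rightarrow> bool" where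
  "strong_solution M E DA A \<phi> lam f \<alpha> \<gamma> T u0 u1 u ut Du \<longleftrightarrow>
     weak_solution M E \<phi> lam f \<alpha> \<gamma> T u0 u1 u ut Du \<and>
     L1_into DA (Vnorm M \<phi> lam 1) T u \<and>
     (\<exists>v. L1_into (L2 M) (L2_norm M) T v \<and>
        (AE t in lborel. t \<in> {0<..<T} \<longrightarrow> (\<forall>\<psi>\<in>Vsp M \<phi> lam \<gamma>. Du t \<psi> = L2_inner M (v t) \<psi>)) \<and>
        (\<exists>V W U. joint_representative M T v V \<and>
           joint_representative M T (\<lambda>t. A (u t)) W \<and>
           joint_representative M T u U \<and>
           (AE (x, t) in M \<Otimes>\<^sub>M lborel. t \<in> {0<..<T} \<longrightarrow> V x t + W x t = f (U x t))))"


definition test_function :: "real \<Rightarrow> (real \<Rightarrow> real) \<Rightarrow> bool" where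
  "test_function T \<eta> \<longleftrightarrow>
     smooth_real \<eta> \<and> (\<exists>a b. 0 < a \<and> b < T \<and> (\<forall>t. t \<notin> {a..b} \<longrightarrow> \<eta> t = 0))"

text \<open>
  \<open>v\<close> is the distributional derivative of \<open>u\<close>; the \<open>L\<^sup>2(X)\<close>-valued identity
  \<open>\<integral> \<eta>' u dt = - \<integral> \<eta> v dt\<close> is tested against all \<open>\<psi>\<close> in \<open>L\<^sup>2(X)\<close>.
\<close>

definition weak_time_deriv ::
  "'a measure \<Rightarrow> real \<Rightarrow> (real \<Rightarrow> 'a \<Rightarrow> real) \<Rightarrow> (real \<Rightarrow> 'a \<Rightarrow> real) \<Rightarrow> bool" where
  "weak_time_deriv M T u v \<longleftrightarrow>
     (\<forall>\<eta> \<psi>. test_function T \<eta> \<and> \<psi> \<in> L2 M \<longrightarrow>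
        (LINT t:{0<..<T}|lebesgue. deriv \<eta> t * L2_inner M (u t) \<psi>) =
        - (LINT t:{0<..<T}|lebesgue. \<eta> t * L2_inner M (v t) \<psi>))"

definition W21_L2 :: "'a measure \<Rightarrow> real \<Rightarrow> (real \<Rightarrow> 'a \<Rightarrow> real) \<Rightarrow> bool" where
  "W21_L2 M T u \<longleftrightarrow>
     L1_into (L2 M) (L2_norm M) T u \<and>
     (\<exists>v w. L1_into (L2 M) (L2_norm M) T v \<and> L1_into (L2 M) (L2_norm M) T w \<and>
        weak_time_deriv M T u v \<and> weak_time_deriv M T v w)"

end

theory Submission
  imports Defs "HOL-Complex_Analysis.Complex_Analysis" "HOL-Real_Asymp.Real_Asymp"
begin

text \<open>
  The proof is spectral. The coefficient \<open>y(t) = (u(t), \<phi>\<^sub>n)\<close> of a weak solution solves the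
  scalar equation \<open>D\<^sup>\<alpha> y + \<lambda> y = f\<^sub>n\<close> with \<open>\<lambda> = \<lambda>\<^sub>n\<close> and \<open>f\<^sub>n(t) = (f(u(t)), \<phi>\<^sub>n)\<close>, and
  therefore \<open>y = k\<^sub>0 * f\<^sub>n + y(0) s + y'(0) S\<close> (\<open>mode_representation\<close>), where \<open>k\<^sub>0\<close>, \<open>s\<close> and \<open>S\<close>
  are the functions with Laplace transforms \<open>X\<^sup>k / (X\<^sup>\<alpha> + \<lambda>)\<close> for \<open>k = 0\<close>, \<open>k = \<alpha> - 1\<close> and
  \<open>k = \<alpha> - 2\<close>. They are functions of Mittag-Leffler type, and everything that is needed about
  their size is one estimate that is uniform in \<open>\<lambda>\<close>: a bound of order \<open>t powr (\<alpha> \<sigma> - k - 1)\<close> for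
  the product with \<open>\<lambda> powr (1 - \<sigma>)\<close> (\<open>ray_kernel_bound\<close>). They are defined by integrals over two
  complex rays, from which the estimate is immediate; the price is a contour argument for the
  Laplace transforms (\<open>strip_cauchy_formula\<close>).

  The factor \<open>\<lambda>\<close> in \<open>\<lambda> k\<^sub>0 * f\<^sub>n\<close> is too much for the kernel alone, because \<open>\<lambda> \<bar>k\<^sub>0(t)\<bar> \<le> C / t\<close>
  is not integrable. One integration by parts in time gains the missing power:
  \<open>\<lambda> k\<^sub>0 * f\<^sub>n = f\<^sub>n - f\<^sub>n(0) s - s * f\<^sub>n'\<close>. This requires \<open>f(u)\<close> to be continuously
  differentiable in time with values in \<open>L\<^sup>2\<close>, which holds because \<open>u\<close> is bounded in space,
  uniformly in time, and continuous in time for the supremum norm (\<open>nemytskii_C1\<close>). The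
  boundedness is the embedding of \<open>V\<^sub>\<gamma>\<close> into \<open>L\<^sup>\<infinity>\<close> (\<open>embedding_Linfty\<close>), which follows from the
  Sobolev embedding and the Markov property by a Nash type argument and is the place where
  \<open>\<alpha> < \<alpha>\<^sub>0\<close> is used: it says \<open>2 \<gamma> > q / (q - 1)\<close>.

  Summing the squares over all modes gives \<open>\<parallel>u(t)\<parallel> \<le> c\<^sub>0 + c\<^sub>1 t\<^sup>1\<^sup>-\<^sup>\<alpha>\<close> in the norm of \<open>V\<^sub>1\<close>
  (\<open>energy_bound\<close>), which is integrable in time since \<open>\<alpha> < 2\<close>. So \<open>A u\<close> is integrable with
  values in \<open>L\<^sup>2\<close>, and so is \<open>f(u) - A u\<close>, which the weak equation identifies with the Caputo
  derivative. In the same way, for better initial data the formula for \<open>y''\<close> bounds \<open>\<partial>\<^sub>t\<^sup>2 u\<close> in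
  \<open>L\<^sup>2\<close> by integrable powers of \<open>t\<close> (\<open>second_time_derivative\<close>).
\<close>

section \<open>A Cauchy formula on a strip\<close>

text \<open>
  With \<open>C = cos (\<psi> / 2)\<close> one has \<open>\<bar>a e\<^sup>i\<^sup>\<psi> + b\<bar>\<^sup>2 = C\<^sup>2 (a + b)\<^sup>2 + (1 - C\<^sup>2) (a - b)\<^sup>2\<close>. The
  estimate is used for all denominators: a sum of two vectors in a sector of opening less than
  \<open>\<pi>\<close> is comparable to the sum of their lengths.
\<close>

lemma sector_norm_lower:
  fixes a b \<psi> \<psi>0 :: real
  assumes "0 \<le> a" "0 \<le> b" "\<bar>\<psi>\<bar> \<le> \<psi>0" "\<psi>0 < pi"
  shows "cos (\<psi>0 / 2) * (a + b) \<le> norm (of_real a * cis \<psi> + of_real b)"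
proof -
  define C where "C = cos (\<psi> / 2)"
  have C2: "cos \<psi> = 2 * C\<^sup>2 - 1" using cos_double_cos[of "\<psi> / 2"] by (simp add: C_def)
  have "(norm (of_real a * cis \<psi> + of_real b))\<^sup>2 = (a * cos \<psi> + b)\<^sup>2 + (a * sin \<psi>)\<^sup>2"
    by (simp add: cmod_power2)
  also have "\<dots> = a\<^sup>2 + b\<^sup>2 + 2 * a * b * cos \<psi>"
    using sin_cos_squared_add[of \<psi>] by algebra
  also have "\<dots> = (C * (a + b))\<^sup>2 + (1 - C\<^sup>2) * (a - b)\<^sup>2"
    unfolding C2 by algebra
  also have "\<dots> \<ge> (C * (a + b))\<^sup>2"
    by (simp add: C_def abs_square_le_1)
  finally have "C * (a + b) \<le> norm (of_real a * cis \<psi> + of_real b)"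
    using power2_le_imp_le norm_ge_zero by blast
  moreover have "cos (\<psi>0 / 2) \<le> C"
  proof -
    have "cos (\<psi>0 / 2) \<le> cos (\<bar>\<psi>\<bar> / 2)" using assms by (intro cos_monotone_0_pi_le) auto
    also have "\<dots> = C" by (cases "\<psi> \<ge> 0") (simp_all add: C_def)
    finally show ?thesis .
  qed
  ultimately show ?thesis using assms mult_right_mono[of "cos (\<psi>0/2)" C "a + b"] by linarith
qed

lemma integrable_exp_neg_abs:
  assumes "\<delta> > (0::real)"
  shows "integrable lborel (\<lambda>x::real. exp (- \<delta> * \<bar>x\<bar>))"
proof -
  have i: "set_integrable lborel {0..} (\<lambda>x::real. exp (- \<delta> * x))"
  proof -
    have "(\<lambda>x::real. exp (- \<delta> * x)) absolutely_integrable_on {0..}"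
      using has_integral_exp_minus_to_infinity[OF assms, of 0]
      by (intro nonnegative_absolutely_integrable_1) auto
    then show ?thesis
      unfolding set_integrable_def by (subst (asm) integrable_completion) auto
  qed
  have j: "integrable lborel (\<lambda>x::real. indicator {0..} (- x) *\<^sub>R exp (- \<delta> * (- x)))"
    using i lborel_integrable_real_affine_iff[of "-1" "\<lambda>x::real. indicator {0..} x *\<^sub>R exp (- \<delta> * x)" 0]
    unfolding set_integrable_def by simp
  have "integrable lborel (\<lambda>x::real. indicator {0..} x *\<^sub>R exp (- \<delta> * x) + indicator {0..} (- x) *\<^sub>R exp (- \<delta> * (- x)))"
    using i j unfolding set_integrable_def by (intro Bochner_Integration.integrable_add)
  then show ?thesis
    by (rule Bochner_Integration.integrable_bound) (auto simp: indicator_def)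
qed

lemma integrable_exp_decay:
  fixes f :: "real \<Rightarrow> 'b::{banach, second_countable_topology}"
  assumes "f \<in> borel_measurable borel" "\<delta> > 0" "\<And>x. norm (f x) \<le> B * exp (- \<delta> * \<bar>x\<bar>)"
  shows "integrable lborel f"
proof (rule Bochner_Integration.integrable_bound)
  show "integrable lborel (\<lambda>x. B * exp (- \<delta> * \<bar>x\<bar>))"
    using integrable_exp_neg_abs[OF assms(2)] by simp
  show "AE x in lborel. norm (f x) \<le> norm (B * exp (- \<delta> * \<bar>x\<bar>))"
  proof (rule AE_I2)
    fix x
    have "norm (f x) \<le> B * exp (- \<delta> * \<bar>x\<bar>)" by (rule assms(3))
    also have "\<dots> \<le> norm (B * exp (- \<delta> * \<bar>x\<bar>))" unfolding real_norm_def by (rule abs_ge_self)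
    finally show "norm (f x) \<le> norm (B * exp (- \<delta> * \<bar>x\<bar>))" .
  qed
qed (use assms in auto)

lemma integral_symmetric_limit:
  fixes f :: "real \<Rightarrow> 'b::{banach, second_countable_topology}"
  assumes "integrable lborel f"
  shows "(\<lambda>n. LINT x|lborel. indicator {- real n..real n} x *\<^sub>R f x) \<longlonglongrightarrow> (LINT x|lborel. f x)"
proof (rule integral_dominated_convergence[where w="\<lambda>x. norm (f x)"])
  show "AE x in lborel. (\<lambda>n. indicator {- real n..real n} x *\<^sub>R f x) \<longlonglongrightarrow> f x"
  proof (rule AE_I2)
    fix x :: real
    have "eventually (\<lambda>n. \<bar>x\<bar> \<le> real n) sequentially"
      using filterlim_real_sequentially unfolding filterlim_at_top by blast
    then have "eventually (\<lambda>n. indicator {- real n..real n} x *\<^sub>R f x = f x) sequentially"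
      by eventually_elim (auto simp: abs_le_iff)
    then show "(\<lambda>n. indicator {- real n..real n} x *\<^sub>R f x) \<longlonglongrightarrow> f x"
      by (rule tendsto_eventually)
  qed
qed (use assms in \<open>auto simp: indicator_def\<close>)

text \<open>
  Cauchy's theorem on long rectangles: the strip is convex, so \<open>H\<close> has a primitive there, and
  the two short sides contribute nothing in the limit because \<open>H\<close> decays.
\<close>

lemma strip_shift:
  fixes H :: "complex \<Rightarrow> complex"
  assumes th: "0 \<le> \<theta>" "\<theta> < \<omega>" and hol: "H holomorphic_on {w. \<bar>Im w\<bar> < \<omega>}" and \<delta>: "\<delta> > 0"
    and bnd: "\<And>w. 0 \<le> Im w \<Longrightarrow> Im w \<le> \<theta> \<Longrightarrow> r \<le> \<bar>Re w\<bar> \<Longrightarrow> norm (H w) \<le> B * exp (- \<delta> * \<bar>Re w\<bar>)"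
  shows "integrable lborel (\<lambda>x. H (Complex x \<theta>))" "integrable lborel (\<lambda>x. H (of_real x))"
    "(LINT x|lborel. H (Complex x \<theta>)) = (LINT x|lborel. H (of_real x))"
proof -
  define S where "S = {w. \<bar>Im w\<bar> < \<omega>}"
  have S_eq: "S = {w. Im w < \<omega>} \<inter> {w. Im w > - \<omega>}" by (auto simp: S_def)
  have opS: "open S" and cvS: "convex S"
    unfolding S_eq
    by (auto intro!: open_Int open_halfspace_Im_lt open_halfspace_Im_gt convex_Int convex_halfspace_Im_lt convex_halfspace_Im_gt)
  have inS: "Complex x \<phi> \<in> S" if "0 \<le> \<phi>" "\<phi> \<le> \<theta>" for x \<phi> using that th by (simp add: S_def)
  have contH: "continuous_on S H" using hol holomorphic_on_imp_continuous_on S_def by auto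
  have cline: "continuous_on A (\<lambda>x. Complex x \<phi>)" for A \<phi>
    unfolding Complex_eq by (intro continuous_intros)
  have contline: "continuous_on UNIV (\<lambda>x. H (Complex x \<phi>))" if "0 \<le> \<phi>" "\<phi> \<le> \<theta>" for \<phi>
    by (rule continuous_on_compose2[OF contH cline]) (use inS that in auto)
  define K where "K = cbox (Complex (-\<bar>r\<bar>) 0) (Complex \<bar>r\<bar> \<theta>)"
  have "K \<subseteq> S" using th by (auto simp: K_def S_def in_cbox_complex_iff)
  then have "compact (H ` K)"
    by (intro compact_continuous_image continuous_on_subset[OF contH]) (auto simp: K_def)
  then have "bounded (H ` K)" by (rule compact_imp_bounded)
  then obtain B0 where B0: "\<And>w. w \<in> K \<Longrightarrow> norm (H w) \<le> B0"
    unfolding bounded_iff by auto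
  \<comment> \<open>The decay is assumed for large real parts only; compactness provides it on the rest of the
    strip.\<close>
  define B' where "B' = max B (B0 * exp (\<delta> * \<bar>r\<bar>))"
  have bnd': "norm (H w) \<le> B' * exp (- \<delta> * \<bar>Re w\<bar>)" if "0 \<le> Im w" "Im w \<le> \<theta>" for w
  proof (cases "\<bar>r\<bar> \<le> \<bar>Re w\<bar>")
    case True
    then have "norm (H w) \<le> B * exp (- \<delta> * \<bar>Re w\<bar>)" using bnd[of w] that by auto
    also have "\<dots> \<le> B' * exp (- \<delta> * \<bar>Re w\<bar>)" by (intro mult_right_mono) (auto simp: B'_def)
    finally show ?thesis .
  next
    case False
    then have "w \<in> K" using that by (auto simp: K_def in_cbox_complex_iff)
    from B0[OF this] have n: "norm (H w) \<le> B0" .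
    then have "0 \<le> B0" using norm_ge_zero order_trans by blast
    have "norm (H w) * exp (\<delta> * \<bar>Re w\<bar>) \<le> B0 * exp (\<delta> * \<bar>r\<bar>)"
      using n False \<delta> \<open>0 \<le> B0\<close> by (intro mult_mono) auto
    then have "norm (H w) \<le> B0 * exp (\<delta> * \<bar>r\<bar>) * exp (- \<delta> * \<bar>Re w\<bar>)"
      by (simp add: exp_minus field_simps)
    also have "\<dots> \<le> B' * exp (- \<delta> * \<bar>Re w\<bar>)" by (intro mult_right_mono) (auto simp: B'_def)
    finally show ?thesis .
  qed
  have int: "integrable lborel (\<lambda>x. H (Complex x \<phi>))" if "0 \<le> \<phi>" "\<phi> \<le> \<theta>" for \<phi>
    using bnd'[of "Complex _ \<phi>"] that \<delta> contline[OF that]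
    by (intro integrable_exp_decay[where B=B' and \<delta>=\<delta>] borel_measurable_continuous_onI) auto
  show i1: "integrable lborel (\<lambda>x. H (Complex x \<theta>))" using int th by auto
  have "integrable lborel (\<lambda>x. H (Complex x 0))" using int[of 0] th by auto
  then show i2: "integrable lborel (\<lambda>x. H (of_real x))" by (simp add: complex_of_real_def)
  have "\<exists>G. \<forall>w\<in>S. (G has_field_derivative H w) (at w within S)"
    by (rule holomorphic_convex_primitive'[OF cvS opS, of H]) (use hol S_def in auto)
  then obtain G where G: "\<And>w. w \<in> S \<Longrightarrow> (G has_field_derivative H w) (at w within S)"
    by blast
  have G': "(G has_field_derivative H w) (at w)" if "w \<in> S" for w
    using G[OF that] at_within_open[OF that opS] by simp
  have ftc: "(LINT x|lborel. indicator {- real n..real n} x *\<^sub>R H (Complex x \<phi>)) = G (Complex n \<phi>) - G (Complex (-n) \<phi>)"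
    if "0 \<le> \<phi>" "\<phi> \<le> \<theta>" for n \<phi>
  proof (rule integral_FTC_atLeastAtMost)
    fix x :: real
    have "((\<lambda>x. Complex x \<phi>) has_vector_derivative 1) (at x within {- real n..real n})"
      unfolding Complex_eq by (auto intro!: derivative_eq_intros)
    then have "((G \<circ> (\<lambda>x. Complex x \<phi>)) has_vector_derivative 1 * H (Complex x \<phi>)) (at x within {- real n..real n})"
      using G'[OF inS[OF that]] by (intro field_vector_diff_chain_within) (auto intro: has_field_derivative_at_within)
    then show "((\<lambda>x. G (Complex x \<phi>)) has_vector_derivative H (Complex x \<phi>)) (at x within {- real n..real n})"
      by (simp add: o_def)
  qed (use contline[OF that] continuous_on_subset in auto)
  have arc: "norm (G (Complex x \<theta>) - G (Complex x 0)) \<le> \<theta> * B' * exp (- \<delta> * \<bar>x\<bar>)" for x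
  proof -
    define L where "L = closed_segment (Complex x 0) (Complex x \<theta>)"
    have L: "Re w = x \<and> 0 \<le> Im w \<and> Im w \<le> \<theta>" if "w \<in> L" for w
    proof -
      have "\<exists>u. 0 \<le> u \<and> u \<le> 1 \<and> w = (1 - u) *\<^sub>R Complex x 0 + u *\<^sub>R Complex x \<theta>"
        using that unfolding L_def in_segment(1) .
      then obtain u where u: "0 \<le> u" "u \<le> 1" "w = (1 - u) *\<^sub>R Complex x 0 + u *\<^sub>R Complex x \<theta>"
        by (elim exE conjE)
      have "Re w = x" "Im w = u * \<theta>" unfolding u(3) by (simp_all add: algebra_simps)
      then show ?thesis using u th by (simp add: mult_left_le_one_le)
    qed
    have "norm (G (Complex x \<theta>) - G (Complex x 0)) \<le> (B' * exp (- \<delta> * \<bar>x\<bar>)) * norm (Complex x \<theta> - Complex x 0)"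
    proof (rule field_differentiable_bound[of L])
      fix w assume "w \<in> L"
      then have "w \<in> S" using L[of w] th by (auto simp: S_def)
      then show "(G has_field_derivative H w) (at w within L)" using G' has_field_derivative_at_within by blast
      show "norm (H w) \<le> B' * exp (- \<delta> * \<bar>x\<bar>)" using bnd'[of w] L[OF \<open>w \<in> L\<close>] by auto
    qed (auto simp: L_def)
    also have "norm (Complex x \<theta> - Complex x 0) = \<theta>" using th by (simp add: cmod_def)
    finally show ?thesis by (simp add: algebra_simps)
  qed
  have lim0: "(\<lambda>n. G (Complex (s * real n) \<theta>) - G (Complex (s * real n) 0)) \<longlonglongrightarrow> 0" if "\<bar>s\<bar> = 1" for s
  proof (rule Lim_null_comparison)
    show "\<forall>\<^sub>F n in sequentially. norm (G (Complex (s * real n) \<theta>) - G (Complex (s * real n) 0)) \<le> \<theta> * B' * exp (- \<delta> * real n)"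
    proof (intro always_eventually allI)
      fix n
      have "\<bar>s * real n\<bar> = real n" using that by (simp add: abs_mult)
      then show "norm (G (Complex (s * real n) \<theta>) - G (Complex (s * real n) 0)) \<le> \<theta> * B' * exp (- \<delta> * real n)"
        using arc[of "s * real n"] by simp
    qed
    have "(\<lambda>n. exp (- \<delta> * real n)) \<longlonglongrightarrow> 0"
      using \<delta> by real_asymp
    then show "(\<lambda>n. \<theta> * B' * exp (- \<delta> * real n)) \<longlonglongrightarrow> 0" by (intro tendsto_mult_right_zero)
  qed
  have "(\<lambda>n. (LINT x|lborel. indicator {- real n..real n} x *\<^sub>R H (Complex x \<theta>))
        - (LINT x|lborel. indicator {- real n..real n} x *\<^sub>R H (Complex x 0))) \<longlonglongrightarrow> 0"
  proof -
    have "(\<lambda>n. (G (Complex (1 * real n) \<theta>) - G (Complex (1 * real n) 0)) - (G (Complex ((-1) * real n) \<theta>) - G (Complex ((-1) * real n) 0))) \<longlonglongrightarrow> 0 - 0"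
      by (intro tendsto_diff lim0) auto
    then show ?thesis using th by (simp add: ftc algebra_simps)
  qed
  moreover have "(\<lambda>n. (LINT x|lborel. indicator {- real n..real n} x *\<^sub>R H (Complex x \<theta>))
        - (LINT x|lborel. indicator {- real n..real n} x *\<^sub>R H (Complex x 0))) \<longlonglongrightarrow>
      (LINT x|lborel. H (Complex x \<theta>)) - (LINT x|lborel. H (Complex x 0))"
    using th by (intro tendsto_diff integral_symmetric_limit int) auto
  ultimately have "0 = (LINT x|lborel. H (Complex x \<theta>)) - (LINT x|lborel. H (Complex x 0))"
    by (rule LIMSEQ_unique)
  then show "(LINT x|lborel. H (Complex x \<theta>)) = (LINT x|lborel. H (of_real x))"
    by (simp add: complex_of_real_def)
qed

lemma frac_le_cross:
  fixes a b m n :: real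
  assumes "a * m \<le> b * n" "0 < m" "0 < n"
  shows "a / n \<le> b / m"
  using assms by (simp add: field_simps)

text \<open>
  The integrand is the derivative of \<open>Ln\<close> of the Moebius map \<open>- \<i> (X + \<zeta>) / (X - \<zeta>)\<close> along the
  ray, divided by \<open>X\<close>. The factor \<open>- \<i>\<close> moves the image of the upper half-plane into the right
  half-plane, away from the branch cut, so the value is read off from the end points \<open>\<zeta> = 0\<close> and
  \<open>\<zeta> = \<infinity>\<close>.
\<close>

lemma exp_log_integral:
  fixes \<theta> X :: real and \<zeta> :: "real \<Rightarrow> complex"
  assumes th: "0 < \<theta>" "\<theta> < pi" and X: "X > 0"
  defines "\<zeta> \<equiv> \<lambda>x::real. exp (Complex x \<theta>) :: complex"
  shows "integrable lborel (\<lambda>x. 2 * \<zeta> x / ((X + \<zeta> x) * (X - \<zeta> x)))"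
    "(LINT x|lborel. 2 * \<zeta> x / ((X + \<zeta> x) * (X - \<zeta> x))) = \<i> * pi / X"
proof -
  have z: "\<zeta> x = of_real (exp x) * cis \<theta>" for x
    by (simp add: \<zeta>_def exp_eq_polar)
  have Imz: "Im (\<zeta> x) > 0" for x using th by (simp add: z sin_gt_zero)
  have nz: "X + \<zeta> x \<noteq> 0" "X - \<zeta> x \<noteq> 0" for x
    using Imz[of x] by (auto simp: complex_eq_iff)
  have zne: "\<zeta> x \<noteq> 0" for x by (simp add: \<zeta>_def)
  have cz: "continuous_on A \<zeta>" for A
    unfolding \<zeta>_def Complex_eq by (intro continuous_intros)
  define f where "f = (\<lambda>x. 2 * \<zeta> x / ((X + \<zeta> x) * (X - \<zeta> x)))"
  have cf: "continuous_on A f" for A unfolding f_def by (intro continuous_intros cz) (use nz in auto)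
  define c where "c = min (cos (\<theta> / 2)) (cos ((pi - \<theta>) / 2))"
  have c: "c > 0" unfolding c_def using th by (auto intro!: cos_gt_zero_pi)
  have b1: "c * (exp x + X) \<le> norm (X + \<zeta> x)" for x
    using sector_norm_lower[of "exp x" X \<theta> \<theta>] th X mult_right_mono[of c "cos (\<theta>/2)" "exp x + X"]
    by (auto simp: z c_def algebra_simps)
  have b2: "c * (exp x + X) \<le> norm (X - \<zeta> x)" for x
  proof -
    have e: "X - \<zeta> x = of_real (exp x) * cis (\<theta> - pi) + X" by (simp add: z complex_eq_iff)
    have "c * (exp x + X) \<le> cos ((pi - \<theta>)/2) * (exp x + X)"
      using X by (intro mult_right_mono) (auto simp: c_def)
    also have "\<dots> \<le> norm (X - \<zeta> x)"
      unfolding e using th X by (intro sector_norm_lower) auto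
    finally show ?thesis .
  qed
  have bf: "norm (f x) \<le> (2 / (c * c * min 1 (X\<^sup>2))) * exp (- 1 * \<bar>x\<bar>)" for x
  proof -
    have s: "0 < exp x + X" using X by (simp add: add_pos_pos)
    have "norm (f x) = 2 * exp x / (norm (X + \<zeta> x) * norm (X - \<zeta> x))"
      by (simp add: f_def norm_divide norm_mult z)
    also have "\<dots> \<le> 2 * exp x / ((c * (exp x + X)) * (c * (exp x + X)))"
    proof (rule divide_left_mono)
      show "c * (exp x + X) * (c * (exp x + X)) \<le> norm (X + \<zeta> x) * norm (X - \<zeta> x)"
        using b1[of x] b2[of x] c s by (intro mult_mono) auto
      show "0 < norm (X + \<zeta> x) * norm (X - \<zeta> x) * (c * (exp x + X) * (c * (exp x + X)))"
        using c s nz[of x] by (intro mult_pos_pos) auto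
    qed auto
    also have "\<dots> = 2 / (c * c) * (exp x / (exp x + X)\<^sup>2)"
      using c s by (simp add: power2_eq_square mult.assoc mult.left_commute)
    also have "\<dots> \<le> 2 / (c * c) * (exp (- \<bar>x\<bar>) / min 1 (X\<^sup>2))"
    proof (rule mult_left_mono)
      have m: "0 < min 1 (X\<^sup>2)" using X by simp
      have "exp x * min 1 (X\<^sup>2) \<le> exp (- \<bar>x\<bar>) * (exp x + X)\<^sup>2"
      proof (cases "x \<ge> 0")
        case True
        have "exp x * min 1 (X\<^sup>2) \<le> exp x" by simp
        also have "\<dots> = exp (- \<bar>x\<bar>) * (exp x)\<^sup>2" using True by (simp add: exp_minus power2_eq_square)
        also have "\<dots> \<le> exp (- \<bar>x\<bar>) * (exp x + X)\<^sup>2" using X by (intro mult_left_mono power_mono) auto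
        finally show ?thesis .
      next
        case False
        have "exp x * min 1 (X\<^sup>2) \<le> exp x * X\<^sup>2" by simp
        also have "\<dots> \<le> exp (- \<bar>x\<bar>) * (exp x + X)\<^sup>2" using False X by (intro mult_mono power_mono) auto
        finally show ?thesis .
      qed
      then show "exp x / (exp x + X)\<^sup>2 \<le> exp (- \<bar>x\<bar>) / min 1 (X\<^sup>2)"
        using m s by (intro frac_le_cross) simp_all
    qed (use c in auto)
    finally show ?thesis by simp
  qed
  show int: "integrable lborel (\<lambda>x. 2 * \<zeta> x / ((X + \<zeta> x) * (X - \<zeta> x)))"
    using integrable_exp_decay[OF borel_measurable_continuous_onI[OF cf] _ bf] unfolding f_def by auto
  then have intf: "integrable lborel f" by (simp add: f_def)
  define m where "m = (\<lambda>x. - \<i> * ((X + \<zeta> x) / (X - \<zeta> x)))"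
  have Rem: "Re (m x) > 0" for x
  proof -
    have *: "Re (- \<i> * w) = Im w" for w by simp
    have "Re (m x) = Im ((X + \<zeta> x) / (X - \<zeta> x))" unfolding m_def by (rule *)
    also have "\<dots> = 2 * X * Im (\<zeta> x) / ((Re (X - \<zeta> x))\<^sup>2 + (Im (X - \<zeta> x))\<^sup>2)"
      by (simp add: Im_divide algebra_simps)
    also have "\<dots> > 0" using Imz[of x] X by (intro divide_pos_pos) (auto simp: add_nonneg_pos)
    finally show ?thesis .
  qed
  have alg: "inverse (- \<i> * ((X + w) / (X - w))) * (- \<i> * ((1 * (X - w) - (X + w) * (- 1)) / ((X - w) * (X - w))))
      = 2 * X / ((X + w) * (X - w))" if "X + w \<noteq> 0" "X - w \<noteq> 0" for w :: complex
  proof -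
    have "1 * (X - w) - (X + w) * (- 1) = 2 * X" by simp
    then show ?thesis using that by (simp add: divide_simps)
  qed
  have der: "((\<lambda>x. Ln (m x)) has_vector_derivative X * f x) (at x within A)" for x A
  proof -
    have dz: "(\<zeta> has_vector_derivative \<zeta> x) (at x within A)"
      unfolding \<zeta>_def Complex_eq
      by (rule has_vector_derivative_eq_rhs[OF field_vector_diff_chain_within[OF _ DERIV_exp[THEN has_field_derivative_at_within], unfolded o_def, where f'=1]])
         (auto intro!: derivative_eq_intros)
    have D: "((\<lambda>\<zeta>. Ln (- \<i> * ((X + \<zeta>) / (X - \<zeta>)))) has_field_derivative (2 * X / ((X + \<zeta> x) * (X - \<zeta> x)))) (at (\<zeta> x))"
    proof -
      have q: "((\<lambda>\<zeta>. (X + \<zeta>) / (X - \<zeta>)) has_field_derivative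
          (1 * (X - \<zeta> x) - (X + \<zeta> x) * (- 1)) / ((X - \<zeta> x) * (X - \<zeta> x))) (at (\<zeta> x))"
        using nz[of x] by (intro DERIV_divide) (auto intro!: derivative_eq_intros)
      have "((\<lambda>\<zeta>. Ln (- \<i> * ((X + \<zeta>) / (X - \<zeta>)))) has_field_derivative
          inverse (m x) * (- \<i> * ((1 * (X - \<zeta> x) - (X + \<zeta> x) * (- 1)) / ((X - \<zeta> x) * (X - \<zeta> x))))) (at (\<zeta> x))"
        unfolding m_def
      proof (rule DERIV_chain2[OF has_field_derivative_Ln DERIV_cmult[OF q]])
        show "- \<i> * ((X + \<zeta> x) / (X - \<zeta> x)) \<notin> \<real>\<^sub>\<le>\<^sub>0"
          using Rem[of x] unfolding m_def complex_nonpos_Reals_iff by linarith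
      qed
      moreover have "inverse (m x) * (- \<i> * ((1 * (X - \<zeta> x) - (X + \<zeta> x) * (- 1)) / ((X - \<zeta> x) * (X - \<zeta> x))))
          = 2 * X / ((X + \<zeta> x) * (X - \<zeta> x))"
        using alg[OF nz[of x]] by (simp add: m_def)
      ultimately show ?thesis by simp
    qed
    have "((\<lambda>\<zeta>. Ln (- \<i> * ((X + \<zeta>) / (X - \<zeta>)))) \<circ> \<zeta> has_vector_derivative (\<zeta> x * (2 * X / ((X + \<zeta> x) * (X - \<zeta> x))))) (at x within A)"
      by (rule field_vector_diff_chain_within[OF dz has_field_derivative_at_within[OF D]])
    moreover have "\<zeta> x * (2 * X / ((X + \<zeta> x) * (X - \<zeta> x))) = X * f x" by (simp add: f_def)
    ultimately show ?thesis unfolding o_def m_def by simp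
  qed
  have ftc: "(LINT x|lborel. indicator {- real n..real n} x *\<^sub>R (X * f x)) = Ln (m (real n)) - Ln (m (- real n))" for n
    by (rule integral_FTC_atLeastAtMost) (auto intro!: der continuous_intros cf)
  have alg2: "(a + w) / (a - w) = (a * (1 / w) + 1) / (a * (1 / w) - 1)" if "w \<noteq> 0" for a w :: complex
  proof -
    have "a * (1 / w) + 1 = (a + w) / w" "a * (1 / w) - 1 = (a - w) / w"
      using that by (simp_all add: add_divide_distrib diff_divide_distrib)
    then show ?thesis using that by simp
  qed
  have "(\<lambda>n. \<zeta> (- real n)) \<longlonglongrightarrow> 0"
  proof -
    have "(\<lambda>n. exp (- real n)) \<longlonglongrightarrow> 0" by real_asymp
    then have "(\<lambda>n. complex_of_real (exp (- real n)) * cis \<theta>) \<longlonglongrightarrow> complex_of_real 0 * cis \<theta>"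
      by (intro tendsto_intros)
    then show ?thesis by (simp add: z)
  qed
  then have l1: "(\<lambda>n. m (- real n)) \<longlonglongrightarrow> - \<i> * ((complex_of_real X + 0) / (complex_of_real X - 0))"
    unfolding m_def using X by (intro tendsto_intros) auto
  have "(\<lambda>n. 1 / \<zeta> (real n)) \<longlonglongrightarrow> 0"
  proof -
    have "(\<lambda>n. exp (- real n)) \<longlonglongrightarrow> 0" by real_asymp
    then have "(\<lambda>n. complex_of_real (exp (- real n)) * cis (- \<theta>)) \<longlonglongrightarrow> complex_of_real 0 * cis (-\<theta>)"
      by (intro tendsto_intros)
    moreover have "1 / \<zeta> (real n) = complex_of_real (exp (- real n)) * cis (- \<theta>)" for n
      by (simp add: z exp_minus field_simps flip: cis_inverse)
    ultimately show ?thesis by simp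
  qed
  then have "(\<lambda>n. - \<i> * ((X * (1 / \<zeta> (real n)) + 1) / (X * (1 / \<zeta> (real n)) - 1))) \<longlonglongrightarrow> - \<i> * ((complex_of_real X * 0 + 1) / (complex_of_real X * 0 - 1))"
    by (intro tendsto_intros) auto
  moreover have "m (real n) = - \<i> * ((X * (1 / \<zeta> (real n)) + 1) / (X * (1 / \<zeta> (real n)) - 1))" for n
    unfolding m_def using alg2[OF zne[of "real n"], of X] by simp
  ultimately have l2: "(\<lambda>n. m (real n)) \<longlonglongrightarrow> \<i>" by simp
  have "(\<lambda>n. Ln (m (real n)) - Ln (m (- real n))) \<longlonglongrightarrow> Ln \<i> - Ln (- \<i>)"
    using l1 l2 X by (intro tendsto_diff tendsto_Ln) (auto simp: complex_nonpos_Reals_iff)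
  moreover have "(\<lambda>n. LINT x|lborel. indicator {- real n..real n} x *\<^sub>R (X * f x)) \<longlonglongrightarrow> (LINT x|lborel. X * f x)"
    by (intro integral_symmetric_limit integrable_mult_right intf)
  ultimately have "(LINT x|lborel. X * f x) = Ln \<i> - Ln (- \<i>)"
    unfolding ftc by (rule LIMSEQ_unique[rotated])
  also have "\<dots> = \<i> * pi" by simp
  finally have "X * (LINT x|lborel. f x) = \<i> * pi" using intf by simp
  then show "(LINT x|lborel. 2 * \<zeta> x / ((X + \<zeta> x) * (X - \<zeta> x))) = \<i> * pi / X"
    using X by (simp add: f_def field_simps)
qed

text \<open>
  In the variable \<open>\<zeta> = e\<^sup>w\<close> the integral runs along the ray of angle \<open>\<theta>\<close>, and the claim is
  Cauchy's formula for \<open>\<zeta>\<^sup>k / (\<zeta>\<^sup>\<alpha> + \<lambda>)\<close> in the sector between that ray and its mirror image,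
  evaluated at \<open>X\<close>; the two rays contribute conjugate amounts, which is why only an imaginary
  part occurs. Instead of a residue, the pole at \<open>w = ln X\<close> is subtracted: a multiple of
  \<open>2 e\<^sup>w / (X + e\<^sup>w)\<close> cancels it, the integral of that multiple is known explicitly after
  division by \<open>X - e\<^sup>w\<close>, and what remains can be moved to the real axis, where it is real.
\<close>

lemma strip_cauchy_formula:
  fixes k \<alpha> lam \<theta> X :: real
  assumes al: "1 \<le> \<alpha>" "0 < \<theta>" "\<alpha> * \<theta> < pi" and k: "-1 < k" "k < \<alpha>" and lam: "lam > 0" and X: "X > 0"
  defines "F \<equiv> \<lambda>w::complex. exp (of_real (k + 1) * w) / (exp (of_real \<alpha> * w) + of_real lam)"
  shows "integrable lborel (\<lambda>x. F (Complex x \<theta>) / (of_real X - exp (Complex x \<theta>)))"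
    "Im (LINT x|lborel. F (Complex x \<theta>) / (of_real X - exp (Complex x \<theta>))) = pi * (X powr k / (X powr \<alpha> + lam))"
proof -
  define \<omega> where "\<omega> = pi / \<alpha>"
  have om: "\<theta> < \<omega>" "\<omega> \<le> pi" "\<alpha> * \<omega> = pi" using al by (auto simp: \<omega>_def field_simps)
  have thpi: "\<theta> < pi" using om by simp
  define S where "S = {w. \<bar>Im w\<bar> < \<omega>}"
  have S_eq: "S = {w. Im w < \<omega>} \<inter> {w. Im w > - \<omega>}" by (auto simp: S_def)
  have opS: "open S"
    unfolding S_eq by (intro open_Int open_halfspace_Im_lt open_halfspace_Im_gt)
  define a where "a = ln X"
  have ea: "exp a = X" using X by (simp add: a_def)
  have polar: "exp w = of_real (exp (Re w)) * cis (Im w)" for w by (rule exp_eq_polar)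
  have polar\<alpha>: "exp (of_real \<alpha> * w) = of_real (exp (\<alpha> * Re w)) * cis (\<alpha> * Im w)" for w
    by (simp add: exp_eq_polar)
  have low1: "cos (\<alpha> * s / 2) * (exp (\<alpha> * Re w) + lam) \<le> norm (exp (of_real \<alpha> * w) + of_real lam)"
    if "\<bar>Im w\<bar> \<le> s" "\<alpha> * s < pi" for w s
    unfolding polar\<alpha> using that al lam
    by (intro sector_norm_lower) (auto simp: abs_mult mult_left_mono)
  have low2: "cos (s / 2) * (exp (Re w) + X) \<le> norm (of_real X + exp w)"
    if "\<bar>Im w\<bar> \<le> s" "s < pi" for w s
    unfolding polar using sector_norm_lower[of "exp (Re w)" X "Im w" s] that X by (simp add: add.commute)
  have nz1: "exp (of_real \<alpha> * w) + of_real lam \<noteq> 0" if "w \<in> S" for w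
  proof -
    have "\<alpha> * \<bar>Im w\<bar> < pi" using that om al by (simp add: S_def \<omega>_def field_simps)
    moreover have "0 \<le> \<alpha> * \<bar>Im w\<bar>" using al by simp
    ultimately have "0 < cos (\<alpha> * \<bar>Im w\<bar> / 2)" using pi_gt_zero by (intro cos_gt_zero_pi) linarith+
    moreover have "0 < exp (\<alpha> * Re w) + lam" using lam by (simp add: add_pos_pos)
    ultimately have "0 < norm (exp (of_real \<alpha> * w) + of_real lam)"
      using low1[of w "\<bar>Im w\<bar>"] \<open>\<alpha> * \<bar>Im w\<bar> < pi\<close> mult_pos_pos by fastforce
    then show ?thesis by auto
  qed
  have nz2: "of_real X + exp w \<noteq> 0" if "w \<in> S" for w
  proof -
    have lt: "\<bar>Im w\<bar> < pi" using that om by (simp add: S_def)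
    then have "0 < cos (\<bar>Im w\<bar> / 2)" using pi_gt_zero by (intro cos_gt_zero_pi) linarith+
    moreover have "0 < exp (Re w) + X" using X by (simp add: add_pos_pos)
    ultimately have "0 < norm (of_real X + exp w)"
      using low2[of w "\<bar>Im w\<bar>"] lt mult_pos_pos by fastforce
    then show ?thesis by auto
  qed
  have eq_a: "w = of_real a" if "w \<in> S" "of_real X - exp w = 0" for w
  proof -
    have "exp w = exp (of_real a)" using that(2) by (simp add: exp_of_real ea)
    moreover have "\<bar>Im w - Im (of_real a)\<bar> < 2 * pi" using that(1) om pi_gt_zero by (simp add: S_def)
    ultimately show ?thesis using complex_exp_exists[of w] exp_complex_eqI[of w "of_real a"] by simp
  qed
  \<comment> \<open>Both \<open>num\<close> and \<open>g\<close> vanish at \<open>a = ln X\<close>, to first order in the case of \<open>g\<close>; after division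
    of both by \<open>w - a\<close> their quotient \<open>H\<close> is seen to be holomorphic.\<close>
  define num where "num = (\<lambda>w. F w - F (of_real a) * (2 * exp w / (of_real X + exp w)))"
  define g where "g = (\<lambda>w. complex_of_real X - exp w)"
  have holF: "F holomorphic_on S" unfolding F_def by (intro holomorphic_intros) (use nz1 in auto)
  have holn: "num holomorphic_on S" unfolding num_def by (intro holomorphic_intros holF) (use nz2 in auto)
  have holg: "g holomorphic_on S" unfolding g_def by (intro holomorphic_intros)
  have eca: "exp (complex_of_real a) = of_real X" by (simp add: exp_of_real ea)
  have "2 * complex_of_real X / (of_real X + of_real X) = 1" using X by (simp flip: mult_2)
  with X have na: "num (of_real a) = 0" by (simp add: num_def eca)
  have ga: "g (of_real a) = 0" by (simp add: g_def eca)
  have FR: "F (of_real x) = of_real (exp ((k + 1) * x) / (exp (\<alpha> * x) + lam))" for x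
    unfolding F_def by (simp only: of_real_mult[symmetric] exp_of_real of_real_add[symmetric] of_real_divide[symmetric])
  have dga: "deriv g (of_real a) = - of_real X"
    unfolding g_def by (intro DERIV_imp_deriv) (auto intro!: derivative_eq_intros simp: eca)
  define q1 where "q1 = (\<lambda>w. if w = of_real a then deriv num (of_real a) else (num w - num (of_real a)) / (w - of_real a))"
  define q2 where "q2 = (\<lambda>w. if w = of_real a then deriv g (of_real a) else (g w - g (of_real a)) / (w - of_real a))"
  define H where "H = (\<lambda>w. q1 w / q2 w)"
  have q2nz: "q2 w \<noteq> 0" if "w \<in> S" for w
    using eq_a[OF that] X by (auto simp: q2_def ga dga) (auto simp: g_def)
  have holH: "H holomorphic_on S"
    unfolding H_def q1_def q2_def
    by (intro holomorphic_on_divide pole_lemma_open holn holg opS) (use q2nz in \<open>auto simp: q2_def\<close>)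
  have Heq: "H w = num w / (of_real X - exp w)" if "w \<in> S" "w \<noteq> of_real a" for w
  proof -
    have "w - of_real a \<noteq> 0" using that by simp
    then show ?thesis using that(2) by (simp add: H_def q1_def q2_def na ga) (simp add: g_def)
  qed
  define c1 where "c1 = cos (\<alpha> * \<theta> / 2)"
  define c2 where "c2 = cos (\<theta> / 2)"
  have c12: "c1 > 0" "c2 > 0" unfolding c1_def c2_def using al thpi pi_gt_zero
    by (auto intro!: cos_gt_zero_pi simp: add_pos_pos) (smt (verit) mult_pos_pos)+
  define N where "N = norm (F (of_real a))"
  have bnum: "norm (num w) \<le> exp ((k + 1) * Re w) / (c1 * (exp (\<alpha> * Re w) + lam)) + N * (2 * exp (Re w) / (c2 * (exp (Re w) + X)))"
    if "0 \<le> Im w" "Im w \<le> \<theta>" for w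
  proof -
    have p1: "0 < c1 * (exp (\<alpha> * Re w) + lam)" and p2: "0 < c2 * (exp (Re w) + X)"
      using c12 lam X by (auto intro!: mult_pos_pos add_pos_pos)
    have "norm (F w) \<le> exp ((k + 1) * Re w) / (c1 * (exp (\<alpha> * Re w) + lam))"
      unfolding F_def norm_divide using low1[of w \<theta>] p1 that al
      by (intro frac_le) (auto simp: c1_def)
    moreover have "norm (2 * exp w / (of_real X + exp w)) \<le> 2 * exp (Re w) / (c2 * (exp (Re w) + X))"
      unfolding norm_divide norm_mult using low2[of w \<theta>] p2 that thpi
      by (intro frac_le) (auto simp: c2_def)
    then have "norm (F (of_real a) * (2 * exp w / (of_real X + exp w))) \<le> N * (2 * exp (Re w) / (c2 * (exp (Re w) + X)))"
      unfolding norm_mult[of "F (of_real a)"] N_def by (intro mult_left_mono) auto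
    ultimately show ?thesis unfolding num_def using norm_triangle_ineq4 add_mono order_trans by meson
  qed
  \<comment> \<open>The rates of decay of the three contributions: \<open>e\<^sup>(\<^sup>k\<^sup>+\<^sup>1\<^sup>)\<^sup>x\<close> to the left, \<open>e\<^sup>(\<^sup>k\<^sup>-\<^sup>\<alpha>\<^sup>)\<^sup>x\<close>
    to the right, and \<open>e\<^sup>-\<^sup>\<bar>\<^sup>x\<^sup>\<bar>\<close> from the subtracted pole.\<close>
  define \<delta> where "\<delta> = min 1 (min (k + 1) (\<alpha> - k))"
  have \<delta>: "\<delta> > 0" "\<delta> \<le> 1" "\<delta> \<le> k + 1" "\<delta> \<le> \<alpha> - k" using k by (auto simp: \<delta>_def)
  define BR where "BR = 2 * (1 / c1 + 2 * N / c2)"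
  define BL where "BL = 2 / X * (1 / (c1 * lam) + 2 * N / (c2 * X))"
  define r where "r = \<bar>a\<bar> + 1"
  have N0: "N \<ge> 0" by (simp add: N_def)
  have BRL: "BR \<ge> 0" "BL \<ge> 0" using c12 N0 X lam by (auto simp: BR_def BL_def)
  have e2: "2 \<le> exp (1::real)" using exp_ge_add_one_self[of "1::real"] by simp
  have bH: "norm (H w) \<le> max BR BL * exp (- \<delta> * \<bar>Re w\<bar>)"
    if w: "0 \<le> Im w" "Im w \<le> \<theta>" "r \<le> \<bar>Re w\<bar>" for w
  proof -
    have wS: "w \<in> S" using w om by (simp add: S_def)
    have wa: "w \<noteq> of_real a" using w by (auto simp: r_def)
    have nH: "norm (H w) = norm (num w) / norm (of_real X - exp w)"
      using Heq[OF wS wa] by (simp add: norm_divide)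
    define x where "x = Re w"
    have n0: "norm (exp w) = exp x" by (simp add: x_def)
    have F1: "exp x * exp ((k + 1 - \<alpha>) * x) = exp ((k+1) * x) / exp (\<alpha> * x) * exp x" by (simp add: exp_diff algebra_simps)
    show ?thesis
    proof (cases "x \<ge> 0")
      case True
      then have "x \<ge> a + 1" using w by (auto simp: r_def x_def)
      then have "exp x \<ge> exp (a + 1)" by simp
      moreover have "X * 2 \<le> X * exp 1" using e2 X by (intro mult_left_mono) auto
      ultimately have "exp x \<ge> 2 * X" unfolding exp_add ea by linarith
      then have d: "exp x / 2 \<le> norm (of_real X - exp w)"
        using norm_triangle_ineq3[of "of_real X" "exp w"] n0 X by simp
      have "norm (num w) \<le> exp ((k + 1) * x) / (c1 * exp (\<alpha> * x)) + N * (2 * exp x / (c2 * exp x))"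
      proof (rule order_trans[OF bnum[OF w(1,2)]], fold x_def, rule add_mono)
        show "exp ((k + 1) * x) / (c1 * (exp (\<alpha> * x) + lam)) \<le> exp ((k + 1) * x) / (c1 * exp (\<alpha> * x))"
          using c12 lam by (intro divide_left_mono mult_left_mono mult_pos_pos) (auto simp: add_pos_pos)
        show "N * (2 * exp x / (c2 * (exp x + X))) \<le> N * (2 * exp x / (c2 * exp x))"
          using c12 X N0 by (intro mult_left_mono divide_left_mono mult_pos_pos) (auto simp: add_pos_pos)
      qed
      also have "\<dots> = 1 / c1 * exp ((k + 1 - \<alpha>) * x) + 2 * N / c2"
        using c12 by (simp add: exp_diff left_diff_distrib field_simps)
      finally have n1: "norm (num w) \<le> 1 / c1 * exp ((k + 1 - \<alpha>) * x) + 2 * N / c2" .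
      have "norm (H w) \<le> (1 / c1 * exp ((k + 1 - \<alpha>) * x) + 2 * N / c2) / (exp x / 2)"
        unfolding nH using n1 d c12 N0 by (intro frac_le) auto
      also have "\<dots> = 2 * (1 / c1 * exp ((k - \<alpha>) * x) + 2 * N / c2 * exp (- x))"
        by (simp add: exp_minus exp_diff field_simps exp_add)
      also have "\<dots> \<le> 2 * (1 / c1 * exp (- \<delta> * x) + 2 * N / c2 * exp (- \<delta> * x))"
      proof -
        have "(k - \<alpha>) * x \<le> - \<delta> * x" using \<delta> True by (intro mult_right_mono) auto
        moreover have "- x \<le> - \<delta> * x" using \<delta> True by (simp add: mult_left_le_one_le)
        ultimately show ?thesis using c12 N0 by (intro mult_left_mono add_mono) auto
      qed
      also have "\<dots> = BR * exp (- \<delta> * \<bar>Re w\<bar>)" using True by (simp add: BR_def x_def algebra_simps)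
      also have "\<dots> \<le> max BR BL * exp (- \<delta> * \<bar>Re w\<bar>)" by (intro mult_right_mono) auto
      finally show ?thesis .
    next
      case False
      then have "x \<le> a - 1" using w by (auto simp: r_def x_def)
      then have "exp (x + 1) \<le> exp a" by simp
      moreover have "exp x * 2 \<le> exp x * exp 1" using e2 by (intro mult_left_mono) auto
      ultimately have "exp x \<le> X / 2" unfolding exp_add ea by linarith
      then have d: "X / 2 \<le> norm (of_real X - exp w)"
        using norm_triangle_ineq2[of "of_real X" "exp w"] n0 X by simp
      have "norm (num w) \<le> exp ((k + 1) * x) / (c1 * lam) + N * (2 * exp x / (c2 * X))"
      proof (rule order_trans[OF bnum[OF w(1,2)]], fold x_def, rule add_mono)
        show "exp ((k + 1) * x) / (c1 * (exp (\<alpha> * x) + lam)) \<le> exp ((k + 1) * x) / (c1 * lam)"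
          using c12 lam by (intro divide_left_mono mult_left_mono mult_pos_pos) (auto simp: add_pos_pos)
        show "N * (2 * exp x / (c2 * (exp x + X))) \<le> N * (2 * exp x / (c2 * X))"
          using c12 X N0 by (intro mult_left_mono divide_left_mono mult_pos_pos) (auto simp: add_pos_pos)
      qed
      also have "\<dots> \<le> exp (\<delta> * x) / (c1 * lam) + N * (2 * exp (\<delta> * x) / (c2 * X))"
      proof -
        have "(k + 1) * x \<le> \<delta> * x" "1 * x \<le> \<delta> * x" using \<delta> False by (auto intro!: mult_right_mono_neg)
        then show ?thesis using c12 N0 X lam by (intro add_mono mult_left_mono divide_right_mono) auto
      qed
      finally have n1: "norm (num w) \<le> exp (\<delta> * x) / (c1 * lam) + N * (2 * exp (\<delta> * x) / (c2 * X))" .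
      have "norm (H w) \<le> (exp (\<delta> * x) / (c1 * lam) + N * (2 * exp (\<delta> * x) / (c2 * X))) / (X / 2)"
        unfolding nH using n1 d X by (intro frac_le) (auto intro: order_trans[OF norm_ge_zero])
      also have "\<dots> = BL * exp (- \<delta> * \<bar>Re w\<bar>)"
        using False X c12 lam by (simp add: BL_def x_def field_simps)
      also have "\<dots> \<le> max BR BL * exp (- \<delta> * \<bar>Re w\<bar>)" by (intro mult_right_mono) auto
      finally show ?thesis .
    qed
  qed
  have shift: "integrable lborel (\<lambda>x. H (Complex x \<theta>))" "integrable lborel (\<lambda>x. H (of_real x))"
    "(LINT x|lborel. H (Complex x \<theta>)) = (LINT x|lborel. H (of_real x))"
    by (rule strip_shift[OF less_imp_le[OF al(2)] om(1) holH[unfolded S_def] \<delta>(1)], rule bH, assumption+)+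
  have "Im (LINT x|lborel. H (of_real x)) = (LINT x|lborel. Im (H (of_real x)))"
    using shift(2) by simp
  also have "\<dots> = 0"
  proof (rule integral_eq_zero_AE)
    have "AE x in lborel. x \<noteq> a" by (rule AE_lborel_singleton)
    then show "AE x in lborel. Im (H (of_real x)) = 0"
    proof eventually_elim
      case (elim x)
      have xS: "of_real x \<in> S" using om al by (simp add: S_def)
      have "H (of_real x) = num (of_real x) / (of_real X - exp (of_real x))"
        using elim by (intro Heq xS) simp
      also have "\<dots> = of_real ((exp ((k + 1) * x) / (exp (\<alpha> * x) + lam) - exp ((k + 1) * a) / (exp (\<alpha> * a) + lam) * (2 * exp x / (X + exp x))) / (X - exp x))"
        by (simp add: num_def FR exp_of_real)
      finally show ?case by (simp only: Im_complex_of_real)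
    qed
  qed
  finally have ImH: "Im (LINT x|lborel. H (Complex x \<theta>)) = 0" using shift(3) by simp
  have inS: "Complex x \<theta> \<in> S" "Complex x \<theta> \<noteq> of_real a" for x
    using om al by (auto simp: S_def complex_eq_iff)
  have Fa: "F (of_real a) = of_real (X powr (k + 1) / (X powr \<alpha> + lam))"
    unfolding FR using X by (simp add: a_def powr_def)
  define P where "P = (\<lambda>x. 2 * exp (Complex x \<theta>) / ((of_real X + exp (Complex x \<theta>)) * (of_real X - exp (Complex x \<theta>))))"
  have intP: "integrable lborel P" and valP: "(LINT x|lborel. P x) = \<i> * pi / X"
    using exp_log_integral[OF al(2) thpi X] by (simp_all add: P_def)
  have e: "F (Complex x \<theta>) / (of_real X - exp (Complex x \<theta>)) = H (Complex x \<theta>) + F (of_real a) * P x" for x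
    using Heq[OF inS] by (simp add: num_def P_def diff_divide_distrib)
  show "integrable lborel (\<lambda>x. F (Complex x \<theta>) / (of_real X - exp (Complex x \<theta>)))"
    unfolding e using shift(1) intP by (intro Bochner_Integration.integrable_add integrable_mult_right) auto
  have "(LINT x|lborel. F (Complex x \<theta>) / (of_real X - exp (Complex x \<theta>))) = (LINT x|lborel. H (Complex x \<theta>)) + F (of_real a) * (\<i> * pi / X)"
    unfolding e using shift(1) intP valP by (subst Bochner_Integration.integral_add) auto
  then have "Im (LINT x|lborel. F (Complex x \<theta>) / (of_real X - exp (Complex x \<theta>))) = Im (of_real (X powr (k + 1) / (X powr \<alpha> + lam)) * (\<i> * pi / X))"
    using ImH Fa by simp
  also have "\<dots> = X powr (k + 1) / (X powr \<alpha> + lam) * (pi / X)"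
    by (simp add: complex_eq_iff)
  also have "\<dots> = pi * (X powr k / (X powr \<alpha> + lam))"
    using X by (simp add: powr_add)
  finally show "Im (LINT x|lborel. F (Complex x \<theta>) / (of_real X - exp (Complex x \<theta>))) = pi * (X powr k / (X powr \<alpha> + lam))" .
qed

section \<open>Mittag-Leffler kernels as integrals along a ray\<close>

text \<open>
  The midpoint of \<open>\<pi> / 2\<close> and \<open>\<pi> / \<alpha>\<close>: on the ray of this angle \<open>e\<^sup>t\<^sup>\<zeta>\<close> decays, and \<open>\<zeta>\<^sup>\<alpha> + \<lambda>\<close>
  has no zero up to this ray.
\<close>

definition ray_angle :: "real \<Rightarrow> real" where
  "ray_angle \<alpha> = pi * (\<alpha> + 2) / (4 * \<alpha>)"

text \<open>
  The integrand \<open>e\<^sup>t\<^sup>\<zeta> \<zeta>\<^sup>k / (\<zeta>\<^sup>\<alpha> + \<lambda>) d\<zeta>\<close> of the inverse Laplace transform with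
  \<open>\<zeta> = e\<^sup>x\<^sup>+\<^sup>i\<^sup>\<theta>\<close>, so that \<open>d\<zeta> = \<zeta> dx\<close> raises the exponent to \<open>k + 1\<close>. Logarithmic coordinates
  turn powers into exponentials and avoid complex powers altogether.
\<close>

definition ray_integrand :: "real \<Rightarrow> real \<Rightarrow> real \<Rightarrow> real \<Rightarrow> real \<Rightarrow> complex" where
  "ray_integrand \<alpha> lam k t x =
     exp (of_real t * exp (Complex x (ray_angle \<alpha>))) *
     (exp (of_real (k + 1) * Complex x (ray_angle \<alpha>)) /
      (exp (of_real \<alpha> * Complex x (ray_angle \<alpha>)) + of_real lam))"

text \<open>
  The contour integral over both rays; it equals \<open>t\<^sup>\<alpha>\<^sup>-\<^sup>k\<^sup>-\<^sup>1 E\<^sub>\<alpha>\<^sub>,\<^sub>\<alpha>\<^sub>-\<^sub>k(- \<lambda> t\<^sup>\<alpha>)\<close> in terms of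
  the Mittag-Leffler function, but only the integral representation is used.
\<close>

definition ray_kernel :: "real \<Rightarrow> real \<Rightarrow> real \<Rightarrow> real \<Rightarrow> real" where
  "ray_kernel \<alpha> lam k t = Im (LINT x|lborel. ray_integrand \<alpha> lam k t x) / pi"

definition ray_decay :: "real \<Rightarrow> real" where
  "ray_decay \<alpha> = - cos (ray_angle \<alpha>)"

definition ray_lower :: "real \<Rightarrow> real" where
  "ray_lower \<alpha> = cos (\<alpha> * ray_angle \<alpha> / 2)"

lemma ray_angle_bounds:
  assumes "1 < \<alpha>" "\<alpha> < 2"
  shows "pi / 2 < ray_angle \<alpha>" "ray_angle \<alpha> < pi" "0 < ray_angle \<alpha>" "\<alpha> * ray_angle \<alpha> < pi"
proof -
  show 1: "pi / 2 < ray_angle \<alpha>" using assms pi_gt_zero by (simp add: ray_angle_def field_simps)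
  show "ray_angle \<alpha> < pi" using assms pi_gt_zero by (simp add: ray_angle_def field_simps)
  show "0 < ray_angle \<alpha>" using 1 pi_gt_zero by linarith
  show "\<alpha> * ray_angle \<alpha> < pi" using assms pi_gt_zero by (simp add: ray_angle_def field_simps)
qed

lemma ray_decay_pos: assumes "1 < \<alpha>" "\<alpha> < 2" shows "ray_decay \<alpha> > 0"
proof -
  have "0 < cos (pi - ray_angle \<alpha>)"
    using ray_angle_bounds[OF assms] by (intro cos_gt_zero_pi) auto
  then show ?thesis by (simp add: ray_decay_def)
qed

lemma ray_lower_pos: assumes "1 < \<alpha>" "\<alpha> < 2" shows "ray_lower \<alpha> > 0"
proof -
  have "0 \<le> \<alpha> * ray_angle \<alpha>" using ray_angle_bounds[OF assms] assms by simp
  then show ?thesis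
    unfolding ray_lower_def using ray_angle_bounds[OF assms] pi_gt_zero by (intro cos_gt_zero_pi) linarith+
qed

lemma Re_exp_ray: "Re (exp (Complex x (ray_angle \<alpha>))) = - ray_decay \<alpha> * exp x"
  by (simp add: ray_decay_def Re_exp)

lemma norm_ray_integrand:
  "norm (ray_integrand \<alpha> lam k t x) =
     exp (- ray_decay \<alpha> * t * exp x) * norm (ray_integrand \<alpha> lam k 0 x)"
proof -
  have "norm (exp (of_real t * exp (Complex x (ray_angle \<alpha>)))) = exp (- ray_decay \<alpha> * t * exp x)"
    by (simp add: Re_exp_ray)
  then show ?thesis unfolding ray_integrand_def norm_mult by simp
qed

lemma norm_ray_integrand_0:
  assumes "1 < \<alpha>" "\<alpha> < 2" "lam > 0"
  shows "norm (ray_integrand \<alpha> lam k 0 x) \<le> exp ((k + 1) * x) / (ray_lower \<alpha> * (exp (\<alpha> * x) + lam))"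
proof -
  have "ray_lower \<alpha> * (exp (\<alpha> * x) + lam) \<le> norm (exp (of_real \<alpha> * Complex x (ray_angle \<alpha>)) + of_real lam)"
  proof -
    have "exp (of_real \<alpha> * Complex x (ray_angle \<alpha>)) = of_real (exp (\<alpha> * x)) * cis (\<alpha> * ray_angle \<alpha>)"
      by (simp add: exp_eq_polar)
    then show ?thesis
      unfolding ray_lower_def using ray_angle_bounds[OF assms(1,2)] assms
      by (simp only: , intro sector_norm_lower) auto
  qed
  moreover have "0 < ray_lower \<alpha> * (exp (\<alpha> * x) + lam)"
    using assms ray_lower_pos by (intro mult_pos_pos) (auto simp: add_pos_pos)
  ultimately show ?thesis unfolding ray_integrand_def
    by (simp add: norm_divide) (intro frac_le, auto)
qed

lemma continuous_on_Complex_line: "continuous_on A (\<lambda>x. Complex x \<phi>)"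
  unfolding Complex_eq by (intro continuous_intros)

lemma ray_denom_nonzero:
  assumes "1 < \<alpha>" "\<alpha> < 2" "lam > 0"
  shows "exp (of_real \<alpha> * Complex x (ray_angle \<alpha>)) + of_real lam \<noteq> 0"
proof -
  have "exp (of_real \<alpha> * Complex x (ray_angle \<alpha>)) = of_real (exp (\<alpha> * x)) * cis (\<alpha> * ray_angle \<alpha>)"
    by (simp add: exp_eq_polar)
  moreover have "sin (\<alpha> * ray_angle \<alpha>) > 0"
    using ray_angle_bounds[OF assms(1,2)] assms by (intro sin_gt_zero) auto
  ultimately show ?thesis by (auto simp: complex_eq_iff)
qed

lemma continuous_on_ray_integrand:
  assumes "1 < \<alpha>" "\<alpha> < 2" "lam > 0"
  shows "continuous_on UNIV (\<lambda>x. ray_integrand \<alpha> lam k t x)" "continuous_on UNIV (\<lambda>t. ray_integrand \<alpha> lam k t x)"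
    "continuous_on UNIV (\<lambda>(t, x). ray_integrand \<alpha> lam k t x)"
  unfolding ray_integrand_def split_beta
  by (intro continuous_intros continuous_on_Complex_line ray_denom_nonzero[OF assms] ballI
      continuous_on_compose2[OF continuous_on_Complex_line[of UNIV]]; simp)+

lemma interpolation_weight:
  fixes a lam \<sigma> :: real
  assumes "a > 0" "lam > 0" "0 \<le> \<sigma>" "\<sigma> \<le> 1"
  shows "lam powr (1 - \<sigma>) * a powr \<sigma> \<le> a + lam"
proof -
  define m where "m = max a lam"
  have "lam powr (1 - \<sigma>) * a powr \<sigma> \<le> m powr (1 - \<sigma>) * m powr \<sigma>"
    using assms by (intro mult_mono powr_mono2) (auto simp: m_def)
  also have "\<dots> = m" using assms by (simp add: m_def flip: powr_add)
  also have "\<dots> \<le> a + lam" using assms by (auto simp: m_def)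
  finally show ?thesis .
qed

lemma norm_ray_integrand_weighted:
  assumes al: "1 < \<alpha>" "\<alpha> < 2" "lam > 0" and s: "0 \<le> \<sigma>" "\<sigma> \<le> 1"
  shows "lam powr (1 - \<sigma>) * norm (ray_integrand \<alpha> lam k t x)
    \<le> exp (- ray_decay \<alpha> * t * exp x) * (exp ((k + 1 - \<alpha> * \<sigma>) * x) / ray_lower \<alpha>)"
proof -
  define w where "w = exp (\<alpha> * x)"
  have w: "w > 0" by (simp add: w_def)
  have ws: "w powr \<sigma> = exp (\<alpha> * \<sigma> * x)" by (simp add: w_def powr_def algebra_simps)
  have "lam powr (1 - \<sigma>) * norm (ray_integrand \<alpha> lam k 0 x)
      \<le> lam powr (1 - \<sigma>) * (exp ((k + 1) * x) / (ray_lower \<alpha> * (w + lam)))"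
    using norm_ray_integrand_0[OF al, of k x] by (intro mult_left_mono) (auto simp: w_def)
  also have "\<dots> = exp ((k + 1) * x) / ray_lower \<alpha> * (lam powr (1 - \<sigma>) / (w + lam))"
    by simp
  also have "\<dots> \<le> exp ((k + 1) * x) / ray_lower \<alpha> * (1 / w powr \<sigma>)"
  proof (intro mult_left_mono frac_le_cross)
    show "lam powr (1 - \<sigma>) * w powr \<sigma> \<le> 1 * (w + lam)" using interpolation_weight[OF w al(3) s] by simp
  qed (use w al ray_lower_pos[OF al(1,2)] in \<open>auto simp: add_pos_pos\<close>)
  also have "\<dots> = exp ((k + 1 - \<alpha> * \<sigma>) * x) / ray_lower \<alpha>"
    unfolding ws by (simp add: exp_diff left_diff_distrib)
  finally have *: "lam powr (1 - \<sigma>) * norm (ray_integrand \<alpha> lam k 0 x) \<le> exp ((k + 1 - \<alpha> * \<sigma>) * x) / ray_lower \<alpha>" .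
  have "lam powr (1 - \<sigma>) * norm (ray_integrand \<alpha> lam k t x)
      = exp (- ray_decay \<alpha> * t * exp x) * (lam powr (1 - \<sigma>) * norm (ray_integrand \<alpha> lam k 0 x))"
    by (subst norm_ray_integrand) simp
  also have "\<dots> \<le> exp (- ray_decay \<alpha> * t * exp x) * (exp ((k + 1 - \<alpha> * \<sigma>) * x) / ray_lower \<alpha>)"
    using * by (intro mult_left_mono) auto
  finally show ?thesis .
qed

lemma integrable_exp_exp:
  assumes "c > 0" "\<kappa> > 0"
  shows "integrable lborel (\<lambda>x::real. exp (- c * exp x) * exp (\<kappa> * x))"
proof (rule integrable_exp_decay[where \<delta>=\<kappa> and B="exp (2 * \<kappa>\<^sup>2 / c)"])
  show "(\<lambda>x::real. exp (- c * exp x) * exp (\<kappa> * x)) \<in> borel_measurable borel"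
    by (intro borel_measurable_continuous_onI continuous_intros)
  fix x :: real
  have "- c * exp x + \<kappa> * x \<le> 2 * \<kappa>\<^sup>2 / c - \<kappa> * \<bar>x\<bar>"
  proof (cases "x \<ge> 0")
    case True
    have "x\<^sup>2 / 2 \<le> exp x" using exp_lower_Taylor_quadratic[OF True] True by linarith
    then have "c * (x\<^sup>2 / 2) \<le> c * exp x" using assms by (intro mult_left_mono) auto
    moreover have "2 * \<kappa> * x = 2 * \<kappa>\<^sup>2 / c + c * (x\<^sup>2 / 2) - c / 2 * (x - 2 * \<kappa> / c)\<^sup>2"
      using assms by (simp add: power2_eq_square field_simps)
    moreover have "c / 2 * (x - 2 * \<kappa> / c)\<^sup>2 \<ge> 0" using assms by simp
    ultimately show ?thesis using True by (simp add: abs_of_nonneg)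
  next
    case False
    have "0 \<le> 2 * \<kappa>\<^sup>2 / c" "0 \<le> c * exp x" using assms by auto
    then show ?thesis using False by (simp add: abs_of_neg)
  qed
  then have "exp (- c * exp x + \<kappa> * x) \<le> exp (2 * \<kappa>\<^sup>2 / c - \<kappa> * \<bar>x\<bar>)" by simp
  then show "norm (exp (- c * exp x) * exp (\<kappa> * x)) \<le> exp (2 * \<kappa>\<^sup>2 / c) * exp (- \<kappa> * \<bar>x\<bar>)"
    by (simp add: exp_diff exp_minus divide_inverse exp_add mult.commute)
qed (use assms in auto)

lemma integral_exp_exp_scale:
  fixes c \<kappa> t :: real
  assumes "c > 0" "\<kappa> > 0" "t > 0"
  shows "(LINT x|lborel. exp (- c * t * exp x) * exp (\<kappa> * x)) = t powr (- \<kappa>) * (LINT x|lborel. exp (- c * exp x) * exp (\<kappa> * x))"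
proof -
  have "(LINT x|lborel. exp (- c * t * exp x) * exp (\<kappa> * x))
      = \<bar>1\<bar> *\<^sub>R (LINT x|lborel. exp (- c * t * exp (- ln t + 1 * x)) * exp (\<kappa> * (- ln t + 1 * x)))"
    by (rule lborel_integral_real_affine[of 1 "\<lambda>x. exp (- c * t * exp x) * exp (\<kappa> * x)" "- ln t"]) simp
  also have "(\<lambda>x. exp (- c * t * exp (- ln t + 1 * x)) * exp (\<kappa> * (- ln t + 1 * x)))
      = (\<lambda>x. t powr (- \<kappa>) * (exp (- c * exp x) * exp (\<kappa> * x)))"
  proof
    fix x
    have "t * exp (- ln t + 1 * x) = exp x" using assms by (simp add: exp_diff)
    then have "c * t * exp (- ln t + 1 * x) = c * exp x" by (simp add: mult.assoc)
    moreover have "exp (\<kappa> * (- ln t + 1 * x)) = t powr (- \<kappa>) * exp (\<kappa> * x)"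
    proof -
      have "\<kappa> * (- ln t + 1 * x) = - \<kappa> * ln t + \<kappa> * x" by (simp add: algebra_simps)
      then show ?thesis unfolding exp_add[symmetric] using assms by (simp add: powr_def flip: exp_add)
    qed
    ultimately show "exp (- c * t * exp (- ln t + 1 * x)) * exp (\<kappa> * (- ln t + 1 * x))
      = t powr (- \<kappa>) * (exp (- c * exp x) * exp (\<kappa> * x))" by (simp add: mult.left_commute)
  qed
  finally show ?thesis by (simp only: integral_mult_right_zero abs_one scaleR_one)
qed

lemma integrable_ray_integrand:
  assumes al: "1 < \<alpha>" "\<alpha> < 2" "lam > 0" and "t > 0" "k > -1"
  shows "integrable lborel (ray_integrand \<alpha> lam k t)"
proof (rule Bochner_Integration.integrable_bound)
  show "integrable lborel (\<lambda>x. exp (- (ray_decay \<alpha> * t) * exp x) * exp ((k + 1) * x) * (1 / (lam * ray_lower \<alpha>)))"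
    using assms ray_decay_pos by (intro integrable_mult_left integrable_exp_exp) auto
  show "AE x in lborel. norm (ray_integrand \<alpha> lam k t x) \<le> norm (exp (- (ray_decay \<alpha> * t) * exp x) * exp ((k + 1) * x) * (1 / (lam * ray_lower \<alpha>)))"
    using norm_ray_integrand_weighted[OF al, of 0 k t] al ray_lower_pos[OF al(1,2)]
    by (intro AE_I2) (simp add: field_simps)
  show "ray_integrand \<alpha> lam k t \<in> borel_measurable lborel"
    using borel_measurable_continuous_onI[OF continuous_on_ray_integrand(1)[OF al]] by simp
qed

text \<open>
  The weight \<open>\<lambda>\<^sup>1\<^sup>-\<^sup>\<sigma>\<close> is absorbed by the denominator \<open>\<zeta>\<^sup>\<alpha> + \<lambda>\<close> at the price of \<open>\<bar>\<zeta>\<bar>\<^sup>-\<^sup>\<alpha>\<^sup>\<sigma>\<close>, and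
  scaling the ray then produces the power of \<open>t\<close>. The constant does not depend on \<open>lam\<close>, so the
  bound can be applied to all modes at once.
\<close>

lemma ray_kernel_bound:
  assumes al: "1 < \<alpha>" "\<alpha> < 2" and s: "0 \<le> \<sigma>" "\<sigma> \<le> 1" and k: "k > -1" "\<alpha> * \<sigma> < k + 1"
  obtains C where "C \<ge> 0"
    "\<And>lam t. lam > 0 \<Longrightarrow> t > 0 \<Longrightarrow> lam powr (1 - \<sigma>) * \<bar>ray_kernel \<alpha> lam k t\<bar> \<le> C * t powr (\<alpha> * \<sigma> - k - 1)"
proof
  define \<kappa> where "\<kappa> = k + 1 - \<alpha> * \<sigma>"
  have \<kappa>: "\<kappa> > 0" using k by (simp add: \<kappa>_def)
  define c where "c = ray_decay \<alpha>"
  have c: "c > 0" using al ray_decay_pos by (simp add: c_def)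
  define J where "J = (LINT x|lborel. exp (- c * exp x) * exp (\<kappa> * x))"
  have J: "J \<ge> 0" unfolding J_def by (intro Bochner_Integration.integral_nonneg) auto
  define C where "C = J / ray_lower \<alpha> / pi"
  show "C \<ge> 0" using J ray_lower_pos[OF al] by (simp add: C_def)
  fix lam t :: real assume lam: "lam > 0" and t: "t > 0"
  have "lam powr (1 - \<sigma>) * \<bar>ray_kernel \<alpha> lam k t\<bar> \<le> lam powr (1 - \<sigma>) * (norm (LINT x|lborel. ray_integrand \<alpha> lam k t x) / pi)"
    unfolding ray_kernel_def abs_divide by (intro mult_left_mono) (simp_all add: divide_right_mono abs_Im_le_cmod)
  also have "\<dots> \<le> lam powr (1 - \<sigma>) * ((LINT x|lborel. norm (ray_integrand \<alpha> lam k t x)) / pi)"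
    by (intro mult_left_mono divide_right_mono integral_norm_bound) auto
  also have "\<dots> = (LINT x|lborel. lam powr (1 - \<sigma>) * norm (ray_integrand \<alpha> lam k t x)) / pi"
    by simp
  also have "\<dots> \<le> (LINT x|lborel. exp (- (c * t) * exp x) * exp (\<kappa> * x) * (1 / ray_lower \<alpha>)) / pi"
  proof (intro divide_right_mono Bochner_Integration.integral_mono integrable_mult_right integrable_norm integrable_mult_left integrable_exp_exp)
    show "integrable lborel (ray_integrand \<alpha> lam k t)" by (rule integrable_ray_integrand) (use al lam t k in auto)
    fix x
    show "lam powr (1 - \<sigma>) * norm (ray_integrand \<alpha> lam k t x) \<le> exp (- (c * t) * exp x) * exp (\<kappa> * x) * (1 / ray_lower \<alpha>)"
      using norm_ray_integrand_weighted[OF al lam s, of k t x] by (simp add: c_def \<kappa>_def)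
  qed (use c t \<kappa> in auto)
  also have "\<dots> = (LINT x|lborel. exp (- c * t * exp x) * exp (\<kappa> * x)) * (1 / ray_lower \<alpha>) / pi"
    by simp
  also have "\<dots> = C * t powr (\<alpha> * \<sigma> - k - 1)"
    unfolding integral_exp_exp_scale[OF c \<kappa> t] by (simp add: C_def J_def \<kappa>_def algebra_simps)
  finally show "lam powr (1 - \<sigma>) * \<bar>ray_kernel \<alpha> lam k t\<bar> \<le> C * t powr (\<alpha> * \<sigma> - k - 1)" .
qed

lemma continuous_on_param_integral:
  fixes f :: "real \<Rightarrow> real \<Rightarrow> 'b::{banach, second_countable_topology}"
  assumes meas: "\<And>t. t \<in> S \<Longrightarrow> f t \<in> borel_measurable M" and cont: "\<And>x. x \<in> space M \<Longrightarrow> continuous_on S (\<lambda>t. f t x)"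
    and w: "integrable M w" "\<And>t x. t \<in> S \<Longrightarrow> x \<in> space M \<Longrightarrow> norm (f t x) \<le> w x"
  shows "continuous_on S (\<lambda>t. LINT x|M. f t x)"
  unfolding continuous_on_sequentially
proof (intro allI ballI impI)
  fix y a assume a: "a \<in> S" and y: "(\<forall>n. y n \<in> S) \<and> y \<longlonglongrightarrow> a"
  show "((\<lambda>t. LINT x|M. f t x) \<circ> y) \<longlonglongrightarrow> (LINT x|M. f a x)"
    unfolding o_def
  proof (rule integral_dominated_convergence[where w=w])
    show "AE x in M. (\<lambda>n. f (y n) x) \<longlonglongrightarrow> f a x"
      using cont a y unfolding continuous_on_sequentially o_def by (intro AE_I2) blast
    show "AE x in M. norm (f (y n) x) \<le> w x" for n using w y by (intro AE_I2) blast
  qed (use meas w a y in auto)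
qed

lemma continuous_on_ray_kernel:
  assumes al: "1 < \<alpha>" "\<alpha> < 2" "lam > 0" and k: "k > -1"
  shows "continuous_on {0<..} (ray_kernel \<alpha> lam k)"
proof -
  have c: "continuous_on {a..} (ray_kernel \<alpha> lam k)" if a: "a > 0" for a
    unfolding ray_kernel_def
  proof (intro continuous_on_divide continuous_on_Im continuous_on_const continuous_on_param_integral)
    show "integrable lborel (\<lambda>x. norm (ray_integrand \<alpha> lam k a x))"
      by (intro integrable_norm integrable_ray_integrand al a k)
    fix t x assume t: "t \<in> {a..}"
    have "exp (- ray_decay \<alpha> * t * exp x) \<le> exp (- ray_decay \<alpha> * a * exp x)"
      using t ray_decay_pos[OF al(1,2)] by simp
    then show "norm (ray_integrand \<alpha> lam k t x) \<le> norm (ray_integrand \<alpha> lam k a x)"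
      unfolding norm_ray_integrand[of _ _ _ t] norm_ray_integrand[of _ _ _ a] by (intro mult_right_mono) auto
  next
    show "ray_integrand \<alpha> lam k t \<in> borel_measurable lborel" for t
      using borel_measurable_continuous_onI[OF continuous_on_ray_integrand(1)[OF al]] by simp
  qed (use continuous_on_subset[OF continuous_on_ray_integrand(2)[OF al]] in auto)
  show ?thesis
  proof (intro continuous_at_imp_continuous_on ballI)
    fix t :: real assume "t \<in> {0<..}"
    then have "continuous_on {t/2..} (ray_kernel \<alpha> lam k)" and t: "t \<in> {t/2<..}"
      using c[of "t/2"] by auto
    then have "continuous_on {t/2<..} (ray_kernel \<alpha> lam k)"
      by (rule_tac continuous_on_subset) auto
    with t have "continuous_on {t/2<..} (ray_kernel \<alpha> lam k)" "t \<in> {t/2<..}" by auto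
    then show "isCont (ray_kernel \<alpha> lam k) t" by (simp add: continuous_on_eq_continuous_at)
  qed
qed

lemma integrable_ray_integrand_0:
  assumes al: "1 < \<alpha>" "\<alpha> < 2" "lam > 0" and k: "k > -1" "k < \<alpha> - 1"
  shows "integrable lborel (ray_integrand \<alpha> lam k 0)"
proof (rule integrable_exp_decay[where \<delta>="min (k + 1) (\<alpha> - (k + 1))" and B="1 / ray_lower \<alpha> * max 1 (1 / lam)"])
  show "ray_integrand \<alpha> lam k 0 \<in> borel_measurable borel"
    using borel_measurable_continuous_onI[OF continuous_on_ray_integrand(1)[OF al]] by simp
  fix x :: real
  let ?d = "min (k + 1) (\<alpha> - (k + 1))"
  have l: "ray_lower \<alpha> > 0" using ray_lower_pos al by auto
  have "exp ((k + 1) * x) / (exp (\<alpha> * x) + lam) \<le> max 1 (1 / lam) * exp (- ?d * \<bar>x\<bar>)"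
  proof (cases "x \<ge> 0")
    case True
    have "exp ((k + 1) * x) / (exp (\<alpha> * x) + lam) \<le> exp ((k + 1) * x) / exp (\<alpha> * x)"
      using al by (intro divide_left_mono mult_pos_pos) (auto simp: add_pos_pos)
    also have "\<dots> = exp (- (\<alpha> - (k + 1)) * x)" by (simp add: algebra_simps flip: exp_diff)
    also have "\<dots> \<le> exp (- ?d * x)"
      using mult_right_mono[of ?d "\<alpha> - (k + 1)" x] True by (simp only: exp_le_cancel_iff mult_minus_left neg_le_iff_le)
    also have "\<dots> = 1 * exp (- ?d * \<bar>x\<bar>)" using True by simp
    also have "\<dots> \<le> max 1 (1 / lam) * exp (- ?d * \<bar>x\<bar>)" by (intro mult_right_mono) auto
    finally show ?thesis .
  next
    case False
    have "exp ((k + 1) * x) / (exp (\<alpha> * x) + lam) \<le> exp ((k + 1) * x) / lam"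
      using al by (intro divide_left_mono mult_pos_pos) (auto simp: add_pos_pos)
    also have "\<dots> = 1 / lam * exp ((k + 1) * x)" by simp
    also have "\<dots> \<le> 1 / lam * exp (?d * x)" using False al
      by (intro mult_left_mono) (auto intro!: mult_right_mono_neg)
    also have "\<dots> \<le> max 1 (1 / lam) * exp (- ?d * \<bar>x\<bar>)" using False by (intro mult_mono) auto
    finally show ?thesis .
  qed
  then have "1 / ray_lower \<alpha> * (exp ((k + 1) * x) / (exp (\<alpha> * x) + lam)) \<le> 1 / ray_lower \<alpha> * (max 1 (1 / lam) * exp (- ?d * \<bar>x\<bar>))"
    using l by (intro mult_left_mono) auto
  then show "norm (ray_integrand \<alpha> lam k 0 x) \<le> 1 / ray_lower \<alpha> * max 1 (1 / lam) * exp (- ?d * \<bar>x\<bar>)"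
    using norm_ray_integrand_0[OF al, of k x] by simp
qed (use k in auto)

text \<open>
  For \<open>k < \<alpha> - 1\<close> the integrand is integrable without the help of \<open>e\<^sup>t\<^sup>\<zeta>\<close>, so the kernel extends
  continuously to \<open>t = 0\<close>.
\<close>

lemma continuous_on_ray_kernel_0:
  assumes al: "1 < \<alpha>" "\<alpha> < 2" "lam > 0" and k: "k > -1" "k < \<alpha> - 1"
  shows "continuous_on {0..} (ray_kernel \<alpha> lam k)"
  unfolding ray_kernel_def
proof (intro continuous_on_divide continuous_on_Im continuous_on_const continuous_on_param_integral)
  show "integrable lborel (\<lambda>x. norm (ray_integrand \<alpha> lam k 0 x))"
    by (intro integrable_norm integrable_ray_integrand_0 al k)
  fix t x assume t: "t \<in> {0::real..}"
  have "exp (- ray_decay \<alpha> * t * exp x) \<le> 1"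
    using t ray_decay_pos[OF al(1,2)] by simp
  then show "norm (ray_integrand \<alpha> lam k t x) \<le> norm (ray_integrand \<alpha> lam k 0 x)"
    unfolding norm_ray_integrand[of _ _ _ t] by (intro mult_left_le_one_le) auto
next
  show "ray_integrand \<alpha> lam k t \<in> borel_measurable lborel" for t
    using borel_measurable_continuous_onI[OF continuous_on_ray_integrand(1)[OF al]] by simp
qed (use continuous_on_subset[OF continuous_on_ray_integrand(2)[OF al]] in auto)

lemma laplace_exp:
  fixes s :: complex
  assumes "Re s > 0"
  shows "set_integrable lborel {0<..} (\<lambda>t. exp (- s * of_real t))"
    "(LINT t:{0<..}|lborel. exp (- s * of_real t)) = 1 / s"
    "(LINT t:{0<..}|lborel. exp (- Re s * t)) = 1 / Re s"
proof -
  have I0: "set_integrable lborel {0..} (\<lambda>t. exp (- Re s * t))"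
  proof -
    have "(\<lambda>x::real. exp (- Re s * x)) absolutely_integrable_on {0..}"
      using has_integral_exp_minus_to_infinity[OF assms, of 0]
      by (intro nonnegative_absolutely_integrable_1) auto
    then show ?thesis
      unfolding set_integrable_def by (subst (asm) integrable_completion) auto
  qed
  have sub: "set_integrable lborel {0<..} h" if "set_integrable lborel {0..} h" for h :: "real \<Rightarrow> 'c::{banach, second_countable_topology}"
    using that by (rule set_integrable_subset) auto
  have eq: "(LINT t:{0<..}|lborel. h t) = (LINT t:{0..}|lborel. h t)" if "set_integrable lborel {0..} h" for h :: "real \<Rightarrow> 'c::{banach, second_countable_topology}"
    unfolding set_lebesgue_integral_def
  proof (rule Bochner_Integration.integral_cong_AE)
    show "AE t in lborel. indicat_real {0<..} t *\<^sub>R h t = indicat_real {0..} t *\<^sub>R h t"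
      using AE_lborel_singleton[of "0::real"] by eventually_elim (auto simp: indicator_def)
  qed (use that sub[OF that] in \<open>auto simp: set_integrable_def dest!: borel_measurable_integrable\<close>)
  have Ic: "set_integrable lborel {0..} (\<lambda>t. exp (- s * of_real t))"
    using I0 unfolding set_integrable_def
  proof (rule Bochner_Integration.integrable_bound)
    show "(\<lambda>t. indicat_real {0..} t *\<^sub>R exp (- s * complex_of_real t)) \<in> borel_measurable lborel"
      by (auto intro!: borel_measurable_scaleR borel_measurable_continuous_onI continuous_intros)
  qed (auto simp: indicator_def)
  show "set_integrable lborel {0<..} (\<lambda>t. exp (- s * of_real t))" using sub[OF Ic] .
  have "(LINT t:{0..}|lborel. exp (- Re s * t)) = integral {0..} (\<lambda>t. exp (- Re s * t))"
    by (rule set_borel_integral_eq_integral[OF I0])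
  also have "\<dots> = 1 / Re s" using has_integral_exp_minus_to_infinity[OF assms, of 0] by (auto dest!: integral_unique)
  finally show "(LINT t:{0<..}|lborel. exp (- Re s * t)) = 1 / Re s" using eq[OF I0] by simp
  have s0: "s \<noteq> 0" using assms by auto
  have "(\<lambda>n. LINT t:{0..real n}|lborel. exp (- s * of_real t)) \<longlonglongrightarrow> (LINT t:{0..}|lborel. exp (- s * of_real t))"
    using tendsto_set_lebesgue_integral_at_top[OF _ Ic] filterlim_real_sequentially
    by (rule filterlim_compose) auto
  moreover have "(LINT t:{0..real n}|lborel. exp (- s * of_real t)) = - exp (- s * of_real n) / s - (- exp (- s * of_real 0) / s)" for n
    unfolding set_lebesgue_integral_def
  proof (rule integral_FTC_atLeastAtMost)
    fix x :: real
    have "((\<lambda>w. - exp (- s * w) / s) has_field_derivative exp (- s * of_real x)) (at (of_real x))"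
      using s0 by (auto intro!: derivative_eq_intros)
    then show "((\<lambda>t. - exp (- s * complex_of_real t) / s) has_vector_derivative exp (- s * complex_of_real x)) (at x within {0..real n})"
      by (rule has_vector_derivative_real_field)
  qed (auto intro!: continuous_intros)
  moreover have "(\<lambda>n. - exp (- s * of_real n) / s - (- exp (- s * of_real 0) / s)) \<longlonglongrightarrow> - 0 / s - (- exp (- s * of_real 0) / s)"
  proof (intro tendsto_intros)
    have "(\<lambda>n. exp (- Re s * real n)) \<longlonglongrightarrow> 0" using assms by real_asymp
    then show "(\<lambda>n. exp (- s * of_real n)) \<longlonglongrightarrow> 0"
      by (subst tendsto_norm_zero_iff[symmetric]) simp
  qed (use s0 in auto)
  ultimately have "(LINT t:{0..}|lborel. exp (- s * of_real t)) = 1 / s"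
    using LIMSEQ_unique by fastforce
  then show "(LINT t:{0<..}|lborel. exp (- s * of_real t)) = 1 / s" using eq[OF Ic] by simp
qed

text \<open>
  By Fubini the Laplace transform in \<open>t\<close> may be taken under the ray integral, where it turns
  \<open>e\<^sup>t\<^sup>\<zeta>\<close> into \<open>1 / (X - \<zeta>)\<close>; the Cauchy formula on the strip evaluates the result.
\<close>

lemma laplace_ray_kernel:
  assumes al: "1 < \<alpha>" "\<alpha> < 2" "lam > 0" and k: "-1 < k" "k < \<alpha>" and X: "X > 0"
  shows "set_integrable lborel {0<..} (\<lambda>t. exp (- X * t) * ray_kernel \<alpha> lam k t)"
    "(LINT t:{0<..}|lborel. exp (- X * t) * ray_kernel \<alpha> lam k t) = X powr k / (X powr \<alpha> + lam)"
proof -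
  define c where "c = ray_decay \<alpha>"
  have c: "c > 0" using al ray_decay_pos by (simp add: c_def)
  define \<zeta> where "\<zeta> = (\<lambda>x. exp (Complex x (ray_angle \<alpha>)))"
  define A where "A = ray_integrand \<alpha> lam k 0"
  define f where "f = (\<lambda>x t. indicator {0<..} t *\<^sub>R (exp (- X * t) *\<^sub>R ray_integrand \<alpha> lam k t x))"
  have ex: "exp (- (of_real X - \<zeta> x) * of_real t) = of_real (exp (- X * t)) * exp (of_real t * \<zeta> x)" for x and t :: real
    unfolding exp_of_real[symmetric] exp_add[symmetric] by (simp add: algebra_simps)
  have fe: "f x t = indicator {0<..} t *\<^sub>R exp (- (of_real X - \<zeta> x) * of_real t) * A x" for x t
    unfolding ex by (simp add: f_def A_def \<zeta>_def ray_integrand_def scaleR_conv_of_real)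
  have Res: "Re (of_real X - \<zeta> x) = X + c * exp x" "X + c * exp x > 0" for x
    using X c Re_exp_ray[of x \<alpha>] by (auto simp: \<zeta>_def c_def add_pos_pos)
  have rep: "Re (of_real X - \<zeta> x) > 0" for x by (simp only: Res)
  have nf: "norm (f x t) = indicator {0<..} t *\<^sub>R exp (- Re (of_real X - \<zeta> x) * t) * norm (A x)" for x t
    unfolding fe by (simp add: norm_mult indicator_def)
  have meas: "case_prod f \<in> borel_measurable (lborel \<Otimes>\<^sub>M lborel)"
  proof -
    have "(\<lambda>(t, x). ray_integrand \<alpha> lam k t x) \<in> borel_measurable (borel \<Otimes>\<^sub>M borel)"
      unfolding borel_prod by (rule borel_measurable_continuous_onI[OF continuous_on_ray_integrand(3)[OF al]])
    then have [measurable]: "(\<lambda>(t, x). ray_integrand \<alpha> lam k t x) \<in> borel_measurable (lborel \<Otimes>\<^sub>M lborel)"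
      by (simp cong: measurable_cong_sets sets_pair_measure_cong)
    have "(\<lambda>p. (\<lambda>(t, x). ray_integrand \<alpha> lam k t x) (snd p, fst p)) \<in> borel_measurable (lborel \<Otimes>\<^sub>M lborel)"
      by measurable
    then show ?thesis unfolding f_def split_beta by simp measurable
  qed
  have intx: "integrable lborel (\<lambda>x. LINT t|lborel. norm (f x t))"
  proof -
    have e: "(LINT t|lborel. norm (f x t)) = norm (A x) / (X + c * exp x)" for x
    proof -
      have "(LINT t|lborel. norm (f x t)) = (LINT t:{0<..}|lborel. exp (- Re (of_real X - \<zeta> x) * t)) * norm (A x)"
        unfolding nf set_lebesgue_integral_def by (simp only: integral_mult_left_zero)
      then show ?thesis unfolding laplace_exp(3)[OF rep[of x]] unfolding Res by simp
    qed
    show ?thesis unfolding e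
    proof (rule integrable_exp_decay[where \<delta>="min (k + 1) (\<alpha> - k)" and B="1 / ray_lower \<alpha> * max (1 / c) (1 / (lam * X))"])
      have "continuous_on UNIV A" unfolding A_def by (rule continuous_on_ray_integrand(1)[OF al])
      then show "(\<lambda>x. norm (A x) / (X + c * exp x)) \<in> borel_measurable borel"
        using Res(2) by (intro borel_measurable_continuous_onI continuous_intros) (auto simp: less_imp_neq[symmetric])
      fix x :: real
      let ?d = "min (k + 1) (\<alpha> - k)"
      have l: "ray_lower \<alpha> > 0" using ray_lower_pos al by auto
      have "exp ((k + 1) * x) / ((exp (\<alpha> * x) + lam) * (X + c * exp x)) \<le> max (1 / c) (1 / (lam * X)) * exp (- ?d * \<bar>x\<bar>)"
      proof (cases "x \<ge> 0")
        case True
        have "exp ((k + 1) * x) / ((exp (\<alpha> * x) + lam) * (X + c * exp x)) \<le> exp ((k + 1) * x) / (exp (\<alpha> * x) * (c * exp x))"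
          using al X c by (intro divide_left_mono mult_mono mult_pos_pos) (auto simp: add_pos_pos)
        also have "\<dots> = 1 / c * exp (- (\<alpha> - k) * x)"
          by (simp add: exp_diff exp_add ring_distribs exp_minus field_simps)
        also have "\<dots> \<le> 1 / c * exp (- ?d * x)"
          using mult_right_mono[of ?d "\<alpha> - k" x] True c
          by (intro mult_left_mono) (simp_all only: exp_le_cancel_iff mult_minus_left neg_le_iff_le, simp_all)
        also have "\<dots> = 1 / c * exp (- ?d * \<bar>x\<bar>)" using True by simp
        also have "\<dots> \<le> max (1 / c) (1 / (lam * X)) * exp (- ?d * \<bar>x\<bar>)" by (intro mult_right_mono) auto
        finally show ?thesis .
      next
        case False
        have "exp ((k + 1) * x) / ((exp (\<alpha> * x) + lam) * (X + c * exp x)) \<le> exp ((k + 1) * x) / (lam * X)"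
          using al X c by (intro divide_left_mono mult_mono mult_pos_pos) (auto simp: add_pos_pos)
        also have "\<dots> = 1 / (lam * X) * exp ((k + 1) * x)" by simp
        also have "\<dots> \<le> 1 / (lam * X) * exp (?d * x)" using False al X
          by (intro mult_left_mono) (auto intro!: mult_right_mono_neg)
        also have "\<dots> = 1 / (lam * X) * exp (- ?d * \<bar>x\<bar>)" using False by simp
        also have "\<dots> \<le> max (1 / c) (1 / (lam * X)) * exp (- ?d * \<bar>x\<bar>)" by (intro mult_right_mono) auto
        finally show ?thesis .
      qed
      then have *: "1 / ray_lower \<alpha> * (exp ((k + 1) * x) / ((exp (\<alpha> * x) + lam) * (X + c * exp x)))
          \<le> 1 / ray_lower \<alpha> * (max (1 / c) (1 / (lam * X)) * exp (- ?d * \<bar>x\<bar>))"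
        using l by (intro mult_left_mono) auto
      have "norm (A x) / (X + c * exp x) \<le> exp ((k + 1) * x) / (ray_lower \<alpha> * (exp (\<alpha> * x) + lam)) / (X + c * exp x)"
        using norm_ray_integrand_0[OF al, of k x] Res(2)[of x] unfolding A_def by (intro divide_right_mono) auto
      with * show "norm (norm (A x) / (X + c * exp x)) \<le> 1 / ray_lower \<alpha> * max (1 / c) (1 / (lam * X)) * exp (- ?d * \<bar>x\<bar>)"
        using Res(2)[of x] by (simp add: mult.assoc)
    qed (use k in auto)
  qed
  have intt: "integrable lborel (f x)" for x
    using laplace_exp(1)[OF rep[of x]] unfolding fe set_integrable_def by (intro integrable_mult_left)
  have fub: "integrable (lborel \<Otimes>\<^sub>M lborel) (case_prod f)"
    by (rule lborel_pair.Fubini_integrable[OF meas]) (use intx intt in auto)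
  have i1: "integrable lborel (\<lambda>t. LINT x|lborel. f x t)" using lborel_pair.integrable_snd[OF fub] .
  have e1: "(LINT x|lborel. f x t) = indicator {0<..} t *\<^sub>R (exp (- X * t) *\<^sub>R (LINT x|lborel. ray_integrand \<alpha> lam k t x))" for t
    unfolding f_def by simp
  have e2: "Im (LINT x|lborel. f x t) / pi = indicator {0<..} t *\<^sub>R (exp (- X * t) * ray_kernel \<alpha> lam k t)" for t
    unfolding e1 by (simp add: ray_kernel_def)
  have "integrable lborel (\<lambda>t. Im (LINT x|lborel. f x t) / pi)" using i1 by (intro integrable_divide) auto
  then show "set_integrable lborel {0<..} (\<lambda>t. exp (- X * t) * ray_kernel \<alpha> lam k t)"
    unfolding e2 set_integrable_def .
  have "(LINT t:{0<..}|lborel. exp (- X * t) * ray_kernel \<alpha> lam k t) = (LINT t|lborel. Im (LINT x|lborel. f x t) / pi)"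
    unfolding set_lebesgue_integral_def e2 ..
  also have "\<dots> = Im (LINT t|lborel. LINT x|lborel. f x t) / pi" using i1 by simp
  also have "(LINT t|lborel. LINT x|lborel. f x t) = (LINT x|lborel. LINT t|lborel. f x t)"
    by (rule lborel_pair.Fubini_integral[OF fub])
  also have "\<dots> = (LINT x|lborel. A x / (of_real X - \<zeta> x))"
  proof (rule Bochner_Integration.integral_cong)
    fix x
    show "(LINT t|lborel. f x t) = A x / (of_real X - \<zeta> x)"
    proof -
      have "(LINT t|lborel. f x t) = (LINT t:{0<..}|lborel. exp (- (of_real X - \<zeta> x) * of_real t)) * A x"
        unfolding fe set_lebesgue_integral_def by (simp only: integral_mult_left_zero)
      then show ?thesis unfolding laplace_exp(2)[OF rep[of x]] by simp
    qed
  qed auto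
  also have "A = (\<lambda>x. exp (of_real (k + 1) * Complex x (ray_angle \<alpha>)) / (exp (of_real \<alpha> * Complex x (ray_angle \<alpha>)) + of_real lam))"
    by (auto simp: A_def ray_integrand_def)
  also have "Im (LINT x|lborel. exp (of_real (k + 1) * Complex x (ray_angle \<alpha>)) / (exp (of_real \<alpha> * Complex x (ray_angle \<alpha>)) + of_real lam) / (of_real X - \<zeta> x)) = pi * (X powr k / (X powr \<alpha> + lam))"
    unfolding \<zeta>_def using ray_angle_bounds[OF al(1,2)] al k X
    by (intro strip_cauchy_formula(2)) auto
  finally show "(LINT t:{0<..}|lborel. exp (- X * t) * ray_kernel \<alpha> lam k t) = X powr k / (X powr \<alpha> + lam)"
    by simp
qed

section \<open>Convolution on the half-line\<close>

definition conv :: "(real \<Rightarrow> real) \<Rightarrow> (real \<Rightarrow> real) \<Rightarrow> real \<Rightarrow> real" where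
  "conv a b t = (LINT s:{0<..<t}|lborel. a (t - s) * b s)"

definition cut :: "real \<Rightarrow> (real \<Rightarrow> real) \<Rightarrow> real \<Rightarrow> real" where
  "cut T a t = indicator {0<..<T} t *\<^sub>R a t"

abbreviation locint :: "real \<Rightarrow> (real \<Rightarrow> real) \<Rightarrow> bool" where
  "locint T a \<equiv> set_integrable lborel {0<..<T} a"

lemma integrable_cut: "locint T a \<Longrightarrow> integrable lborel (cut T a)"
  by (simp add: set_integrable_def cut_def[abs_def])

lemma conv_cut:
  assumes "t \<le> T"
  shows "conv a b t = (LINT s|lborel. cut T a (t - s) * cut T b s)"
  unfolding conv_def set_lebesgue_integral_def
  by (rule Bochner_Integration.integral_cong) (use assms in \<open>auto simp: cut_def indicator_def\<close>)

lemma conv_commute: "conv a b t = conv b a t"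
  unfolding conv_cut[OF order_refl]
  by (subst lborel_integral_real_affine[of "-1" _ t]) (auto simp: mult.commute)

lemma locint_mono: "locint T a \<Longrightarrow> t \<le> T \<Longrightarrow> locint t a"
  by (erule set_integrable_subset) auto

lemma product_integrable_line:
  fixes A B :: "real \<Rightarrow> real"
  assumes A: "integrable lborel A" and B: "integrable lborel B"
  shows "integrable (lborel \<Otimes>\<^sub>M lborel) (\<lambda>(t, r). A (t - r) * B r)"
    "integrable lborel (\<lambda>t. LINT r|lborel. A (t - r) * B r)"
    "(LINT t|lborel. LINT r|lborel. A (t - r) * B r) = (LINT t|lborel. A t) * (LINT t|lborel. B t)"
proof -
  have [measurable]: "A \<in> borel_measurable borel" "B \<in> borel_measurable borel"
    using A B by (auto dest: borel_measurable_integrable)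
  have shift: "(LINT t|lborel. h (t - r)) = (LINT t|lborel. h t)" "integrable lborel (\<lambda>t. h (t - r)) = integrable lborel h"
    for h :: "real \<Rightarrow> real" and r
    using lborel_integral_real_affine[of 1 h "- r"] lborel_integrable_real_affine_iff[of 1 h "- r"] by simp_all
  have "integrable (lborel \<Otimes>\<^sub>M lborel) (\<lambda>(r, t). A (t - r) * B r)"
  proof (rule lborel_pair.Fubini_integrable)
    show "(\<lambda>(r, t). A (t - r) * B r) \<in> borel_measurable (lborel \<Otimes>\<^sub>M lborel)" by measurable
    have "(\<lambda>r. LINT t|lborel. norm (case (r, t) of (r, t) \<Rightarrow> A (t - r) * B r)) = (\<lambda>r. (LINT t|lborel. \<bar>A t\<bar>) * \<bar>B r\<bar>)"
      using shift(1)[of "\<lambda>t. \<bar>A t\<bar>"] by (simp add: abs_mult)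
    then show "integrable lborel (\<lambda>r. LINT t|lborel. norm (case (r, t) of (r, t) \<Rightarrow> A (t - r) * B r))"
      using B by simp
    show "AE r in lborel. integrable lborel (\<lambda>t. case (r, t) of (r, t) \<Rightarrow> A (t - r) * B r)"
      using A shift(2)[of A] by simp
  qed
  then have sw: "integrable (lborel \<Otimes>\<^sub>M lborel) (case_prod (\<lambda>r t. A (t - r) * B r))" .
  show "integrable (lborel \<Otimes>\<^sub>M lborel) (\<lambda>(t, r). A (t - r) * B r)"
    using lborel_pair.integrable_product_swap[OF sw] by (simp add: split_beta)
  show "integrable lborel (\<lambda>t. LINT r|lborel. A (t - r) * B r)"
    using lborel_pair.integrable_snd[OF sw] .
  have "(LINT t|lborel. LINT r|lborel. A (t - r) * B r) = (LINT r|lborel. LINT t|lborel. A (t - r) * B r)"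
    by (rule lborel_pair.Fubini_integral[OF sw])
  also have "\<dots> = (LINT t|lborel. A t) * (LINT t|lborel. B t)"
    using shift(1)[of A] by simp
  finally show "(LINT t|lborel. LINT r|lborel. A (t - r) * B r) = (LINT t|lborel. A t) * (LINT t|lborel. B t)" .
qed

lemma conv_cut_eq_0: "t \<le> 0 \<Longrightarrow> (LINT s|lborel. cut T a (t - s) * cut T b s) = 0"
  by (rule integral_eq_zero_AE) (auto simp: cut_def indicator_def)

lemma locint_conv:
  assumes "locint T a" "locint T b"
  shows "locint T (conv a b)"
proof -
  have "integrable lborel (\<lambda>t. LINT s|lborel. cut T a (t - s) * cut T b s)"
    by (intro product_integrable_line integrable_cut assms)
  then have "set_integrable lborel {0<..<T} (\<lambda>t. LINT s|lborel. cut T a (t - s) * cut T b s)"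
    by (intro integrable_mult_indicator[where 'b=real, folded set_integrable_def]) auto
  then show ?thesis
    by (rule set_integrable_cong[THEN iffD1, rotated -1]) (auto simp: conv_cut[OF less_imp_le, symmetric])
qed

lemma conv_assoc:
  assumes a: "locint T a" and b: "locint T b" and c: "locint T c"
    and K: "\<And>r. 0 < r \<Longrightarrow> r < T \<Longrightarrow> \<bar>c r\<bar> \<le> K" and t: "t \<le> T"
  shows "conv a (conv b c) t = conv (conv a b) c t"
proof -
  define A where "A = cut T a"
  define B where "B = cut T b"
  define C where "C = cut T c"
  have iA: "integrable lborel A" and iB: "integrable lborel B" and iC: "integrable lborel C"
    using a b c by (auto simp: A_def B_def C_def integrable_cut)
  have [measurable]: "A \<in> borel_measurable borel" "B \<in> borel_measurable borel" "C \<in> borel_measurable borel"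
    using iA iB iC by (auto dest: borel_measurable_integrable)
  have K0: "\<bar>C r\<bar> \<le> \<bar>K\<bar>" for r using K[of r] by (auto simp: C_def cut_def indicator_def)
  have shift: "(LINT t|lborel. h (t - r)) = (LINT t|lborel. h t)" for h :: "real \<Rightarrow> real" and r
    using lborel_integral_real_affine[of 1 h "- r"] by simp
  define F where "F = (\<lambda>s r. A (t - s) * (B (s - r) * C r))"
  have iB': "integrable lborel (\<lambda>r. B (- r))" and iA': "integrable lborel (\<lambda>s. A (t - s))"
    using lborel_integrable_real_affine_iff[of "-1" B 0] lborel_integrable_real_affine_iff[of "-1" A t] iA iB by simp_all
  have "integrable (lborel \<Otimes>\<^sub>M lborel) (case_prod F)"
  proof (rule Bochner_Integration.integrable_bound)
    have "integrable (lborel \<Otimes>\<^sub>M lborel) (case_prod (\<lambda>r s. B (- (r - s)) * A (t - s)))"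
      by (rule product_integrable_line(1)[OF iB' iA'])
    from lborel_pair.integrable_product_swap[OF this]
    show "integrable (lborel \<Otimes>\<^sub>M lborel) (\<lambda>p. K * (B (fst p - snd p) * A (t - fst p)))"
      by (intro integrable_mult_right) (simp add: case_prod_unfold)
    show "case_prod F \<in> borel_measurable (lborel \<Otimes>\<^sub>M lborel)" unfolding F_def by measurable
    show "AE p in lborel \<Otimes>\<^sub>M lborel. norm (case_prod F p) \<le> norm (K * (B (fst p - snd p) * A (t - fst p)))"
    proof (rule AE_I2)
      fix p :: "real \<times> real"
      have "(\<bar>A (t - fst p)\<bar> * \<bar>B (fst p - snd p)\<bar>) * \<bar>C (snd p)\<bar> \<le> (\<bar>A (t - fst p)\<bar> * \<bar>B (fst p - snd p)\<bar>) * \<bar>K\<bar>"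
        by (intro mult_left_mono K0) auto
      then show "norm (case_prod F p) \<le> norm (K * (B (fst p - snd p) * A (t - fst p)))"
        by (simp add: F_def split_beta abs_mult mult_ac)
    qed
  qed
  note fub = lborel_pair.Fubini_integral[OF this]
  have 1: "cut T (conv b c) s = (LINT r|lborel. B (s - r) * C r)" if "s < T" for s
    using that conv_cut_eq_0[of s T b c] conv_cut[of s T b c] by (cases "s > 0") (auto simp: cut_def[of T "conv b c"] B_def C_def)
  have "conv a (conv b c) t = (LINT s|lborel. LINT r|lborel. F s r)"
    unfolding conv_cut[OF t, of a] F_def
  proof (rule Bochner_Integration.integral_cong)
    fix s
    show "cut T a (t - s) * cut T (conv b c) s = (LINT r|lborel. A (t - s) * (B (s - r) * C r))"
    proof (cases "s < T")
      case True then show ?thesis using 1[OF True] by (simp add: A_def)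
    next
      case False then show ?thesis using t by (auto simp: A_def cut_def indicator_def)
    qed
  qed auto
  also have "\<dots> = (LINT r|lborel. LINT s|lborel. F s r)" using fub by simp
  also have "\<dots> = conv (conv a b) c t"
    unfolding conv_cut[OF t, of "conv a b"]
  proof (rule Bochner_Integration.integral_cong)
    fix r
    have "(LINT s|lborel. F s r) = (LINT s|lborel. A (t - s) * B (s - r)) * C r"
      unfolding F_def mult.assoc[symmetric] by simp
    also have "(LINT s|lborel. A (t - s) * B (s - r)) = (LINT s|lborel. A ((t - r) - s) * B s)"
      using shift[of "\<lambda>s. A (t - r - s) * B s" r] by simp
    also have "(LINT s|lborel. A ((t - r) - s) * B s) * C r = cut T (conv a b) (t - r) * C r"
    proof (cases "0 < r \<and> r < T")
      case True
      show ?thesis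
        using True t conv_cut_eq_0[of "t - r" T a b] conv_cut[of "t - r" T a b]
        by (cases "t - r > 0") (auto simp: cut_def[of T "conv a b"] A_def B_def)
    qed (auto simp: C_def cut_def)
    finally show "(LINT s|lborel. F s r) = cut T (conv a b) (t - r) * cut T c r" by (simp add: C_def)
  qed auto
  finally show ?thesis .
qed

lemma cont_bounded:
  assumes "continuous_on {0..T::real} b"
  obtains K where "\<And>r. 0 \<le> r \<Longrightarrow> r \<le> T \<Longrightarrow> \<bar>b r :: real\<bar> \<le> K"
proof -
  have "bounded (b ` {0..T})" by (intro compact_imp_bounded compact_continuous_image assms) auto
  then obtain K where "\<forall>x\<in>{0..T}. \<bar>b x\<bar> \<le> K" by (auto simp: bounded_iff)
  then show ?thesis using that[of K] by auto
qed

lemma locint_continuous: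
  assumes "continuous_on {0..T::real} b"
  shows "locint T b"
proof -
  have "set_integrable lborel {0..T} b" by (rule borel_integrable_atLeastAtMost') fact
  then show ?thesis by (rule set_integrable_subset) auto
qed

lemma conv_assoc_cont:
  assumes "locint T a" "locint T b" "continuous_on {0..T} c" "t \<le> T"
  shows "conv a (conv b c) t = conv (conv a b) c t"
proof -
  obtain K where "\<And>r. 0 \<le> r \<Longrightarrow> r \<le> T \<Longrightarrow> \<bar>c r\<bar> \<le> K" using cont_bounded[OF assms(3)] by blast
  then show ?thesis by (intro conv_assoc[of T _ _ _ K] locint_continuous assms) auto
qed

text \<open>
  Continuity of one factor suffices, the other may be singular at \<open>0\<close> like the kernels. The
  continuous factor is extended by its boundary values, and the integrands then converge almost
  everywhere with a common bound.
\<close>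

lemma continuous_on_conv:
  assumes a: "locint T a" and b: "continuous_on {0..T} b"
  shows "continuous_on {0..T} (conv a b)"
proof (cases "T \<ge> 0")
  case True
  define bb where "bb = (\<lambda>x. b (max 0 (min x T)))"
  have cbb: "continuous_on UNIV bb" unfolding bb_def
    by (rule continuous_on_compose2[OF b]) (use True in \<open>auto intro!: continuous_intros\<close>)
  obtain K where K: "\<And>r. 0 \<le> r \<Longrightarrow> r \<le> T \<Longrightarrow> \<bar>b r\<bar> \<le> K" using cont_bounded[OF b] by blast
  have Kbb: "\<bar>bb x\<bar> \<le> K" for x unfolding bb_def using K True by auto
  have K0: "K \<ge> 0" using Kbb[of 0] by linarith
  define A where "A = cut T a"
  have iA: "integrable lborel A" using a by (simp add: A_def integrable_cut)
  have [measurable]: "A \<in> borel_measurable borel" "bb \<in> borel_measurable borel"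
    using iA borel_measurable_continuous_onI[OF cbb] by (auto dest: borel_measurable_integrable)
  have e: "conv a b t = (LINT s|lborel. indicator {..<t} s * (bb (t - s) * A s))" if "t \<in> {0..T}" for t
    unfolding conv_commute[of a b t] unfolding conv_def set_lebesgue_integral_def
    by (rule Bochner_Integration.integral_cong) (use that in \<open>auto simp: A_def cut_def indicator_def bb_def\<close>)
  show ?thesis
    unfolding continuous_on_sequentially
  proof (intro allI ballI impI)
    fix y t assume t: "t \<in> {0..T}" and y: "(\<forall>n. y n \<in> {0..T}) \<and> y \<longlonglongrightarrow> t"
    have "(\<lambda>n. LINT s|lborel. indicator {..<y n} s * (bb (y n - s) * A s)) \<longlonglongrightarrow> (LINT s|lborel. indicator {..<t} s * (bb (t - s) * A s))"
    proof (rule integral_dominated_convergence[where w="\<lambda>s. K * \<bar>A s\<bar>"])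
      show "AE s in lborel. (\<lambda>n. indicator {..<y n} s * (bb (y n - s) * A s)) \<longlonglongrightarrow> indicator {..<t} s * (bb (t - s) * A s)"
        using AE_lborel_singleton[of t]
      proof eventually_elim
        case (elim s)
        have "(\<lambda>n. bb (y n - s)) \<longlonglongrightarrow> bb (t - s)"
          by (rule continuous_on_tendsto_compose[OF cbb]) (use y in \<open>auto intro!: tendsto_intros\<close>)
        moreover have "(\<lambda>n. indicator {..<y n} s :: real) \<longlonglongrightarrow> indicator {..<t} s"
        proof (cases "s < t")
          case True
          then have "\<forall>\<^sub>F n in sequentially. s < y n" using y order_tendstoD(1) by blast
          then have "\<forall>\<^sub>F n in sequentially. indicator {..<y n} s = (indicator {..<t} s :: real)"
            by eventually_elim (use True in auto)
          then show ?thesis by (rule tendsto_eventually)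
        next
          case False
          then have "t < s" using elim by simp
          then have "\<forall>\<^sub>F n in sequentially. y n < s" using y order_tendstoD(2) by blast
          then have "\<forall>\<^sub>F n in sequentially. indicator {..<y n} s = (indicator {..<t} s :: real)"
            by eventually_elim (use False in auto)
          then show ?thesis by (rule tendsto_eventually)
        qed
        ultimately show ?case by (intro tendsto_intros)
      qed
      show "AE s in lborel. norm (indicator {..<y n} s * (bb (y n - s) * A s)) \<le> K * \<bar>A s\<bar>" for n
        using Kbb K0 by (intro AE_I2) (auto simp: indicator_def abs_mult intro!: mult_right_mono)
    qed (use iA in auto)
    then show "(conv a b \<circ> y) \<longlonglongrightarrow> conv a b t" using e y t by (simp add: o_def)
  qed
qed auto

lemma conv_integrable:
  assumes a: "locint T a" and b: "continuous_on {0..T} b" and t: "t \<le> T"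
  shows "set_integrable lborel {0<..<t} (\<lambda>s. a (t - s) * b s)" "set_integrable lborel {0<..<t} (\<lambda>s. b (t - s) * a s)"
proof -
  obtain K where K: "\<And>r. 0 \<le> r \<Longrightarrow> r \<le> T \<Longrightarrow> \<bar>b r\<bar> \<le> K" using cont_bounded[OF b] by blast
  define A where "A = cut t a"
  define B where "B = cut t b"
  have iA: "integrable lborel A" and iB: "integrable lborel B"
    using locint_mono[OF a t] locint_mono[OF locint_continuous[OF b] t] by (auto simp: A_def B_def integrable_cut)
  have [measurable]: "A \<in> borel_measurable borel" "B \<in> borel_measurable borel"
    using iA iB by (auto dest: borel_measurable_integrable)
  have KB: "\<bar>B r\<bar> \<le> \<bar>K\<bar>" for r using K[of r] t by (auto simp: B_def cut_def indicator_def)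
  have 1: "integrable lborel (\<lambda>s. B (t - s) * A s)"
  proof (rule Bochner_Integration.integrable_bound)
    show "integrable lborel (\<lambda>s. \<bar>K\<bar> * \<bar>A s\<bar>)" using iA by auto
    show "AE s in lborel. norm (B (t - s) * A s) \<le> norm (\<bar>K\<bar> * \<bar>A s\<bar>)"
      using KB by (auto simp: abs_mult intro!: mult_right_mono)
  qed auto
  have "(\<lambda>s. B (t - s) * A s) = (\<lambda>s. indicator {0<..<t} s *\<^sub>R (b (t - s) * a s))"
    by (auto simp: A_def B_def cut_def indicator_def)
  then show "set_integrable lborel {0<..<t} (\<lambda>s. b (t - s) * a s)" using 1 by (simp add: set_integrable_def)
  have 2: "integrable lborel (\<lambda>s. A (t - s) * B s)"
    using lborel_integrable_real_affine[OF 1, of "-1" t] by (simp add: mult.commute)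
  have "(\<lambda>s. A (t - s) * B s) = (\<lambda>s. indicator {0<..<t} s *\<^sub>R (a (t - s) * b s))"
    by (auto simp: A_def B_def cut_def indicator_def)
  then show "set_integrable lborel {0<..<t} (\<lambda>s. a (t - s) * b s)" using 2 by (simp add: set_integrable_def)
qed

lemma conv_add_right:
  assumes "locint T a" "continuous_on {0..T} b" "continuous_on {0..T} c" "t \<le> T"
  shows "conv a (\<lambda>s. b s + c s) t = conv a b t + conv a c t"
  unfolding conv_def using conv_integrable(1)[OF assms(1,2,4)] conv_integrable(1)[OF assms(1,3,4)]
  by (simp add: ring_distribs set_integral_add)

lemma conv_diff_right:
  assumes "locint T a" "continuous_on {0..T} b" "continuous_on {0..T} c" "t \<le> T"
  shows "conv a (\<lambda>s. b s - c s) t = conv a b t - conv a c t"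
  unfolding conv_def using conv_integrable(1)[OF assms(1,2,4)] conv_integrable(1)[OF assms(1,3,4)]
  by (simp add: right_diff_distrib set_integral_diff)

lemma conv_diff_left:
  assumes "locint T a" "locint T a'" "continuous_on {0..T} b" "t \<le> T"
  shows "conv (\<lambda>s. a s - a' s) b t = conv a b t - conv a' b t"
  unfolding conv_def using conv_integrable(1)[OF assms(1,3,4)] conv_integrable(1)[OF assms(2,3,4)]
  by (simp add: left_diff_distrib set_integral_diff)

lemma conv_scale_left: "conv (\<lambda>s. k * a s) b t = k * conv a b t"
  unfolding conv_def by (simp add: mult.assoc)

lemma conv_scale_right: "conv a (\<lambda>s. k * b s) t = k * conv a b t"
  unfolding conv_def by (simp add: mult.left_commute)

lemma conv_cong:
  assumes "\<And>s. 0 < s \<Longrightarrow> s < t \<Longrightarrow> a s = a' s" "\<And>s. 0 < s \<Longrightarrow> s < t \<Longrightarrow> b s = b' s"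
  shows "conv a b t = conv a' b' t"
  unfolding conv_def by (rule set_lebesgue_integral_cong) (use assms in auto)

text \<open>
  The primitive that vanishes at \<open>0\<close>, written as a convolution so that it commutes with other
  convolutions.
\<close>

abbreviation primitive :: "(real \<Rightarrow> real) \<Rightarrow> real \<Rightarrow> real" where
  "primitive a \<equiv> conv (\<lambda>_. 1) a"

lemma primitive_eq: "primitive a t = (LINT s:{0<..<t}|lborel. a s)"
  by (simp add: conv_def)

lemma continuous_on_primitive: "locint T a \<Longrightarrow> continuous_on {0..T} (primitive a)"
proof -
  assume a: "locint T a"
  have "primitive a = conv a (\<lambda>_. 1)" by (rule ext) (rule conv_commute)
  then show ?thesis using continuous_on_conv[OF a, of "\<lambda>_. 1"] by simp
qed

lemma primitive_has_derivative:
  assumes a: "locint T a" and c: "continuous_on {0<..<T} a" and t: "0 < t" "t < T"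
  shows "(primitive a has_real_derivative a t) (at t)"
proof -
  define t0 where "t0 = t / 2"
  define t1 where "t1 = (t + T) / 2"
  have tt: "0 < t0" "t0 < t" "t < t1" "t1 < T" using t by (auto simp: t0_def t1_def)
  have c1: "continuous_on {t0..t1} a" using c by (rule continuous_on_subset) (use tt in auto)
  have e: "primitive a x = primitive a t0 + integral {t0..x} a" if "x \<in> {t0<..<t1}" for x
  proof -
    have 1: "set_integrable lborel {0<..<t0} a" "set_integrable lborel {t0..<x} a"
      using a by (rule set_integrable_subset; use tt that in auto)+
    have "continuous_on {t0..x} a" using c1 by (rule continuous_on_subset) (use that in auto)
    then have 2: "set_integrable lborel {t0..x} a" by (rule borel_integrable_atLeastAtMost')
    have "{0<..<x} = {0<..<t0} \<union> {t0..<x}" using tt that by auto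
    then have "primitive a x = primitive a t0 + (LINT s:{t0..<x}|lborel. a s)"
      unfolding primitive_eq using set_integral_Un[OF _ 1] by (simp add: disjoint_iff)
    also have "(LINT s:{t0..<x}|lborel. a s) = (LINT s:{t0..x}|lborel. a s)"
      unfolding set_lebesgue_integral_def
    proof (rule Bochner_Integration.integral_cong_AE)
      show "AE s in lborel. indicat_real {t0..<x} s *\<^sub>R a s = indicat_real {t0..x} s *\<^sub>R a s"
        using AE_lborel_singleton[of x] by eventually_elim (auto simp: indicator_def)
    qed (use 1 2 in \<open>auto simp: set_integrable_def dest: borel_measurable_integrable\<close>)
    also have "\<dots> = integral {t0..x} a" by (rule set_borel_integral_eq_integral[OF 2])
    finally show ?thesis .
  qed
  have "((\<lambda>x. primitive a t0 + integral {t0..x} a) has_real_derivative 0 + a t) (at t within {t0<..<t1})"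
    by (intro derivative_intros has_field_derivative_subset[OF integral_has_real_derivative[OF c1]]) (use tt in auto)
  then have "((\<lambda>x. primitive a t0 + integral {t0..x} a) has_real_derivative a t) (at t)"
    using tt at_within_open[of t "{t0<..<t1}"] by simp
  then show ?thesis
    by (rule DERIV_cong_ev[THEN iffD1, rotated -1])
       (use tt e eventually_nhds_in_open[of "{t0<..<t1}" t] in \<open>auto elim!: eventually_mono\<close>)
qed

lemma primitive_0 [simp]: "primitive a 0 = 0"
  by (simp add: primitive_eq set_lebesgue_integral_def)

lemma eq_primitive:
  assumes T: "T > 0" and F: "continuous_on {0..T} F" and a: "locint T a" "continuous_on {0<..<T} a"
    and d: "\<And>t. 0 < t \<Longrightarrow> t < T \<Longrightarrow> (F has_real_derivative a t) (at t)" and t: "0 \<le> t" "t \<le> T"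
  shows "F t = F 0 + primitive a t"
proof (cases "t = 0")
  case False
  have "F t - primitive a t = F 0 - primitive a 0"
  proof (rule DERIV_isconst_end[of 0 t "\<lambda>t. F t - primitive a t"])
    show "continuous_on {0..t} (\<lambda>t. F t - primitive a t)"
      using t by (intro continuous_on_subset[OF continuous_on_diff[OF F continuous_on_primitive[OF a(1)]]]) auto
    fix x assume "0 < x" "x < t"
    then show "((\<lambda>t. F t - primitive a t) has_real_derivative 0) (at x)"
      using DERIV_diff[OF d primitive_has_derivative[OF a]] t by fastforce
  qed (use t False in auto)
  then show ?thesis by simp
qed auto

lemma primitive_inj:
  assumes "locint T a" "locint T b" "continuous_on {0<..<T} a" "continuous_on {0<..<T} b"
    and e: "\<And>t. 0 < t \<Longrightarrow> t < T \<Longrightarrow> primitive a t = primitive b t" and t: "0 < t" "t < T"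
  shows "a t = b t"
proof -
  have "(primitive a has_real_derivative b t) (at t)"
    by (rule DERIV_cong_ev[THEN iffD1, rotated -1, OF primitive_has_derivative[OF assms(2,4) t]])
       (use t e eventually_nhds_in_open[of "{0<..<T}" t] in \<open>auto elim!: eventually_mono\<close>)
  then show ?thesis using DERIV_unique primitive_has_derivative[OF assms(1,3) t] by blast
qed

section \<open>Laplace transforms\<close>

abbreviation labs :: "real \<Rightarrow> (real \<Rightarrow> real) \<Rightarrow> bool" where
  "labs X a \<equiv> set_integrable lborel {0<..} (\<lambda>t. exp (- X * t) * a t)"

abbreviation laplace :: "real \<Rightarrow> (real \<Rightarrow> real) \<Rightarrow> real" where
  "laplace X a \<equiv> (LINT t:{0<..}|lborel. exp (- X * t) * a t)"

lemma labs_conv: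
  assumes a: "labs X a" and b: "labs X b"
  shows "labs X (conv a b)" "laplace X (conv a b) = laplace X a * laplace X b"
proof -
  define A where "A = (\<lambda>t. indicator {0<..} t *\<^sub>R (exp (- X * t) * a t))"
  define B where "B = (\<lambda>t. indicator {0<..} t *\<^sub>R (exp (- X * t) * b t))"
  have iA: "integrable lborel A" and iB: "integrable lborel B"
    using a b by (auto simp: A_def B_def set_integrable_def)
  have e: "(LINT r|lborel. A (t - r) * B r) = indicator {0<..} t *\<^sub>R (exp (- X * t) * conv a b t)" for t
  proof -
    have "(\<lambda>r. A (t - r) * B r) = (\<lambda>r. indicator {0<..} t * exp (- X * t) * (indicator {0<..<t} r *\<^sub>R (a (t - r) * b r)))"
    proof
      fix r
      have "exp (- X * t) = exp (- X * (t - r)) * exp (- X * r)" by (simp add: algebra_simps flip: exp_add)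
      then show "A (t - r) * B r = indicator {0<..} t * exp (- X * t) * (indicator {0<..<t} r *\<^sub>R (a (t - r) * b r))"
        by (auto simp: A_def B_def indicator_def)
    qed
    then show ?thesis by (simp only: integral_mult_right_zero conv_def set_lebesgue_integral_def) simp
  qed
  note p = product_integrable_line(2,3)[OF iA iB]
  show "labs X (conv a b)" using p(1) unfolding e set_integrable_def .
  show "laplace X (conv a b) = laplace X a * laplace X b"
    using p(2) unfolding e by (simp add: set_lebesgue_integral_def A_def B_def)
qed

lemma labs_imp_locint:
  assumes a: "labs X a"
  shows "locint T a"
proof -
  let ?h = "\<lambda>t. indicator {0<..<T} t *\<^sub>R (exp (- X * t) * a t)"
  have "set_integrable lborel {0<..<T} (\<lambda>t. exp (- X * t) * a t)" using a by (rule set_integrable_subset) auto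
  then have i: "integrable lborel (\<lambda>t. ?h t)" by (simp add: set_integrable_def)
  have "integrable lborel (\<lambda>t. exp (X * t) * (?h t))"
  proof (rule Bochner_Integration.integrable_bound)
    show "integrable lborel (\<lambda>t. exp (\<bar>X\<bar> * \<bar>T\<bar>) * (?h t))"
      using i by (rule integrable_mult_right)
    show "AE t in lborel. norm (exp (X * t) * (?h t))
        \<le> norm (exp (\<bar>X\<bar> * \<bar>T\<bar>) * (?h t))"
    proof (rule AE_I2)
      fix t
      have "exp (X * t) \<le> exp (\<bar>X\<bar> * \<bar>T\<bar>)" if "0 < t" "t < T"
      proof -
        have "X * t \<le> \<bar>X\<bar> * \<bar>t\<bar>" by (metis abs_ge_self abs_mult)
        also have "\<dots> \<le> \<bar>X\<bar> * \<bar>T\<bar>" using that by (intro mult_left_mono) auto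
        finally show ?thesis by simp
      qed
      then show "norm (exp (X * t) * (?h t))
        \<le> norm (exp (\<bar>X\<bar> * \<bar>T\<bar>) * (?h t))"
        by (auto simp: indicator_def abs_mult intro!: mult_right_mono)
    qed
    show "(\<lambda>t. exp (X * t) * (?h t)) \<in> borel_measurable lborel"
      using i by (intro borel_measurable_times borel_measurable_integrable[OF i]) auto
  qed
  moreover have "(\<lambda>t. exp (X * t) * (?h t)) = (\<lambda>t. indicator {0<..<T} t *\<^sub>R a t)"
    by (auto simp: indicator_def exp_minus)
  ultimately show ?thesis by (simp add: set_integrable_def)
qed

lemma conv_growth:
  assumes a: "labs 1 a" and b: "\<And>s. 0 < s \<Longrightarrow> \<bar>b s\<bar> \<le> B * exp s" and t: "t \<ge> 0" and bc: "continuous_on {0..} b"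
  shows "\<bar>conv a b t\<bar> \<le> B * laplace 1 (\<lambda>t. \<bar>a t\<bar>) * exp t"
proof -
  have B0: "B \<ge> 0" using order_trans[OF abs_ge_zero b[of 1]] by (simp add: zero_le_mult_iff)
  have ia: "labs 1 (\<lambda>t. \<bar>a t\<bar>)" using set_integrable_abs[OF a] by (simp add: abs_mult)
  have ia': "integrable lborel (\<lambda>s. indicator {0<..} s *\<^sub>R (exp (- 1 * s) * \<bar>a s\<bar>))"
    using ia by (simp add: set_integrable_def)
  have la: "locint t a" by (rule labs_imp_locint[OF a])
  have bc': "continuous_on {0..t} b" using bc by (rule continuous_on_subset) auto
  have i: "set_integrable lborel {0<..<t} (\<lambda>s. b (t - s) * a s)" by (rule conv_integrable(2)[OF la bc']) auto
  have "\<bar>conv a b t\<bar> \<le> (LINT s:{0<..<t}|lborel. \<bar>b (t - s) * a s\<bar>)"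
    unfolding conv_commute[of a b t] unfolding conv_def using set_integral_norm_bound[OF i] by simp
  also have "\<dots> \<le> (LINT s:{0<..}|lborel. B * exp t * (exp (- 1 * s) * \<bar>a s\<bar>))"
    unfolding set_lebesgue_integral_def
  proof (rule Bochner_Integration.integral_mono)
    show "integrable lborel (\<lambda>s. indicat_real {0<..<t} s *\<^sub>R \<bar>b (t - s) * a s\<bar>)"
      using set_integrable_abs[OF i] by (simp add: set_integrable_def)
    show "integrable lborel (\<lambda>s. indicat_real {0<..} s *\<^sub>R (B * exp t * (exp (- 1 * s) * \<bar>a s\<bar>)))"
      using integrable_mult_right[OF ia', of "B * exp t"] by (simp add: mult.left_commute)
    fix s
    have "\<bar>b (t - s)\<bar> \<le> B * exp t * exp (- s)" if "s < t" using b[of "t - s"] that by (simp add: exp_diff exp_minus field_simps)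
    then have "\<bar>b (t - s)\<bar> * \<bar>a s\<bar> \<le> B * exp t * exp (- s) * \<bar>a s\<bar>" if "s < t" using that by (intro mult_right_mono) auto
    then show "indicat_real {0<..<t} s *\<^sub>R \<bar>b (t - s) * a s\<bar> \<le> indicat_real {0<..} s *\<^sub>R (B * exp t * (exp (- 1 * s) * \<bar>a s\<bar>))"
      using B0 by (auto simp: indicator_def abs_mult mult.assoc)
  qed
  also have "\<dots> = B * exp t * laplace 1 (\<lambda>t. \<bar>a t\<bar>)" by simp
  finally show ?thesis by (simp add: mult.commute mult.left_commute)
qed

text \<open>
  The set where \<open>g\<close> does not vanish is open, and a nonempty open set has positive measure.
\<close>

lemma continuous_AE_zero:
  fixes g :: "real \<Rightarrow> real"
  assumes c: "continuous_on {0<..<T} g" and ae: "AE t in lborel. t \<in> {0<..<T} \<longrightarrow> g t = 0" and t: "0 < t" "t < T"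
  shows "g t = 0"
proof (rule ccontr)
  assume nz: "g t \<noteq> 0"
  define S where "S = {0<..<T} \<inter> g -` (- {0})"
  have "open S" unfolding S_def by (rule continuous_open_preimage[OF c]) auto
  moreover have "t \<in> S" using t nz by (simp add: S_def)
  ultimately have nn: "\<not> negligible S" by (intro open_not_negligible) auto
  obtain N where N: "{t \<in> space lborel. \<not> (t \<in> {0<..<T} \<longrightarrow> g t = 0)} \<subseteq> N" "N \<in> null_sets lborel"
    using ae by (auto elim!: AE_E simp: null_sets_def)
  have "negligible N" using N(2) by (simp add: negligible_iff_null_sets null_sets_completionI)
  moreover have "S \<subseteq> N" using N(1) by (auto simp: S_def)
  ultimately show False using nn negligible_subset by blast
qed

text \<open>
  Lerch's argument. After the substitution \<open>x = e\<^sup>-\<^sup>t\<close> the hypothesis says that \<open>x\<^sup>2 w(- ln x)\<close>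
  is orthogonal to all polynomials on \<open>[0,1]\<close>, and Weierstrass approximation makes its square
  integral vanish. Only integers from \<open>2\<close> on are used because the growth \<open>e\<^sup>t\<close> of \<open>w\<close> has to be
  compensated.
\<close>

lemma laplace_unique:
  assumes cont: "continuous_on {0..} w" and bnd: "\<And>t. 0 < t \<Longrightarrow> \<bar>w t\<bar> \<le> B * exp t"
    and int: "\<And>n::nat. n \<ge> 2 \<Longrightarrow> labs (real n) w" and zero: "\<And>n::nat. n \<ge> 2 \<Longrightarrow> laplace (real n) w = 0"
    and t: "t > 0"
  shows "w t = 0"
proof -
  have B0: "B \<ge> 0" using order_trans[OF abs_ge_zero bnd[of 1]] by (simp add: zero_le_mult_iff)
  \<comment> \<open>The factor \<open>x\<^sup>2\<close> makes \<open>W\<close> continuous at \<open>x = 0\<close>, that is, at \<open>t = \<infinity>\<close>.\<close>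
  define W where "W = (\<lambda>x. if x \<le> 0 then 0 else x\<^sup>2 * w (- ln x))"
  have Wb: "\<bar>W x\<bar> \<le> B * \<bar>x\<bar>" if "x < 1" for x
  proof (cases "x \<le> 0")
    case False
    then have "ln x < 0" using that by simp
    then have "\<bar>w (- ln x)\<bar> \<le> B * exp (- ln x)" by (intro bnd) auto
    then have "x\<^sup>2 * \<bar>w (- ln x)\<bar> \<le> x\<^sup>2 * (B * exp (- ln x))" by (intro mult_left_mono) auto
    also have "\<dots> = B * x" using False by (simp add: exp_minus power2_eq_square)
    finally show ?thesis using False by (simp add: W_def abs_mult)
  next
    case True
    then have "W x = 0" by (simp add: W_def)
    then show ?thesis using B0 by (metis abs_ge_zero abs_zero mult_nonneg_nonneg)
  qed
  have contW: "continuous_on {0..1} W"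
  proof -
    have c1: "continuous_on {0<..1} (\<lambda>x. x\<^sup>2 * w (- ln x))"
      by (intro continuous_intros continuous_on_compose2[OF cont]) auto
    have "continuous (at x within {0..1}) W" if x: "x \<in> {0..1}" for x
    proof (cases "x = 0")
      case True
      have "(W \<longlongrightarrow> 0) (at 0 within {0..1})"
      proof (rule Lim_null_comparison)
        show "\<forall>\<^sub>F x in at 0 within {0..1}. norm (W x) \<le> B * \<bar>x\<bar>"
          using eventually_at_ball'[of 1 0 "{0..1::real}"] by (auto elim!: eventually_mono intro!: Wb simp: dist_real_def)
        show "((\<lambda>x. B * \<bar>x\<bar>) \<longlongrightarrow> 0) (at 0 within {0..1})"
          by (auto intro!: tendsto_eq_intros)
      qed
      then show ?thesis using True by (simp add: continuous_within W_def)
    next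
      case False
      then have x0: "x > 0" using x by simp
      have "continuous (at x within {0<..1}) (\<lambda>x. x\<^sup>2 * w (- ln x))"
        using c1 x x0 by (auto simp: continuous_on_eq_continuous_within)
      then have "continuous (at x within {0<..1}) W"
        by (rule continuous_transform_within[OF _ zero_less_one]) (use x x0 in \<open>auto simp: W_def\<close>)
      moreover have "at x within {0<..1} = at x within {0..1}"
        by (rule at_within_nhd[of _ "{0<..}"]) (use x0 in auto)
      ultimately show ?thesis by simp
    qed
    then show ?thesis by (simp add: continuous_on_eq_continuous_within)
  qed
  have We: "W (exp (- t)) = exp (- 2 * t) * w t" for t
    by (simp add: W_def power2_eq_square flip: exp_add)
  define v where "v = (\<lambda>t. exp (- 2 * t) * w t)"
  let ?v = "\<lambda>t. indicator {0<..} t *\<^sub>R v t"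
  have cv: "continuous_on {0..} v" unfolding v_def by (intro continuous_intros cont)
  have vb: "\<bar>v t\<bar> \<le> B * exp (- t)" if "0 < t" for t
  proof -
    have "exp (- 2 * t) * \<bar>w t\<bar> \<le> exp (- 2 * t) * (B * exp t)" using bnd[OF that] by (intro mult_left_mono) auto
    also have "\<dots> = B * exp (- t)" by (simp flip: exp_add)
    finally show ?thesis by (simp add: v_def abs_mult)
  qed
  have iv: "set_integrable lborel {0<..} v" using int[of 2] by (simp add: v_def)
  have mv: "(\<lambda>t. ?v t) \<in> borel_measurable lborel"
    using iv by (auto simp: set_integrable_def dest: borel_measurable_integrable)
  have iabs: "integrable lborel (\<lambda>t. \<bar>?v t\<bar>)" using iv by (auto simp: set_integrable_def)
  define J where "J = (LINT t|lborel. \<bar>?v t\<bar>)"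
  have iv2: "integrable lborel (\<lambda>t. (?v t)\<^sup>2)"
  proof (rule Bochner_Integration.integrable_bound)
    show "integrable lborel (\<lambda>t. B * \<bar>?v t\<bar>)" using iabs by (rule integrable_mult_right)
    show "AE t in lborel. norm ((?v t)\<^sup>2) \<le> norm (B * \<bar>?v t\<bar>)"
    proof (rule AE_I2)
      fix t :: real
      have "\<bar>v t\<bar> * \<bar>v t\<bar> \<le> B * \<bar>v t\<bar>" if "0 < t"
      proof (rule mult_right_mono)
        have "B * exp (- t) \<le> B * 1" using that B0 by (intro mult_left_mono) auto
        then show "\<bar>v t\<bar> \<le> B" using vb[OF that] by simp
      qed simp
      then show "norm ((?v t)\<^sup>2) \<le> norm (B * \<bar>?v t\<bar>)"
        using B0 by (auto simp: indicator_def power2_eq_square abs_mult)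
    qed
  qed (use mv in measurable)
  have poly0: "integrable lborel (\<lambda>t. p (exp (- t)) * (?v t)) \<and> (LINT t|lborel. p (exp (- t)) * (?v t)) = 0"
    if p: "real_polynomial_function p" for p
  proof -
    obtain a N where p': "p = (\<lambda>x. \<Sum>i\<le>N. a i * x ^ i)" using p unfolding real_polynomial_function_iff_sum by blast
    have e: "a i * (exp (- t)) ^ i * (?v t) = a i * (indicator {0<..} t *\<^sub>R (exp (- real (i + 2) * t) * w t))" for i and t :: real
    proof -
      have "exp (- real (i + 2) * t) = exp (- t) ^ i * exp (- 2 * t)"
        by (simp add: exp_of_nat_mult[symmetric] exp_add[symmetric] algebra_simps)
      then show ?thesis by (simp add: v_def)
    qed
    have i: "integrable lborel (\<lambda>t. a i * (indicator {0<..} t *\<^sub>R (exp (- real (i + 2) * t) * w t)))" for i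
      using int[of "i + 2"] by (intro integrable_mult_right) (simp add: set_integrable_def)
    have z: "(LINT t|lborel. a i * (indicator {0<..} t *\<^sub>R (exp (- real (i + 2) * t) * w t))) = 0" for i
      using zero[of "i + 2"] unfolding set_lebesgue_integral_def integral_mult_right_zero by (simp only: mult_zero_right)
    have "(LINT t|lborel. (\<Sum>i\<le>N. a i * (indicator {0<..} t *\<^sub>R (exp (- real (i + 2) * t) * w t))))
        = (\<Sum>i\<le>N. LINT t|lborel. a i * (indicator {0<..} t *\<^sub>R (exp (- real (i + 2) * t) * w t)))"
      by (rule Bochner_Integration.integral_sum) (rule i)
    also have "\<dots> = 0" by (rule sum.neutral) (use z in blast)
    finally show ?thesis unfolding p' sum_distrib_right e using i by (intro conjI Bochner_Integration.integrable_sum) auto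
  qed
  have "(LINT t|lborel. (?v t)\<^sup>2) \<le> e * J" if e: "e > 0" for e
  proof -
    obtain p where p: "real_polynomial_function p" "\<And>x. x \<in> {0..1} \<Longrightarrow> \<bar>W x - p x\<bar> < e"
      using Stone_Weierstrass_real_polynomial_function[OF _ contW e] by auto
    have "(LINT t|lborel. (?v t)\<^sup>2) = (LINT t|lborel. (?v t)\<^sup>2) - (LINT t|lborel. p (exp (- t)) * (?v t))"
      using poly0[OF p(1)] by simp
    also have "\<dots> = (LINT t|lborel. (?v t)\<^sup>2 - p (exp (- t)) * (?v t))"
      using poly0[OF p(1)] iv2 by (subst Bochner_Integration.integral_diff) auto
    also have "\<dots> \<le> (LINT t|lborel. e * \<bar>?v t\<bar>)"
    proof (rule Bochner_Integration.integral_mono)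
      show "integrable lborel (\<lambda>t. (?v t)\<^sup>2 - p (exp (- t)) * (?v t))"
        using poly0[OF p(1)] iv2 by (intro Bochner_Integration.integrable_diff) auto
      show "integrable lborel (\<lambda>t. e * \<bar>?v t\<bar>)" using iabs by (rule integrable_mult_right)
      fix t :: real
      have "(v t)\<^sup>2 - p (exp (- t)) * v t \<le> e * \<bar>v t\<bar>" if "t > 0"
      proof -
        have "(v t)\<^sup>2 - p (exp (- t)) * v t = (W (exp (- t)) - p (exp (- t))) * v t"
          unfolding We v_def by (simp add: power2_eq_square algebra_simps)
        also have "\<dots> \<le> \<bar>W (exp (- t)) - p (exp (- t))\<bar> * \<bar>v t\<bar>" by (simp add: abs_mult[symmetric])
        also have "\<dots> \<le> e * \<bar>v t\<bar>" using p(2)[of "exp (- t)"] that by (intro mult_right_mono) auto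
        finally show ?thesis .
      qed
      then show "(?v t)\<^sup>2 - p (exp (- t)) * (?v t) \<le> e * \<bar>?v t\<bar>"
        by (auto simp: indicator_def)
    qed
    also have "\<dots> = e * J" by (simp add: J_def)
    finally show ?thesis .
  qed
  then have "(LINT t|lborel. (?v t)\<^sup>2) \<le> 0"
  proof -
    assume *: "\<And>e. 0 < e \<Longrightarrow> (LINT t|lborel. (?v t)\<^sup>2) \<le> e * J"
    have J0: "J \<ge> 0" unfolding J_def by (rule Bochner_Integration.integral_nonneg) auto
    show ?thesis
    proof (rule field_le_epsilon)
      fix d :: real assume d: "d > 0"
      have "(LINT t|lborel. (?v t)\<^sup>2) \<le> d / (J + 1) * J" using d J0 by (intro *) auto
      also have "\<dots> \<le> 0 + d" using d J0 by (simp add: field_simps)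
      finally show "(LINT t|lborel. (?v t)\<^sup>2) \<le> 0 + d" .
    qed
  qed
  then have "(LINT t|lborel. (?v t)\<^sup>2) = 0"
    by (intro antisym Bochner_Integration.integral_nonneg) auto
  then have ae: "AE t in lborel. (?v t)\<^sup>2 = 0"
    using integral_nonneg_eq_0_iff_AE[OF iv2] by simp
  have "v t = 0"
  proof (rule continuous_AE_zero[of "t + 1" v t])
    show "continuous_on {0<..<t + 1} v" by (rule continuous_on_subset[OF cv]) auto
    show "AE r in lborel. r \<in> {0<..<t + 1} \<longrightarrow> v r = 0"
      using ae by eventually_elim (auto simp: indicator_def)
  qed (use t in auto)
  then show ?thesis by (simp add: v_def)
qed

lemma laplace_powr:
  assumes "x > 0" "X > 0"
  shows "labs X (\<lambda>t. t powr (x - 1))" "laplace X (\<lambda>t. t powr (x - 1)) = Gamma x * X powr (- x)"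
proof -
  define h where "h = (\<lambda>t::real. t powr (x - 1) / exp t)"
  have "h absolutely_integrable_on {0..}"
    using Gamma_integral_real[OF assms(1)] unfolding h_def by (intro nonnegative_absolutely_integrable_1) auto
  then have i: "set_integrable lborel {0..} h"
    unfolding set_integrable_def by (subst (asm) integrable_completion) (auto simp: h_def)
  have val: "(LINT t:{0..}|lborel. h t) = Gamma x"
    using set_borel_integral_eq_integral(2)[OF i] Gamma_integral_real[OF assms(1)] by (auto simp: h_def dest!: integral_unique)
  have e: "indicator {0..} (0 + X * t) *\<^sub>R h (0 + X * t) = X powr (x - 1) * (indicator {0<..} t *\<^sub>R (exp (- X * t) * t powr (x - 1)))" for t
    using assms by (cases "t = 0"; cases "t < 0")
      (auto simp: h_def indicator_def powr_mult exp_minus divide_inverse zero_le_mult_iff)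
  have i': "integrable lborel (\<lambda>t. X powr (x - 1) * (indicator {0<..} t *\<^sub>R (exp (- X * t) * t powr (x - 1))))"
    using lborel_integrable_real_affine[OF i[unfolded set_integrable_def], of X 0] assms unfolding e by simp
  then show "labs X (\<lambda>t. t powr (x - 1))" using assms by (simp add: set_integrable_def)
  have "Gamma x = X * (X powr (x - 1) * laplace X (\<lambda>t. t powr (x - 1)))"
    using lborel_integral_real_affine[of X "\<lambda>t. indicator {0..} t *\<^sub>R h t" 0] assms val unfolding e set_lebesgue_integral_def
    by (simp only: integral_mult_right_zero) simp
  also have "\<dots> = X powr x * laplace X (\<lambda>t. t powr (x - 1))"
    using assms by (simp add: powr_diff)
  finally show "laplace X (\<lambda>t. t powr (x - 1)) = Gamma x * X powr (- x)"
    using assms by (simp add: powr_minus field_simps)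
qed

section \<open>The scalar fractional equation\<close>

lemma conv_left_commute:
  assumes "locint T a" "locint T b" "continuous_on {0..T} c" "t \<le> T"
  shows "conv a (conv b c) t = conv b (conv a c) t"
proof -
  have "conv a (conv b c) t = conv (conv a b) c t" by (rule conv_assoc_cont[OF assms])
  also have "conv a b = conv b a" by (rule ext) (rule conv_commute)
  also have "conv (conv b a) c t = conv b (conv a c) t"
    by (rule conv_assoc_cont[symmetric]) (use assms in auto)
  finally show ?thesis .
qed

lemma primitive_add:
  assumes "locint t a" "locint t b"
  shows "primitive (\<lambda>s. a s + b s) t = primitive a t + primitive b t"
  unfolding primitive_eq using assms by (simp add: set_integral_add)

lemma primitive_one: "0 \<le> t \<Longrightarrow> primitive (\<lambda>_. 1) t = t"
  by (simp add: primitive_eq set_lebesgue_integral_def)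

lemma continuous_on_conv_halfline:
  assumes "\<And>T. locint T a" "continuous_on {0..} b"
  shows "continuous_on {0..} (conv a b)"
proof -
  have "continuous (at t within {0..}) (conv a b)" if "t \<ge> 0" for t
  proof -
    have "continuous_on {0..t + 1} (conv a b)"
      by (intro continuous_on_conv assms continuous_on_subset[OF assms(2)]) auto
    then have "continuous (at t within {0..t + 1}) (conv a b)"
      using that by (auto simp: continuous_on_eq_continuous_within)
    moreover have "at t within {0..t + 1} = at t within {0..}"
      by (rule at_within_nhd[of _ "{..<t + 1}"]) auto
    ultimately show ?thesis by simp
  qed
  then show ?thesis by (simp add: continuous_on_eq_continuous_within)
qed

lemma laplace_one:
  assumes "X > 0"
  shows "labs X (\<lambda>_. 1)" "laplace X (\<lambda>_. 1) = 1 / X"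
proof -
  have "labs X (\<lambda>t. t powr (1 - 1))" by (rule laplace_powr) (use assms in auto)
  then show "labs X (\<lambda>_. 1)"
    by (rule set_integrable_cong[THEN iffD1, rotated -1]) auto
  show "laplace X (\<lambda>_. 1) = 1 / X" using laplace_exp(3)[of "of_real X"] assms by simp
qed

text \<open>
  Transforms are recorded as functions of a positive real argument; this makes the identities
  between the kernels below a matter of rational functions.
\<close>

definition has_laplace :: "(real \<Rightarrow> real) \<Rightarrow> (real \<Rightarrow> real) \<Rightarrow> bool" where
  "has_laplace a L \<longleftrightarrow> (\<forall>X>0. labs X a \<and> laplace X a = L X)"

text \<open>
  The regularity under which Laplace transforms determine a function; convolution with a
  function that has a transform preserves it.
\<close>

definition moderate :: "(real \<Rightarrow> real) \<Rightarrow> bool" where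
  "moderate a \<longleftrightarrow> continuous_on {0..} a \<and> (\<exists>B. \<forall>t>0. \<bar>a t\<bar> \<le> B * exp t)"

lemma has_laplaceD:
  assumes "has_laplace a L" "X > 0"
  shows "labs X a" "laplace X a = L X"
  using assms unfolding has_laplace_def by blast+

lemma has_laplace_locint: "has_laplace a L \<Longrightarrow> locint T a"
  by (rule labs_imp_locint[OF has_laplaceD(1)[OF _ zero_less_one]])

lemma has_laplace_one: "has_laplace (\<lambda>_. 1) (\<lambda>X. 1 / X)"
  using laplace_one by (simp add: has_laplace_def)

lemma has_laplace_conv:
  assumes a: "has_laplace a K" and b: "has_laplace b L"
  shows "has_laplace (conv a b) (\<lambda>X. K X * L X)"
  unfolding has_laplace_def
  using labs_conv[OF has_laplaceD(1)[OF a] has_laplaceD(1)[OF b]] has_laplaceD(2)[OF a] has_laplaceD(2)[OF b] by simp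

lemma has_laplace_scale:
  assumes "has_laplace a L"
  shows "has_laplace (\<lambda>t. k * a t) (\<lambda>X. k * L X)"
  unfolding has_laplace_def
proof (intro allI impI conjI)
  fix X :: real assume "X > 0"
  then have a: "labs X a" "laplace X a = L X" using assms by (simp_all add: has_laplace_def)
  show "labs X (\<lambda>t. k * a t)"
    using set_integrable_mult_right[of k lborel "{0<..}" "\<lambda>t. exp (- X * t) * a t"] a(1) by (simp add: mult.left_commute)
  show "laplace X (\<lambda>t. k * a t) = k * L X" using a(2) by (simp add: mult.left_commute)
qed

lemma has_laplace_add:
  assumes "has_laplace a K" "has_laplace b L"
  shows "has_laplace (\<lambda>t. a t + b t) (\<lambda>X. K X + L X)"
  using assms by (simp add: has_laplace_def ring_distribs set_integral_add)

lemma moderate_one: "moderate (\<lambda>_. 1)"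
proof -
  have "\<forall>t>0. \<bar>1::real\<bar> \<le> 1 * exp t" by simp
  then show ?thesis unfolding moderate_def by (intro conjI continuous_on_const exI)
qed

lemma moderate_conv:
  assumes a: "has_laplace a L" and b: "moderate b"
  shows "moderate (conv a b)"
proof -
  obtain B where B: "\<And>t. 0 < t \<Longrightarrow> \<bar>b t\<bar> \<le> B * exp t" and c: "continuous_on {0..} b"
    using b by (auto simp: moderate_def)
  have "labs 1 a" by (rule has_laplaceD(1)[OF a zero_less_one])
  from conv_growth[OF this B _ c] have "\<forall>t>0. \<bar>conv a b t\<bar> \<le> B * laplace 1 (\<lambda>t. \<bar>a t\<bar>) * exp t" by simp
  then show ?thesis
    unfolding moderate_def by (intro conjI exI continuous_on_conv_halfline c has_laplace_locint[OF a])
qed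

lemma moderate_lincomb:
  assumes "moderate a" "moderate b"
  shows "moderate (\<lambda>t. k * a t + b t)"
proof -
  obtain A where A: "\<And>t. 0 < t \<Longrightarrow> \<bar>a t\<bar> \<le> A * exp t" using assms(1) by (auto simp: moderate_def)
  obtain B where B: "\<And>t. 0 < t \<Longrightarrow> \<bar>b t\<bar> \<le> B * exp t" using assms(2) by (auto simp: moderate_def)
  have "\<bar>k * a t + b t\<bar> \<le> (\<bar>k\<bar> * A + B) * exp t" if "0 < t" for t
    using abs_triangle_ineq[of "k * a t" "b t"] mult_left_mono[OF A[OF that], of "\<bar>k\<bar>"] B[OF that]
    by (simp add: abs_mult distrib_right mult.assoc)
  then show ?thesis using assms unfolding moderate_def by (intro conjI exI[of _ "\<bar>k\<bar> * A + B"] continuous_intros) auto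
qed

lemma has_laplace_unique:
  assumes "moderate a" "moderate b" and a: "has_laplace a K" and b: "has_laplace b L"
    and e: "\<And>X. X > 0 \<Longrightarrow> K X = L X" and t: "t > 0"
  shows "a t = b t"
proof -
  have "moderate (\<lambda>t. (-1) * b t + a t)" by (intro moderate_lincomb assms)
  then obtain B where B: "\<And>t. 0 < t \<Longrightarrow> \<bar>(-1) * b t + a t\<bar> \<le> B * exp t" and c: "continuous_on {0..} (\<lambda>t. (-1) * b t + a t)"
    by (auto simp: moderate_def)
  have h: "has_laplace (\<lambda>t. (-1) * b t + a t) (\<lambda>X. (-1) * L X + K X)"
    by (intro has_laplace_add has_laplace_scale a b)
  have "(-1) * b t + a t = 0"
    by (rule laplace_unique[OF c B _ _ t]) (use h e in \<open>auto simp: has_laplace_def\<close>)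
  then show ?thesis by simp
qed

lemma locint_scale: "locint T a \<Longrightarrow> locint T (\<lambda>s. k * a s)"
  by (rule set_integrable_mult_right) auto

lemma locint_add: "locint T a \<Longrightarrow> locint T b \<Longrightarrow> locint T (\<lambda>s. a s + b s)"
  by (rule set_integral_add(1))

lemma primitive_lincomb:
  assumes "locint t a" "locint t b" "locint t c"
  shows "primitive (\<lambda>s. a s + k * b s + m * c s) t = primitive a t + k * primitive b t + m * primitive c t"
proof -
  have "primitive (\<lambda>s. (a s + k * b s) + m * c s) t = primitive (\<lambda>s. a s + k * b s) t + primitive (\<lambda>s. m * c s) t"
    by (intro primitive_add locint_add locint_scale assms)
  also have "primitive (\<lambda>s. a s + k * b s) t = primitive a t + primitive (\<lambda>s. k * b s) t"
    by (intro primitive_add locint_scale assms)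
  finally show ?thesis by (simp only: conv_scale_right)
qed

lemma powr_pred:
  assumes "(x::real) > 0"
  shows "1 / x * (x powr (a - 1) / D) = x powr (a - 2) / D" "1 / x * (x powr 1 / D) = x powr 0 / D"
proof -
  have "x powr (a - 1) = x powr (a - 2) * x" using powr_add[of x "a - 2" 1] assms by simp
  then show "1 / x * (x powr (a - 1) / D) = x powr (a - 2) / D" using assms by simp
  show "1 / x * (x powr 1 / D) = x powr 0 / D" using assms by simp
qed

lemma resolvent_identity:
  assumes "(x::real) > 0" "lam > 0"
  shows "lam * (1 / x * (1 / x * (x powr 0 / (x powr a + lam)))) + x powr (a - 2) / (x powr a + lam) = 1 / x * (1 / x)"
proof -
  have e: "x powr (a - 2) = x powr a / (x * x)" using assms by (simp add: powr_diff power2_eq_square)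
  have "x powr a + lam > 0" using assms by (simp add: add_pos_pos)
  then have D: "x powr a + lam \<noteq> 0" by simp
  have "lam * (1 / x * (1 / x * (x powr 0 / (x powr a + lam)))) + x powr (a - 2) / (x powr a + lam)
      = (1 / x * (1 / x)) * ((lam + x powr a) / (x powr a + lam))"
    unfolding e using assms by (simp add: ring_distribs add_divide_distrib)
  also have "(lam + x powr a) / (x powr a + lam) = 1" using D by (simp add: add.commute)
  finally show ?thesis by simp
qed

text \<open>
  The four kernels are those with Laplace transforms \<open>X\<^sup>k / (X\<^sup>\<alpha> + \<lambda>)\<close> for
  \<open>k = 0, 1, \<alpha> - 1, \<alpha> - 2\<close>. The solution of the homogeneous equation with value one and
  derivative zero at \<open>0\<close> is \<open>ks\<close>, and the one with value zero and derivative one is \<open>kS\<close>; the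
  response to a source is convolution with \<open>kP\<close>, whose derivative is \<open>kq\<close>. The algebraic
  relations between them are identities of rational functions of \<open>X\<close> and \<open>X\<^sup>\<alpha>\<close>.
\<close>

locale caputo_kernel =
  fixes \<alpha> lam :: real
  assumes al: "1 < \<alpha>" "\<alpha> < 2" "lam > 0"
begin

abbreviation "kP \<equiv> ray_kernel \<alpha> lam 0"
abbreviation "kq \<equiv> ray_kernel \<alpha> lam 1"
abbreviation "ks \<equiv> ray_kernel \<alpha> lam (\<alpha> - 1)"
abbreviation "kS \<equiv> ray_kernel \<alpha> lam (\<alpha> - 2)"

definition riemann_kernel :: "real \<Rightarrow> real" where
  "riemann_kernel r = r powr (1 - \<alpha>) / Gamma (2 - \<alpha>)"

lemma kernel_laplace:
  assumes "-1 < k" "k < \<alpha>"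
  shows "has_laplace (ray_kernel \<alpha> lam k) (\<lambda>X. X powr k / (X powr \<alpha> + lam))"
  using laplace_ray_kernel[OF al assms] by (simp add: has_laplace_def)

lemma kernels_laplace:
  "has_laplace kP (\<lambda>X. X powr 0 / (X powr \<alpha> + lam))" "has_laplace kq (\<lambda>X. X powr 1 / (X powr \<alpha> + lam))"
  "has_laplace ks (\<lambda>X. X powr (\<alpha> - 1) / (X powr \<alpha> + lam))" "has_laplace kS (\<lambda>X. X powr (\<alpha> - 2) / (X powr \<alpha> + lam))"
  by (rule kernel_laplace; use al in simp)+

lemmas locint_kernel [simp] = kernels_laplace[THEN has_laplace_locint]

lemma Gamma_pos: "Gamma (2 - \<alpha>) > 0"
  using al by (intro Gamma_real_pos) auto

lemma riemann_laplace: "has_laplace riemann_kernel (\<lambda>X. X powr (\<alpha> - 2))"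
proof -
  have e: "riemann_kernel = (\<lambda>t. 1 / Gamma (2 - \<alpha>) * t powr ((2 - \<alpha>) - 1))"
    by (auto simp: riemann_kernel_def)
  have "has_laplace (\<lambda>t. t powr ((2 - \<alpha>) - 1)) (\<lambda>X. Gamma (2 - \<alpha>) * X powr (- (2 - \<alpha>)))"
    unfolding has_laplace_def using laplace_powr[of "2 - \<alpha>"] al by simp
  from has_laplace_scale[OF this, of "1 / Gamma (2 - \<alpha>)"] show ?thesis
    unfolding e using Gamma_pos by simp
qed

lemmas locint_riemann [simp] = has_laplace_locint[OF riemann_laplace]

lemma kernel_bounded:
  assumes "-1 < k" "k < \<alpha> - 1"
  obtains B where "\<And>t. t \<ge> 0 \<Longrightarrow> \<bar>ray_kernel \<alpha> lam k t\<bar> \<le> B" "B \<ge> 0"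
proof
  define B where "B = (LINT x|lborel. norm (ray_integrand \<alpha> lam k 0 x)) / pi"
  show "B \<ge> 0" unfolding B_def by (intro divide_nonneg_nonneg Bochner_Integration.integral_nonneg) auto
  fix t :: real assume t: "t \<ge> 0"
  have i: "integrable lborel (ray_integrand \<alpha> lam k t)"
    using integrable_ray_integrand[OF al, of t k] integrable_ray_integrand_0[OF al, of k] t assms by (cases "t = 0") auto
  have "\<bar>ray_kernel \<alpha> lam k t\<bar> \<le> norm (LINT x|lborel. ray_integrand \<alpha> lam k t x) / pi"
    unfolding ray_kernel_def abs_divide by (simp add: divide_right_mono abs_Im_le_cmod)
  also have "\<dots> \<le> (LINT x|lborel. norm (ray_integrand \<alpha> lam k t x)) / pi"
    by (intro divide_right_mono integral_norm_bound) auto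
  also have "\<dots> \<le> B" unfolding B_def
  proof (intro divide_right_mono Bochner_Integration.integral_mono integrable_norm i integrable_ray_integrand_0 al assms)
    fix x
    have "exp (- ray_decay \<alpha> * t * exp x) \<le> 1"
      using t ray_decay_pos[OF al(1,2)] by simp
    then show "norm (ray_integrand \<alpha> lam k t x) \<le> norm (ray_integrand \<alpha> lam k 0 x)"
      unfolding norm_ray_integrand[of _ _ _ t] by (intro mult_left_le_one_le) auto
  qed auto
  finally show "\<bar>ray_kernel \<alpha> lam k t\<bar> \<le> B" .
qed

lemma cont_kernel: "continuous_on {0..} kP" "continuous_on {0..} kS" "continuous_on {0<..} kq" "continuous_on {0<..} ks"
  "continuous_on {0<..} kP" "continuous_on {0<..} kS"
  by (rule continuous_on_ray_kernel_0[OF al] continuous_on_ray_kernel[OF al]; use al in simp)+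

lemma moderate_kernel: "moderate kP" "moderate kS"
proof -
  have "moderate (ray_kernel \<alpha> lam k)" if k: "-1 < k" "k < \<alpha> - 1" for k
  proof -
    obtain B where B: "\<And>t. t \<ge> 0 \<Longrightarrow> \<bar>ray_kernel \<alpha> lam k t\<bar> \<le> B" "B \<ge> 0" by (rule kernel_bounded[OF k]) auto
    have "\<forall>t>0. \<bar>ray_kernel \<alpha> lam k t\<bar> \<le> B * exp t"
    proof (intro allI impI)
      fix t :: real assume "t > 0"
      then show "\<bar>ray_kernel \<alpha> lam k t\<bar> \<le> B * exp t" using B(1)[of t] mult_left_mono[of 1 "exp t" B] B(2) by simp
    qed
    then show ?thesis unfolding moderate_def by (intro conjI exI continuous_on_ray_kernel_0[OF al k])
  qed
  then show "moderate kP" "moderate kS" using al by simp_all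
qed

lemma primitive_commute: "primitive a = conv a (\<lambda>_. 1)"
  by (rule ext) (rule conv_commute)

lemma primitive_ks: assumes "t > 0" shows "primitive ks t = kS t"
proof (rule has_laplace_unique[OF _ moderate_kernel(2) has_laplace_conv[OF has_laplace_one kernels_laplace(3)] kernels_laplace(4) _ assms])
  show "moderate (primitive ks)" unfolding primitive_commute by (rule moderate_conv[OF kernels_laplace(3) moderate_one])
qed (rule powr_pred(1))

lemma primitive_kq: assumes "t > 0" shows "primitive kq t = kP t"
proof (rule has_laplace_unique[OF _ moderate_kernel(1) has_laplace_conv[OF has_laplace_one kernels_laplace(2)] kernels_laplace(1) _ assms])
  show "moderate (primitive kq)" unfolding primitive_commute by (rule moderate_conv[OF kernels_laplace(2) moderate_one])
qed (rule powr_pred(2))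

lemma cont_primitive_kP: "continuous_on {0..} (primitive kP)"
  using moderate_conv[OF has_laplace_one moderate_kernel(1)] by (simp add: moderate_def)

lemma primitive_primitive_kP: assumes "t > 0" shows "lam * primitive (primitive kP) t = t - kS t"
proof -
  have "lam * primitive (primitive kP) t + kS t = primitive (\<lambda>_. 1) t"
    by (rule has_laplace_unique[OF moderate_lincomb[OF moderate_conv[OF has_laplace_one moderate_conv[OF has_laplace_one moderate_kernel(1)]] moderate_kernel(2)]
          moderate_conv[OF has_laplace_one moderate_one]
          has_laplace_add[OF has_laplace_scale[OF has_laplace_conv[OF has_laplace_one has_laplace_conv[OF has_laplace_one kernels_laplace(1)]]] kernels_laplace(4)]
          has_laplace_conv[OF has_laplace_one has_laplace_one] resolvent_identity[OF _ al(3)] assms])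
  then show ?thesis using primitive_one[of t] assms by simp
qed

lemma riemann_conv_kP: assumes "t > 0" shows "conv riemann_kernel kP t = kS t"
  by (rule has_laplace_unique[OF moderate_conv[OF riemann_laplace moderate_kernel(1)] moderate_kernel(2)
        has_laplace_conv[OF riemann_laplace kernels_laplace(1)] kernels_laplace(4) _ assms]) simp

lemma ks_eq: assumes "t > 0" shows "ks t = 1 - lam * primitive kP t"
proof -
  define T where "T = t + 1"
  have cp: "continuous_on {0..T} (primitive kP)" by (rule continuous_on_subset[OF cont_primitive_kP]) auto
  have li: "locint t' (\<lambda>s. lam * primitive kP s)" if "t' \<le> T" for t'
    by (rule locint_scale, rule locint_mono[OF locint_continuous[OF cp] that])
  have "lam * primitive kP t + ks t = 1"
  proof (rule primitive_inj[of T "\<lambda>s. lam * primitive kP s + ks s" "\<lambda>_. 1"])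
    show "locint T (\<lambda>s. lam * primitive kP s + ks s)" using li by (intro locint_add) auto
    show "locint T (\<lambda>_. 1)" by (intro locint_continuous continuous_intros)
    show "continuous_on {0<..<T} (\<lambda>s. lam * primitive kP s + ks s)"
      by (intro continuous_intros continuous_on_subset[OF cp] continuous_on_subset[OF cont_kernel(4)]) auto
    fix t' assume t': "0 < t'" "t' < T"
    have "primitive (\<lambda>s. lam * primitive kP s + ks s) t' = lam * primitive (primitive kP) t' + primitive ks t'"
      using li[of t'] t' by (subst primitive_add) (auto simp: conv_scale_right)
    then show "primitive (\<lambda>s. lam * primitive kP s + ks s) t' = primitive (\<lambda>_. 1) t'"
      using primitive_primitive_kP[OF t'(1)] primitive_ks[OF t'(1)] primitive_one[of t'] t' by simp
  qed (use assms in \<open>auto simp: T_def\<close>)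
  then show ?thesis by simp
qed

lemma riemann_primitive:
  assumes "t > 0"
  shows "primitive riemann_kernel t = t powr (2 - \<alpha>) / ((2 - \<alpha>) * Gamma (2 - \<alpha>))"
proof -
  have "((\<lambda>x. x powr (1 - \<alpha>)) has_integral t powr (1 - \<alpha> + 1) / (1 - \<alpha> + 1)) {0..t}"
    by (rule has_integral_powr_from_0) (use al assms in auto)
  then have "((\<lambda>x. x powr (1 - \<alpha>) / Gamma (2 - \<alpha>)) has_integral t powr (1 - \<alpha> + 1) / (1 - \<alpha> + 1) / Gamma (2 - \<alpha>)) {0..t}"
    by (rule has_integral_divide)
  then have h: "(riemann_kernel has_integral t powr (2 - \<alpha>) / ((2 - \<alpha>) * Gamma (2 - \<alpha>))) {0..t}"
    by (simp add: riemann_kernel_def[abs_def])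
  have "primitive riemann_kernel t = integral {0<..<t} riemann_kernel"
    unfolding primitive_eq by (rule set_borel_integral_eq_integral) simp
  also have "\<dots> = integral {0..t} riemann_kernel" by (rule integral_open_interval_real[symmetric])
  also have "\<dots> = t powr (2 - \<alpha>) / ((2 - \<alpha>) * Gamma (2 - \<alpha>))" using h by (rule integral_unique)
  finally show ?thesis .
qed

lemma abs_conv_le:
  assumes "locint T a" "continuous_on {0..T} b" "t \<le> T" "\<And>s. 0 < s \<Longrightarrow> 0 \<le> a s" "\<And>s. 0 < s \<Longrightarrow> s < t \<Longrightarrow> \<bar>b s\<bar> \<le> K"
  shows "\<bar>conv a b t\<bar> \<le> K * primitive a t"
proof -
  have i: "set_integrable lborel {0<..<t} (\<lambda>s. b (t - s) * a s)" by (rule conv_integrable(2)[OF assms(1-3)])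
  have "\<bar>conv a b t\<bar> \<le> (LINT s:{0<..<t}|lborel. \<bar>b (t - s) * a s\<bar>)"
    unfolding conv_commute[of a b t] unfolding conv_def using set_integral_norm_bound[OF i] by simp
  also have "\<dots> \<le> (LINT s:{0<..<t}|lborel. K * a s)"
  proof (rule set_integral_mono)
    show "set_integrable lborel {0<..<t} (\<lambda>s. \<bar>b (t - s) * a s\<bar>)" using i by (rule set_integrable_abs)
    show "set_integrable lborel {0<..<t} (\<lambda>s. K * a s)" by (rule locint_scale[OF locint_mono[OF assms(1,3)]])
    fix s assume s: "s \<in> {0<..<t}"
    have "\<bar>b (t - s)\<bar> * a s \<le> K * a s" using s assms(4)[of s] assms(5)[of "t - s"] by (intro mult_right_mono) auto
    then show "\<bar>b (t - s) * a s\<bar> \<le> K * a s" using s assms(4)[of s] by (simp add: abs_mult)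
  qed
  also have "\<dots> = K * primitive a t" by (simp add: primitive_eq)
  finally show ?thesis .
qed

text \<open>
  The function on the left and the double primitive have the same second derivative on \<open>(0,T)\<close>
  and both vanish at \<open>0\<close>, so they differ by a linear function \<open>b t\<close>. Since \<open>y s - y 0 - s * z 0\<close>
  is of order \<open>s\<close>, the left-hand side is of order \<open>t\<^sup>3\<^sup>-\<^sup>\<alpha>\<close>, which is smaller than \<open>t\<close> near \<open>0\<close>
  because \<open>\<alpha> < 2\<close>; hence \<open>b = 0\<close>. This is where the initial velocity enters the equation.
\<close>

lemma caputo_integrated:
  assumes T: "T > 0" and y: "continuous_on {0..T} y" and z: "continuous_on {0..T} z"
    and yz: "\<And>t. 0 \<le> t \<Longrightarrow> t \<le> T \<Longrightarrow> (y has_real_derivative z t) (at t within {0..T})"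
    and G: "continuous_on {0..T} G"
    and W: "\<And>t. 0 < t \<Longrightarrow> t < T \<Longrightarrow> (conv riemann_kernel (\<lambda>s. y s - y 0 - s * z 0) has_real_derivative W t) (at t)"
    and WG: "\<And>t. 0 < t \<Longrightarrow> t < T \<Longrightarrow> (W has_real_derivative G t) (at t)"
    and t: "0 \<le> t" "t \<le> T"
  shows "conv riemann_kernel (\<lambda>s. y s - y 0 - s * z 0) t = primitive (primitive G) t"
proof -
  define w where "w = (\<lambda>s. y s - y 0 - s * z 0)"
  have cw: "continuous_on {0..T} w" unfolding w_def by (intro continuous_intros y)
  define c where "c = conv riemann_kernel w"
  have cc: "continuous_on {0..T} c" unfolding c_def by (intro continuous_on_conv cw) auto
  have lG: "locint T G" by (rule locint_continuous[OF G])
  have cG: "continuous_on {0..T} (primitive G)" by (rule continuous_on_primitive[OF lG])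
  have lpG: "locint T (primitive G)" by (rule locint_continuous[OF cG])
  have cpG: "continuous_on {0..T} (primitive (primitive G))" by (rule continuous_on_primitive[OF lpG])
  have G': "continuous_on {0<..<T} G" by (rule continuous_on_subset[OF G]) auto
  have cG': "continuous_on {0<..<T} (primitive G)" by (rule continuous_on_subset[OF cG]) auto
  have "\<exists>b. \<forall>x\<in>{0<..<T}. W x - primitive G x = b"
  proof -
    have "(\<lambda>x. W x - primitive G x) constant_on {0<..<T}"
    proof (rule has_field_derivative_0_imp_constant_on)
      fix x assume "x \<in> {0<..<T}"
      then show "((\<lambda>x. W x - primitive G x) has_real_derivative 0) (at x)"
        using DERIV_diff[OF WG primitive_has_derivative[OF lG G']] by fastforce
    qed auto
    then show ?thesis by (auto simp: constant_on_def)
  qed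
  then obtain b where b: "\<And>x. 0 < x \<Longrightarrow> x < T \<Longrightarrow> W x - primitive G x = b" by auto
  have d: "c s - primitive (primitive G) s = b * s" if s: "0 \<le> s" "s \<le> T" for s
  proof (cases "s = 0")
    case False
    have "(\<lambda>x. c x - primitive (primitive G) x - b * x) s = (\<lambda>x. c x - primitive (primitive G) x - b * x) 0"
    proof (rule DERIV_isconst_end[of 0 s])
      show "continuous_on {0..s} (\<lambda>x. c x - primitive (primitive G) x - b * x)"
        by (intro continuous_intros continuous_on_subset[OF cc] continuous_on_subset[OF cpG]) (use s in auto)
      fix x assume x: "0 < x" "x < s"
      then have "((\<lambda>x. c x - primitive (primitive G) x - b * x) has_real_derivative W x - primitive G x - b * 1) (at x)"
        using s W[of x] by (intro DERIV_diff primitive_has_derivative[OF lpG cG'] DERIV_cmult DERIV_ident) (auto simp: c_def w_def)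
      then show "((\<lambda>x. c x - primitive (primitive G) x - b * x) has_real_derivative 0) (at x)"
        using b[of x] x s by simp
    qed (use s False in auto)
    moreover have "c 0 = 0" by (simp add: c_def conv_def set_lebesgue_integral_def)
    ultimately show ?thesis by simp
  qed (simp add: c_def conv_def set_lebesgue_integral_def)
  obtain Kz where Kz: "\<And>r. 0 \<le> r \<Longrightarrow> r \<le> T \<Longrightarrow> \<bar>z r\<bar> \<le> Kz" using cont_bounded[OF z] by blast
  obtain KG where KG: "\<And>r. 0 \<le> r \<Longrightarrow> r \<le> T \<Longrightarrow> \<bar>G r\<bar> \<le> KG" using cont_bounded[OF G] by blast
  have K0: "Kz \<ge> 0" "KG \<ge> 0" using Kz[of 0] KG[of 0] T by (auto intro: order_trans[OF abs_ge_zero])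
  have wb: "\<bar>w s\<bar> \<le> 2 * Kz * s" if s: "0 \<le> s" "s \<le> T" for s
  proof -
    have "norm (y s - y 0) \<le> Kz * norm (s - 0)"
      by (rule field_differentiable_bound[of "{0..T}" y z]) (use yz Kz s T in auto)
    moreover have "\<bar>s * z 0\<bar> \<le> Kz * s" using Kz[of 0] T s mult_right_mono[of "\<bar>z 0\<bar>" Kz s] by (simp add: abs_mult mult.commute)
    ultimately show ?thesis unfolding w_def using s by simp
  qed
  \<comment> \<open>The constant comes from the primitive \<open>s\<^sup>2\<^sup>-\<^sup>\<alpha> / ((2 - \<alpha>) \<Gamma>(2 - \<alpha>))\<close> of the
    Riemann-Liouville kernel.\<close>
  define C where "C = 2 * Kz / ((2 - \<alpha>) * Gamma (2 - \<alpha>))"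
  have bb: "\<bar>b\<bar> \<le> C * s powr (2 - \<alpha>) + KG * s" if s: "0 < s" "s < T" for s
  proof -
    have "\<bar>c s\<bar> \<le> (2 * Kz * s) * primitive riemann_kernel s"
      unfolding c_def
    proof (rule abs_conv_le[of T])
      show "\<bar>w r\<bar> \<le> 2 * Kz * s" if "0 < r" "r < s" for r
        using wb[of r] that s K0 mult_left_mono[of r s "2 * Kz"] by simp
      show "0 \<le> riemann_kernel r" for r using Gamma_pos by (simp add: riemann_kernel_def)
    qed (use s cw in auto)
    also have "\<dots> = C * s powr (2 - \<alpha>) * s" by (simp add: riemann_primitive[OF s(1)] C_def)
    finally have 1: "\<bar>c s\<bar> \<le> C * s powr (2 - \<alpha>) * s" .
    have 2: "\<bar>primitive G r\<bar> \<le> KG * s" if "0 < r" "r < s" for r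
    proof -
      have "\<bar>conv (\<lambda>_. 1) G r\<bar> \<le> KG * primitive (\<lambda>_. 1) r"
        by (rule abs_conv_le[of T]) (use that s G KG in \<open>auto intro!: locint_continuous\<close>)
      also have "\<dots> \<le> KG * s" using that K0 primitive_one[of r] by (auto intro!: mult_left_mono)
      finally show ?thesis .
    qed
    have "\<bar>primitive (primitive G) s\<bar> \<le> (KG * s) * primitive (\<lambda>_. 1) s"
      by (rule abs_conv_le[of T]) (use s cG 2 in \<open>auto intro!: locint_continuous\<close>)
    then have "\<bar>primitive (primitive G) s\<bar> \<le> KG * s * s" using s primitive_one[of s] by simp
    then have "\<bar>b * s\<bar> \<le> C * s powr (2 - \<alpha>) * s + KG * s * s" using 1 d[of s] s by linarith
    then have "\<bar>b\<bar> * s \<le> (C * s powr (2 - \<alpha>) + KG * s) * s" using s by (simp add: abs_mult algebra_simps)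
    then show ?thesis using s by simp
  qed
  have "\<bar>b\<bar> \<le> 0"
  proof (rule tendsto_le[of "at_right 0" "\<lambda>s. C * s powr (2 - \<alpha>) + KG * s" 0 "\<lambda>_. \<bar>b\<bar>"])
    show "((\<lambda>s. C * s powr (2 - \<alpha>) + KG * s) \<longlongrightarrow> 0) (at_right 0)"
    proof -
      have "((\<lambda>s. s powr (2 - \<alpha>)) \<longlongrightarrow> 0) (at_right 0)" using al by real_asymp
      then have "((\<lambda>s. C * s powr (2 - \<alpha>) + KG * s) \<longlongrightarrow> C * 0 + KG * 0) (at_right 0)"
        by (intro tendsto_intros)
      then show ?thesis by simp
    qed
    show "\<forall>\<^sub>F s in at_right 0. \<bar>b\<bar> \<le> C * s powr (2 - \<alpha>) + KG * s"
      unfolding eventually_at_right_field using bb T by (intro exI[of _ T]) auto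
  qed auto
  then have "b = 0" by simp
  then show ?thesis using d[OF t] by (simp add: c_def w_def)
qed

text \<open>
  Convolve the integrated equation with \<open>kP\<close>. On the left this gives convolution with \<open>kS\<close>, on
  the right the double primitive of \<open>kP * (f - \<lambda> y)\<close>, and the relation \<open>\<lambda> 1 * 1 * kP = t - kS\<close>
  makes the terms \<open>kS * y\<close> cancel. What is left is the asserted formula after two primitives.
\<close>

lemma mode_representation:
  assumes T: "T > 0" and y: "continuous_on {0..T} y" and f: "continuous_on {0..T} f"
    and I: "\<And>t. 0 \<le> t \<Longrightarrow> t \<le> T \<Longrightarrow> conv riemann_kernel (\<lambda>s. y s - y0 - s * z0) t = primitive (primitive (\<lambda>s. f s - lam * y s)) t"
    and t: "0 < t" "t < T"
  shows "y t = conv kP f t + y0 * ks t + z0 * kS t"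
proof -
  define w where "w = (\<lambda>s. y s - y0 - s * z0)"
  define G where "G = (\<lambda>s. f s - lam * y s)"
  define R where "R = (\<lambda>s. conv kP f s + y0 * ks s + z0 * kS s)"
  have cw: "continuous_on {0..T} w" unfolding w_def by (intro continuous_intros y)
  have cG: "continuous_on {0..T} G" unfolding G_def by (intro continuous_intros y f)
  have one: "locint T' (\<lambda>_. 1)" for T' by (intro locint_continuous continuous_intros)
  have c1: "continuous_on {0..T} (primitive G)" by (rule continuous_on_primitive[OF locint_continuous[OF cG]])
  have cPf: "continuous_on {0..T} (conv kP f)" and cPy: "continuous_on {0..T} (conv kP y)" and cPG: "continuous_on {0..T} (conv kP G)"
    by (intro continuous_on_conv f y cG; simp)+
  have cS: "continuous_on {0..T} kS" by (rule continuous_on_subset[OF cont_kernel(2)]) auto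
  have pp: "primitive (primitive y) t = primitive (primitive R) t" if t: "0 < t" "t < T" for t
  proof -
    have "conv kS w t = conv (conv kP riemann_kernel) w t"
      by (rule conv_cong) (auto simp: riemann_conv_kP conv_commute[of kP])
    also have "\<dots> = conv kP (conv riemann_kernel w) t"
      by (rule conv_assoc_cont[symmetric, of T]) (use cw t in auto)
    also have "\<dots> = conv kP (primitive (primitive G)) t"
      by (rule conv_cong) (use I t in \<open>auto simp: w_def G_def\<close>)
    also have "\<dots> = primitive (conv kP (primitive G)) t"
      by (rule conv_left_commute[of T]) (use c1 one t in auto)
    also have "\<dots> = primitive (primitive (conv kP G)) t"
      by (rule conv_cong[OF refl], rule conv_left_commute[of T]) (use cG one t in auto)
    also have "\<dots> = primitive (\<lambda>s. primitive (conv kP f) s - lam * primitive (conv kP y) s) t"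
    proof (rule conv_cong[OF refl])
      fix s assume s: "0 < s" "s < t"
      have "primitive (conv kP G) s = primitive (\<lambda>r. conv kP f r - lam * conv kP y r) s"
      proof (rule conv_cong[OF refl])
        fix r assume "0 < r" "r < s"
        then show "conv kP G r = conv kP f r - lam * conv kP y r"
          unfolding G_def using s t by (subst conv_diff_right[of T]) (auto intro!: continuous_intros f y simp: conv_scale_right)
      qed
      also have "\<dots> = primitive (conv kP f) s - lam * primitive (conv kP y) s"
        using s t by (subst conv_diff_right[of T]) (auto intro!: continuous_intros cPf cPy one simp: conv_scale_right)
      finally show "primitive (conv kP G) s = primitive (conv kP f) s - lam * primitive (conv kP y) s" .
    qed
    also have "\<dots> = primitive (primitive (conv kP f)) t - lam * primitive (primitive (conv kP y)) t"
      using t by (subst conv_diff_right[of T])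
        (auto intro!: continuous_intros one continuous_on_primitive locint_continuous cPf cPy simp: conv_scale_right)
    also have "lam * primitive (primitive (conv kP y)) t = conv (\<lambda>s. s - kS s) y t"
    proof -
      have "primitive (primitive (conv kP y)) t = primitive (conv (primitive kP) y) t"
        by (rule conv_cong[OF refl], rule conv_assoc_cont[of T]) (use y one t in auto)
      also have "\<dots> = conv (primitive (primitive kP)) y t"
        by (rule conv_assoc_cont[of T]) (use y one t in \<open>auto intro!: locint_conv\<close>)
      finally have "lam * primitive (primitive (conv kP y)) t = conv (\<lambda>s. lam * primitive (primitive kP) s) y t"
        by (simp add: conv_scale_left)
      also have "\<dots> = conv (\<lambda>s. s - kS s) y t"
        by (rule conv_cong) (auto simp: primitive_primitive_kP)
      finally show ?thesis .
    qed
    also have "conv (\<lambda>s. s - kS s) y t = conv (\<lambda>s. s) y t - conv kS y t"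
      by (rule conv_diff_left[of T]) (use t y in \<open>auto intro!: locint_continuous continuous_intros\<close>)
    also have "conv (\<lambda>s. s) y t = conv (primitive (\<lambda>_. 1)) y t"
      by (rule conv_cong) (auto simp: primitive_one)
    also have "\<dots> = primitive (primitive y) t"
      by (rule conv_assoc_cont[symmetric, of T]) (use y one t in auto)
    finally have A: "conv kS w t = primitive (primitive (conv kP f)) t - (primitive (primitive y) t - conv kS y t)" .
    have "conv kS w t = conv kS y t - y0 * conv kS (\<lambda>_. 1) t - z0 * conv kS (\<lambda>s. s) t"
    proof -
      have "conv kS w t = conv kS (\<lambda>s. y s - (y0 * 1)) t - conv kS (\<lambda>s. z0 * s) t"
        unfolding w_def using t by (subst conv_diff_right[of T, symmetric]) (auto intro!: continuous_intros y simp: mult.commute)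
      also have "conv kS (\<lambda>s. y s - (y0 * 1)) t = conv kS y t - conv kS (\<lambda>s. y0 * 1) t"
        using t by (intro conv_diff_right[of T]) (auto intro!: continuous_intros y)
      finally show ?thesis unfolding conv_scale_right .
    qed
    moreover have "conv kS (\<lambda>_. 1) t = primitive (primitive ks) t"
      unfolding conv_commute[of kS "\<lambda>_. 1" t] by (rule conv_cong) (auto simp: primitive_ks)
    moreover have "conv kS (\<lambda>s. s) t = primitive (primitive kS) t"
    proof -
      have "conv kS (\<lambda>s. s) t = conv kS (primitive (\<lambda>_. 1)) t"
        by (rule conv_cong) (auto simp: primitive_one)
      also have "\<dots> = primitive (conv kS (\<lambda>_. 1)) t"
        by (rule conv_left_commute[of T]) (use one t in auto)
      finally show ?thesis by (simp add: primitive_commute[of kS])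
    qed
    moreover have "primitive (primitive R) t = primitive (primitive (conv kP f)) t + y0 * primitive (primitive ks) t + z0 * primitive (primitive kS) t"
    proof -
      have "primitive R s = primitive (conv kP f) s + y0 * primitive ks s + z0 * primitive kS s" if "s < T" for s
      proof -
        have l: "locint s (conv kP f)"
          using locint_mono[OF locint_continuous[OF cPf], of s] that by auto
        show ?thesis unfolding R_def by (rule primitive_lincomb) (use l in auto)
      qed
      then have "primitive (primitive R) t = primitive (\<lambda>s. primitive (conv kP f) s + y0 * primitive ks s + z0 * primitive kS s) t"
        using t by (intro conv_cong) auto
      also have "\<dots> = primitive (primitive (conv kP f)) t + y0 * primitive (primitive ks) t + z0 * primitive (primitive kS) t"
      proof -
        have l: "locint t (primitive (conv kP f))" "locint t (primitive ks)" "locint t (primitive kS)"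
          using locint_mono[OF locint_continuous[OF cPf], of t] t by (auto intro!: locint_conv one)
        show ?thesis by (rule primitive_lincomb[OF l])
      qed
      finally show ?thesis .
    qed
    ultimately show ?thesis using A by simp
  qed
  have lR: "locint T R" unfolding R_def by (intro locint_add locint_scale locint_continuous[OF cPf]) auto
  have cpR: "continuous_on {0..T} (primitive R)" by (rule continuous_on_primitive[OF lR])
  have ly: "locint T y" by (rule locint_continuous[OF y])
  have cpy: "continuous_on {0..T} (primitive y)" by (rule continuous_on_primitive[OF ly])
  have p: "primitive y t = primitive R t" if t: "0 < t" "t < T" for t
    by (rule primitive_inj[of T, OF locint_continuous[OF cpy] locint_continuous[OF cpR] _ _ pp t])
       (auto intro: continuous_on_subset[OF cpy] continuous_on_subset[OF cpR])
  have "continuous_on {0<..<T} R" unfolding R_def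
    by (intro continuous_intros continuous_on_subset[OF cPf] continuous_on_subset[OF cont_kernel(4)] continuous_on_subset[OF cS]) auto
  then have "y t = R t"
    by (intro primitive_inj[of T, OF ly lR _ _ p t] continuous_on_subset[OF y]) auto
  then show ?thesis by (simp add: R_def)
qed

lemma source_eq:
  assumes T: "T > 0" and f: "continuous_on {0..T} f" and f': "continuous_on {0..T} f'"
    and d: "\<And>t. 0 \<le> t \<Longrightarrow> t \<le> T \<Longrightarrow> (f has_real_derivative f' t) (at t within {0..T})"
    and t: "0 \<le> t" "t \<le> T"
  shows "f t = f 0 + primitive f' t"
proof (rule eq_primitive[OF T f locint_continuous[OF f'] _ _ t])
  fix t assume t: "0 < t" "t < T"
  then show "(f has_real_derivative f' t) (at t)" using d[of t] at_within_Icc_at[of 0 t T] by simp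
next
  show "continuous_on {0<..<T} f'" by (rule continuous_on_subset[OF f']) auto
qed

text \<open>
  Integration by parts in the convolution, with \<open>\<lambda> 1 * kP = 1 - ks\<close>. The first identity trades
  the factor \<open>lam\<close>, which no bound on \<open>kP\<close> compensates, for a derivative of the source.
\<close>

lemma kP_conv_source:
  assumes T: "T > 0" and f': "continuous_on {0..T} f'"
    and fe: "\<And>t. 0 \<le> t \<Longrightarrow> t \<le> T \<Longrightarrow> f t = f 0 + primitive f' t"
    and t: "0 < t" "t < T"
  shows "lam * conv kP f t = f t - f 0 * ks t - conv ks f' t"
    "conv kP f t = primitive (primitive (\<lambda>s. f 0 * kq s + conv kq f' s)) t"
proof -
  have one: "locint T' (\<lambda>_. 1)" for T' by (intro locint_continuous continuous_intros)
  have cp: "continuous_on {0..T} (primitive f')" by (rule continuous_on_primitive[OF locint_continuous[OF f']])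
  have split: "conv a f s = f 0 * primitive a s + conv a (primitive f') s" if a: "locint T a" and s: "s \<le> T" for a s
  proof -
    have "conv a f s = conv a (\<lambda>r. f 0 * 1 + primitive f' r) s"
    proof (rule conv_cong[OF refl])
      fix r assume "0 < r" "r < s"
      then have "f r = f 0 + primitive f' r" using s by (intro fe) auto
      then show "f r = f 0 * 1 + primitive f' r" by linarith
    qed
    also have "\<dots> = conv a (\<lambda>r. f 0 * 1) s + conv a (primitive f') s"
      by (rule conv_add_right[OF a]) (use s cp in \<open>auto intro!: continuous_intros\<close>)
    finally show ?thesis unfolding conv_scale_right primitive_commute[of a] .
  qed
  have "conv kP (primitive f') t = conv (conv kP (\<lambda>_. 1)) f' t"
    by (rule conv_assoc_cont[of T]) (use f' t one in auto)
  then have "lam * conv kP (primitive f') t = conv (\<lambda>s. lam * primitive kP s) f' t"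
    by (simp add: conv_scale_left primitive_commute[of kP])
  also have "\<dots> = conv (\<lambda>s. 1 - ks s) f' t" by (rule conv_cong) (auto simp: ks_eq)
  also have "\<dots> = primitive f' t - conv ks f' t"
    by (rule conv_diff_left[of T]) (use f' t one in auto)
  finally have cf: "lam * conv kP (primitive f') t = primitive f' t - conv ks f' t" .
  have "lam * (f 0 * primitive kP t) = f 0 - f 0 * ks t"
    unfolding ks_eq[OF t(1)] by (simp add: algebra_simps)
  with cf show "lam * conv kP f t = f t - f 0 * ks t - conv ks f' t"
    unfolding split[OF locint_kernel(1) less_imp_le[OF t(2)]] using fe[of t] t by (simp add: ring_distribs)
  have lq: "locint T (conv kq f')" by (intro locint_conv locint_continuous[OF f']) auto
  have fc: "continuous_on {0..T} f"
  proof (rule continuous_on_eq[of _ "\<lambda>t. f 0 + primitive f' t"])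
    show "continuous_on {0..T} (\<lambda>t. f 0 + primitive f' t)" by (intro continuous_intros cp)
    show "f 0 + primitive f' x = f x" if "x \<in> {0..T}" for x
      by (rule fe[symmetric]) (use that in auto)
  qed
  have "conv kP f t = conv (primitive kq) f t" by (rule conv_cong) (auto simp: primitive_kq)
  also have "\<dots> = primitive (conv kq f) t"
    by (rule conv_assoc_cont[symmetric, of T]) (use fc t one in auto)
  also have "\<dots> = primitive (primitive (\<lambda>s. f 0 * kq s + conv kq f' s)) t"
  proof (rule conv_cong[OF refl])
    fix s assume s: "0 < s" "s < t"
    have "conv kq f s = f 0 * primitive kq s + conv kq (primitive f') s" by (rule split) (use s t in auto)
    also have "conv kq (primitive f') s = primitive (conv kq f') s"
      by (rule conv_left_commute[of T]) (use f' s t one in auto)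
    also have "f 0 * primitive kq s + primitive (conv kq f') s = primitive (\<lambda>s. f 0 * kq s + conv kq f' s) s"
      using s t locint_mono[OF lq, of s] by (subst primitive_add) (auto intro!: locint_scale simp: conv_scale_right)
    finally show "conv kq f s = primitive (\<lambda>s. f 0 * kq s + conv kq f' s) s" .
  qed
  finally show "conv kP f t = primitive (primitive (\<lambda>s. f 0 * kq s + conv kq f' s)) t" .
qed

text \<open>
  Each of the three terms of the representation is a double primitive up to an affine function,
  and the affine functions add up to \<open>y0 + t * z0\<close>.
\<close>

lemma mode_second_derivative:
  assumes T: "T > 0" and y: "continuous_on {0..T} y" and z: "continuous_on {0..T} z"
    and yz: "\<And>t. 0 \<le> t \<Longrightarrow> t \<le> T \<Longrightarrow> (y has_real_derivative z t) (at t within {0..T})"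
    and f': "continuous_on {0..T} f'"
    and fe: "\<And>t. 0 \<le> t \<Longrightarrow> t \<le> T \<Longrightarrow> f t = f 0 + primitive f' t"
    and rep: "\<And>t. 0 < t \<Longrightarrow> t < T \<Longrightarrow> y t = conv kP f t + y0 * ks t + z0 * kS t"
    and t: "0 < t" "t < T"
  defines "v \<equiv> \<lambda>s. f 0 * kq s + conv kq f' s - lam * y0 * kq s - lam * z0 * kP s"
  shows "(z has_real_derivative v t) (at t)" "continuous_on {0<..<T} v"
proof -
  have lq: "locint T (conv kq f')" by (intro locint_conv locint_continuous[OF f']) auto
  have cq: "continuous_on {0..T} (conv kq f')" by (intro continuous_on_conv f') auto
  define F where "F = (\<lambda>s. f 0 * kq s + conv kq f' s)"
  have lF: "locint T F" unfolding F_def by (intro locint_add locint_scale lq) auto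
  have ve: "v = (\<lambda>s. F s + (- lam * y0) * kq s + (- lam * z0) * kP s)" by (auto simp: v_def F_def)
  have lv: "locint T v" unfolding ve by (intro locint_add locint_scale lF) auto
  show cv: "continuous_on {0<..<T} v" unfolding v_def
    by (intro continuous_intros continuous_on_subset[OF cq] continuous_on_subset[OF cont_kernel(3)] continuous_on_subset[OF cont_kernel(5)]) auto
  have cpv: "continuous_on {0..T} (primitive v)" by (rule continuous_on_primitive[OF lv])
  have pv: "primitive v s = primitive F s + (- lam * y0) * primitive kq s + (- lam * z0) * primitive kP s" if "s \<le> T" for s
    unfolding ve by (rule primitive_lincomb[OF locint_mono[OF lF that]]) auto
  have ye: "y t = y0 + t * z0 + primitive (primitive v) t" if t: "0 < t" "t < T" for t
  proof -
    have "primitive (primitive v) t = primitive (\<lambda>s. primitive F s + (- lam * y0) * primitive kq s + (- lam * z0) * primitive kP s) t"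
      by (rule conv_cong) (use pv t in auto)
    also have "\<dots> = primitive (primitive F) t + (- lam * y0) * primitive (primitive kq) t + (- lam * z0) * primitive (primitive kP) t"
    proof -
      have one: "locint T' (\<lambda>_. 1)" for T' by (intro locint_continuous continuous_intros)
      have l: "locint t (primitive F)" "locint t (primitive kq)" "locint t (primitive kP)"
        using locint_mono[OF lF, of t] t by (auto intro!: locint_conv one)
      show ?thesis by (rule primitive_lincomb[OF l])
    qed
    also have "primitive (primitive F) t = conv kP f t"
      unfolding F_def by (rule kP_conv_source(2)[OF T f' fe t, symmetric])
    also have "primitive (primitive kq) t = primitive kP t" by (rule conv_cong) (auto simp: primitive_kq)
    finally have "primitive (primitive v) t = conv kP f t + (- lam * y0) * primitive kP t + (- lam * z0) * primitive (primitive kP) t" .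
    moreover have "(- lam * y0) * primitive kP t = y0 * ks t - y0" unfolding ks_eq[OF t(1)] by (simp add: algebra_simps)
    moreover have "(- lam * z0) * primitive (primitive kP) t = z0 * kS t - z0 * t"
    proof -
      have "(- lam * z0) * primitive (primitive kP) t = - z0 * (lam * primitive (primitive kP) t)" by simp
      then show ?thesis unfolding primitive_primitive_kP[OF t(1)] by (simp add: algebra_simps)
    qed
    ultimately show ?thesis using rep[OF t] by (simp add: mult.commute)
  qed
  have ze: "z t = z0 + primitive v t" if t: "0 < t" "t < T" for t
  proof -
    have "((\<lambda>t. y0 + t * z0 + primitive (primitive v) t) has_real_derivative 0 + 1 * z0 + primitive v t) (at t)"
      by (intro derivative_intros DERIV_cmult_right primitive_has_derivative[OF locint_continuous[OF cpv] continuous_on_subset[OF cpv] t]) auto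
    then have "(y has_real_derivative 0 + 1 * z0 + primitive v t) (at t)"
      by (rule DERIV_cong_ev[THEN iffD1, rotated -1])
         (use t ye eventually_nhds_in_open[of "{0<..<T}" t] in \<open>auto elim!: eventually_mono\<close>)
    moreover have "(y has_real_derivative z t) (at t)"
      using yz[of t] at_within_Icc_at[of 0 t T] t by simp
    ultimately have "0 + 1 * z0 + primitive v t = z t" by (rule DERIV_unique)
    then show ?thesis by simp
  qed
  have "((\<lambda>t. z0 + primitive v t) has_real_derivative 0 + v t) (at t)"
    by (intro derivative_intros primitive_has_derivative[OF lv cv t])
  then have "((\<lambda>t. z0 + primitive v t) has_real_derivative v t) (at t)" by simp
  then show "(z has_real_derivative v t) (at t)"
    by (rule DERIV_cong_ev[THEN iffD1, rotated -1])
       (use t ze eventually_nhds_in_open[of "{0<..<T}" t] in \<open>auto elim!: eventually_mono\<close>)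
qed

end

section \<open>Square integrable functions and orthonormal bases\<close>

lemma L2_borel: "h \<in> L2 M \<Longrightarrow> h \<in> borel_measurable M"
  by (simp add: L2_def)

lemma L2_square: "h \<in> L2 M \<Longrightarrow> integrable M (\<lambda>x. (h x)\<^sup>2)"
  by (simp add: L2_def)

lemma L2_prod:
  assumes g: "g \<in> L2 M" and h: "h \<in> L2 M"
  shows "integrable M (\<lambda>x. g x * h x)"
proof (rule Bochner_Integration.integrable_bound)
  show "integrable M (\<lambda>x. (g x)\<^sup>2 + (h x)\<^sup>2)" using L2_square[OF g] L2_square[OF h] by simp
  show "(\<lambda>x. g x * h x) \<in> borel_measurable M" using L2_borel[OF g] L2_borel[OF h] by measurable
  show "AE x in M. norm (g x * h x) \<le> norm ((g x)\<^sup>2 + (h x)\<^sup>2)"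
  proof (rule AE_I2)
    fix x
    have "2 * (\<bar>g x\<bar> * \<bar>h x\<bar>) \<le> (g x)\<^sup>2 + (h x)\<^sup>2"
      using sum_squares_bound[of "\<bar>g x\<bar>" "\<bar>h x\<bar>"] by (simp add: mult.assoc)
    moreover have "0 \<le> \<bar>g x\<bar> * \<bar>h x\<bar>" by simp
    ultimately have "\<bar>g x\<bar> * \<bar>h x\<bar> \<le> (g x)\<^sup>2 + (h x)\<^sup>2" by linarith
    then show "norm (g x * h x) \<le> norm ((g x)\<^sup>2 + (h x)\<^sup>2)" by (simp add: abs_mult)
  qed
qed

lemma L2_zero: "(\<lambda>x. 0) \<in> L2 M"
  by (simp add: L2_def)

lemma L2_scale: "h \<in> L2 M \<Longrightarrow> (\<lambda>x. c * h x) \<in> L2 M"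
  by (auto simp: L2_def power_mult_distrib)

lemma L2_add:
  assumes g: "g \<in> L2 M" and h: "h \<in> L2 M"
  shows "(\<lambda>x. g x + h x) \<in> L2 M"
proof -
  have e: "(g x + h x)\<^sup>2 = (g x)\<^sup>2 + (h x)\<^sup>2 + 2 * (g x * h x)" for x by (simp add: power2_sum)
  show ?thesis using L2_borel[OF g] L2_borel[OF h] L2_square[OF g] L2_square[OF h] L2_prod[OF g h]
    unfolding L2_def mem_Collect_eq e by (intro conjI borel_measurable_add Bochner_Integration.integrable_add integrable_mult_right)
qed

lemma L2_diff:
  assumes g: "g \<in> L2 M" and h: "h \<in> L2 M"
  shows "(\<lambda>x. g x - h x) \<in> L2 M"
  using L2_add[OF g L2_scale[OF h, of "-1"]] by simp

lemma L2_sum: "(\<And>n. n \<in> I \<Longrightarrow> h n \<in> L2 M) \<Longrightarrow> (\<lambda>x. \<Sum>n\<in>I. h n x) \<in> L2 M"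
  by (induction I rule: infinite_finite_induct) (auto intro: L2_zero L2_add)

lemma L2_inner_commute: "L2_inner M g h = L2_inner M h g"
  by (simp add: L2_inner_def mult.commute)

lemma L2_inner_add: "g \<in> L2 M \<Longrightarrow> h \<in> L2 M \<Longrightarrow> k \<in> L2 M \<Longrightarrow> L2_inner M (\<lambda>x. g x + h x) k = L2_inner M g k + L2_inner M h k"
  using L2_prod[of g M k] L2_prod[of h M k] by (simp add: L2_inner_def ring_distribs)

lemma L2_inner_diff: "g \<in> L2 M \<Longrightarrow> h \<in> L2 M \<Longrightarrow> k \<in> L2 M \<Longrightarrow> L2_inner M (\<lambda>x. g x - h x) k = L2_inner M g k - L2_inner M h k"
  using L2_prod[of g M k] L2_prod[of h M k] by (simp add: L2_inner_def left_diff_distrib)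

lemma L2_inner_scale: "L2_inner M (\<lambda>x. c * g x) k = c * L2_inner M g k"
  by (simp add: L2_inner_def mult.assoc)

lemma L2_inner_sum:
  "(\<And>n. n \<in> I \<Longrightarrow> h n \<in> L2 M) \<Longrightarrow> k \<in> L2 M \<Longrightarrow> L2_inner M (\<lambda>x. \<Sum>n\<in>I. h n x) k = (\<Sum>n\<in>I. L2_inner M (h n) k)"
proof (induction I rule: infinite_finite_induct)
  case (insert n I)
  then show ?case by (simp add: L2_inner_add L2_sum)
qed (simp_all add: L2_inner_def)

lemma L2_inner_cong_AE:
  assumes "g \<in> L2 M" "g' \<in> L2 M" "h \<in> L2 M" "AE x in M. g x = g' x"
  shows "L2_inner M g h = L2_inner M g' h"
  unfolding L2_inner_def
proof (rule Bochner_Integration.integral_cong_AE)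
  show "AE x in M. g x * h x = g' x * h x" using assms(4) by eventually_elim simp
  show "(\<lambda>x. g x * h x) \<in> borel_measurable M" "(\<lambda>x. g' x * h x) \<in> borel_measurable M"
    using assms by (auto intro!: borel_measurable_times dest: L2_borel)
qed

lemma L2_inner_self: "L2_inner M h h = (\<integral>x. (h x)\<^sup>2 \<partial>M)"
  by (simp add: L2_inner_def power2_eq_square)

lemma L2_inner_nonneg [simp]: "0 \<le> L2_inner M h h"
  unfolding L2_inner_self by (rule Bochner_Integration.integral_nonneg) auto

lemma L2_norm_nonneg [simp]: "0 \<le> L2_norm M h"
  by (simp add: L2_norm_def)

lemma L2_norm_square: "(L2_norm M h)\<^sup>2 = L2_inner M h h"
  by (simp add: L2_norm_def)

lemma L2_inner_self_eq_0:
  assumes "h \<in> L2 M" "L2_inner M h h = 0"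
  shows "AE x in M. h x = 0"
  using integral_nonneg_eq_0_iff_AE[OF L2_square[OF assms(1)]] assms(2) by (simp add: L2_inner_self)

lemma L2_diff_inner:
  assumes g: "g \<in> L2 M" and h: "h \<in> L2 M"
  shows "L2_inner M (\<lambda>x. g x - h x) (\<lambda>x. g x - h x) = L2_inner M g g - 2 * L2_inner M g h + L2_inner M h h"
    "L2_inner M (\<lambda>x. g x + h x) (\<lambda>x. g x + h x) = L2_inner M g g + 2 * L2_inner M g h + L2_inner M h h"
proof -
  have e: "(g x - h x) * (g x - h x) = g x * g x - 2 * (g x * h x) + h x * h x"
    "(g x + h x) * (g x + h x) = g x * g x + 2 * (g x * h x) + h x * h x" for x by (simp_all add: algebra_simps)
  show "L2_inner M (\<lambda>x. g x - h x) (\<lambda>x. g x - h x) = L2_inner M g g - 2 * L2_inner M g h + L2_inner M h h"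
    "L2_inner M (\<lambda>x. g x + h x) (\<lambda>x. g x + h x) = L2_inner M g g + 2 * L2_inner M g h + L2_inner M h h"
    unfolding L2_inner_def e using L2_prod[OF g g] L2_prod[OF g h] L2_prod[OF h h] by simp_all
qed

lemma L2_Cauchy_Schwarz:
  assumes g: "g \<in> L2 M" and h: "h \<in> L2 M"
  shows "\<bar>L2_inner M g h\<bar> \<le> L2_norm M g * L2_norm M h"
proof (cases "L2_inner M h h = 0")
  case True
  have "L2_inner M h g = L2_inner M (\<lambda>x. 0) g"
    using L2_inner_self_eq_0[OF h True] by (intro L2_inner_cong_AE g h L2_zero)
  then have "L2_inner M g h = 0" by (simp add: L2_inner_commute[of M g]) (simp add: L2_inner_def)
  then show ?thesis by simp
next
  case False
  define c where "c = L2_inner M h h"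
  have c: "c > 0" using False L2_inner_nonneg[of M h] unfolding c_def by linarith
  define t where "t = L2_inner M g h / c"
  have "0 \<le> L2_inner M (\<lambda>x. g x - t * h x) (\<lambda>x. g x - t * h x)" by simp
  also have "\<dots> = L2_inner M g g - 2 * (t * L2_inner M g h) + t * (t * c)"
    unfolding L2_diff_inner(1)[OF g L2_scale[OF h]]
    by (simp add: L2_inner_commute[of M g "\<lambda>x. t * h x"] L2_inner_commute[of M h "\<lambda>x. t * h x"] L2_inner_scale c_def L2_inner_commute[of M h g])
  also have "\<dots> = L2_inner M g g - (L2_inner M g h)\<^sup>2 / c"
    using c by (simp add: t_def power2_eq_square field_simps)
  finally have "(L2_inner M g h)\<^sup>2 \<le> L2_inner M g g * c" using c by (simp add: field_simps)
  also have "\<dots> = (L2_norm M g * L2_norm M h)\<^sup>2" by (simp add: power_mult_distrib L2_norm_square c_def)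
  finally show ?thesis by (simp add: abs_le_square_iff[symmetric] flip: abs_mult)
qed

lemma L2_norm_triangle:
  assumes g: "g \<in> L2 M" and h: "h \<in> L2 M"
  shows "L2_norm M (\<lambda>x. g x + h x) \<le> L2_norm M g + L2_norm M h"
proof (rule power2_le_imp_le)
  have "(L2_norm M (\<lambda>x. g x + h x))\<^sup>2 = L2_inner M g g + 2 * L2_inner M g h + L2_inner M h h"
    unfolding L2_norm_square by (rule L2_diff_inner(2)[OF g h])
  also have "\<dots> \<le> (L2_norm M g)\<^sup>2 + 2 * (L2_norm M g * L2_norm M h) + (L2_norm M h)\<^sup>2"
    unfolding L2_norm_square using L2_Cauchy_Schwarz[OF g h] by linarith
  also have "\<dots> = (L2_norm M g + L2_norm M h)\<^sup>2" by (simp add: power2_sum)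
  finally show "(L2_norm M (\<lambda>x. g x + h x))\<^sup>2 \<le> (L2_norm M g + L2_norm M h)\<^sup>2" .
qed simp

lemma L2_norm_scale: "L2_norm M (\<lambda>x. c * h x) = \<bar>c\<bar> * L2_norm M h"
proof -
  have "L2_inner M (\<lambda>x. c * h x) (\<lambda>x. c * h x) = c\<^sup>2 * L2_inner M h h"
    unfolding L2_inner_self power_mult_distrib by (rule integral_mult_right_zero)
  then show ?thesis unfolding L2_norm_def by (simp add: real_sqrt_mult)
qed

lemma L2_norm_cong_AE:
  assumes "g \<in> L2 M" "h \<in> L2 M" "AE x in M. g x = h x"
  shows "L2_norm M g = L2_norm M h"
proof -
  have "L2_inner M g g = L2_inner M h g" by (rule L2_inner_cong_AE[OF assms(1,2,1,3)])
  also have "\<dots> = L2_inner M g h" by (rule L2_inner_commute)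
  also have "\<dots> = L2_inner M h h" by (rule L2_inner_cong_AE[OF assms(1,2,2,3)])
  finally show ?thesis by (simp add: L2_norm_def)
qed

lemma L2_norm_mono:
  assumes g: "g \<in> borel_measurable M" and h: "h \<in> L2 M" and le: "AE x in M. \<bar>g x\<bar> \<le> K * \<bar>h x\<bar>" and K: "K \<ge> 0"
  shows "g \<in> L2 M" "L2_norm M g \<le> K * L2_norm M h"
proof -
  have le2: "AE x in M. (g x)\<^sup>2 \<le> K\<^sup>2 * (h x)\<^sup>2"
    using le
  proof eventually_elim
    case (elim x)
    have "\<bar>g x\<bar>\<^sup>2 \<le> (K * \<bar>h x\<bar>)\<^sup>2" by (rule power_mono[OF elim]) simp
    then show ?case by (simp only: power_mult_distrib power2_abs)
  qed
  have ih: "integrable M (\<lambda>x. K\<^sup>2 * (h x)\<^sup>2)" using L2_square[OF h] by simp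
  have ig: "integrable M (\<lambda>x. (g x)\<^sup>2)"
  proof (rule Bochner_Integration.integrable_bound[OF ih])
    show "(\<lambda>x. (g x)\<^sup>2) \<in> borel_measurable M" by (rule borel_measurable_power[OF g])
    show "AE x in M. norm ((g x)\<^sup>2) \<le> norm (K\<^sup>2 * (h x)\<^sup>2)"
      using le2
    proof eventually_elim
      case (elim x)
      have "0 \<le> (g x)\<^sup>2" "0 \<le> K\<^sup>2 * (h x)\<^sup>2" by (rule zero_le_power2, intro mult_nonneg_nonneg zero_le_power2)
      then show ?case using elim by (simp only: real_norm_def abs_of_nonneg)
    qed
  qed
  then show gL: "g \<in> L2 M" using g by (simp add: L2_def)
  have "(L2_norm M g)\<^sup>2 = (\<integral>x. (g x)\<^sup>2 \<partial>M)" by (simp only: L2_norm_square L2_inner_self)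
  also have "\<dots> \<le> (\<integral>x. K\<^sup>2 * (h x)\<^sup>2 \<partial>M)" by (rule integral_mono_AE[OF ig ih le2])
  also have "\<dots> = K\<^sup>2 * (L2_norm M h)\<^sup>2" by (simp only: L2_norm_square L2_inner_self integral_mult_right_zero)
  also have "\<dots> = (K * L2_norm M h)\<^sup>2" by (simp only: power_mult_distrib)
  finally show "L2_norm M g \<le> K * L2_norm M h" by (rule power2_le_imp_le) (rule mult_nonneg_nonneg[OF K L2_norm_nonneg])
qed

text \<open>
  A series whose integrals of absolute values are summable is almost everywhere absolutely
  convergent. This extracts pointwise convergence from fast convergence in \<open>L\<^sup>2\<close>.
\<close>

lemma AE_summable:
  fixes f :: "nat \<Rightarrow> 'a \<Rightarrow> real"
  assumes i: "\<And>j. integrable M (f j)" and s: "summable (\<lambda>j. \<integral>x. \<bar>f j x\<bar> \<partial>M)"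
  shows "AE x in M. summable (\<lambda>j. \<bar>f j x\<bar>)"
proof -
  have [measurable]: "f j \<in> borel_measurable M" for j using i by (rule borel_measurable_integrable)
  have "(\<integral>\<^sup>+x. (\<Sum>j. ennreal \<bar>f j x\<bar>) \<partial>M) = (\<Sum>j. \<integral>\<^sup>+x. ennreal \<bar>f j x\<bar> \<partial>M)"
    by (rule nn_integral_suminf) auto
  also have "\<dots> = (\<Sum>j. ennreal (\<integral>x. \<bar>f j x\<bar> \<partial>M))"
  proof (rule suminf_cong)
    fix j
    show "(\<integral>\<^sup>+x. ennreal \<bar>f j x\<bar> \<partial>M) = ennreal (\<integral>x. \<bar>f j x\<bar> \<partial>M)"
      by (rule nn_integral_eq_integral) (use i in auto)
  qed
  finally have eq: "(\<integral>\<^sup>+x. (\<Sum>j. ennreal \<bar>f j x\<bar>) \<partial>M) = (\<Sum>j. ennreal (\<integral>x. \<bar>f j x\<bar> \<partial>M))" .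
  have "(\<Sum>j. ennreal (\<integral>x. \<bar>f j x\<bar> \<partial>M)) \<noteq> top"
    by (rule ennreal_suminf_neq_top[OF s]) (rule Bochner_Integration.integral_nonneg, rule abs_ge_zero)
  then have "AE x in M. (\<Sum>j. ennreal \<bar>f j x\<bar>) \<noteq> \<infinity>"
    unfolding eq[symmetric] infinity_ennreal_def[symmetric] by (intro nn_integral_PInf_AE) measurable
  then show ?thesis
  proof eventually_elim
    case (elim x)
    show ?case
    proof (rule summable_suminf_not_top)
      show "(\<Sum>i. ennreal \<bar>f i x\<bar>) \<noteq> top" using elim unfolding infinity_ennreal_def .
    qed (rule abs_ge_zero)
  qed
qed

lemma L2_integrable:
  assumes "finite_measure M" "h \<in> L2 M"
  shows "integrable M h" "(\<integral>x. \<bar>h x\<bar> \<partial>M) \<le> sqrt (measure M (space M)) * L2_norm M h"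
proof -
  interpret finite_measure M by fact
  have o: "(\<lambda>_. 1) \<in> L2 M" by (simp add: L2_def)
  show "integrable M h" using L2_prod[OF assms(2) o] by simp
  have ha: "(\<lambda>x. \<bar>h x\<bar>) \<in> L2 M" using assms(2) by (auto simp: L2_def)
  have "(\<integral>x. \<bar>h x\<bar> \<partial>M) \<le> \<bar>L2_inner M (\<lambda>_. 1) (\<lambda>x. \<bar>h x\<bar>)\<bar>" by (simp add: L2_inner_def)
  also have "\<dots> \<le> L2_norm M (\<lambda>_. 1) * L2_norm M (\<lambda>x. \<bar>h x\<bar>)" by (rule L2_Cauchy_Schwarz[OF o ha])
  also have "L2_norm M (\<lambda>x. \<bar>h x\<bar>) = L2_norm M h" by (simp add: L2_norm_def L2_inner_def)
  also have "L2_norm M (\<lambda>_. 1) = sqrt (measure M (space M))" by (simp add: L2_norm_def L2_inner_def)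
  finally show "(\<integral>x. \<bar>h x\<bar> \<partial>M) \<le> sqrt (measure M (space M)) * L2_norm M h" .
qed

locale L2_basis =
  fixes M :: "'a measure" and \<phi> :: "nat \<Rightarrow> 'a \<Rightarrow> real"
  assumes fin: "finite_measure M" and onb: "orthonormal_basis M \<phi>"
begin

abbreviation cf :: "('a \<Rightarrow> real) \<Rightarrow> nat \<Rightarrow> real" where
  "cf h n \<equiv> L2_inner M h (\<phi> n)"

definition psum :: "(nat \<Rightarrow> real) \<Rightarrow> nat \<Rightarrow> 'a \<Rightarrow> real" where
  "psum c k = (\<lambda>x. \<Sum>n<k. c n * \<phi> n x)"

lemma phi_L2 [simp]: "\<phi> n \<in> L2 M"
  using onb by (simp add: orthonormal_basis_def)

lemma phi_inner: "L2_inner M (\<phi> i) (\<phi> j) = (if i = j then 1 else 0)"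
  using onb by (simp add: orthonormal_basis_def)

lemma psum_L2 [simp]: "psum c k \<in> L2 M"
  unfolding psum_def by (intro L2_sum L2_scale) simp

lemma psum_inner: "h \<in> L2 M \<Longrightarrow> L2_inner M (psum c k) h = (\<Sum>n<k. c n * cf h n)"
  unfolding psum_def by (subst L2_inner_sum) (auto intro: L2_scale simp: L2_inner_scale L2_inner_commute[of M "\<phi> _" h])

lemma cf_psum: "cf (psum c k) n = (if n < k then c n else 0)"
  by (subst psum_inner) (simp_all add: phi_inner if_distrib cong: if_cong)

lemma psum_norm: "L2_inner M (psum c k) (psum c k) = (\<Sum>n<k. (c n)\<^sup>2)"
  by (subst psum_inner) (auto simp: cf_psum power2_eq_square)

lemma psum_diff: "j \<le> k \<Longrightarrow> (\<lambda>x. psum c k x - psum c j x) = psum (\<lambda>n. if n < j then 0 else c n) k"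
proof
  fix x assume jk: "j \<le> k"
  have "{..<k} = {..<j} \<union> {j..<k}" using jk by auto
  then have "(\<Sum>n<k. F n) = (\<Sum>n<j. F n) + (\<Sum>n\<in>{j..<k}. F n)" for F :: "nat \<Rightarrow> real"
    by (simp add: sum.union_disjoint ivl_disj_int)
  then show "psum c k x - psum c j x = psum (\<lambda>n. if n < j then 0 else c n) k x"
    by (simp add: psum_def)
qed

lemma residual_norm:
  assumes h: "h \<in> L2 M"
  shows "L2_inner M (\<lambda>x. h x - psum (cf h) k x) (\<lambda>x. h x - psum (cf h) k x) = L2_inner M h h - (\<Sum>n<k. (cf h n)\<^sup>2)"
proof -
  have "L2_inner M h (psum (cf h) k) = (\<Sum>n<k. (cf h n)\<^sup>2)"
    by (subst L2_inner_commute) (simp add: psum_inner[OF h] power2_eq_square)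
  then show ?thesis using L2_diff_inner(1)[OF h psum_L2[of "cf h" k]] by (simp add: psum_norm)
qed

lemma psum_tendsto:
  assumes "h \<in> L2 M"
  shows "(\<lambda>k. L2_norm M (\<lambda>x. h x - psum (cf h) k x)) \<longlonglongrightarrow> 0"
  using onb assms by (simp add: orthonormal_basis_def psum_def)

lemma parseval:
  assumes h: "h \<in> L2 M"
  shows "(\<lambda>n. (cf h n)\<^sup>2) sums L2_inner M h h"
proof -
  have "(\<lambda>k. (L2_norm M (\<lambda>x. h x - psum (cf h) k x))\<^sup>2) \<longlonglongrightarrow> 0\<^sup>2"
    by (intro tendsto_power psum_tendsto h)
  then have "(\<lambda>k. L2_inner M h h - (\<Sum>n<k. (cf h n)\<^sup>2)) \<longlonglongrightarrow> 0"
    by (simp add: L2_norm_square residual_norm[OF h])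
  then have "(\<lambda>k. L2_inner M h h - (L2_inner M h h - (\<Sum>n<k. (cf h n)\<^sup>2))) \<longlonglongrightarrow> L2_inner M h h - 0"
    by (intro tendsto_diff tendsto_const)
  then show ?thesis by (simp add: sums_def)
qed

lemma parseval_inner:
  assumes g: "g \<in> L2 M" and h: "h \<in> L2 M"
  shows "(\<lambda>n. cf g n * cf h n) sums L2_inner M g h"
proof -
  have "(\<lambda>n. ((cf (\<lambda>x. g x + h x) n)\<^sup>2 - (cf (\<lambda>x. g x - h x) n)\<^sup>2) / 4) sums
      ((L2_inner M (\<lambda>x. g x + h x) (\<lambda>x. g x + h x) - L2_inner M (\<lambda>x. g x - h x) (\<lambda>x. g x - h x)) / 4)"
    by (intro sums_divide sums_diff parseval L2_add L2_diff g h)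
  moreover have "((cf (\<lambda>x. g x + h x) n)\<^sup>2 - (cf (\<lambda>x. g x - h x) n)\<^sup>2) / 4 = cf g n * cf h n" for n
    using g h by (simp add: L2_inner_add L2_inner_diff power2_sum power2_diff)
  ultimately show ?thesis using L2_diff_inner[OF g h] by simp
qed

lemma L2_norm_eq: "h \<in> L2 M \<Longrightarrow> L2_norm M h = sqrt (\<Sum>n. (cf h n)\<^sup>2)"
  using parseval[of h] by (simp add: L2_norm_def sums_iff)

lemma cf_ext:
  assumes "g \<in> L2 M" "h \<in> L2 M" "\<And>n. cf g n = cf h n"
  shows "AE x in M. g x = h x"
proof -
  have d: "(\<lambda>x. g x - h x) \<in> L2 M" by (intro L2_diff assms)
  have "(\<lambda>n. (cf (\<lambda>x. g x - h x) n)\<^sup>2) sums L2_inner M (\<lambda>x. g x - h x) (\<lambda>x. g x - h x)" by (rule parseval[OF d])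
  moreover have "cf (\<lambda>x. g x - h x) n = 0" for n using assms by (simp add: L2_inner_diff)
  ultimately have "L2_inner M (\<lambda>x. g x - h x) (\<lambda>x. g x - h x) = 0" by (simp add: sums_iff)
  from L2_inner_self_eq_0[OF d this] show ?thesis by eventually_elim simp
qed

lemma cf_cong_AE: "g \<in> L2 M \<Longrightarrow> h \<in> L2 M \<Longrightarrow> AE x in M. g x = h x \<Longrightarrow> cf g n = cf h n"
  by (rule L2_inner_cong_AE) auto

text \<open>
  Completeness of \<open>L\<^sup>2\<close> in terms of coefficients: partial sums along a subsequence with
  geometric decay converge almost everywhere, and Fatou's lemma identifies the limit.
\<close>

theorem riesz_fischer:
  assumes c: "summable (\<lambda>n. (c n)\<^sup>2)"
  shows "\<exists>h\<in>L2 M. \<forall>n. cf h n = c n"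
proof -
  interpret finite_measure M by (rule fin)
  define S where "S = (\<Sum>n. (c n)\<^sup>2)"
  have tail: "\<exists>N. \<forall>k\<ge>N. S - (\<Sum>n<k. (c n)\<^sup>2) \<le> (1/4)^j" for j
  proof -
    have "(\<lambda>k. S - (\<Sum>n<k. (c n)\<^sup>2)) \<longlonglongrightarrow> S - S"
      using summable_LIMSEQ[OF c] unfolding S_def by (intro tendsto_intros)
    then have "\<forall>\<^sub>F k in sequentially. S - (\<Sum>n<k. (c n)\<^sup>2) < (1/4)^j"
      by (intro order_tendstoD) auto
    then show ?thesis unfolding eventually_sequentially using less_imp_le by blast
  qed
  then have "\<forall>j. \<exists>N. \<forall>k\<ge>N. S - (\<Sum>n<k. (c n)\<^sup>2) \<le> (1/4)^j" by blast
  from choice[OF this] obtain N where N': "\<forall>j. \<forall>k\<ge>N j. S - (\<Sum>n<k. (c n)\<^sup>2) \<le> (1/4)^j" by blast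
  have N: "N j \<le> k \<Longrightarrow> S - (\<Sum>n<k. (c n)\<^sup>2) \<le> (1/4)^j" for j k using N' by simp
  define r where "r j = (\<Sum>i\<le>j. N i) + j" for j
  have rN: "N j \<le> r j" for j unfolding r_def by (simp add: trans_le_add1 member_le_sum)
  have rj: "j \<le> r j" for j by (simp add: r_def)
  have rmono: "mono r" by (rule incseq_SucI) (simp add: r_def)
  define s where "s j = psum c (r j)" for j
  have sL2: "s j \<in> L2 M" for j by (simp add: s_def)
  have sdiff: "L2_inner M (\<lambda>x. s i x - s j x) (\<lambda>x. s i x - s j x) \<le> (1/4)^j" if "j \<le> i" for i j
  proof -
    have rr: "r j \<le> r i" using that rmono by (rule monoD[rotated])
    have "L2_inner M (\<lambda>x. s i x - s j x) (\<lambda>x. s i x - s j x) = (\<Sum>n<r i. (if n < r j then 0 else c n)\<^sup>2)"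
      unfolding s_def psum_diff[OF rr] psum_norm ..
    also have "\<dots> = (\<Sum>n<r i. (c n)\<^sup>2) - (\<Sum>n<r j. (c n)\<^sup>2)"
    proof -
      have u: "{..<r i} = {..<r j} \<union> {r j..<r i}" using rr by auto
      have "(\<Sum>n<r i. F n) = (\<Sum>n<r j. F n) + (\<Sum>n\<in>{r j..<r i}. F n)" for F :: "nat \<Rightarrow> real"
        unfolding u by (rule sum.union_disjoint) auto
      note sp = this
      show ?thesis unfolding sp by simp
    qed
    also have "\<dots> \<le> S - (\<Sum>n<r j. (c n)\<^sup>2)"
      unfolding S_def using sum_le_suminf[OF c, of "{..<r i}"] by simp
    also have "\<dots> \<le> (1/4)^j" by (rule N[OF rN])
    finally show ?thesis .
  qed
  define d where "d j = (\<lambda>x. s (Suc j) x - s j x)" for j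
  have dL2: "d j \<in> L2 M" for j unfolding d_def by (intro L2_diff sL2)
  have dn: "L2_norm M (d j) \<le> (1/2)^j" for j
  proof (rule power2_le_imp_le)
    have "(L2_norm M (d j))\<^sup>2 \<le> (1/4)^j" unfolding L2_norm_square d_def by (rule sdiff) simp
    also have "\<dots> = ((1/2)^j)\<^sup>2" by (simp add: power2_eq_square power_mult_distrib[symmetric])
    finally show "(L2_norm M (d j))\<^sup>2 \<le> ((1/2)^j)\<^sup>2" .
  qed simp
  have "AE x in M. summable (\<lambda>j. \<bar>d j x\<bar>)"
  proof (rule AE_summable)
    show "integrable M (d j)" for j by (rule L2_integrable[OF fin dL2])
    show "summable (\<lambda>j. \<integral>x. \<bar>d j x\<bar> \<partial>M)"
    proof (rule summable_comparison_test')
      show "summable (\<lambda>j. sqrt (measure M (space M)) * (1/2)^j)" by (intro summable_mult summable_geometric) simp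
      fix j
      have "(\<integral>x. \<bar>d j x\<bar> \<partial>M) \<le> sqrt (measure M (space M)) * L2_norm M (d j)" by (rule L2_integrable[OF fin dL2])
      also have "\<dots> \<le> sqrt (measure M (space M)) * (1/2)^j" by (intro mult_left_mono dn) simp
      finally show "norm (\<integral>x. \<bar>d j x\<bar> \<partial>M) \<le> sqrt (measure M (space M)) * (1/2)^j"
        by (simp add: Bochner_Integration.integral_nonneg)
    qed
  qed
  define h where "h x = lim (\<lambda>j. s j x)" for x
  have [measurable]: "s j \<in> borel_measurable M" for j using sL2 by (simp add: L2_def)
  have [measurable]: "h \<in> borel_measurable M" unfolding h_def by (rule borel_measurable_lim_metric) simp
  have conv: "AE x in M. (\<lambda>j. s j x) \<longlonglongrightarrow> h x"
    using \<open>AE x in M. summable (\<lambda>j. \<bar>d j x\<bar>)\<close>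
  proof eventually_elim
    case (elim x)
    then have "summable (\<lambda>j. d j x)" by (rule summable_rabs_cancel)
    then have "(\<lambda>k. \<Sum>j<k. d j x) \<longlonglongrightarrow> (\<Sum>j. d j x)" by (rule summable_LIMSEQ)
    moreover have "(\<Sum>j<k. d j x) = s k x - s 0 x" for k
      unfolding d_def by (rule sum_lessThan_telescope[of "\<lambda>j. s j x"])
    ultimately have "(\<lambda>k. s k x - s 0 x + s 0 x) \<longlonglongrightarrow> (\<Sum>j. d j x) + s 0 x" by (intro tendsto_intros) simp
    then have "convergent (\<lambda>k. s k x)" by (auto simp: convergent_def)
    then show ?case unfolding h_def by (simp add: convergent_LIMSEQ_iff)
  qed
  have hs: "(\<lambda>x. h x - s j x) \<in> L2 M \<and> L2_inner M (\<lambda>x. h x - s j x) (\<lambda>x. h x - s j x) \<le> (1/4)^j" for j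
  proof -
    have "(\<integral>\<^sup>+x. ennreal ((h x - s j x)\<^sup>2) \<partial>M) = (\<integral>\<^sup>+x. liminf (\<lambda>i. ennreal ((s i x - s j x)\<^sup>2)) \<partial>M)"
    proof (rule nn_integral_cong_AE)
      show "AE x in M. ennreal ((h x - s j x)\<^sup>2) = liminf (\<lambda>i. ennreal ((s i x - s j x)\<^sup>2))"
        using conv
      proof eventually_elim
        case (elim x)
        then have "(\<lambda>i. ennreal ((s i x - s j x)\<^sup>2)) \<longlonglongrightarrow> ennreal ((h x - s j x)\<^sup>2)"
          by (intro tendsto_intros)
        then show ?case by (rule lim_imp_Liminf[OF sequentially_bot, symmetric])
      qed
    qed
    also have "\<dots> \<le> liminf (\<lambda>i. \<integral>\<^sup>+x. ennreal ((s i x - s j x)\<^sup>2) \<partial>M)"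
      by (rule nn_integral_liminf) simp
    also have "\<dots> \<le> ennreal ((1/4)^j)"
    proof -
      have "\<forall>\<^sub>F i in sequentially. (\<integral>\<^sup>+x. ennreal ((s i x - s j x)\<^sup>2) \<partial>M) \<le> ennreal ((1/4)^j)"
        using eventually_ge_at_top[of j]
      proof eventually_elim
        case (elim i)
        have "(\<integral>\<^sup>+x. ennreal ((s i x - s j x)\<^sup>2) \<partial>M) = ennreal (L2_inner M (\<lambda>x. s i x - s j x) (\<lambda>x. s i x - s j x))"
          unfolding L2_inner_self by (rule nn_integral_eq_integral[OF L2_square[OF L2_diff[OF sL2 sL2]]]) simp
        also have "\<dots> \<le> ennreal ((1/4)^j)" by (intro ennreal_leI sdiff elim)
        finally show ?case .
      qed
      then have "liminf (\<lambda>i. \<integral>\<^sup>+x. ennreal ((s i x - s j x)\<^sup>2) \<partial>M) \<le> liminf (\<lambda>i. ennreal ((1/4)^j))"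
        by (rule Liminf_mono)
      then show ?thesis by (simp add: Liminf_const)
    qed
    finally have fin': "(\<integral>\<^sup>+x. ennreal ((h x - s j x)\<^sup>2) \<partial>M) \<le> ennreal ((1/4)^j)" .
    have i: "integrable M (\<lambda>x. (h x - s j x)\<^sup>2)"
      by (rule integrableI_nonneg) (use fin' in \<open>auto intro: le_less_trans\<close>)
    moreover have "(\<integral>\<^sup>+x. ennreal ((h x - s j x)\<^sup>2) \<partial>M) = ennreal (\<integral>x. (h x - s j x)\<^sup>2 \<partial>M)"
      by (rule nn_integral_eq_integral[OF i]) simp
    ultimately show ?thesis using fin' by (simp add: L2_def L2_inner_self ennreal_le_iff)
  qed
  have hL2: "h \<in> L2 M"
    using L2_add[OF hs[of 0, THEN conjunct1] sL2[of 0]] by simp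
  have "cf h n = c n" for n
  proof -
    have "\<bar>cf h n - c n\<bar> \<le> (1/2)^j" if "n < j" for j
    proof -
      have "cf (s j) n = c n" using that rj[of j] by (simp add: s_def cf_psum)
      then have "\<bar>cf h n - c n\<bar> = \<bar>cf (\<lambda>x. h x - s j x) n\<bar>" using hL2 sL2 by (simp add: L2_inner_diff)
      also have "\<dots> \<le> L2_norm M (\<lambda>x. h x - s j x) * L2_norm M (\<phi> n)"
        by (intro L2_Cauchy_Schwarz) (use hs in auto)
      also have "L2_norm M (\<phi> n) = 1" by (simp add: L2_norm_def phi_inner)
      also have "L2_norm M (\<lambda>x. h x - s j x) \<le> (1/2)^j"
      proof (rule power2_le_imp_le)
        show "(L2_norm M (\<lambda>x. h x - s j x))\<^sup>2 \<le> ((1/2)^j)\<^sup>2"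
        proof -
          have "((1/2::real)^j)\<^sup>2 = (1/4)^j" by (simp add: power2_eq_square power_mult_distrib[symmetric])
          then show ?thesis unfolding L2_norm_square using hs[of j] by simp
        qed
      qed simp
      finally show ?thesis by simp
    qed
    then have "\<forall>\<^sub>F j in sequentially. \<bar>cf h n - c n\<bar> \<le> (1/2)^j"
      by (rule eventually_mono[OF eventually_gt_at_top[of n]])
    moreover have "(\<lambda>j. (1/2::real)^j) \<longlonglongrightarrow> 0" by (intro LIMSEQ_power_zero) simp
    ultimately have "\<bar>cf h n - c n\<bar> \<le> 0"
      by (intro tendsto_le[OF sequentially_bot _ tendsto_const]) auto
    then show ?thesis by simp
  qed
  then show ?thesis using hL2 by blast
qed

end

section \<open>Dirichlet forms that are diagonal in an eigenbasis\<close>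

text \<open>
  Only the domain of the form is described in terms of coefficients. That the form itself is
  diagonal, and that \<open>V\<^sub>1\<close> lies in the domain of the operator, is derived from closedness and
  self-adjointness.
\<close>

locale spectral_form = L2_basis M \<phi> for M :: "'a measure" and \<phi> +
  fixes D :: "('a \<Rightarrow> real) set" and E :: "('a \<Rightarrow> real) \<Rightarrow> ('a \<Rightarrow> real) \<Rightarrow> real"
    and DA :: "('a \<Rightarrow> real) set" and A :: "('a \<Rightarrow> real) \<Rightarrow> 'a \<Rightarrow> real" and lam :: "nat \<Rightarrow> real"
  assumes form: "dirichlet_form M D E"
    and operator: "selfadjoint_operator M DA A"
    and DA_D: "DA \<subseteq> D" and E_A: "\<And>u v. u \<in> DA \<Longrightarrow> v \<in> D \<Longrightarrow> E u v = L2_inner M (A u) v"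
    and D_eq: "D = Vsp M \<phi> lam (1 / 2)"
    and eigen: "\<And>n. \<phi> n \<in> DA" "\<And>n. AE x in M. A (\<phi> n) x = lam n * \<phi> n x"
    and lam_mono: "incseq lam" and lam_0: "0 < lam 0"
begin

lemma lam_ge: "lam 0 \<le> lam n"
  using lam_mono by (simp add: incseq_def)

lemma lam_pos [simp]: "0 < lam n"
  using lam_ge[of n] lam_0 by linarith

lemma lam_nonneg [simp]: "0 \<le> lam n"
  by (rule less_imp_le[OF lam_pos])

lemma lam_abs [simp]: "\<bar>lam n\<bar> = lam n"
  by (rule abs_of_nonneg[OF lam_nonneg])

lemma subD: "L2_subspace M D"
  using form by (simp add: dirichlet_form_def)

lemmas sub_facts = subD[unfolded L2_subspace_def]

lemma D_L2: "u \<in> D \<Longrightarrow> u \<in> L2 M"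
  using sub_facts[THEN conjunct1] by (rule subsetD)

lemmas D_zero = sub_facts[THEN conjunct2, THEN conjunct1, rule_format]
lemmas D_add = sub_facts[THEN conjunct2, THEN conjunct2, THEN conjunct1, rule_format]
lemmas D_scale = sub_facts[THEN conjunct2, THEN conjunct2, THEN conjunct2, THEN conjunct1, rule_format]

lemmas form_1 = form[unfolded dirichlet_form_def, THEN conjunct2, THEN conjunct2]
lemmas form_2 = form_1[THEN conjunct2]
lemmas form_3 = form_2[THEN conjunct2]
lemmas form_4 = form_3[THEN conjunct2]
lemmas form_5 = form_4[THEN conjunct2, THEN conjunct2]
lemmas E_AE = form_1[THEN conjunct1, rule_format]
lemmas E_sym = form_2[THEN conjunct1, rule_format]
lemmas E_add = form_3[THEN conjunct1, rule_format]
lemmas E_scale = form_4[THEN conjunct1, rule_format]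
lemmas E_nonneg = form_4[THEN conjunct2, THEN conjunct1, rule_format]
lemmas E_closed = form_5[THEN conjunct1]
lemmas E_markov = form_5[THEN conjunct2]

lemma D_diff: assumes "u \<in> D" "v \<in> D" shows "(\<lambda>x. u x - v x) \<in> D"
proof -
  have "(\<lambda>x. u x + (-1) * v x) \<in> D" by (rule D_add[OF assms(1) D_scale[OF assms(2)]])
  then show ?thesis by simp
qed

lemma E_diff:
  assumes "u \<in> D" "v \<in> D" "w \<in> D"
  shows "E (\<lambda>x. u x - v x) w = E u w - E v w"
proof -
  have "E (\<lambda>x. u x + (-1) * v x) w = E u w + E (\<lambda>x. (-1) * v x) w"
    by (rule E_add[OF assms(1) D_scale[OF assms(2)] assms(3)])
  also have "E (\<lambda>x. (-1) * v x) w = (-1) * E v w" by (rule E_scale[OF assms(2,3)])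
  finally show ?thesis by simp
qed

lemma phi_D: "\<phi> n \<in> D"
  using eigen DA_D by auto

lemma A_L2: "u \<in> DA \<Longrightarrow> A u \<in> L2 M"
  using operator by (auto simp: selfadjoint_operator_def L2_operator_def)

lemma E_phi: assumes "v \<in> D" shows "E (\<phi> n) v = lam n * cf v n"
proof -
  have "E (\<phi> n) v = L2_inner M (A (\<phi> n)) v" by (rule E_A[OF eigen(1) assms])
  also have "\<dots> = L2_inner M (\<lambda>x. lam n * \<phi> n x) v"
    by (intro L2_inner_cong_AE A_L2 eigen L2_scale phi_L2 D_L2 assms)
  also have "\<dots> = lam n * cf v n" by (simp add: L2_inner_scale L2_inner_commute[of M "\<phi> n" v])
  finally show ?thesis .
qed

lemma psum_D: "psum c k \<in> D"
proof (induction k)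
  case 0
  then show ?case by (simp add: psum_def D_zero)
next
  case (Suc k)
  have "psum c (Suc k) = (\<lambda>x. psum c k x + c k * \<phi> k x)" by (simp add: psum_def)
  then show ?case using D_add[OF Suc D_scale[OF phi_D]] by simp
qed

lemma E_psum: assumes "v \<in> D" shows "E (psum c k) v = (\<Sum>n<k. c n * (lam n * cf v n))"
proof (induction k)
  case 0
  have "E (\<lambda>x. 0 * (0::real)) v = 0 * E (\<lambda>x. 0) v" by (rule E_scale[OF D_zero assms])
  then show ?case by (simp add: psum_def)
next
  case (Suc k)
  have "psum c (Suc k) = (\<lambda>x. psum c k x + c k * \<phi> k x)" by (simp add: psum_def)
  then show ?case using Suc E_add[OF psum_D D_scale[OF phi_D] assms] E_scale[OF phi_D assms] E_phi[OF assms] by simp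
qed

lemma D_iff: "u \<in> D \<longleftrightarrow> u \<in> L2 M \<and> summable (\<lambda>n. lam n * (cf u n)\<^sup>2)"
  by (simp add: D_eq Vsp_def mult.commute)

text \<open>
  The partial sums of the expansion are a Cauchy sequence for the form norm because
  \<open>D = V\<^sub>1\<^sub>/\<^sub>2\<close>. By closedness they converge in \<open>D\<close>, and the limit is \<open>u\<close> because the form norm
  controls the \<open>L\<^sup>2\<close> norm.
\<close>

lemma E_diag:
  assumes u: "u \<in> D"
  shows "(\<lambda>n. lam n * (cf u n)\<^sup>2) sums E u u"
proof -
  define c where "c = cf u"
  have uL: "u \<in> L2 M" by (rule D_L2[OF u])
  have s1: "summable (\<lambda>n. lam n * (c n)\<^sup>2)" using u by (simp add: D_iff c_def)
  have s2: "summable (\<lambda>n. (c n)\<^sup>2)" using parseval[OF uL] by (simp add: sums_iff c_def)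
  define F where "F k = (\<Sum>n<k. lam n * (c n)\<^sup>2 + (c n)\<^sup>2)" for k
  have Epp: "E (psum a k) (psum a k) = (\<Sum>n<k. lam n * (a n)\<^sup>2)" for a k
    unfolding E_psum[OF psum_D] by (rule sum.cong) (auto simp: cf_psum power2_eq_square)
  have fn: "form_norm M E 1 (\<lambda>x. psum c i x - psum c j x) = sqrt (F i - F j)" if "j \<le> i" for i j
  proof -
    have "{..<i} = {..<j} \<union> {j..<i}" using that by auto
    then have sp: "(\<Sum>n<i. G n) = (\<Sum>n<j. G n) + (\<Sum>n\<in>{j..<i}. G n)" for G :: "nat \<Rightarrow> real"
      by (simp add: sum.union_disjoint ivl_disj_int)
    have "E (psum (\<lambda>n. if n < j then 0 else c n) i) (psum (\<lambda>n. if n < j then 0 else c n) i) + 1 * L2_inner M (psum (\<lambda>n. if n < j then 0 else c n) i) (psum (\<lambda>n. if n < j then 0 else c n) i)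
        = F i - F j"
      unfolding Epp psum_norm F_def sp by (simp add: sum.distrib)
    then show ?thesis unfolding form_norm_def psum_diff[OF that] by simp
  qed
  have fn': "form_norm M E 1 (\<lambda>x. psum c i x - psum c j x) = sqrt \<bar>F i - F j\<bar>" for i j
  proof (cases "j \<le> i")
    case True
    have "F j \<le> F i" unfolding F_def by (rule sum_mono2) (use True in \<open>auto intro!: add_nonneg_nonneg mult_nonneg_nonneg\<close>)
    then show ?thesis using fn[OF True] by simp
  next
    case False
    then have ji: "i \<le> j" by simp
    have "F i \<le> F j" unfolding F_def by (rule sum_mono2) (use ji in \<open>auto intro!: add_nonneg_nonneg mult_nonneg_nonneg\<close>)
    define a where "a = (\<lambda>x. psum c j x - psum c i x)"
    have aD: "a \<in> D" unfolding a_def by (intro D_diff psum_D)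
    have "(\<lambda>x. psum c i x - psum c j x) = (\<lambda>x. (-1) * a x)" by (auto simp: a_def)
    moreover have "E (\<lambda>x. (-1) * a x) (\<lambda>x. (-1) * a x) = E a a"
      using E_scale[OF aD D_scale[OF aD, of "-1"], of "-1"] E_sym[OF aD D_scale[OF aD, of "-1"]] E_scale[OF aD aD, of "-1"] by linarith
    moreover have "L2_inner M (\<lambda>x. (-1) * a x) (\<lambda>x. (-1) * a x) = L2_inner M a a" by (simp add: L2_inner_self)
    ultimately have "form_norm M E 1 (\<lambda>x. psum c i x - psum c j x) = form_norm M E 1 a" by (simp add: form_norm_def)
    then show ?thesis using fn[OF ji] \<open>F i \<le> F j\<close> by (simp add: a_def)
  qed
  have "Cauchy F"
  proof -
    have "convergent F" using summable_add[OF s1 s2] unfolding F_def[abs_def] summable_iff_convergent .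
    then show ?thesis by (rule convergent_Cauchy)
  qed
  have "\<exists>k. \<forall>i\<ge>k. \<forall>j\<ge>k. form_norm M E 1 (\<lambda>x. psum c i x - psum c j x) < e" if e: "e > 0" for e
  proof -
    obtain k where k: "\<And>i j. i \<ge> k \<Longrightarrow> j \<ge> k \<Longrightarrow> norm (F i - F j) < e\<^sup>2"
      using CauchyD[OF \<open>Cauchy F\<close>, of "e\<^sup>2"] e by auto
    have "sqrt \<bar>F i - F j\<bar> < e" if "i \<ge> k" "j \<ge> k" for i j
      using real_sqrt_less_mono[OF k[OF that]] e by simp
    then show ?thesis unfolding fn' by blast
  qed
  then obtain u' where u': "u' \<in> D" "(\<lambda>n. form_norm M E 1 (\<lambda>x. psum c n x - u' x)) \<longlonglongrightarrow> 0"
    using E_closed[unfolded closed_form_def, rule_format, of 1 "psum c"] psum_D by auto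
  let ?d = "\<lambda>n x. psum c n x - u' x"
  have d: "(?d n) \<in> D" for n by (intro D_diff psum_D u')
  have "(\<lambda>n. (form_norm M E 1 (?d n))\<^sup>2) \<longlonglongrightarrow> 0\<^sup>2" by (intro tendsto_power u'(2))
  moreover have "(form_norm M E 1 (?d n))\<^sup>2 = E (?d n) (?d n) + L2_inner M (?d n) (?d n)" for n
    unfolding form_norm_def using E_nonneg[OF d[of n]] by simp
  ultimately have lim: "(\<lambda>n. E (?d n) (?d n) + L2_inner M (?d n) (?d n)) \<longlonglongrightarrow> 0" by simp
  have l1: "(\<lambda>n. E (?d n) (?d n)) \<longlonglongrightarrow> 0"
    by (rule tendsto_sandwich[OF _ _ tendsto_const lim]) (use E_nonneg[OF d] in auto)
  have l2: "(\<lambda>n. L2_inner M (?d n) (?d n)) \<longlonglongrightarrow> 0"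
    by (rule tendsto_sandwich[OF _ _ tendsto_const lim]) (use E_nonneg[OF d] in auto)
  have u'L: "u' \<in> L2 M" by (rule D_L2[OF u'(1)])
  have cfu': "cf u' m = c m" for m
  proof -
    have "(\<lambda>n. L2_norm M (?d n)) \<longlonglongrightarrow> sqrt 0" unfolding L2_norm_def by (intro tendsto_real_sqrt l2)
    then have n0: "(\<lambda>n. L2_norm M (?d n)) \<longlonglongrightarrow> 0" by simp
    have "\<forall>\<^sub>F n in sequentially. \<bar>c m - cf u' m\<bar> \<le> L2_norm M (?d n)"
      using eventually_gt_at_top[of m]
    proof eventually_elim
      case (elim n)
      have "c m - cf u' m = cf (?d n) m" using elim u'L by (simp add: L2_inner_diff cf_psum)
      also have "\<bar>\<dots>\<bar> \<le> L2_norm M (?d n) * L2_norm M (\<phi> m)"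
        by (intro L2_Cauchy_Schwarz L2_diff u'L) auto
      also have "L2_norm M (\<phi> m) = 1" by (simp add: L2_norm_def phi_inner)
      finally show ?case by simp
    qed
    then have "\<bar>c m - cf u' m\<bar> \<le> 0" by (intro tendsto_le[OF sequentially_bot n0 tendsto_const])
    then show ?thesis by simp
  qed
  have ae: "AE x in M. u x = u' x" by (rule cf_ext[OF uL u'L]) (simp add: cfu' c_def)
  have Euu: "E u u = E u' u'"
    using E_AE[OF u u'(1) u ae] E_AE[OF u u'(1) u'(1) ae] E_sym[OF u u'(1)] by linarith
  have "E (?d n) (?d n) = E u' u' - (\<Sum>m<n. lam m * (c m)\<^sup>2)" for n
  proof -
    have "E (psum c n) u' = (\<Sum>m<n. lam m * (c m)\<^sup>2)"
      unfolding E_psum[OF u'(1)] by (rule sum.cong) (auto simp: cfu' power2_eq_square)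
    then show ?thesis
      using E_diff[OF psum_D[of c n] u'(1) d[of n]] E_sym[OF psum_D[of c n] d[of n]] E_sym[OF u'(1) d[of n]]
        E_diff[OF psum_D[of c n] u'(1) psum_D[of c n]] E_diff[OF psum_D[of c n] u'(1) u'(1)] E_sym[OF u'(1) psum_D[of c n]] Epp[of c n]
      by linarith
  qed
  then have "(\<lambda>n. E u' u' - (\<Sum>m<n. lam m * (c m)\<^sup>2)) \<longlonglongrightarrow> 0" using l1 by simp
  then have "(\<lambda>n. E u' u' - (E u' u' - (\<Sum>m<n. lam m * (c m)\<^sup>2))) \<longlonglongrightarrow> E u' u' - 0" by (intro tendsto_intros)
  then show ?thesis unfolding Euu sums_def c_def by simp
qed

lemma E_ge: assumes "u \<in> D" shows "lam 0 * L2_inner M u u \<le> E u u"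
proof (rule sums_le)
  show "(\<lambda>n. lam 0 * (cf u n)\<^sup>2) sums (lam 0 * L2_inner M u u)" by (intro sums_mult parseval D_L2 assms)
  show "(\<lambda>n. lam n * (cf u n)\<^sup>2) sums E u u" by (rule E_diag[OF assms])
  show "lam 0 * (cf u n)\<^sup>2 \<le> lam n * (cf u n)\<^sup>2" for n using lam_ge[of n] by (intro mult_right_mono) auto
qed

lemma inner_sum_eq:
  assumes "g \<in> L2 M" "h \<in> L2 M" "\<And>n. cf g n * cf h n = a n"
  shows "a sums L2_inner M g h"
  using parseval_inner[OF assms(1,2)] assms(3) by simp

text \<open>
  If \<open>\<Sum> \<lambda>\<^sub>n c\<^sub>n \<phi>\<^sub>n\<close> converges to \<open>w\<close>, then \<open>u\<close> lies in the domain of the adjoint with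
  \<open>A\<^sup>* u = w\<close>, and a self-adjoint operator contains its adjoint.
\<close>

lemma V1_subset_DA: "Vsp M \<phi> lam 1 \<subseteq> DA"
proof
  fix u assume u: "u \<in> Vsp M \<phi> lam 1"
  then have uL: "u \<in> L2 M" by (simp add: Vsp_def)
  have "summable (\<lambda>n. (cf u n)\<^sup>2 * lam n powr (2 * 1))" using u by (simp add: Vsp_def)
  moreover have "(cf u n)\<^sup>2 * lam n powr (2 * 1) = (lam n * cf u n)\<^sup>2" for n
    by (simp add: power_mult_distrib powr_numeral)
  ultimately have "summable (\<lambda>n. (lam n * cf u n)\<^sup>2)" by simp
  from riesz_fischer[OF this] obtain w where w: "w \<in> L2 M" "\<And>n. cf w n = lam n * cf u n" by auto
  have "L2_inner M (A v) u = L2_inner M v w" if v: "v \<in> DA" for v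
  proof -
    have vL: "v \<in> L2 M" using v DA_D D_L2 by auto
    have "cf (A v) n = lam n * cf v n" for n
    proof -
      have "cf (A v) n = L2_inner M v (A (\<phi> n))"
        using operator v eigen(1) by (auto simp: selfadjoint_operator_def)
      also have "\<dots> = L2_inner M (A (\<phi> n)) v" by (rule L2_inner_commute)
      also have "\<dots> = L2_inner M (\<lambda>x. lam n * \<phi> n x) v"
        by (intro L2_inner_cong_AE A_L2 eigen L2_scale phi_L2 vL)
      also have "\<dots> = lam n * cf v n" by (simp add: L2_inner_scale L2_inner_commute[of M "\<phi> n" v])
      finally show ?thesis .
    qed
    then have "(\<lambda>n. lam n * cf v n * cf u n) sums L2_inner M (A v) u"
      by (intro inner_sum_eq A_L2 v uL) simp
    moreover have "(\<lambda>n. lam n * cf v n * cf u n) sums L2_inner M v w"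
      by (intro inner_sum_eq vL w) (simp add: w)
    ultimately show ?thesis by (rule sums_unique2)
  qed
  moreover have "\<forall>v\<in>L2 M. (\<exists>w\<in>L2 M. \<forall>u\<in>DA. L2_inner M (A u) v = L2_inner M u w) \<longrightarrow> v \<in> DA"
    using operator unfolding selfadjoint_operator_def by (elim conjE)
  ultimately show "u \<in> DA" using uL w(1) by blast
qed

lemma cf_A: assumes v: "v \<in> DA" shows "cf (A v) n = lam n * cf v n"
proof -
  have vL: "v \<in> L2 M" using v DA_D D_L2 by auto
  have "cf (A v) n = L2_inner M v (A (\<phi> n))"
    using operator v eigen(1) by (auto simp: selfadjoint_operator_def)
  also have "\<dots> = L2_inner M (A (\<phi> n)) v" by (rule L2_inner_commute)
  also have "\<dots> = L2_inner M (\<lambda>x. lam n * \<phi> n x) v"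
    by (intro L2_inner_cong_AE A_L2 eigen L2_scale phi_L2 vL)
  also have "\<dots> = lam n * cf v n" by (simp add: L2_inner_scale L2_inner_commute[of M "\<phi> n" v])
  finally show ?thesis .
qed

definition resolvent :: "real \<Rightarrow> ('a \<Rightarrow> real) \<Rightarrow> 'a \<Rightarrow> real" where
  "resolvent h g = (SOME u. u \<in> D \<and> (\<forall>n. cf u n = cf g n / (1 + h * lam n)))"

lemma resolvent:
  assumes h: "h > 0" and g: "g \<in> L2 M"
  shows "resolvent h g \<in> D" "cf (resolvent h g) n = cf g n / (1 + h * lam n)"
proof -
  have p: "1 \<le> 1 + h * lam n" for n using h less_imp_le[OF lam_pos[of n]] by simp
  have s: "summable (\<lambda>n. (cf g n)\<^sup>2)" using parseval[OF g] by (simp add: sums_iff)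
  have "summable (\<lambda>n. (cf g n / (1 + h * lam n))\<^sup>2)"
  proof (rule summable_comparison_test'[OF s])
    fix n
    have "(cf g n)\<^sup>2 / (1 + h * lam n)\<^sup>2 \<le> (cf g n)\<^sup>2 / 1"
      using p[of n] by (intro divide_left_mono) (auto intro: one_le_power)
    then show "norm ((cf g n / (1 + h * lam n))\<^sup>2) \<le> (cf g n)\<^sup>2" by (simp add: power_divide)
  qed
  from riesz_fischer[OF this] obtain u where u: "u \<in> L2 M" "\<And>n. cf u n = cf g n / (1 + h * lam n)" by auto
  have "summable (\<lambda>n. lam n * (cf u n)\<^sup>2)"
  proof (rule summable_comparison_test'[OF summable_divide[OF s, of h]])
    fix n
    have "h * lam n \<le> (1 + h * lam n)\<^sup>2"
    proof -
      have "1 + h * lam n \<le> (1 + h * lam n) * (1 + h * lam n)" using p[of n] mult_left_mono[OF p[of n], of "1 + h * lam n"] by simp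
      then show ?thesis by (simp add: power2_eq_square)
    qed
    then have "lam n / (1 + h * lam n)\<^sup>2 \<le> 1 / h"
      using h p[of n] by (intro iffD2[OF divide_le_eq]) (auto simp: field_simps)
    then have "(cf g n)\<^sup>2 * (lam n / (1 + h * lam n)\<^sup>2) \<le> (cf g n)\<^sup>2 * (1 / h)" by (intro mult_left_mono) auto
    then show "norm (lam n * (cf u n)\<^sup>2) \<le> (cf g n)\<^sup>2 / h"
      by (simp add: u(2) power_divide mult.commute abs_mult less_imp_le)
  qed
  then have "u \<in> D \<and> (\<forall>n. cf u n = cf g n / (1 + h * lam n))" using u by (simp add: D_iff)
  from someI[of "\<lambda>u. u \<in> D \<and> (\<forall>n. cf u n = cf g n / (1 + h * lam n))", OF this]
  show "resolvent h g \<in> D" "cf (resolvent h g) n = cf g n / (1 + h * lam n)" unfolding resolvent_def by auto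
qed

lemma resolvent_L2: "h > 0 \<Longrightarrow> g \<in> L2 M \<Longrightarrow> resolvent h g \<in> L2 M"
  using resolvent(1) D_L2 by blast

lemma resolvent_energy:
  assumes h: "h > 0" and g: "g \<in> L2 M"
  shows "h * E (resolvent h g) (resolvent h g) \<le> L2_inner M g g"
proof (rule sums_le)
  show "(\<lambda>n. h * (lam n * (cf (resolvent h g) n)\<^sup>2)) sums (h * E (resolvent h g) (resolvent h g))"
    by (intro sums_mult E_diag resolvent h g)
  show "(\<lambda>n. (cf g n)\<^sup>2) sums L2_inner M g g" by (rule parseval[OF g])
  fix n
  have p: "1 \<le> 1 + h * lam n" for n using h less_imp_le[OF lam_pos[of n]] by simp
  have "h * lam n \<le> (1 + h * lam n)\<^sup>2"
  proof -
    have "1 + h * lam n \<le> (1 + h * lam n) * (1 + h * lam n)" using p[of n] mult_left_mono[OF p[of n], of "1 + h * lam n"] by simp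
    then show ?thesis by (simp add: power2_eq_square)
  qed
  then have "h * lam n / (1 + h * lam n)\<^sup>2 \<le> 1" using p[of n] by (simp add: divide_le_eq)
  then have "(h * lam n / (1 + h * lam n)\<^sup>2) * (cf g n)\<^sup>2 \<le> 1 * (cf g n)\<^sup>2" by (intro mult_right_mono) auto
  then show "h * (lam n * (cf (resolvent h g) n)\<^sup>2) \<le> (cf g n)\<^sup>2"
    by (simp add: resolvent(2)[OF h g] power_divide)
qed

text \<open>
  The resolvent \<open>R = (1 + h A)\<^sup>-\<^sup>1 g\<close> minimizes \<open>h E(v,v) + \<parallel>v - g\<parallel>\<^sup>2\<close>, quantitatively: a
  competitor pays at least its squared distance to \<open>R\<close>.
\<close>

lemma resolvent_minimal:
  assumes h: "h > 0" and g: "g \<in> L2 M" and v: "v \<in> D"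
  defines "R \<equiv> resolvent h g"
  shows "h * E R R + L2_inner M (\<lambda>x. R x - g x) (\<lambda>x. R x - g x) + L2_inner M (\<lambda>x. v x - R x) (\<lambda>x. v x - R x)
    \<le> h * E v v + L2_inner M (\<lambda>x. v x - g x) (\<lambda>x. v x - g x)"
proof (rule sums_le)
  have R: "R \<in> D" "\<And>n. cf R n = cf g n / (1 + h * lam n)" unfolding R_def by (rule resolvent[OF h g])+
  have L: "R \<in> L2 M" "v \<in> L2 M" using R v D_L2 by auto
  show "(\<lambda>n. h * (lam n * (cf R n)\<^sup>2) + (cf R n - cf g n)\<^sup>2 + (cf v n - cf R n)\<^sup>2) sums
     (h * E R R + L2_inner M (\<lambda>x. R x - g x) (\<lambda>x. R x - g x) + L2_inner M (\<lambda>x. v x - R x) (\<lambda>x. v x - R x))"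
    using parseval[OF L2_diff[OF L(1) g]] parseval[OF L2_diff[OF L(2,1)]] E_diag[OF R(1)] L g
    by (intro sums_add sums_mult) (simp_all add: L2_inner_diff)
  show "(\<lambda>n. h * (lam n * (cf v n)\<^sup>2) + (cf v n - cf g n)\<^sup>2) sums (h * E v v + L2_inner M (\<lambda>x. v x - g x) (\<lambda>x. v x - g x))"
    using parseval[OF L2_diff[OF L(2) g]] E_diag[OF v] L g
    by (intro sums_add sums_mult) (simp_all add: L2_inner_diff)
  fix n
  have "1 + h * lam n > 0" using h lam_pos[of n] by (intro add_pos_pos mult_pos_pos) auto
  then have "(1 + h * lam n) * cf R n = cf g n" by (simp add: R(2))
  then have e: "cf g n = cf R n + h * lam n * cf R n" by (simp add: ring_distribs)
  have "h * (lam n * (cf v n)\<^sup>2) + (cf v n - cf g n)\<^sup>2 - (h * (lam n * (cf R n)\<^sup>2) + (cf R n - cf g n)\<^sup>2 + (cf v n - cf R n)\<^sup>2)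
      = h * lam n * (cf v n - cf R n)\<^sup>2"
    unfolding e by (simp add: power2_eq_square algebra_simps)
  moreover have "0 \<le> h * lam n * (cf v n - cf R n)\<^sup>2" using h less_imp_le[OF lam_pos[of n]] by simp
  ultimately show "h * (lam n * (cf R n)\<^sup>2) + (cf R n - cf g n)\<^sup>2 + (cf v n - cf R n)\<^sup>2 \<le> h * (lam n * (cf v n)\<^sup>2) + (cf v n - cf g n)\<^sup>2"
    by linarith
qed

text \<open>
  Truncating \<open>R\<close> by a normal contraction does not increase the energy, by the Markov property,
  nor the distance to \<open>g\<close>, since \<open>g\<close> takes values in \<open>[0,1]\<close>. So the truncation is also a
  minimizer and coincides with \<open>R\<close>.
\<close>

lemma resolvent_markov:
  assumes h: "h > 0" and g: "g \<in> L2 M" and g01: "AE x in M. 0 \<le> g x \<and> g x \<le> 1"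
  shows "AE x in M. 0 \<le> resolvent h g x \<and> resolvent h g x \<le> 1"
proof -
  define R where "R = resolvent h g"
  have RD: "R \<in> D" unfolding R_def by (rule resolvent[OF h g])
  have RL: "R \<in> L2 M" by (rule D_L2[OF RD])
  have aee: "AE x in M. - e \<le> R x \<and> R x \<le> 1 + e" if e: "e > 0" for e
  proof -
    obtain p where p: "\<And>t. t \<in> {0..1} \<Longrightarrow> p t = t" "\<And>t. - e \<le> p t" "\<And>t. p t \<le> 1 + e"
      "\<And>s t. s < t \<Longrightarrow> 0 \<le> p t - p s" "\<And>s t. s < t \<Longrightarrow> p t - p s \<le> t - s"
      "(\<lambda>x. p (R x)) \<in> D" "E (\<lambda>x. p (R x)) (\<lambda>x. p (R x)) \<le> E R R"
    proof -
      have "\<exists>p::real \<Rightarrow> real. smooth_real p \<and> (\<forall>t\<in>{0..1}. p t = t) \<and> (\<forall>t. - e \<le> p t \<and> p t \<le> 1 + e) \<and>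
          (\<forall>\<tau> t. \<tau> < t \<longrightarrow> 0 \<le> p t - p \<tau> \<and> p t - p \<tau> \<le> t - \<tau>) \<and>
          (\<forall>u\<in>D. (\<lambda>x. p (u x)) \<in> D \<and> E (\<lambda>x. p (u x)) (\<lambda>x. p (u x)) \<le> E u u)"
        using E_markov e unfolding markovian_form_def by (elim allE impE)
      then obtain p where "(\<forall>t\<in>{0..1}. p t = t)" "(\<forall>t. - e \<le> p t \<and> p t \<le> 1 + e)"
          "(\<forall>\<tau> t. \<tau> < t \<longrightarrow> 0 \<le> p t - p \<tau> \<and> p t - p \<tau> \<le> t - \<tau>)"
          "(\<forall>u\<in>D. (\<lambda>x. p (u x)) \<in> D \<and> E (\<lambda>x. p (u x)) (\<lambda>x. p (u x)) \<le> E u u)" by (elim exE conjE)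
      then show ?thesis using RD by (intro that[of p]) simp_all
    qed
    define v where "v = (\<lambda>x. p (R x))"
    have vD: "v \<in> D" using p(6) by (simp add: v_def)
    have vL: "v \<in> L2 M" by (rule D_L2[OF vD])
    have closer: "\<bar>p t - a\<bar> \<le> \<bar>t - a\<bar>" if a: "0 \<le> a" "a \<le> 1" for t a
    proof (cases "t > 1")
      case True
      then have "p 1 = 1" "0 \<le> p t - p 1" "p t - p 1 \<le> t - 1" using p(1)[of 1] p(4,5)[of 1 t] by auto
      then show ?thesis using a True by auto
    next
      case f1: False
      show ?thesis
      proof (cases "t < 0")
        case True
        then have "p 0 = 0" "0 \<le> p 0 - p t" "p 0 - p t \<le> 0 - t" using p(1)[of 0] p(4,5)[of t 0] by auto
        then show ?thesis using a True by auto
      next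
        case False
        then show ?thesis using f1 p(1)[of t] by simp
      qed
    qed
    have le: "L2_inner M (\<lambda>x. v x - g x) (\<lambda>x. v x - g x) \<le> L2_inner M (\<lambda>x. R x - g x) (\<lambda>x. R x - g x)"
      unfolding L2_inner_self
    proof (rule integral_mono_AE)
      show "integrable M (\<lambda>x. (v x - g x)\<^sup>2)" "integrable M (\<lambda>x. (R x - g x)\<^sup>2)"
        by (intro L2_square L2_diff vL g RL)+
      show "AE x in M. (v x - g x)\<^sup>2 \<le> (R x - g x)\<^sup>2"
        using g01
      proof eventually_elim
        case (elim x)
        then have "\<bar>p (R x) - g x\<bar> \<le> \<bar>R x - g x\<bar>" by (intro closer) auto
        then show ?case unfolding v_def abs_le_square_iff .
      qed
    qed
    have "h * E v v \<le> h * E R R" using p(7) h unfolding v_def by (intro mult_left_mono) auto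
    then have "L2_inner M (\<lambda>x. v x - R x) (\<lambda>x. v x - R x) \<le> 0"
      using resolvent_minimal[OF h g vD] le unfolding R_def[symmetric] by linarith
    then have "L2_inner M (\<lambda>x. v x - R x) (\<lambda>x. v x - R x) = 0"
      using L2_inner_nonneg[of M "\<lambda>x. v x - R x"] by linarith
    from L2_inner_self_eq_0[OF L2_diff[OF vL RL] this]
    show ?thesis
    proof eventually_elim
      case (elim x)
      then have "R x = p (R x)" by (simp add: v_def)
      then show ?case using p(2)[of "R x"] p(3)[of "R x"] by linarith
    qed
  qed
  have "AE x in M. - inverse (real (Suc n)) \<le> R x \<and> R x \<le> 1 + inverse (real (Suc n))" for n
    by (rule aee) simp
  then have "AE x in M. \<forall>n. - inverse (real (Suc n)) \<le> R x \<and> R x \<le> 1 + inverse (real (Suc n))"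
    unfolding AE_all_countable by (intro allI)
  then show ?thesis
    unfolding R_def[symmetric]
  proof eventually_elim
    case (elim x)
    note l = LIMSEQ_inverse_real_of_nat
    have l1: "(\<lambda>n. - inverse (real (Suc n))) \<longlonglongrightarrow> - 0" by (rule tendsto_minus[OF l])
    have l2: "(\<lambda>n. 1 + inverse (real (Suc n))) \<longlonglongrightarrow> 1 + 0" by (intro tendsto_intros l)
    have "- 0 \<le> R x" by (rule LIMSEQ_le_const2[OF l1]) (intro exI[of _ 0] allI impI elim[rule_format, THEN conjunct1])
    moreover have "R x \<le> 1 + 0" by (rule LIMSEQ_le_const[OF l2]) (intro exI[of _ 0] allI impI elim[rule_format, THEN conjunct2])
    ultimately show ?case by simp
  qed
qed

lemma resolvent_Linfty:
  assumes h: "h > 0" and g: "g \<in> borel_measurable M" and g1: "\<And>x. \<bar>g x\<bar> \<le> 1"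
  shows "AE x in M. \<bar>resolvent h g x\<bar> \<le> 1"
proof -
  interpret finite_measure M by (rule fin)
  have bdd: "k \<in> L2 M" if "k \<in> borel_measurable M" "\<And>x. \<bar>k x\<bar> \<le> 1" for k
  proof -
    have "(\<lambda>_. 1) \<in> L2 M" by (simp add: L2_def)
    then show ?thesis by (rule L2_norm_mono(1)[where K=1, OF that(1)]) (use that in auto)
  qed
  define gp where "gp = (\<lambda>x. max (g x) 0)"
  define gm where "gm = (\<lambda>x. max (- g x) 0)"
  have gL: "g \<in> L2 M" "gp \<in> L2 M" "gm \<in> L2 M"
    using g g1 by (auto intro!: bdd simp: gp_def gm_def abs_le_iff max_def)
  have b: "AE x in M. 0 \<le> resolvent h gp x \<and> resolvent h gp x \<le> 1" "AE x in M. 0 \<le> resolvent h gm x \<and> resolvent h gm x \<le> 1"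
    by (rule resolvent_markov[OF h gL(2)], use g1 in \<open>simp add: gp_def abs_le_iff\<close>)
      (rule resolvent_markov[OF h gL(3)], rule AE_I2, insert g1, simp add: gm_def abs_le_iff minus_le_iff)
  have e: "g = (\<lambda>x. gp x - gm x)" by (auto simp: gp_def gm_def max_def)
  have cg: "cf g n = cf gp n - cf gm n" for n by (subst e) (rule L2_inner_diff[OF gL(2,3) phi_L2])
  have "AE x in M. resolvent h g x = resolvent h gp x - resolvent h gm x"
  proof (rule cf_ext)
    show "resolvent h g \<in> L2 M" "(\<lambda>x. resolvent h gp x - resolvent h gm x) \<in> L2 M"
      by (intro L2_diff resolvent_L2 h gL)+
    show "cf (resolvent h g) n = cf (\<lambda>x. resolvent h gp x - resolvent h gm x) n" for n
      using h gL by (simp add: L2_inner_diff resolvent_L2 resolvent(2) cg diff_divide_distrib)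
  qed
  with b show ?thesis by eventually_elim auto
qed

text \<open>
  Dual to the bound in \<open>L\<^sup>\<infinity>\<close>: test with the sign of the resolvent and move the symmetric
  resolvent to the other side.
\<close>

lemma resolvent_L1:
  assumes h: "h > 0" and g: "g \<in> L2 M"
  shows "(\<integral>x. \<bar>resolvent h g x\<bar> \<partial>M) \<le> (\<integral>x. \<bar>g x\<bar> \<partial>M)"
proof -
  interpret finite_measure M by (rule fin)
  define R where "R = resolvent h g"
  have RL: "R \<in> L2 M" unfolding R_def by (rule resolvent_L2[OF h g])
  have Rm: "R \<in> borel_measurable M" by (rule L2_borel[OF RL])
  define \<psi> where "\<psi> = (\<lambda>x. sgn (R x))"
  have pm: "\<psi> \<in> borel_measurable M" unfolding \<psi>_def using Rm by measurable
  have p1: "\<bar>\<psi> x\<bar> \<le> 1" for x by (simp add: \<psi>_def sgn_if)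
  have "(\<lambda>_. 1) \<in> L2 M" by (simp add: L2_def)
  then have pL: "\<psi> \<in> L2 M" by (rule L2_norm_mono(1)[where K=1, OF pm]) (use p1 in auto)
  define P where "P = resolvent h \<psi>"
  have PL: "P \<in> L2 M" unfolding P_def by (rule resolvent_L2[OF h pL])
  have Pb: "AE x in M. \<bar>P x\<bar> \<le> 1" unfolding P_def by (rule resolvent_Linfty[OF h pm p1])
  have "(\<integral>x. \<bar>R x\<bar> \<partial>M) = L2_inner M R \<psi>" unfolding L2_inner_def \<psi>_def by (simp add: abs_sgn)
  also have "\<dots> = L2_inner M g P"
  proof -
    have "(\<lambda>n. cf g n * cf \<psi> n / (1 + h * lam n)) sums L2_inner M R \<psi>"
      by (intro inner_sum_eq RL pL) (simp add: R_def resolvent(2)[OF h g])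
    moreover have "(\<lambda>n. cf g n * cf \<psi> n / (1 + h * lam n)) sums L2_inner M g P"
      by (intro inner_sum_eq g PL) (simp add: P_def resolvent(2)[OF h pL])
    ultimately show ?thesis by (rule sums_unique2)
  qed
  also have "\<dots> \<le> (\<integral>x. \<bar>g x\<bar> \<partial>M)"
    unfolding L2_inner_def
  proof (rule integral_mono_AE)
    show "integrable M (\<lambda>x. g x * P x)" by (rule L2_prod[OF g PL])
    show "integrable M (\<lambda>x. \<bar>g x\<bar>)" using L2_integrable(1)[OF fin g] by simp
    show "AE x in M. g x * P x \<le> \<bar>g x\<bar>"
      using Pb
    proof eventually_elim
      case (elim x)
      have "g x * P x \<le> \<bar>g x\<bar> * \<bar>P x\<bar>" by (simp flip: abs_mult)
      also have "\<dots> \<le> \<bar>g x\<bar> * 1" using elim by (intro mult_left_mono) auto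
      finally show ?case by simp
    qed
  qed
  finally show ?thesis by (simp add: R_def)
qed

end

section \<open>Spectral spaces of bounded functions\<close>

lemma powr_square: "((a::real) powr b)\<^sup>2 = a powr (2 * b)"
  by (simp add: power2_eq_square powr_add[symmetric])

locale sobolev_form = spectral_form +
  fixes q :: real
  assumes q: "q > 1" and emb: "continuously_embedded_Lp M D E (2 * q)"
begin

text \<open>
  Since the spectrum is bounded below by \<open>lam 0\<close>, the energy alone dominates the form norm.
\<close>

lemma sobolev:
  "\<exists>C>0. \<forall>u\<in>D. integrable M (\<lambda>x. \<bar>u x\<bar> powr (2 * q)) \<and> (\<integral>x. \<bar>u x\<bar> powr (2 * q) \<partial>M) \<le> (C * E u u) powr q"
proof -
  obtain C0 where C0: "\<forall>u\<in>D. integrable M (\<lambda>x. \<bar>u x\<bar> powr (2 * q)) \<and>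
        (\<integral>x. \<bar>u x\<bar> powr (2 * q) \<partial>M) powr (1 / (2 * q)) \<le> C0 * form_norm M E 1 u"
    using emb unfolding continuously_embedded_Lp_def by (elim exE)
  define C1 where "C1 = max C0 1"
  have C1: "C1 \<ge> 1" "C0 \<le> C1" by (simp_all add: C1_def)
  define B where "B = 1 + 1 / lam 0"
  have B: "B > 0" using lam_0 by (simp add: B_def add_pos_pos)
  show ?thesis
  proof (intro exI[of _ "C1\<^sup>2 * B"] conjI ballI)
    show "C1\<^sup>2 * B > 0" using C1 B by simp
    fix u assume u: "u \<in> D"
    show "integrable M (\<lambda>x. \<bar>u x\<bar> powr (2 * q))" using C0 u by blast
    define I where "I = (\<integral>x. \<bar>u x\<bar> powr (2 * q) \<partial>M)"
    have I0: "I \<ge> 0" unfolding I_def by (rule Bochner_Integration.integral_nonneg) simp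
    have E0: "E u u \<ge> 0" by (rule E_nonneg[OF u])
    have "L2_inner M u u \<le> E u u / lam 0" using E_ge[OF u] lam_0 by (simp add: field_simps)
    then have "E u u + 1 * L2_inner M u u \<le> B * E u u" by (simp add: B_def ring_distribs)
    then have fn: "form_norm M E 1 u \<le> sqrt (B * E u u)" unfolding form_norm_def by (rule real_sqrt_le_mono)
    have fn0: "0 \<le> form_norm M E 1 u" unfolding form_norm_def using E0 L2_inner_nonneg[of M u] by (intro real_sqrt_ge_zero) linarith
    have "I powr (1 / (2 * q)) \<le> C0 * form_norm M E 1 u" using C0 u by (simp add: I_def)
    also have "\<dots> \<le> C1 * form_norm M E 1 u" by (rule mult_right_mono[OF C1(2) fn0])
    also have "\<dots> \<le> C1 * sqrt (B * E u u)" using fn C1 by (intro mult_left_mono) auto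
    also have "\<dots> = (C1\<^sup>2 * B * E u u) powr (1 / 2)"
      using C1 B E0 by (simp add: powr_half_sqrt real_sqrt_mult)
    finally have "(I powr (1 / (2 * q))) powr (2 * q) \<le> ((C1\<^sup>2 * B * E u u) powr (1 / 2)) powr (2 * q)"
      using q by (intro powr_mono2) auto
    then have "I \<le> (C1\<^sup>2 * B * E u u) powr q" using q I0 by (simp add: powr_powr)
    then show "(\<integral>x. \<bar>u x\<bar> powr (2 * q) \<partial>M) \<le> (C1\<^sup>2 * B * E u u) powr q" by (simp add: I_def)
  qed
qed

text \<open>
  Compare \<open>\<bar>a\<bar>\<close> with the threshold \<open>s\<close>. Integrated, this interpolates \<open>L\<^sup>2\<close> between \<open>L\<^sup>1\<close> and
  \<open>L\<^sup>2\<^sup>q\<close> without Hoelder's inequality.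
\<close>

lemma split_square:
  fixes s a :: real
  assumes s: "s > 0"
  shows "a\<^sup>2 \<le> s * \<bar>a\<bar> + s powr (2 - 2 * q) * \<bar>a\<bar> powr (2 * q)"
proof (cases "\<bar>a\<bar> \<le> s")
  case True
  have "a\<^sup>2 = \<bar>a\<bar> * \<bar>a\<bar>" by (simp add: power2_eq_square)
  also have "\<dots> \<le> s * \<bar>a\<bar>" by (rule mult_right_mono[OF True]) simp
  also have "\<dots> \<le> s * \<bar>a\<bar> + s powr (2 - 2 * q) * \<bar>a\<bar> powr (2 * q)" by simp
  finally show ?thesis .
next
  case False
  then have a: "\<bar>a\<bar> > s" "\<bar>a\<bar> > 0" using s by auto
  have "a\<^sup>2 = \<bar>a\<bar> powr 2" using a by simp
  also have "\<dots> = \<bar>a\<bar> powr (2 - 2 * q) * \<bar>a\<bar> powr (2 * q)" unfolding powr_add[symmetric] by simp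
  also have "\<dots> \<le> s powr (2 - 2 * q) * \<bar>a\<bar> powr (2 * q)"
    using a s q by (intro mult_right_mono powr_mono2') auto
  also have "\<dots> \<le> s * \<bar>a\<bar> + s powr (2 - 2 * q) * \<bar>a\<bar> powr (2 * q)" using s by simp
  finally show ?thesis .
qed

text \<open>
  Nash's inequality: apply the splitting with \<open>s\<close> half of the squared norm, so that the first
  term takes up only half of the left-hand side.
\<close>

lemma nash:
  "\<exists>C>0. \<forall>u\<in>D. (\<integral>x. \<bar>u x\<bar> \<partial>M) \<le> 1 \<longrightarrow> (L2_inner M u u / 2) powr (2 * q - 1) \<le> (C * E u u) powr q"
proof -
  obtain C where C: "C > 0" and sb: "\<forall>u\<in>D. integrable M (\<lambda>x. \<bar>u x\<bar> powr (2 * q)) \<and> (\<integral>x. \<bar>u x\<bar> powr (2 * q) \<partial>M) \<le> (C * E u u) powr q"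
    using sobolev by (elim exE conjE)
  note iq = sb[rule_format, THEN conjunct1] and sob = sb[rule_format, THEN conjunct2]
  show ?thesis
  proof (intro exI[of _ C] conjI ballI impI C)
    fix u assume u: "u \<in> D" and u1: "(\<integral>x. \<bar>u x\<bar> \<partial>M) \<le> 1"
    define s where "s = L2_inner M u u / 2"
    define X where "X = (C * E u u) powr q"
    have X0: "X \<ge> 0" by (simp add: X_def)
    have uL: "u \<in> L2 M" by (rule D_L2[OF u])
    have "s powr (2 * q - 1) \<le> X"
    proof (cases "s = 0")
      case True then show ?thesis using X0 by simp
    next
      case False
      then have s: "s > 0" using L2_inner_nonneg[of M u] unfolding s_def by linarith
      have "2 * s = (\<integral>x. (u x)\<^sup>2 \<partial>M)" by (simp add: s_def L2_inner_self)
      also have "\<dots> \<le> (\<integral>x. s * \<bar>u x\<bar> + s powr (2 - 2 * q) * \<bar>u x\<bar> powr (2 * q) \<partial>M)"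
        using L2_integrable(1)[OF fin uL] iq[OF u]
        by (intro Bochner_Integration.integral_mono L2_square[OF uL] split_square s Bochner_Integration.integrable_add integrable_mult_right integrable_abs)
      also have "\<dots> = s * (\<integral>x. \<bar>u x\<bar> \<partial>M) + s powr (2 - 2 * q) * (\<integral>x. \<bar>u x\<bar> powr (2 * q) \<partial>M)"
        using L2_integrable(1)[OF fin uL] iq[OF u] by simp
      also have "\<dots> \<le> s * 1 + s powr (2 - 2 * q) * X"
        using s u1 sob[OF u] unfolding X_def by (intro add_mono mult_left_mono) auto
      finally have "s \<le> s powr (2 - 2 * q) * X" by simp
      then have "s powr (2 * q - 2) * s \<le> s powr (2 * q - 2) * (s powr (2 - 2 * q) * X)" by (intro mult_left_mono) auto
      also have "\<dots> = X" using s by (simp add: mult.assoc[symmetric] powr_add[symmetric])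
      also have "s powr (2 * q - 2) * s = s powr (2 * q - 1)"
        using s powr_add[of s "2 * q - 2" 1] by simp
      finally show ?thesis .
    qed
    then show "(L2_inner M u u / 2) powr (2 * q - 1) \<le> (C * E u u) powr q" by (simp add: s_def X_def)
  qed
qed

text \<open>
  Half of the Sobolev dimension: \<open>2 q = 2 d / (d - 2)\<close> for \<open>d = 2 nu\<close>.
\<close>

definition nu :: real where "nu = q / (q - 1)"

lemma nu: "nu > 0" "(nu + 1) * q = nu * (2 * q - 1)" "1 < nu"
proof -
  have 1: "nu + 1 = (2 * q - 1) / (q - 1)" using q by (simp add: nu_def divide_simps)
  show "nu > 0" unfolding nu_def using q by simp
  show "1 < nu" unfolding nu_def using q by simp
  show "(nu + 1) * q = nu * (2 * q - 1)" unfolding 1 unfolding nu_def by simp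
qed

text \<open>
  A product of resolvents with doubling step sizes takes the place of the heat semigroup at a
  time of order \<open>e 2\<^sup>i\<close>. It is a contraction of \<open>L\<^sup>1\<close> like the semigroup, but requires no
  functional calculus.
\<close>

fun smooth :: "real \<Rightarrow> ('a \<Rightarrow> real) \<Rightarrow> nat \<Rightarrow> 'a \<Rightarrow> real" where
  "smooth e g 0 = g"
| "smooth e g (Suc i) = resolvent (e * 2 ^ i) (smooth e g i)"

lemma smooth_L2: "e > 0 \<Longrightarrow> g \<in> L2 M \<Longrightarrow> smooth e g i \<in> L2 M"
  by (induction i) (simp_all add: resolvent_L2)

lemma smooth_L1:
  assumes "e > 0" "g \<in> L2 M" "(\<integral>x. \<bar>g x\<bar> \<partial>M) \<le> 1"
  shows "(\<integral>x. \<bar>smooth e g i x\<bar> \<partial>M) \<le> 1"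
proof (induction i)
  case (Suc i)
  have "(\<integral>x. \<bar>smooth e g (Suc i) x\<bar> \<partial>M) \<le> (\<integral>x. \<bar>smooth e g i x\<bar> \<partial>M)"
    using resolvent_L1[of "e * 2 ^ i" "smooth e g i"] smooth_L2[of e g i] assms by simp
  then show ?case using Suc by linarith
qed (use assms in simp)

lemma cf_smooth:
  assumes "e > 0" "g \<in> L2 M"
  shows "cf (smooth e g i) n * (\<Prod>l<i. 1 + e * 2 ^ l * lam n) = cf g n"
proof (induction i)
  case (Suc i)
  have "1 + e * 2 ^ i * lam n > 0" using assms by (intro add_pos_nonneg) auto
  then have "cf (smooth e g (Suc i)) n * (1 + e * 2 ^ i * lam n) = cf (smooth e g i) n"
    using resolvent(2)[of "e * 2 ^ i" "smooth e g i" n] smooth_L2[OF assms, of i] assms by simp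
  then have "cf (smooth e g (Suc i)) n * (1 + e * 2 ^ i * lam n) * (\<Prod>l<i. 1 + e * 2 ^ l * lam n) = cf g n"
    using Suc by (simp only:)
  then show ?case by (simp only: prod.lessThan_Suc mult_ac)
qed simp

lemma prod_le_exp:
  assumes "e > 0" "L \<ge> (0::real)"
  shows "(\<Prod>l<i. 1 + e * 2 ^ l * L) \<le> exp (e * 2 ^ i * L)"
proof -
  have s: "(\<Sum>l<i. (2::real) ^ l) \<le> 2 ^ i" by (induction i) auto
  have "(\<Prod>l<i. 1 + e * 2 ^ l * L) \<le> (\<Prod>l<i. exp (e * 2 ^ l * L))"
  proof (rule prod_mono)
    fix l
    have "0 \<le> e * 2 ^ l * L" using assms by simp
    then show "0 \<le> 1 + e * 2 ^ l * L \<and> 1 + e * 2 ^ l * L \<le> exp (e * 2 ^ l * L)"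
      using exp_ge_add_one_self[of "e * 2 ^ l * L"] by linarith
  qed
  also have "\<dots> = exp (\<Sum>l<i. e * 2 ^ l * L)" by (simp add: exp_sum)
  also have "(\<Sum>l<i. e * 2 ^ l * L) = e * (\<Sum>l<i. 2 ^ l) * L" by (simp add: sum_distrib_left sum_distrib_right)
  also have "\<dots> \<le> e * 2 ^ i * L" using assms s by (intro mult_right_mono mult_left_mono) auto
  finally show ?thesis by simp
qed

text \<open>
  Ultracontractivity of the smoothing. By Nash's inequality the squared \<open>L\<^sup>2\<close> norm of
  \<open>smooth e g m\<close> is at most \<open>K (e 2\<^sup>m)\<^sup>-\<^sup>\<nu>\<close>, by induction on \<open>m\<close> with the same constant \<open>K\<close>; the
  induction starts because \<open>e\<close> may be chosen as small as necessary in dependence on \<open>g\<close>. With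
  \<open>e 2\<^sup>i = 1 / L\<close> the smoothing damps the modes with \<open>lam n \<le> L\<close> only by a bounded factor.
\<close>

lemma spectral_counting:
  "\<exists>K>0. \<forall>g\<in>L2 M. (\<integral>x. \<bar>g x\<bar> \<partial>M) \<le> 1 \<longrightarrow> (\<forall>L>0. \<forall>N. (\<Sum>n\<in>{n\<in>{..<N}. lam n \<le> L}. (cf g n)\<^sup>2) \<le> K * L powr nu)"
proof -
  obtain C where C: "C > 0" and nash': "\<forall>u\<in>D. (\<integral>x. \<bar>u x\<bar> \<partial>M) \<le> 1 \<longrightarrow> (L2_inner M u u / 2) powr (2 * q - 1) \<le> (C * E u u) powr q"
    using nash by (elim exE conjE)
  note nash = nash'[rule_format]
  define \<theta> where "\<theta> = q / (2 * q - 1)"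
  have th: "\<theta> > 0" "1 - \<theta> = (q - 1) / (2 * q - 1)" "1 - \<theta> > 0"
  proof -
    show "\<theta> > 0" unfolding \<theta>_def using q by simp
    show e: "1 - \<theta> = (q - 1) / (2 * q - 1)" unfolding \<theta>_def using q by (simp add: divide_simps)
    show "1 - \<theta> > 0" unfolding e using q by simp
  qed
  define B where "B = 2 * 2 powr nu * C powr \<theta>"
  have B: "B > 0" using C by (simp add: B_def)
  \<comment> \<open>The fixed point of \<open>K \<mapsto> B K\<^sup>\<theta>\<close>, so that the constant in the induction does not grow.\<close>
  define K where "K = B powr (1 / (1 - \<theta>))"
  have K: "K > 0" using B by (simp add: K_def)
  have KB: "B * K powr \<theta> = K"
  proof -
    have "K powr (1 - \<theta>) = B" using B th(3) by (simp add: K_def powr_powr)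
    then have "B * K powr \<theta> = K powr (1 - \<theta>) * K powr \<theta>" by simp
    also have "\<dots> = K" using K by (simp add: powr_add[symmetric])
    finally show ?thesis .
  qed
  show ?thesis
  proof (intro exI[of _ "exp 2 * K"] conjI ballI allI impI)
    show "exp 2 * K > 0" using K by simp
    fix g L and N :: nat assume g: "g \<in> L2 M" and g1: "(\<integral>x. \<bar>g x\<bar> \<partial>M) \<le> 1" and L: "L > (0::real)"
    have "filterlim (\<lambda>i::nat. K * (L * 2 ^ i) powr nu) at_top sequentially"
      using K L nu(1) by real_asymp
    then have "\<forall>\<^sub>F i in sequentially. L2_inner M g g \<le> K * (L * 2 ^ i) powr nu"
      unfolding filterlim_at_top by (rule spec)
    then obtain i where i: "L2_inner M g g \<le> K * (L * 2 ^ i) powr nu"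
      unfolding eventually_sequentially by blast
    define e where "e = 1 / (L * 2 ^ i)"
    have e: "e > 0" using L by (simp add: e_def)
    have base: "L2_inner M g g \<le> K * e powr (- nu)"
    proof -
      have "e powr (- nu) = (L * 2 ^ i) powr nu" using L unfolding e_def by (simp add: powr_minus powr_divide)
      then show ?thesis using i by simp
    qed
    have decay: "L2_inner M (smooth e g m) (smooth e g m) \<le> K * (e * 2 ^ m) powr (- nu)" for m
    proof (induction m)
      case 0
      then show ?case using base by simp
    next
      case (Suc m)
      define h where "h = e * 2 ^ m"
      have h: "h > 0" using e by (simp add: h_def)
      define w where "w = smooth e g m"
      define w' where "w' = smooth e g (Suc m)"
      have wL: "w \<in> L2 M" unfolding w_def by (rule smooth_L2[OF e g])
      have w': "w' = resolvent h w" by (simp add: w'_def w_def h_def)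
      have w'D: "w' \<in> D" unfolding w' by (rule resolvent(1)[OF h wL])
      define y where "y = L2_inner M w w"
      define y' where "y' = L2_inner M w' w'"
      have y0: "y \<ge> 0" "y' \<ge> 0" by (simp_all add: y_def y'_def)
      have yK: "y \<le> K * h powr (- nu)" using Suc by (simp add: y_def w_def h_def)
      have "h * E w' w' \<le> y" unfolding w' y_def by (rule resolvent_energy[OF h wL])
      then have "E w' w' \<le> y / h" using h by (simp add: field_simps)
      also have "\<dots> \<le> K * h powr (- nu) / h" using yK h by (intro divide_right_mono) auto
      also have "\<dots> = K * h powr (- (nu + 1))"
      proof -
        have "h powr (- (nu + 1)) = h powr (- nu) / h" using h powr_add[of h "- nu" "-1"] by (simp add: powr_minus divide_inverse)
        then show ?thesis by simp
      qed
      finally have Ew: "E w' w' \<le> K * h powr (- (nu + 1))" .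
      have "(y' / 2) powr (2 * q - 1) \<le> (C * E w' w') powr q"
        unfolding y'_def by (rule nash[OF w'D]) (simp only: w'_def, rule smooth_L1[OF e g g1])
      also have "\<dots> \<le> (C * (K * h powr (- (nu + 1)))) powr q"
        using C q Ew E_nonneg[OF w'D] by (intro powr_mono2 mult_left_mono) auto
      also have "\<dots> = (C * K) powr q * h powr (- (nu * (2 * q - 1)))"
      proof -
        have "(C * (K * h powr (- (nu + 1)))) powr q = ((C * K) * h powr (- (nu + 1))) powr q" by (simp only: mult.assoc)
        also have "\<dots> = (C * K) powr q * (h powr (- (nu + 1))) powr q" by (rule powr_mult)
        also have "(h powr (- (nu + 1))) powr q = h powr (- ((nu + 1) * q))" unfolding powr_powr by (simp only: mult_minus_left)
        finally show ?thesis unfolding nu(2) .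
      qed
      finally have A: "(y' / 2) powr (2 * q - 1) \<le> (C * K) powr q * h powr (- (nu * (2 * q - 1)))" .
      have "((y' / 2) powr (2 * q - 1)) powr (1 / (2 * q - 1)) \<le> ((C * K) powr q * h powr (- (nu * (2 * q - 1)))) powr (1 / (2 * q - 1))"
        using A q by (intro powr_mono2) auto
      moreover have "((y' / 2) powr (2 * q - 1)) powr (1 / (2 * q - 1)) = y' / 2" using q y0 by (simp add: powr_powr)
      moreover have "((C * K) powr q * h powr (- (nu * (2 * q - 1)))) powr (1 / (2 * q - 1)) = (C * K) powr \<theta> * h powr (- nu)"
      proof -
        have "((C * K) powr q * h powr (- (nu * (2 * q - 1)))) powr (1 / (2 * q - 1))
            = ((C * K) powr q) powr (1 / (2 * q - 1)) * (h powr (- (nu * (2 * q - 1)))) powr (1 / (2 * q - 1))"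
          by (rule powr_mult)
        also have "((C * K) powr q) powr (1 / (2 * q - 1)) = (C * K) powr \<theta>" by (simp add: powr_powr \<theta>_def)
        also have "(h powr (- (nu * (2 * q - 1)))) powr (1 / (2 * q - 1)) = h powr (- nu)" using q by (simp add: powr_powr)
        finally show ?thesis .
      qed
      ultimately have "y' \<le> 2 * ((C * K) powr \<theta> * h powr (- nu))" by simp
      also have "h powr (- nu) = 2 powr nu * (h * 2) powr (- nu)"
        using h by (simp add: powr_mult powr_minus)
      also have "2 * ((C * K) powr \<theta> * (2 powr nu * (h * 2) powr (- nu))) = (B * K powr \<theta>) * (h * 2) powr (- nu)"
      proof -
        have "(C * K) powr \<theta> = C powr \<theta> * K powr \<theta>" by (rule powr_mult)
        then show ?thesis unfolding B_def by (simp only: mult_ac)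
      qed
      finally have "y' \<le> K * (h * 2) powr (- nu)" unfolding KB .
      moreover have "h * 2 = e * 2 ^ Suc m" by (simp add: h_def)
      ultimately show ?case unfolding y'_def w'_def by (simp only:)
    qed
    have eL: "e * 2 ^ i = 1 / L" using L by (simp add: e_def)
    define P where "P n = (\<Prod>l<i. 1 + e * 2 ^ l * lam n)" for n
    have P1: "1 \<le> P n" for n unfolding P_def by (rule prod_ge_1) (use e in auto)
    have "(cf g n)\<^sup>2 \<le> exp 2 * (cf (smooth e g i) n)\<^sup>2" if n: "lam n \<le> L" for n
    proof -
      have "P n \<le> exp (e * 2 ^ i * lam n)" unfolding P_def by (rule prod_le_exp[OF e lam_nonneg])
      also have "\<dots> \<le> exp 1" unfolding eL using n L by simp
      finally have "P n \<le> exp 1" .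
      then have "(P n)\<^sup>2 \<le> (exp 1)\<^sup>2" using P1[of n] by (intro power_mono) auto
      also have "(exp (1::real))\<^sup>2 = exp 2" by (simp add: power2_eq_square flip: exp_add)
      finally have "(P n)\<^sup>2 * (cf (smooth e g i) n)\<^sup>2 \<le> exp 2 * (cf (smooth e g i) n)\<^sup>2" by (intro mult_right_mono) auto
      moreover have "(cf g n)\<^sup>2 = (P n)\<^sup>2 * (cf (smooth e g i) n)\<^sup>2"
        unfolding cf_smooth[OF e g, of i n, symmetric] P_def by (simp only: power_mult_distrib mult.commute)
      ultimately show ?thesis by simp
    qed
    then have "(\<Sum>n\<in>{n\<in>{..<N}. lam n \<le> L}. (cf g n)\<^sup>2) \<le> (\<Sum>n\<in>{n\<in>{..<N}. lam n \<le> L}. exp 2 * (cf (smooth e g i) n)\<^sup>2)"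
      by (intro sum_mono) auto
    also have "\<dots> = exp 2 * (\<Sum>n\<in>{n\<in>{..<N}. lam n \<le> L}. (cf (smooth e g i) n)\<^sup>2)" by (simp add: sum_distrib_left)
    also have "\<dots> \<le> exp 2 * L2_inner M (smooth e g i) (smooth e g i)"
    proof (intro mult_left_mono)
      have ps: "(\<lambda>n. (cf (smooth e g i) n)\<^sup>2) sums L2_inner M (smooth e g i) (smooth e g i)" by (rule parseval[OF smooth_L2[OF e g]])
      show "(\<Sum>n\<in>{n\<in>{..<N}. lam n \<le> L}. (cf (smooth e g i) n)\<^sup>2) \<le> L2_inner M (smooth e g i) (smooth e g i)"
        using sum_le_suminf[OF sums_summable[OF ps], of "{n\<in>{..<N}. lam n \<le> L}"] sums_unique[OF ps] by simp
    qed simp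
    also have "\<dots> \<le> exp 2 * (K * (e * 2 ^ i) powr (- nu))" using decay by (intro mult_left_mono) auto
    also have "(e * 2 ^ i) powr (- nu) = L powr nu" unfolding eL using L by (simp add: powr_minus powr_divide)
    finally show "(\<Sum>n\<in>{n\<in>{..<N}. lam n \<le> L}. (cf g n)\<^sup>2) \<le> exp 2 * K * L powr nu" by (simp add: mult.assoc)
  qed
qed

text \<open>
  Sum the previous bound over the dyadic scales \<open>lam 0 * 2 ^ j\<close>; the resulting geometric series
  converges precisely because \<open>2 * \<gamma> > nu\<close>. In other words, \<open>L\<^sup>1\<close> is contained in the dual of
  \<open>V\<^sub>\<gamma>\<close>.
\<close>

lemma negative_power_bound:
  assumes gam: "2 * \<gamma> > nu"
  shows "\<exists>C\<ge>0. \<forall>g\<in>L2 M. (\<integral>x. \<bar>g x\<bar> \<partial>M) \<le> 1 \<longrightarrow> (\<forall>N. (\<Sum>n<N. (cf g n)\<^sup>2 * lam n powr (- 2 * \<gamma>)) \<le> C)"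
proof -
  obtain K where K: "K > 0" and count': "\<forall>g\<in>L2 M. (\<integral>x. \<bar>g x\<bar> \<partial>M) \<le> 1 \<longrightarrow> (\<forall>L>0. \<forall>N. (\<Sum>n\<in>{n\<in>{..<N}. lam n \<le> L}. (cf g n)\<^sup>2) \<le> K * L powr nu)"
    using spectral_counting by (elim exE conjE)
  note count = count'[rule_format]
  have g0: "\<gamma> > 0" using gam nu(1) by linarith
  define r where "r = 2 powr (nu - 2 * \<gamma>)"
  have r: "0 < r" "r < 1" using gam by (auto simp: r_def powr_less_one)
  define C where "C = 2 powr (2 * \<gamma>) * (K * lam 0 powr (nu - 2 * \<gamma>) * (1 / (1 - r)))"
  show ?thesis
  proof (intro exI[of _ C] conjI ballI allI impI)
    show "C \<ge> 0" using K r by (simp add: C_def)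
    fix g and N :: nat assume g: "g \<in> L2 M" and g1: "(\<integral>x. \<bar>g x\<bar> \<partial>M) \<le> 1"
    define T where "T j = lam 0 * 2 ^ j" for j :: nat
    let ?g = "\<lambda>n j. if lam n \<le> T j then (cf g n)\<^sup>2 else 0"
    have T: "T j > 0" for j using lam_0 by (simp add: T_def)
    have ex: "\<exists>j. lam n \<le> T j" for n
    proof -
      obtain j where "lam n / lam 0 < 2 ^ j" using real_arch_pow[of 2 "lam n / lam 0"] by auto
      then have "lam n \<le> T j" using lam_0 by (simp add: T_def field_simps)
      then show ?thesis ..
    qed
    \<comment> \<open>The dyadic scale of the mode \<open>n\<close>.\<close>
    define J where "J n = (LEAST j. lam n \<le> T j)" for n
    have J1: "lam n \<le> T (J n)" for n unfolding J_def by (rule LeastI_ex[OF ex])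
    have J2: "lam n powr (- 2 * \<gamma>) \<le> 2 powr (2 * \<gamma>) * T (J n) powr (- 2 * \<gamma>)" for n
    proof -
      have "T (J n) / 2 \<le> lam n"
      proof (cases "J n")
        case 0
        have "lam 0 / 2 \<le> lam n" using lam_ge[of n] lam_0 by linarith
        then show ?thesis unfolding 0 T_def by simp
      next
        case (Suc j)
        then have "\<not> lam n \<le> T j" using not_less_Least[of j "\<lambda>j. lam n \<le> T j"] by (simp add: J_def)
        then show ?thesis using Suc by (simp add: T_def)
      qed
      then have "lam n powr (- 2 * \<gamma>) \<le> (T (J n) / 2) powr (- 2 * \<gamma>)"
        using T[of "J n"] g0 by (intro powr_mono2') auto
      also have "\<dots> = 2 powr (2 * \<gamma>) * T (J n) powr (- 2 * \<gamma>)"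
      proof -
        have "(T (J n) / 2) powr (- 2 * \<gamma>) = T (J n) powr (- 2 * \<gamma>) / 2 powr (- 2 * \<gamma>)"
          by (rule powr_divide)
        also have "2 powr (- 2 * \<gamma>) = inverse (2 powr (2 * \<gamma>))" by (simp add: powr_minus)
        finally show ?thesis by (simp only: divide_inverse inverse_inverse_eq mult.commute)
      qed
      finally show ?thesis .
    qed
    define m where "m = Max (insert 0 (J ` {..<N}))"
    have Jm: "J n \<le> m" if "n < N" for n unfolding m_def using that by (intro Max_ge) auto
    have "(\<Sum>n<N. (cf g n)\<^sup>2 * lam n powr (- 2 * \<gamma>)) \<le> (\<Sum>n<N. 2 powr (2 * \<gamma>) * (\<Sum>j\<le>m. T j powr (- 2 * \<gamma>) * ?g n j))"
    proof (rule sum_mono)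
      fix n assume n: "n \<in> {..<N}"
      have "(cf g n)\<^sup>2 * lam n powr (- 2 * \<gamma>) \<le> (cf g n)\<^sup>2 * (2 powr (2 * \<gamma>) * T (J n) powr (- 2 * \<gamma>))"
        by (intro mult_left_mono J2) simp
      also have "\<dots> = 2 powr (2 * \<gamma>) * (T (J n) powr (- 2 * \<gamma>) * (if lam n \<le> T (J n) then (cf g n)\<^sup>2 else 0))"
        using J1[of n] by simp
      also have "\<dots> \<le> 2 powr (2 * \<gamma>) * (\<Sum>j\<le>m. T j powr (- 2 * \<gamma>) * ?g n j)"
        by (intro mult_left_mono member_le_sum) (use Jm n in auto)
      finally show "(cf g n)\<^sup>2 * lam n powr (- 2 * \<gamma>) \<le> 2 powr (2 * \<gamma>) * (\<Sum>j\<le>m. T j powr (- 2 * \<gamma>) * ?g n j)" .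
    qed
    also have "\<dots> = 2 powr (2 * \<gamma>) * (\<Sum>n<N. \<Sum>j\<le>m. T j powr (- 2 * \<gamma>) * ?g n j)"
      by (rule sum_distrib_left[symmetric])
    finally have outer: "(\<Sum>n<N. (cf g n)\<^sup>2 * lam n powr (- 2 * \<gamma>)) \<le>
        2 powr (2 * \<gamma>) * (\<Sum>n<N. \<Sum>j\<le>m. T j powr (- 2 * \<gamma>) * ?g n j)" .
    have "(\<Sum>n<N. \<Sum>j\<le>m. T j powr (- 2 * \<gamma>) * ?g n j)
        = (\<Sum>j\<le>m. T j powr (- 2 * \<gamma>) * (\<Sum>n<N. ?g n j))"
      unfolding sum_distrib_left by (rule sum.swap)
    also have "\<dots> = (\<Sum>j\<le>m. T j powr (- 2 * \<gamma>) * (\<Sum>n\<in>{n\<in>{..<N}. lam n \<le> T j}. (cf g n)\<^sup>2))"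
      by (rule sum.cong[OF refl], subst sum.inter_filter) simp_all
    also have "\<dots> \<le> (\<Sum>j\<le>m. T j powr (- 2 * \<gamma>) * (K * T j powr nu))"
      by (intro sum_mono mult_left_mono count g g1 T) simp
    also have "\<dots> = (\<Sum>j\<le>m. K * lam 0 powr (nu - 2 * \<gamma>) * r ^ j)"
    proof (rule sum.cong[OF refl])
      fix j
      have "T j powr (- 2 * \<gamma>) * (K * T j powr nu) = K * T j powr (nu - 2 * \<gamma>)"
      proof -
        have "T j powr (nu - 2 * \<gamma>) = T j powr (- 2 * \<gamma>) * T j powr nu" unfolding powr_add[symmetric] by simp
        then show ?thesis by (simp only: mult_ac)
      qed
      also have "T j powr (nu - 2 * \<gamma>) = lam 0 powr (nu - 2 * \<gamma>) * (2 ^ j) powr (nu - 2 * \<gamma>)"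
        unfolding T_def using lam_0 by (simp add: powr_mult)
      also have "(2 ^ j) powr (nu - 2 * \<gamma>) = r ^ j"
      proof -
        have "(2 ^ j) powr (nu - 2 * \<gamma>) = (2 powr real j) powr (nu - 2 * \<gamma>)" by (simp add: powr_realpow)
        also have "\<dots> = r powr real j" unfolding r_def powr_powr by (simp only: mult.commute)
        also have "\<dots> = r ^ j" using r(1) by (rule powr_realpow)
        finally show ?thesis .
      qed
      finally show "T j powr (- 2 * \<gamma>) * (K * T j powr nu) = K * lam 0 powr (nu - 2 * \<gamma>) * r ^ j" by simp
    qed
    also have "\<dots> = K * lam 0 powr (nu - 2 * \<gamma>) * (\<Sum>j\<le>m. r ^ j)" by (simp only: sum_distrib_left)
    also have "\<dots> \<le> K * lam 0 powr (nu - 2 * \<gamma>) * (1 / (1 - r))"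
    proof (intro mult_left_mono)
      have "(\<Sum>j\<in>{..m}. r ^ j) \<le> (\<Sum>j. r ^ j)" using r by (intro sum_le_suminf summable_geometric) auto
      then show "(\<Sum>j\<le>m. r ^ j) \<le> 1 / (1 - r)" using r by (simp add: suminf_geometric)
    qed (use K in simp)
    finally have "2 powr (2 * \<gamma>) * (\<Sum>n<N. \<Sum>j\<le>m. T j powr (- 2 * \<gamma>) * ?g n j) \<le> C"
      unfolding C_def by (rule mult_left_mono) simp
    with outer show "(\<Sum>n<N. (cf g n)\<^sup>2 * lam n powr (- 2 * \<gamma>)) \<le> C" by (rule order_trans)
  qed
qed

lemma inner_le_dual:
  assumes h: "h \<in> Vsp M \<phi> lam \<gamma>" and g: "g \<in> L2 M" and C: "\<And>N. (\<Sum>n<N. (cf g n)\<^sup>2 * lam n powr (- 2 * \<gamma>)) \<le> C"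
  shows "L2_inner M h g \<le> Vnorm M \<phi> lam \<gamma> h * sqrt C"
proof -
  have hL: "h \<in> L2 M" and s: "summable (\<lambda>n. (cf h n)\<^sup>2 * lam n powr (2 * \<gamma>))" using h by (simp_all add: Vsp_def)
  have "(\<lambda>N. \<Sum>n<N. cf h n * cf g n) \<longlonglongrightarrow> L2_inner M h g" using parseval_inner[OF hL g] by (simp add: sums_def)
  moreover have "(\<Sum>n<N. cf h n * cf g n) \<le> Vnorm M \<phi> lam \<gamma> h * sqrt C" for N
  proof -
    have "cf h n * cf g n = (cf h n * lam n powr \<gamma>) * (cf g n * lam n powr (- \<gamma>))" for n
    proof -
      have "lam n powr \<gamma> * lam n powr (- \<gamma>) = 1" using less_imp_neq[OF lam_pos[of n]] by (simp add: powr_minus)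
      then have "cf h n * cf g n = cf h n * cf g n * (lam n powr \<gamma> * lam n powr (- \<gamma>))" by simp
      then show ?thesis by (simp only: mult_ac)
    qed
    then have "cf h n * cf g n \<le> \<bar>cf h n * lam n powr \<gamma>\<bar> * \<bar>cf g n * lam n powr (- \<gamma>)\<bar>" for n
      unfolding abs_mult[symmetric] by (simp only: abs_ge_self)
    then have "(\<Sum>n<N. cf h n * cf g n) \<le> (\<Sum>n<N. \<bar>cf h n * lam n powr \<gamma>\<bar> * \<bar>cf g n * lam n powr (- \<gamma>)\<bar>)"
      by (rule sum_mono)
    also have "\<dots> \<le> L2_set (\<lambda>n. cf h n * lam n powr \<gamma>) {..<N} * L2_set (\<lambda>n. cf g n * lam n powr (- \<gamma>)) {..<N}"
      by (rule L2_set_mult_ineq)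
    also have "\<dots> \<le> Vnorm M \<phi> lam \<gamma> h * sqrt C"
    proof (rule mult_mono)
      have e: "(cf h n * lam n powr \<gamma>)\<^sup>2 = (cf h n)\<^sup>2 * lam n powr (2 * \<gamma>)" for n
        unfolding power_mult_distrib powr_square ..
      show "L2_set (\<lambda>n. cf h n * lam n powr \<gamma>) {..<N} \<le> Vnorm M \<phi> lam \<gamma> h"
        unfolding L2_set_def Vnorm_def e by (intro real_sqrt_le_mono sum_le_suminf s) auto
      have e': "(cf g n * lam n powr (- \<gamma>))\<^sup>2 = (cf g n)\<^sup>2 * lam n powr (- 2 * \<gamma>)" for n
        unfolding power_mult_distrib powr_square by simp
      show "L2_set (\<lambda>n. cf g n * lam n powr (- \<gamma>)) {..<N} \<le> sqrt C"
        unfolding L2_set_def e' by (intro real_sqrt_le_mono C)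
      show "0 \<le> Vnorm M \<phi> lam \<gamma> h" unfolding Vnorm_def by (intro real_sqrt_ge_zero suminf_nonneg s) auto
    qed (rule L2_set_nonneg)
    finally show ?thesis .
  qed
  ultimately show ?thesis by (intro LIMSEQ_le_const2) auto
qed

text \<open>
  Dual to the previous bound: if \<open>h\<close> exceeded the constant on a set of positive measure, the
  normalized indicator function of that set would violate the estimate for the pairing.
\<close>

theorem embedding_Linfty:
  assumes gam: "2 * \<gamma> > nu"
  shows "\<exists>C\<ge>0. \<forall>h\<in>Vsp M \<phi> lam \<gamma>. AE x in M. \<bar>h x\<bar> \<le> C * Vnorm M \<phi> lam \<gamma> h"
proof -
  interpret finite_measure M by (rule fin)
  obtain C where C: "C \<ge> 0" and neg': "\<forall>g\<in>L2 M. (\<integral>x. \<bar>g x\<bar> \<partial>M) \<le> 1 \<longrightarrow> (\<forall>N. (\<Sum>n<N. (cf g n)\<^sup>2 * lam n powr (- 2 * \<gamma>)) \<le> C)"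
    using negative_power_bound[OF gam] by (elim exE conjE)
  note neg = neg'[rule_format]
  have one_sided: "AE x in M. h x \<le> sqrt C * Vnorm M \<phi> lam \<gamma> h" if h: "h \<in> Vsp M \<phi> lam \<gamma>" for h
  proof -
    define c where "c = sqrt C * Vnorm M \<phi> lam \<gamma> h"
    have hL: "h \<in> L2 M" using h by (simp add: Vsp_def)
    have hm [measurable]: "h \<in> borel_measurable M" by (rule L2_borel[OF hL])
    define S where "S = {x\<in>space M. h x > c}"
    have S [measurable]: "S \<in> sets M" unfolding S_def by measurable
    have "AE x in M. x \<notin> S"
    proof (cases "measure M S = 0")
      case True
      then have "S \<in> null_sets M" using S by (intro null_setsI) (simp_all add: emeasure_eq_measure)
      then show ?thesis by (rule AE_not_in)
    next
      case False
      then have m: "measure M S > 0" using measure_nonneg[of M S] by linarith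
      define g where "g = (\<lambda>x. (1 / measure M S) * indicator S x)"
      have iS: "(indicator S :: 'a \<Rightarrow> real) \<in> L2 M"
      proof -
        have "(\<lambda>_. 1) \<in> L2 M" by (simp add: L2_def)
        then show ?thesis by (rule L2_norm_mono(1)[where K=1, rotated]) (auto simp: indicator_def)
      qed
      have gL: "g \<in> L2 M" unfolding g_def by (rule L2_scale[OF iS])
      have iSi: "integrable M (\<lambda>x. indicator S x :: real)" by (rule L2_integrable(1)[OF fin iS])
      have "(\<integral>x. \<bar>g x\<bar> \<partial>M) = (\<integral>x. (1 / measure M S) * indicator S x \<partial>M)"
        unfolding g_def by (rule Bochner_Integration.integral_cong) (auto simp: indicator_def)
      also have "\<dots> = 1" using m S by simp
      finally have g1: "(\<integral>x. \<bar>g x\<bar> \<partial>M) \<le> 1" by simp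
      have "L2_inner M h g \<le> c"
        unfolding c_def using inner_le_dual[OF h gL neg[OF gL g1]] by (simp add: mult.commute)
      moreover have "L2_inner M h g = (1 / measure M S) * L2_inner M (indicator S) h"
        using L2_inner_scale[of M "1 / measure M S" "indicator S" h] L2_inner_commute[of M h g] by (simp only: g_def)
      ultimately have "L2_inner M (indicator S) h \<le> c * measure M S" using m by (simp add: field_simps)
      moreover have "c * measure M S = (\<integral>x. c * indicator S x \<partial>M)" using S by simp
      moreover have "(\<integral>x. indicator S x * h x - c * indicator S x \<partial>M) = (\<integral>x. indicator S x * h x \<partial>M) - (\<integral>x. c * indicator S x \<partial>M)"
        by (rule Bochner_Integration.integral_diff[OF L2_prod[OF iS hL] integrable_mult_right[OF iSi]])
      ultimately have le: "(\<integral>x. indicator S x * h x - c * indicator S x \<partial>M) \<le> 0"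
        unfolding L2_inner_def by linarith
      have int: "integrable M (\<lambda>x. indicator S x * h x - c * indicator S x)"
        by (rule Bochner_Integration.integrable_diff[OF L2_prod[OF iS hL] integrable_mult_right[OF iSi]])
      have nn: "0 \<le> indicator S x * h x - c * indicator S x" for x by (auto simp: S_def indicator_def)
      have "(\<integral>x. indicator S x * h x - c * indicator S x \<partial>M) = 0"
        using le Bochner_Integration.integral_nonneg[of M "\<lambda>x. indicator S x * h x - c * indicator S x", OF nn] by linarith
      then have "AE x in M. indicator S x * h x - c * indicator S x = 0"
        using integral_nonneg_eq_0_iff_AE[OF int] nn by simp
      then show ?thesis by eventually_elim (auto simp: S_def indicator_def split: if_splits)
    qed
    with AE_space show ?thesis by eventually_elim (auto simp: S_def c_def not_less)
  qed
  show ?thesis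
  proof (intro exI[of _ "sqrt C"] conjI ballI)
    show "sqrt C \<ge> 0" using C by simp
    fix h assume h: "h \<in> Vsp M \<phi> lam \<gamma>"
    then have hL: "h \<in> L2 M" by (simp add: Vsp_def)
    define k where "k = (\<lambda>x. (-1) * h x)"
    have sq: "(cf k n)\<^sup>2 = (cf h n)\<^sup>2" for n
      unfolding k_def L2_inner_scale by simp
    have m1: "k \<in> Vsp M \<phi> lam \<gamma>"
      using h L2_scale[OF hL, of "-1"] unfolding Vsp_def mem_Collect_eq sq unfolding k_def by simp
    have m2: "Vnorm M \<phi> lam \<gamma> k = Vnorm M \<phi> lam \<gamma> h"
      by (simp only: Vnorm_def sq)
    note m3 = one_sided[OF m1, unfolded m2]
    show "AE x in M. \<bar>h x\<bar> \<le> sqrt C * Vnorm M \<phi> lam \<gamma> h"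
    proof (rule AE_mp[OF one_sided[OF h] AE_mp[OF m3]], rule AE_I2, intro impI)
      fix x assume "k x \<le> sqrt C * Vnorm M \<phi> lam \<gamma> h" and le: "h x \<le> sqrt C * Vnorm M \<phi> lam \<gamma> h"
      then have "- h x \<le> sqrt C * Vnorm M \<phi> lam \<gamma> h" by (simp add: k_def)
      with le show "\<bar>h x\<bar> \<le> sqrt C * Vnorm M \<phi> lam \<gamma> h" by (rule abs_leI)
    qed
  qed
qed

end

section \<open>Measurability in time from the coefficients\<close>

lemma borel_measurable_on_interval:
  assumes "continuous_on {0<..<T::real} c"
  shows "(\<lambda>t. indicator {0<..<T} t * c t :: real) \<in> borel_measurable lborel"
  using borel_measurable_continuous_on_indicator[OF _ assms] by simp

definition round_cut :: "real \<Rightarrow> nat \<Rightarrow> real \<Rightarrow> real" where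
  "round_cut d k x = (if \<bar>x\<bar> \<le> real k then d * of_int \<lfloor>x / d\<rfloor> else 0)"

lemma round_cut_error:
  assumes "d > 0" "\<bar>x\<bar> \<le> real k"
  shows "\<bar>x - round_cut d k x\<bar> \<le> d"
proof -
  have "of_int \<lfloor>x / d\<rfloor> \<le> x / d" "x / d < of_int \<lfloor>x / d\<rfloor> + 1" by linarith+
  from mult_left_mono[OF this(1), of d] mult_strict_left_mono[OF this(2), of d]
  have "d * of_int \<lfloor>x / d\<rfloor> \<le> x" "x < d * of_int \<lfloor>x / d\<rfloor> + d"
    using assms(1) by (simp_all add: distrib_left)
  then show ?thesis using assms(2) by (simp add: round_cut_def)
qed

lemma finite_range_round_cut:
  assumes "d > 0"
  shows "finite (range (round_cut d k))"
proof (rule finite_subset)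
  define m where "m = \<lceil>real k / d\<rceil> + 1"
  show "range (round_cut d k) \<subseteq> insert 0 ((\<lambda>z. d * of_int z) ` {- m..m})"
  proof
    fix y assume "y \<in> range (round_cut d k)"
    then obtain x where y: "y = round_cut d k x" by blast
    show "y \<in> insert 0 ((\<lambda>z. d * of_int z) ` {- m..m})"
    proof (cases "\<bar>x\<bar> \<le> real k")
      case True
      have "\<bar>x / d\<bar> \<le> real k / d" using True assms by (simp add: divide_right_mono)
      then have "x / d \<le> real k / d" "- (real k / d) \<le> x / d" by (simp_all only: abs_le_iff) linarith
      then have "\<lfloor>x / d\<rfloor> \<le> m" "- m \<le> \<lfloor>x / d\<rfloor>" unfolding m_def by linarith+
      then have "\<lfloor>x / d\<rfloor> \<in> {- m..m}" by simp
      then show ?thesis using True by (auto simp: y round_cut_def)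
    next
      case False
      then show ?thesis by (simp add: y round_cut_def)
    qed
  qed
qed simp

lemma round_cut_measurable [measurable]: "round_cut d k \<in> borel_measurable borel"
proof -
  have "(\<lambda>x::real. x * inverse d) \<in> borel_measurable borel"
    by (rule borel_measurable_continuous_onI) (intro continuous_on_mult_right continuous_on_id)
  from measurable_compose[OF this borel_measurable_real_floor]
  have fl: "(\<lambda>x. real_of_int \<lfloor>x / d\<rfloor>) \<in> borel_measurable borel"
    by (simp only: divide_inverse)
  have "round_cut d k = (\<lambda>x. d * real_of_int \<lfloor>x / d\<rfloor> * indicator {- real k..real k} x)"
    by (rule ext) (auto simp: round_cut_def abs_le_iff indicator_def)
  also have "\<dots> \<in> borel_measurable borel"
    by (rule borel_measurable_times[OF borel_measurable_times[OF borel_measurable_const fl]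
          borel_measurable_indicator[OF borel_closed[OF closed_atLeastAtMost]]])
  finally show ?thesis .
qed

context L2_basis
begin

lemma psum_cong: "(\<And>n. n < k \<Longrightarrow> c n = c' n) \<Longrightarrow> psum c k = psum c' k"
  by (auto simp: psum_def intro!: sum.cong)

lemma simple_into_round:
  assumes V: "\<And>c k. psum c k \<in> V" and cont: "\<And>n. continuous_on {0<..<T} (\<lambda>t. cf (u t) n)" and d: "d > 0"
  shows "simple_into V T (\<lambda>t. psum (\<lambda>n. round_cut d k (cf (u t) n)) k)"
proof -
  define S where "S = (\<lambda>t. psum (\<lambda>n. round_cut d k (cf (u t) n)) k)"
  define r where "r t = (\<lambda>n\<in>{..<k}. round_cut d k (cf (u t) n))" for t
  define Q where "Q = PiE {..<k} (\<lambda>_::nat. range (round_cut d k))"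
  have finQ: "finite Q" unfolding Q_def by (intro finite_PiE finite_range_round_cut d) auto
  have rQ: "r t \<in> Q" for t unfolding r_def Q_def by auto
  have Sr: "S t = psum (r t) k" for t unfolding S_def r_def by (rule psum_cong) simp
  have "S ` {0<..<T} \<subseteq> (\<lambda>\<rho>. psum \<rho> k) ` Q" using rQ by (auto simp: Sr)
  then have fin: "finite (S ` {0<..<T})" using finQ by (meson finite_imageI finite_subset)
  have lev: "{t\<in>{0<..<T}. r t = \<rho>} \<in> sets lebesgue" if \<rho>: "\<rho> \<in> Q" for \<rho>
  proof -
    define c where "c n t = indicator {0<..<T} t * cf (u t) n" for n t
    have [measurable]: "c n \<in> borel_measurable lborel" for n
      unfolding c_def[abs_def] by (rule borel_measurable_on_interval[OF cont])
    have "{t\<in>{0<..<T}. r t = \<rho>} = {t\<in>space lborel. t \<in> {0<..<T} \<and> (\<forall>n\<in>{..<k}. round_cut d k (c n t) = \<rho> n)}"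
    proof -
      have "r t = \<rho> \<longleftrightarrow> (\<forall>n\<in>{..<k}. round_cut d k (c n t) = \<rho> n)" if "t \<in> {0<..<T}" for t
      proof -
        have ext: "r t \<in> extensional {..<k}" "\<rho> \<in> extensional {..<k}"
          using rQ[of t] \<rho> by (auto simp: Q_def PiE_def)
        have "r t = \<rho> \<longleftrightarrow> (\<forall>n\<in>{..<k}. r t n = \<rho> n)"
          using extensionalityI[OF ext] by auto
        then show ?thesis using that by (simp add: r_def c_def)
      qed
      then show ?thesis by auto
    qed
    also have "\<dots> \<in> sets lborel" by measurable
    finally show ?thesis by (rule sets_completionI_sets)
  qed
  have "{t\<in>{0<..<T}. S t = v} \<in> sets lebesgue" for v
  proof -
    have "{t\<in>{0<..<T}. S t = v} = (\<Union>\<rho>\<in>{\<rho>\<in>Q. psum \<rho> k = v}. {t\<in>{0<..<T}. r t = \<rho>})"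
      using rQ by (auto simp: Sr)
    also have "\<dots> \<in> sets lebesgue" by (intro sets.finite_UN) (use finQ lev in auto)
    finally show ?thesis .
  qed
  then show ?thesis unfolding simple_into_def S_def[symmetric] using fin V by (auto simp: S_def)
qed

text \<open>
  Strongly measurable approximants are partial sums with rounded coefficients. The rounding step
  \<open>d k\<close> is so small that the rounding errors of the first \<open>k\<close> coefficients are negligible in the
  weighted norm, and the remaining error is the tail of a convergent series.
\<close>

lemma L1_into_coefficients:
  assumes V: "\<And>c k. psum c k \<in> V" and \<omega>: "\<And>n. \<omega> n > 0" "\<And>n. w0 \<le> \<omega> n" "w0 > 0"
    and N: "\<And>h. h \<in> L2 M \<Longrightarrow> N h = sqrt (\<Sum>n. \<omega> n * (cf h n)\<^sup>2)"
    and u: "\<And>t. 0 < t \<Longrightarrow> t < T \<Longrightarrow> u t \<in> V" "\<And>t. 0 < t \<Longrightarrow> t < T \<Longrightarrow> u t \<in> L2 M"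
    and s: "\<And>t. 0 < t \<Longrightarrow> t < T \<Longrightarrow> summable (\<lambda>n. \<omega> n * (cf (u t) n)\<^sup>2)"
    and cont: "\<And>n. continuous_on {0<..<T} (\<lambda>t. cf (u t) n)"
    and B: "set_integrable lborel {0<..<T} B" "\<And>t. 0 < t \<Longrightarrow> t < T \<Longrightarrow> N (u t) \<le> B t"
  shows "L1_into V N T u"
proof -
  have \<omega>0: "\<omega> n \<ge> 0" for n using less_imp_le[OF \<omega>(1)] .
  \<comment> \<open>Chosen such that \<open>\<Sum>n<k. \<omega> n * (d k)\<^sup>2\<close> tends to zero.\<close>
  define d where "d k = (1/2)^k / (1 + (\<Sum>n<k. \<omega> n))" for k
  have sw: "(\<Sum>n<k. \<omega> n) \<ge> 0" for k by (rule sum_nonneg) (rule \<omega>0)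
  have d: "d k > 0" for k using sw[of k] by (simp add: d_def add_pos_nonneg)
  have d2: "(\<Sum>n<k. \<omega> n * (d k)\<^sup>2) \<le> (1/4)^k" for k
  proof -
    define s' where "s' = (\<Sum>n<k. \<omega> n)"
    have s': "s' \<ge> 0" using sw by (simp add: s'_def)
    have "s' \<le> (1 + s')\<^sup>2" using s' by (simp add: power2_eq_square ring_distribs)
    then have "s' / (1 + s')\<^sup>2 \<le> 1" using s' by (simp add: divide_le_eq)
    then have "(1/4)^k * (s' / (1 + s')\<^sup>2) \<le> (1/4)^k * 1" by (intro mult_left_mono) auto
    moreover have "(\<Sum>n<k. \<omega> n * (d k)\<^sup>2) = (1/4)^k * (s' / (1 + s')\<^sup>2)"
    proof -
      have A: "(\<Sum>n<k. \<omega> n * (d k)\<^sup>2) = s' * (d k)\<^sup>2" by (simp only: s'_def sum_distrib_right)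
      have B: "(d k)\<^sup>2 = (1/4)^k / (1 + s')\<^sup>2"
        unfolding d_def s'_def[symmetric] power_divide by (simp add: power2_eq_square power_mult_distrib[symmetric])
      show ?thesis unfolding A unfolding B by simp
    qed
    ultimately show ?thesis by simp
  qed
  define S where "S k = (\<lambda>t. psum (\<lambda>n. round_cut (d k) k (cf (u t) n)) k)" for k
  have simple: "simple_into V T (S k)" for k unfolding S_def by (rule simple_into_round[OF V cont d])
  have conv: "(\<lambda>k. N (\<lambda>y. u t y - S k t y)) \<longlonglongrightarrow> 0" if t: "0 < t" "t < T" for t
  proof -
    define c where "c = cf (u t)"
    define G where "G n = \<omega> n * (c n)\<^sup>2" for n
    have sG: "summable G" using s[OF t] by (simp add: G_def[abs_def] c_def)
    have Gc: "G n \<le> suminf G" for n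
      using sum_le_suminf[OF sG, of "{n}"] \<omega>0 by (simp add: G_def)
    define b where "b = sqrt (suminf G / w0)"
    have cb: "\<bar>c n\<bar> \<le> b" for n
    proof -
      have "w0 * (c n)\<^sup>2 \<le> G n" unfolding G_def using \<omega>(2) by (intro mult_right_mono) auto
      then have "(c n)\<^sup>2 \<le> suminf G / w0" using Gc[of n] \<omega>(3) by (simp add: field_simps)
      then have "sqrt ((c n)\<^sup>2) \<le> b" unfolding b_def by (rule real_sqrt_le_mono)
      then show ?thesis by simp
    qed
    have up: "\<forall>\<^sub>F k in sequentially. N (\<lambda>y. u t y - S k t y) \<le> sqrt ((1/4)^k + (suminf G - (\<Sum>n<k. G n)))"
    proof -
      have "\<forall>\<^sub>F k in sequentially. b \<le> real k"
        using filterlim_real_sequentially unfolding filterlim_at_top by (rule spec)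
      then show ?thesis
      proof eventually_elim
        case (elim k)
        define F where "F n = \<omega> n * (cf (\<lambda>y. u t y - S k t y) n)\<^sup>2" for n
        have cfd: "cf (\<lambda>y. u t y - S k t y) n = c n - (if n < k then round_cut (d k) k (c n) else 0)" for n
          unfolding S_def c_def by (subst L2_inner_diff[OF u(2)[OF t] psum_L2 phi_L2]) (simp add: cf_psum)
        have F: "F = (\<lambda>n. G n + (if n \<in> {..<k} then F n - G n else 0))"
          by (auto simp: F_def G_def cfd)
        have "(\<lambda>n. if n \<in> {..<k} then F n - G n else 0) sums (\<Sum>n<k. F n - G n)"
          by (rule sums_If_finite_set) simp
        from sums_add[OF summable_sums[OF sG] this] have "F sums (suminf G + (\<Sum>n<k. F n - G n))"
          unfolding F[symmetric] .
        then have "suminf F = (\<Sum>n<k. F n) + (suminf G - (\<Sum>n<k. G n))"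
          by (simp add: sums_iff sum_subtractf)
        moreover have "(\<Sum>n<k. F n) \<le> (\<Sum>n<k. \<omega> n * (d k)\<^sup>2)"
        proof (rule sum_mono)
          fix n assume n: "n \<in> {..<k}"
          have "\<bar>c n\<bar> \<le> real k" using cb[of n] elim by linarith
          then have "\<bar>c n - round_cut (d k) k (c n)\<bar> \<le> d k" by (rule round_cut_error[OF d])
          then have "\<bar>c n - round_cut (d k) k (c n)\<bar>\<^sup>2 \<le> (d k)\<^sup>2" by (intro power_mono) auto
          then show "F n \<le> \<omega> n * (d k)\<^sup>2" unfolding F_def cfd using n \<omega>0 by (auto intro!: mult_left_mono)
        qed
        ultimately have "suminf F \<le> (1/4)^k + (suminf G - (\<Sum>n<k. G n))" using d2[of k] by linarith
        moreover have "N (\<lambda>y. u t y - S k t y) = sqrt (suminf F)"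
          unfolding F_def by (rule N) (auto simp: S_def intro!: L2_diff u(2)[OF t])
        ultimately show ?case by (simp only: real_sqrt_le_iff)
      qed
    qed
    have lim: "(\<lambda>k. sqrt ((1/4)^k + (suminf G - (\<Sum>n<k. G n)))) \<longlonglongrightarrow> 0"
    proof -
      have "(\<lambda>k. sqrt ((1/4)^k + (suminf G - (\<Sum>n<k. G n)))) \<longlonglongrightarrow> sqrt (0 + (suminf G - suminf G))"
        by (intro tendsto_real_sqrt tendsto_add tendsto_diff tendsto_const summable_LIMSEQ[OF sG] LIMSEQ_power_zero) simp
      then show ?thesis by simp
    qed
    have lo: "\<And>k. 0 \<le> N (\<lambda>y. u t y - S k t y)"
    proof -
      fix k
      have L: "(\<lambda>y. u t y - S k t y) \<in> L2 M" by (auto simp: S_def intro!: L2_diff u(2)[OF t])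
      show "0 \<le> N (\<lambda>y. u t y - S k t y)"
      proof (cases "summable (\<lambda>n. \<omega> n * (cf (\<lambda>y. u t y - S k t y) n)\<^sup>2)")
        case True
        then show ?thesis unfolding N[OF L] by (intro real_sqrt_ge_zero suminf_nonneg) (auto intro!: mult_nonneg_nonneg \<omega>0)
      next
        case False
        have "cf (\<lambda>y. u t y - S k t y) n = c n" if "n \<ge> k" for n
          unfolding S_def c_def using that by (subst L2_inner_diff[OF u(2)[OF t] psum_L2 phi_L2]) (simp add: cf_psum)
        then have "summable (\<lambda>n. \<omega> n * (cf (\<lambda>y. u t y - S k t y) n)\<^sup>2)"
          by (intro iffD2[OF summable_cong sG[unfolded G_def[abs_def]]] eventually_sequentiallyI[of k]) simp
        then show ?thesis using False by blast
      qed
    qed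
    show ?thesis
      by (rule real_tendsto_sandwich[OF always_eventually up tendsto_const lim]) (rule allI, rule lo)
  qed
  define c where "c n t = indicator {0<..<T} t * cf (u t) n" for n t
  have cm [measurable]: "c n \<in> borel_measurable lborel" for n
    unfolding c_def[abs_def] by (rule borel_measurable_on_interval[OF cont])
  have Neq: "indicator {0<..<T} t *\<^sub>R N (u t) = sqrt (\<Sum>n. \<omega> n * (c n t)\<^sup>2)" for t
    using N[OF u(2), of t] by (auto simp: c_def indicator_def)
  have iN: "integrable lborel (\<lambda>t. indicator {0<..<T} t *\<^sub>R N (u t))"
  proof (rule Bochner_Integration.integrable_bound)
    show "integrable lborel (\<lambda>t. indicator {0<..<T} t *\<^sub>R B t)" using B(1) by (simp add: set_integrable_def)
    show "(\<lambda>t. indicator {0<..<T} t *\<^sub>R N (u t)) \<in> borel_measurable lborel" unfolding Neq by measurable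
    have N0: "N (u t) \<ge> 0" if "0 < t" "t < T" for t
      unfolding N[OF u(2)[OF that]] by (intro real_sqrt_ge_zero suminf_nonneg s that) (auto intro!: mult_nonneg_nonneg \<omega>0)
    show "AE t in lborel. norm (indicator {0<..<T} t *\<^sub>R N (u t)) \<le> norm (indicator {0<..<T} t *\<^sub>R B t)"
    proof (rule AE_I2)
      fix t
      show "norm (indicator {0<..<T} t *\<^sub>R N (u t)) \<le> norm (indicator {0<..<T} t *\<^sub>R B t)"
        using N0[of t] B(2)[of t] by (auto simp: indicator_def)
    qed
  qed
  have "set_integrable lebesgue {0<..<T} (\<lambda>t. N (u t))"
    using iN borel_measurable_integrable[OF iN] unfolding set_integrable_def by (simp add: integrable_completion)
  moreover have "AE t in lebesgue. t \<in> {0<..<T} \<longrightarrow> (\<lambda>n. N (\<lambda>y. u t y - S n t y)) \<longlonglongrightarrow> 0"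
    by (rule AE_I2) (simp add: conv)
  moreover have "AE t in lebesgue. t \<in> {0<..<T} \<longrightarrow> u t \<in> V" by (rule AE_I2) (simp add: u(1))
  ultimately show ?thesis unfolding L1_into_def by (intro conjI exI[of _ S] allI simple)
qed

text \<open>
  The partial sums of the expansion are jointly measurable and converge in \<open>L\<^sup>1((0,T);L\<^sup>2)\<close> by
  dominated convergence. Along a fast subsequence they converge for almost every time and almost
  every point.
\<close>

lemma joint_representative_ex:
  assumes u: "\<And>t. 0 < t \<Longrightarrow> t < T \<Longrightarrow> u t \<in> L2 M"
    and cont: "\<And>n. continuous_on {0<..<T} (\<lambda>t. cf (u t) n)"
    and B: "set_integrable lborel {0<..<T} B" "\<And>t. 0 < t \<Longrightarrow> t < T \<Longrightarrow> L2_norm M (u t) \<le> B t"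
  shows "\<exists>U. joint_representative M T u U"
proof -
  interpret finite_measure M by (rule fin)
  define c where "c n t = indicator {0<..<T} t * cf (u t) n" for n t
  have cm [measurable]: "c n \<in> borel_measurable lborel" for n
    unfolding c_def[abs_def] by (rule borel_measurable_on_interval[OF cont])
  have [measurable]: "\<phi> n \<in> borel_measurable M" for n using phi_L2[of n] by (rule L2_borel)
  define e where "e k t = sqrt ((\<Sum>n. (c n t)\<^sup>2) - (\<Sum>n<k. (c n t)\<^sup>2))" for k t
  have em [measurable]: "e k \<in> borel_measurable lborel" for k unfolding e_def[abs_def] by measurable
  have e_out: "e k t = 0" if "t \<notin> {0<..<T}" for k t using that by (simp add: e_def c_def)
  have e_in: "e k t = L2_norm M (\<lambda>x. u t x - psum (\<lambda>n. c n t) k x)" if t: "0 < t" "t < T" for k t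
  proof -
    have c: "(\<lambda>n. c n t) = cf (u t)" using t by (auto simp: c_def)
    have "(\<Sum>n. (cf (u t) n)\<^sup>2) = L2_inner M (u t) (u t)" using parseval[OF u[OF t]] by (simp add: sums_iff)
    moreover have "(\<Sum>n. (c n t)\<^sup>2) = (\<Sum>n. (cf (u t) n)\<^sup>2)" "(\<Sum>n<k. (c n t)\<^sup>2) = (\<Sum>n<k. (cf (u t) n)\<^sup>2)"
      using t by (simp_all add: c_def)
    ultimately show ?thesis unfolding e_def L2_norm_def c residual_norm[OF u[OF t]] by simp
  qed
  have e0: "e k t \<ge> 0" for k t
    by (cases "0 < t \<and> t < T") (simp_all add: e_in e_out)
  have elim0: "(\<lambda>k. e k t) \<longlonglongrightarrow> 0" for t
  proof (cases "0 < t \<and> t < T")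
    case True
    then have c: "(\<lambda>n. c n t) = cf (u t)" by (auto simp: c_def)
    show ?thesis using psum_tendsto[OF u, of t] True by (simp add: e_in c)
  next
    case False
    then show ?thesis by (simp add: e_out)
  qed
  have eB: "e k t \<le> indicator {0<..<T} t *\<^sub>R B t" for k t
  proof (cases "0 < t \<and> t < T")
    case True
    then have t: "0 < t" "t < T" by auto
    have "e k t \<le> L2_norm M (u t)"
    proof -
      have "(\<lambda>n. c n t) = cf (u t)" using t by (auto simp: c_def)
      then have "(e k t)\<^sup>2 = L2_inner M (u t) (u t) - (\<Sum>n<k. (cf (u t) n)\<^sup>2)"
        unfolding e_in[OF t] L2_norm_square by (simp add: residual_norm[OF u[OF t]])
      also have "\<dots> \<le> (L2_norm M (u t))\<^sup>2" unfolding L2_norm_square by (simp add: sum_nonneg)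
      finally show ?thesis by (rule power2_le_imp_le) simp
    qed
    then show ?thesis using B(2)[OF t] t by simp
  qed (simp add: e_out)
  have iB: "integrable lborel (\<lambda>t. indicator {0<..<T} t *\<^sub>R B t)" using B(1) by (simp add: set_integrable_def)
  have ie: "integrable lborel (e k)" for k
  proof (rule Bochner_Integration.integrable_bound[OF iB em], rule AE_I2)
    fix t
    show "norm (e k t) \<le> norm (indicator {0<..<T} t *\<^sub>R B t)"
      using e0[of k t] eB[of k t] unfolding real_norm_def by linarith
  qed
  have "(\<lambda>k. LINT t|lborel. e k t) \<longlonglongrightarrow> (LINT t::real|lborel. 0)"
  proof (rule integral_dominated_convergence[where w="\<lambda>t. indicator {0<..<T} t *\<^sub>R B t"])
    show "AE t in lborel. (\<lambda>k. e k t) \<longlonglongrightarrow> 0" by (rule AE_I2) (rule elim0)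
    show "AE t in lborel. norm (e k t) \<le> indicator {0<..<T} t *\<^sub>R B t" for k
      by (rule AE_I2) (simp only: real_norm_def abs_of_nonneg[OF e0] eB)
  qed (simp_all only: iB em borel_measurable_const)
  then have lim: "(\<lambda>k. LINT t|lborel. e k t) \<longlonglongrightarrow> 0" by simp
  have "\<forall>j. \<exists>k. (LINT t|lborel. e k t) \<le> (1/2)^j"
  proof
    fix j :: nat
    have "\<forall>\<^sub>F k in sequentially. (LINT t|lborel. e k t) < (1/2)^j" by (rule order_tendstoD(2)[OF lim]) simp
    then show "\<exists>k. (LINT t|lborel. e k t) \<le> (1/2)^j" unfolding eventually_sequentially by (meson less_imp_le order_refl)
  qed
  from choice[OF this] obtain r where r: "\<And>j. (LINT t|lborel. e (r j) t) \<le> (1/2)^j" by auto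
  have ae: "AE t in lborel. summable (\<lambda>j. \<bar>e (r j) t\<bar>)"
  proof (rule AE_summable)
    show "summable (\<lambda>j. LINT t|lborel. \<bar>e (r j) t\<bar>)"
    proof (rule summable_comparison_test')
      show "summable (\<lambda>j. (1/2::real)^j)" by (rule summable_geometric) simp
      show "norm (LINT t|lborel. \<bar>e (r j) t\<bar>) \<le> (1/2)^j" for j
        using r[of j] e0 by (simp add: Bochner_Integration.integral_nonneg)
    qed
  qed (rule ie)
  define P where "P j = (\<lambda>p. psum (\<lambda>n. c n (snd p)) (r j) (fst p))" for j
  have Pm [measurable]: "P j \<in> borel_measurable (M \<Otimes>\<^sub>M lborel)" for j
  proof -
    have 1: "(\<lambda>p. \<phi> n (fst p)) \<in> borel_measurable (M \<Otimes>\<^sub>M lborel)" for n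
      by (rule measurable_compose[OF measurable_fst L2_borel[OF phi_L2]])
    have 2: "(\<lambda>p. c n (snd p)) \<in> borel_measurable (M \<Otimes>\<^sub>M lborel)" for n
      by (rule measurable_compose[OF measurable_snd cm])
    show ?thesis unfolding P_def psum_def by (intro borel_measurable_sum borel_measurable_times 1 2)
  qed
  define U where "U x t = lim (\<lambda>j. P j (x, t))" for x t
  have "(\<lambda>(x, t). U x t) \<in> borel_measurable (M \<Otimes>\<^sub>M lborel)"
  proof -
    have "(\<lambda>p. lim (\<lambda>j. P j p)) \<in> borel_measurable (M \<Otimes>\<^sub>M lborel)"
      by (rule borel_measurable_lim_metric) (rule Pm)
    then show ?thesis by (simp add: U_def split_beta)
  qed
  moreover have "AE t in lborel. t \<in> {0<..<T} \<longrightarrow> (AE x in M. U x t = u t x)"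
    using ae
  proof eventually_elim
    case (elim t)
    show ?case
    proof
      assume "t \<in> {0<..<T}"
      then have t: "0 < t" "t < T" by auto
      define p where "p j = psum (\<lambda>n. c n t) (r j)" for j
      have L: "(\<lambda>x. u t x - p j x) \<in> L2 M" for j unfolding p_def by (intro L2_diff u t psum_L2)
      have "AE x in M. summable (\<lambda>j. \<bar>u t x - p j x\<bar>)"
      proof (rule AE_summable)
        show "integrable M (\<lambda>x. u t x - p j x)" for j by (rule L2_integrable[OF fin L])
        show "summable (\<lambda>j. \<integral>x. \<bar>u t x - p j x\<bar> \<partial>M)"
        proof (rule summable_comparison_test')
          show "summable (\<lambda>j. sqrt (measure M (space M)) * \<bar>e (r j) t\<bar>)" by (intro summable_mult elim)
          show "norm (\<integral>x. \<bar>u t x - p j x\<bar> \<partial>M) \<le> sqrt (measure M (space M)) * \<bar>e (r j) t\<bar>" for j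
            using L2_integrable(2)[OF fin L[of j]] e_in[OF t, of "r j"] e0[of "r j" t]
            by (simp add: p_def Bochner_Integration.integral_nonneg)
        qed
      qed
      then show "AE x in M. U x t = u t x"
      proof eventually_elim
        case (elim x)
        have "(\<lambda>j. \<bar>u t x - p j x\<bar>) \<longlonglongrightarrow> 0" by (rule summable_LIMSEQ_zero[OF elim])
        then have "(\<lambda>j. u t x - p j x) \<longlonglongrightarrow> 0" by (rule tendsto_rabs_zero_cancel)
        then have "(\<lambda>j. u t x - (u t x - p j x)) \<longlonglongrightarrow> u t x - 0" by (intro tendsto_intros)
        then have "(\<lambda>j. P j (x, t)) \<longlonglongrightarrow> u t x" by (simp add: P_def p_def)
        then show ?case unfolding U_def by (rule limI)
      qed
    qed
  qed
  ultimately show ?thesis unfolding joint_representative_def by blast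
qed

end

section \<open>Differentiability of the nonlinear term\<close>

lemma L2_norm_combine:
  assumes d: "d \<in> borel_measurable M" and a: "a \<in> L2 M" and b: "b \<in> L2 M" and c: "c1 \<ge> 0" "c2 \<ge> 0"
    and le: "AE x in M. \<bar>d x\<bar> \<le> c1 * \<bar>a x\<bar> + c2 * \<bar>b x\<bar>"
  shows "L2_norm M d \<le> c1 * L2_norm M a + c2 * L2_norm M b"
proof -
  have abs_L2: "(\<lambda>x. \<bar>h x\<bar>) \<in> L2 M" if "h \<in> L2 M" for h using that by (auto simp: L2_def)
  have abs_norm: "L2_norm M (\<lambda>x. \<bar>h x\<bar>) = L2_norm M h" for h by (simp add: L2_norm_def L2_inner_def)
  have s: "(\<lambda>x. c1 * \<bar>a x\<bar>) \<in> L2 M" "(\<lambda>x. c2 * \<bar>b x\<bar>) \<in> L2 M" by (intro L2_scale abs_L2 a b)+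
  have "L2_norm M d \<le> 1 * L2_norm M (\<lambda>x. c1 * \<bar>a x\<bar> + c2 * \<bar>b x\<bar>)"
  proof (rule L2_norm_mono(2)[OF d L2_add[OF s]])
    show "AE x in M. \<bar>d x\<bar> \<le> 1 * \<bar>c1 * \<bar>a x\<bar> + c2 * \<bar>b x\<bar>\<bar>"
      using le by eventually_elim simp
  qed simp
  also have "\<dots> \<le> L2_norm M (\<lambda>x. c1 * \<bar>a x\<bar>) + L2_norm M (\<lambda>x. c2 * \<bar>b x\<bar>)"
    using L2_norm_triangle[OF s] by simp
  also have "\<dots> = c1 * L2_norm M a + c2 * L2_norm M b"
    unfolding L2_norm_scale abs_norm using c by simp
  finally show ?thesis .
qed

lemma L2_inner_tendsto:
  assumes v: "v \<in> L2 M" and w: "\<And>s. s \<in> S \<Longrightarrow> w s \<in> L2 M" and h: "h \<in> L2 M"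
    and lim: "((\<lambda>s. L2_norm M (\<lambda>x. w s x - v x)) \<longlongrightarrow> 0) (at t within S)"
  shows "((\<lambda>s. L2_inner M (w s) h) \<longlongrightarrow> L2_inner M v h) (at t within S)"
proof -
  have "((\<lambda>s. L2_inner M (w s) h - L2_inner M v h) \<longlongrightarrow> 0) (at t within S)"
  proof (rule Lim_null_comparison)
    show "((\<lambda>s. L2_norm M (\<lambda>x. w s x - v x) * L2_norm M h) \<longlongrightarrow> 0) (at t within S)"
      using tendsto_mult[OF lim tendsto_const[of "L2_norm M h"]] by simp
    show "\<forall>\<^sub>F s in at t within S. norm (L2_inner M (w s) h - L2_inner M v h) \<le> L2_norm M (\<lambda>x. w s x - v x) * L2_norm M h"
      unfolding eventually_at_filter
    proof (rule always_eventually, intro allI impI)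
      fix s assume s: "s \<in> S"
      have "L2_inner M (w s) h - L2_inner M v h = L2_inner M (\<lambda>x. w s x - v x) h"
        by (rule L2_inner_diff[OF w[OF s] v h, symmetric])
      then show "norm (L2_inner M (w s) h - L2_inner M v h) \<le> L2_norm M (\<lambda>x. w s x - v x) * L2_norm M h"
        using L2_Cauchy_Schwarz[OF L2_diff[OF w[OF s] v] h] by simp
    qed
  qed
  then show ?thesis by (rule LIM_zero_cancel)
qed

lemma C0_into_L2_inner:
  assumes "C0_into (L2 M) (L2_norm M) T u" "h \<in> L2 M"
  shows "continuous_on {0..T} (\<lambda>t. L2_inner M (u t) h)"
  unfolding continuous_on_def
proof
  fix t assume t: "t \<in> {0..T}"
  show "((\<lambda>t. L2_inner M (u t) h) \<longlongrightarrow> L2_inner M (u t) h) (at t within {0..T})"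
    using assms t by (intro L2_inner_tendsto) (auto simp: C0_into_def)
qed

text \<open>
  Pairing with a fixed function turns norm differentiability into scalar differentiability; this
  is how every statement about the evolution is reduced to coefficients.
\<close>

lemma has_deriv_into_L2_inner:
  assumes d: "has_deriv_into (L2 M) (L2_norm M) u v t S" and t: "t \<in> S" and h: "h \<in> L2 M"
  shows "((\<lambda>t. L2_inner M (u t) h) has_real_derivative L2_inner M v h) (at t within S)"
proof -
  have u: "u s \<in> L2 M" if "s \<in> S" for s using d that by (simp add: has_deriv_into_def)
  have q: "(\<lambda>y. (u s y - u t y) / (s - t)) \<in> L2 M" if "s \<in> S" for s
    using L2_scale[OF L2_diff[OF u[OF that] u[OF t]], of "1 / (s - t)"] by simp
  have "((\<lambda>s. L2_inner M (\<lambda>y. (u s y - u t y) / (s - t)) h) \<longlongrightarrow> L2_inner M v h) (at t within S)"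
    using d by (intro L2_inner_tendsto q h) (auto simp: has_deriv_into_def)
  then show ?thesis unfolding has_field_derivative_iff
  proof (rule Lim_transform_eventually)
    show "\<forall>\<^sub>F s in at t within S. L2_inner M (\<lambda>y. (u s y - u t y) / (s - t)) h = (L2_inner M (u s) h - L2_inner M (u t) h) / (s - t)"
      unfolding eventually_at_filter
    proof (rule always_eventually, intro allI impI)
      fix s assume s: "s \<in> S"
      have "L2_inner M (\<lambda>y. (u s y - u t y) / (s - t)) h = L2_inner M (\<lambda>y. (1 / (s - t)) * (u s y - u t y)) h" by simp
      also have "\<dots> = (1 / (s - t)) * (L2_inner M (u s) h - L2_inner M (u t) h)"
        unfolding L2_inner_scale L2_inner_diff[OF u[OF s] u[OF t] h] ..
      finally show "L2_inner M (\<lambda>y. (u s y - u t y) / (s - t)) h = (L2_inner M (u s) h - L2_inner M (u t) h) / (s - t)" by simp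
    qed
  qed
qed

lemma has_deriv_into_L2_tendsto:
  assumes d: "has_deriv_into (L2 M) (L2_norm M) u v t S" and t: "t \<in> S"
  shows "((\<lambda>s. L2_norm M (\<lambda>y. u s y - u t y)) \<longlongrightarrow> 0) (at t within S)"
proof (rule Lim_null_comparison)
  let ?q = "\<lambda>s y. (u s y - u t y) / (s - t) - v y"
  have u: "v \<in> L2 M" "\<And>s. s \<in> S \<Longrightarrow> u s \<in> L2 M" and lim: "((\<lambda>s. L2_norm M (?q s)) \<longlongrightarrow> 0) (at t within S)"
    using d by (auto simp: has_deriv_into_def)
  have "((\<lambda>s. \<bar>s - t\<bar> * (L2_norm M (?q s) + L2_norm M v)) \<longlongrightarrow> \<bar>t - t\<bar> * (0 + L2_norm M v)) (at t within S)"
    by (intro tendsto_intros lim)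
  then show "((\<lambda>s. \<bar>s - t\<bar> * (L2_norm M (?q s) + L2_norm M v)) \<longlongrightarrow> 0) (at t within S)" by simp
  show "\<forall>\<^sub>F s in at t within S. norm (L2_norm M (\<lambda>y. u s y - u t y)) \<le> \<bar>s - t\<bar> * (L2_norm M (?q s) + L2_norm M v)"
    unfolding eventually_at_filter
  proof (rule always_eventually, intro allI impI)
    fix s assume s: "s \<noteq> t" "s \<in> S"
    have q: "?q s \<in> L2 M"
      using L2_diff[OF L2_scale[OF L2_diff[OF u(2)[OF s(2)] u(2)[OF t]], of "1 / (s - t)"] u(1)] by simp
    have "(\<lambda>y. u s y - u t y) = (\<lambda>y. (s - t) * (?q s y + v y))" using s(1) by auto
    then have "L2_norm M (\<lambda>y. u s y - u t y) = \<bar>s - t\<bar> * L2_norm M (\<lambda>y. ?q s y + v y)" by (simp only: L2_norm_scale)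
    also have "\<dots> \<le> \<bar>s - t\<bar> * (L2_norm M (?q s) + L2_norm M v)" by (intro mult_left_mono L2_norm_triangle q u(1)) simp
    finally show "norm (L2_norm M (\<lambda>y. u s y - u t y)) \<le> \<bar>s - t\<bar> * (L2_norm M (?q s) + L2_norm M v)" by simp
  qed
qed

lemma C0_into_bounded:
  assumes u: "C0_into V N T u"
    and tri: "\<And>g h. g \<in> V \<Longrightarrow> h \<in> V \<Longrightarrow> \<bar>N g - N h\<bar> \<le> N (\<lambda>y. g y - h y)"
  shows "\<exists>B\<ge>0. \<forall>t\<in>{0..T}. N (u t) \<le> B"
proof -
  have "continuous_on {0..T} (\<lambda>t. N (u t))"
    unfolding continuous_on_def
  proof
    fix t assume t: "t \<in> {0..T}"
    have ut: "u t \<in> V" and lim: "((\<lambda>s. N (\<lambda>y. u s y - u t y)) \<longlongrightarrow> 0) (at t within {0..T})"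
      using u t by (auto simp: C0_into_def)
    have "((\<lambda>s. N (u s) - N (u t)) \<longlongrightarrow> 0) (at t within {0..T})"
    proof (rule Lim_null_comparison[OF _ lim])
      show "\<forall>\<^sub>F s in at t within {0..T}. norm (N (u s) - N (u t)) \<le> N (\<lambda>y. u s y - u t y)"
        unfolding eventually_at_filter
      proof (rule always_eventually, intro allI impI)
        fix s assume "s \<in> {0..T}"
        then have "u s \<in> V" using u by (auto simp: C0_into_def)
        then show "norm (N (u s) - N (u t)) \<le> N (\<lambda>y. u s y - u t y)" using tri[OF _ ut] by simp
      qed
    qed
    then show "((\<lambda>t. N (u t)) \<longlongrightarrow> N (u t)) (at t within {0..T})" by (rule LIM_zero_cancel)
  qed
  then obtain B where B: "\<And>r. 0 \<le> r \<Longrightarrow> r \<le> T \<Longrightarrow> \<bar>N (u r)\<bar> \<le> B" using cont_bounded by blast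
  have "N (u t) \<le> \<bar>B\<bar>" if "t \<in> {0..T}" for t using B[of t] that by auto
  then show ?thesis by (intro exI[of _ "\<bar>B\<bar>"]) auto
qed

lemma L2_norm_diff_abs:
  assumes "g \<in> L2 M" "h \<in> L2 M"
  shows "\<bar>L2_norm M g - L2_norm M h\<bar> \<le> L2_norm M (\<lambda>y. g y - h y)"
proof -
  have 1: "L2_norm M g \<le> L2_norm M (\<lambda>y. g y - h y) + L2_norm M h"
    using L2_norm_triangle[OF L2_diff[OF assms] assms(2)] by simp
  have "L2_norm M h \<le> L2_norm M (\<lambda>y. (-1) * (g y - h y)) + L2_norm M g"
    using L2_norm_triangle[OF L2_scale[OF L2_diff[OF assms], of "-1"] assms(1)] by simp
  then have "L2_norm M h \<le> L2_norm M (\<lambda>y. g y - h y) + L2_norm M g" unfolding L2_norm_scale by simp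
  with 1 show ?thesis by linarith
qed

lemma C1_real_function:
  assumes "f C1_differentiable_on UNIV"
  shows "(f has_real_derivative deriv f x) (at x)" "continuous_on UNIV (deriv f)"
proof -
  obtain D where D: "\<And>x. (f has_vector_derivative D x) (at x)" "continuous_on UNIV D"
    using assms unfolding C1_differentiable_on_def by auto
  have d: "(f has_real_derivative D x) (at x)" for x
    using D(1)[of x] by (simp add: has_real_derivative_iff_has_vector_derivative)
  then have e: "deriv f = D" by (intro ext DERIV_imp_deriv)
  show "(f has_real_derivative deriv f x) (at x)" "continuous_on UNIV (deriv f)" using d D(2) by (auto simp: e)
qed

text \<open>
  By the mean value theorem the quotient is \<open>g \<xi> * ((a - b) / h)\<close>; the error splits into the
  error of the inner quotient and the oscillation of \<open>g\<close>. The bound is arranged so that it can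
  be integrated in the space variable.
\<close>

lemma difference_quotient_error:
  fixes f g :: "real \<Rightarrow> real"
  assumes d: "\<And>x. (f has_real_derivative g x) (at x)" and K: "\<bar>a\<bar> \<le> K" "\<bar>b\<bar> \<le> K"
    and L: "\<And>\<xi>. \<bar>\<xi>\<bar> \<le> K \<Longrightarrow> \<bar>g \<xi>\<bar> \<le> L" and \<epsilon>: "\<And>\<xi>. \<bar>\<xi>\<bar> \<le> K \<Longrightarrow> \<bar>\<xi> - b\<bar> \<le> \<bar>a - b\<bar> \<Longrightarrow> \<bar>g \<xi> - g b\<bar> \<le> \<epsilon>"
  shows "\<bar>(f a - f b) / h - g b * v\<bar> \<le> L * \<bar>(a - b) / h - v\<bar> + \<epsilon> * \<bar>v\<bar>"
proof -
  obtain \<xi> where x: "\<bar>\<xi>\<bar> \<le> K" "\<bar>\<xi> - b\<bar> \<le> \<bar>a - b\<bar>" and fx: "f a - f b = (a - b) * g \<xi>"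
  proof (cases a b rule: linorder_cases)
    case less
    from MVT2[OF less, of f g] d obtain z where "a < z" "z < b" "f b - f a = (b - a) * g z" by auto
    then show ?thesis using K by (intro that[of z]) (auto simp: algebra_simps)
  next
    case equal
    then show ?thesis using K by (intro that[of b]) auto
  next
    case greater
    from MVT2[OF greater, of f g] d obtain z where "b < z" "z < a" "f a - f b = (a - b) * g z" by auto
    then show ?thesis using K by (intro that[of z]) auto
  qed
  have "(f a - f b) / h - g b * v = g \<xi> * ((a - b) / h - v) + (g \<xi> - g b) * v"
    unfolding fx by (simp add: algebra_simps)
  then have "\<bar>(f a - f b) / h - g b * v\<bar> \<le> \<bar>g \<xi>\<bar> * \<bar>(a - b) / h - v\<bar> + \<bar>g \<xi> - g b\<bar> * \<bar>v\<bar>"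
    unfolding abs_mult[symmetric] by (simp only: abs_triangle_ineq)
  also have "\<dots> \<le> L * \<bar>(a - b) / h - v\<bar> + \<epsilon> * \<bar>v\<bar>"
    by (intro add_mono mult_right_mono L \<epsilon> x) auto
  finally show ?thesis .
qed

lemma tendsto_0_up_to_epsilon:
  fixes F a :: "real \<Rightarrow> real"
  assumes le: "\<And>\<epsilon>. \<epsilon> > 0 \<Longrightarrow> \<forall>\<^sub>F s in G. F s \<le> a s + \<epsilon> * c" and nn: "\<And>s. 0 \<le> F s" and c: "c \<ge> 0" and a: "(a \<longlongrightarrow> 0) G"
  shows "(F \<longlongrightarrow> 0) G"
proof (rule tendstoI)
  fix e :: real assume e: "e > 0"
  define \<epsilon> where "\<epsilon> = e / (2 * (c + 1))"
  have \<epsilon>: "\<epsilon> > 0" "\<epsilon> * c \<le> e / 2" using e c by (auto simp: \<epsilon>_def field_simps)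
  have "\<forall>\<^sub>F s in G. a s < e / 2" using order_tendstoD(2)[OF a, of "e / 2"] e by simp
  with le[OF \<epsilon>(1)] show "\<forall>\<^sub>F s in G. dist (F s) 0 < e"
  proof eventually_elim
    case (elim s)
    then show ?case using nn[of s] \<epsilon>(2) unfolding dist_real_def by simp
  qed
qed

text \<open>
  On \<open>L\<^sup>2\<close> alone superposition operators are in general not differentiable. Uniform bounds and
  continuity in time for the supremum norm, hypotheses \<open>K\<close> and \<open>unif\<close>, remedy this: \<open>f'\<close> is
  uniformly continuous on \<open>[- K, K]\<close>, so the factor \<open>f'(\<xi>) - f'(u t)\<close> in the difference quotient
  is uniformly small.
\<close>

lemma nemytskii_C1:
  assumes fin: "finite_measure M" and f: "f C1_differentiable_on UNIV"
    and u: "C1_into (L2 M) (L2_norm M) T u ut"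
    and K: "\<And>t. t \<in> {0..T} \<Longrightarrow> AE x in M. \<bar>u t x\<bar> \<le> K"
    and unif: "\<And>t. t \<in> {0..T} \<Longrightarrow> \<exists>\<rho>. (\<forall>s\<in>{0..T}. AE x in M. \<bar>u s x - u t x\<bar> \<le> \<rho> s) \<and> (\<rho> \<longlongrightarrow> 0) (at t within {0..T})"
  shows "C1_into (L2 M) (L2_norm M) T (\<lambda>t x. f (u t x)) (\<lambda>t x. deriv f (u t x) * ut t x)"
proof -
  interpret finite_measure M by (rule fin)
  define g where "g = deriv f"
  have d: "(f has_real_derivative g x) (at x)" for x unfolding g_def by (rule C1_real_function(1)[OF f])
  have gc: "continuous_on UNIV g" unfolding g_def by (rule C1_real_function(2)[OF f])
  have fc: "continuous_on UNIV f" by (rule DERIV_continuous_on[OF has_field_derivative_at_within[OF d]])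
  have fm: "f \<in> borel_measurable borel" and gm: "g \<in> borel_measurable borel"
    by (rule borel_measurable_continuous_onI[OF fc], rule borel_measurable_continuous_onI[OF gc])
  have cpt: "compact {- K..K}" by simp
  have "bounded (g ` {- K..K})" using compact_continuous_image[OF continuous_on_subset[OF gc] cpt] compact_imp_bounded by auto
  then obtain L' where L': "\<And>y. y \<in> g ` {- K..K} \<Longrightarrow> norm y \<le> L'" unfolding bounded_iff by auto
  define L where "L = max 0 L'"
  have L: "\<bar>g \<xi>\<bar> \<le> L" if "\<bar>\<xi>\<bar> \<le> K" for \<xi> using L'[of "g \<xi>"] that by (auto simp: L_def abs_le_iff)
  have L0: "L \<ge> 0" by (simp add: L_def)
  have "bounded (f ` {- K..K})" using compact_continuous_image[OF continuous_on_subset[OF fc] cpt] compact_imp_bounded by auto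
  then obtain B where B: "\<And>y. y \<in> f ` {- K..K} \<Longrightarrow> norm y \<le> B" unfolding bounded_iff by auto
  have UC: "uniformly_continuous_on {- K..K} g"
    by (rule compact_uniformly_continuous[OF continuous_on_subset[OF gc] cpt]) simp
  have modulus: "\<exists>\<delta>>0. \<forall>\<xi> b. \<bar>\<xi>\<bar> \<le> K \<longrightarrow> \<bar>b\<bar> \<le> K \<longrightarrow> \<bar>\<xi> - b\<bar> < \<delta> \<longrightarrow> \<bar>g \<xi> - g b\<bar> \<le> \<epsilon>" if e0: "\<epsilon> > 0" for \<epsilon>
  proof -
    obtain \<delta> where "\<delta> > 0" and \<delta>: "\<forall>b\<in>{- K..K}. \<forall>\<xi>\<in>{- K..K}. dist \<xi> b < \<delta> \<longrightarrow> dist (g \<xi>) (g b) < \<epsilon>"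
      using UC e0 unfolding uniformly_continuous_on_def by meson
    have "\<bar>g \<xi> - g b\<bar> \<le> \<epsilon>" if "\<bar>\<xi>\<bar> \<le> K" "\<bar>b\<bar> \<le> K" "\<bar>\<xi> - b\<bar> < \<delta>" for \<xi> b
    proof -
      have m: "\<xi> \<in> {- K..K}" "b \<in> {- K..K}" using that by (auto simp: abs_le_iff)
      have "dist (g \<xi>) (g b) < \<epsilon>" by (rule \<delta>[rule_format, OF m(2) m(1)]) (simp add: dist_real_def that)
      then show ?thesis by (simp add: dist_real_def)
    qed
    with \<open>\<delta> > 0\<close> show ?thesis by blast
  qed
  have uL: "u t \<in> L2 M" and utL: "ut t \<in> L2 M" if "t \<in> {0..T}" for t
    using u that by (auto simp: C1_into_def C0_into_def)
  have um: "u t \<in> borel_measurable M" and utm: "ut t \<in> borel_measurable M" if "t \<in> {0..T}" for t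
    using uL[OF that] utL[OF that] by (auto intro: L2_borel)
  have fum: "(\<lambda>x. f (u t x)) \<in> borel_measurable M" and gum: "(\<lambda>x. g (u t x)) \<in> borel_measurable M" if "t \<in> {0..T}" for t
    by (rule measurable_compose[OF um[OF that] fm], rule measurable_compose[OF um[OF that] gm])
  have FL: "(\<lambda>x. f (u t x)) \<in> L2 M" if t: "t \<in> {0..T}" for t
  proof -
    have o: "(\<lambda>_. 1) \<in> L2 M" by (simp add: L2_def)
    show ?thesis
    proof (rule L2_norm_mono(1)[OF fum[OF t] o, where K="max 0 B"])
      show "AE x in M. \<bar>f (u t x)\<bar> \<le> max 0 B * \<bar>1\<bar>"
        using K[OF t]
      proof eventually_elim
        case (elim x)
        then have "u t x \<in> {- K..K}" by (auto simp: abs_le_iff)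
        then have "norm (f (u t x)) \<le> B" using B by blast
        then show ?case by simp
      qed
    qed simp
  qed
  have GL: "(\<lambda>x. g (u t x) * ut t x) \<in> L2 M" if t: "t \<in> {0..T}" for t
  proof (rule L2_norm_mono(1)[OF borel_measurable_times[OF gum[OF t] utm[OF t]] utL[OF t] _ L0])
    show "AE x in M. \<bar>g (u t x) * ut t x\<bar> \<le> L * \<bar>ut t x\<bar>"
      using K[OF t] by eventually_elim (auto simp: abs_mult intro!: mult_right_mono L)
  qed
  have close: "\<forall>\<^sub>F s in at t within {0..T}. s \<in> {0..T} \<and> s \<noteq> t \<and>
      (AE x in M. \<forall>\<xi>. \<bar>\<xi>\<bar> \<le> K \<longrightarrow> \<bar>\<xi> - u t x\<bar> \<le> \<bar>u s x - u t x\<bar> \<longrightarrow> \<bar>g \<xi> - g (u t x)\<bar> \<le> \<epsilon>)"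
    if t: "t \<in> {0..T}" and \<epsilon>: "\<epsilon> > 0" for t \<epsilon>
  proof -
    obtain \<delta> where \<delta>: "\<delta> > 0" and mod': "\<forall>\<xi> b. \<bar>\<xi>\<bar> \<le> K \<longrightarrow> \<bar>b\<bar> \<le> K \<longrightarrow> \<bar>\<xi> - b\<bar> < \<delta> \<longrightarrow> \<bar>g \<xi> - g b\<bar> \<le> \<epsilon>"
      using modulus[OF \<epsilon>] by (elim exE conjE)
    obtain \<rho> where \<rho>: "\<forall>s\<in>{0..T}. AE x in M. \<bar>u s x - u t x\<bar> \<le> \<rho> s" "(\<rho> \<longlongrightarrow> 0) (at t within {0..T})"
      using unif[OF t] by (elim exE conjE)
    have e1: "\<forall>\<^sub>F s in at t within {0..T}. \<rho> s < \<delta>" by (rule order_tendstoD(2)[OF \<rho>(2) \<delta>])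
    have e2: "\<forall>\<^sub>F s in at t within {0..T}. s \<in> {0..T} \<and> s \<noteq> t"
      unfolding eventually_at_filter by (rule always_eventually) simp
    show ?thesis
      using e1 e2
    proof eventually_elim
      case (elim s)
      have "AE x in M. \<forall>\<xi>. \<bar>\<xi>\<bar> \<le> K \<longrightarrow> \<bar>\<xi> - u t x\<bar> \<le> \<bar>u s x - u t x\<bar> \<longrightarrow> \<bar>g \<xi> - g (u t x)\<bar> \<le> \<epsilon>"
        using \<rho>(1)[rule_format, OF conjunct1[OF elim(2)]] K[OF t]
      proof eventually_elim
        case (elim x)
        show ?case
        proof (intro allI impI)
          fix \<xi> assume x: "\<bar>\<xi>\<bar> \<le> K" "\<bar>\<xi> - u t x\<bar> \<le> \<bar>u s x - u t x\<bar>"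
          have "\<bar>\<xi> - u t x\<bar> < \<delta>" using x(2) elim(1) \<open>\<rho> s < \<delta>\<close> by linarith
          then show "\<bar>g \<xi> - g (u t x)\<bar> \<le> \<epsilon>" by (rule mod'[rule_format, OF x(1) elim(2)])
        qed
      qed
      with elim(2) show ?case by simp
    qed
  qed
  have deriv_F: "has_deriv_into (L2 M) (L2_norm M) (\<lambda>t x. f (u t x)) (\<lambda>x. g (u t x) * ut t x) t {0..T}" if t: "t \<in> {0..T}" for t
    unfolding has_deriv_into_def
  proof (intro conjI ballI GL[OF t] FL)
    have hd: "((\<lambda>s. L2_norm M (\<lambda>y. (u s y - u t y) / (s - t) - ut t y)) \<longlongrightarrow> 0) (at t within {0..T})"
      using u t by (auto simp: C1_into_def has_deriv_into_def)
    show "((\<lambda>s. L2_norm M (\<lambda>y. (f (u s y) - f (u t y)) / (s - t) - g (u t y) * ut t y)) \<longlongrightarrow> 0) (at t within {0..T})"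
    proof (rule tendsto_0_up_to_epsilon[where c="L2_norm M (ut t)"])
      show "((\<lambda>s. L * L2_norm M (\<lambda>y. (u s y - u t y) / (s - t) - ut t y)) \<longlongrightarrow> 0) (at t within {0..T})"
        using tendsto_mult[OF tendsto_const[of L] hd] by simp
      fix \<epsilon> :: real assume \<epsilon>: "\<epsilon> > 0"
      show "\<forall>\<^sub>F s in at t within {0..T}. L2_norm M (\<lambda>y. (f (u s y) - f (u t y)) / (s - t) - g (u t y) * ut t y)
          \<le> L * L2_norm M (\<lambda>y. (u s y - u t y) / (s - t) - ut t y) + \<epsilon> * L2_norm M (ut t)"
        using close[OF t \<epsilon>]
      proof eventually_elim
        case (elim s)
        then have s: "s \<in> {0..T}" by simp
        show ?case
        proof (rule L2_norm_combine[OF _ _ utL[OF t] L0 less_imp_le[OF \<epsilon>]])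
          show "(\<lambda>y. (f (u s y) - f (u t y)) / (s - t) - g (u t y) * ut t y) \<in> borel_measurable M"
            by (intro borel_measurable_diff borel_measurable_divide borel_measurable_times fum[OF s] fum[OF t] gum[OF t] utm[OF t] borel_measurable_const)
          show "(\<lambda>y. (u s y - u t y) / (s - t) - ut t y) \<in> L2 M"
            using L2_diff[OF L2_scale[OF L2_diff[OF uL[OF s] uL[OF t]], of "1 / (s - t)"] utL[OF t]] by simp
          show "AE x in M. \<bar>(f (u s x) - f (u t x)) / (s - t) - g (u t x) * ut t x\<bar>
              \<le> L * \<bar>(u s x - u t x) / (s - t) - ut t x\<bar> + \<epsilon> * \<bar>ut t x\<bar>"
            using K[OF s] K[OF t] elim[THEN conjunct2, THEN conjunct2]
          proof eventually_elim
            case (elim x)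
            show ?case by (rule difference_quotient_error[OF d elim(1,2) L elim(3)[rule_format]])
          qed
        qed
      qed
    qed simp_all
  qed
  have C0F: "C0_into (L2 M) (L2_norm M) T (\<lambda>t x. f (u t x))"
    unfolding C0_into_def using FL has_deriv_into_L2_tendsto[OF deriv_F] by blast
  have C0G: "C0_into (L2 M) (L2_norm M) T (\<lambda>t x. g (u t x) * ut t x)"
    unfolding C0_into_def
  proof (intro ballI conjI GL)
    fix t assume t: "t \<in> {0..T}"
    have c: "((\<lambda>s. L2_norm M (\<lambda>y. ut s y - ut t y)) \<longlongrightarrow> 0) (at t within {0..T})"
      using u t by (auto simp: C1_into_def C0_into_def)
    show "((\<lambda>s. L2_norm M (\<lambda>y. g (u s y) * ut s y - g (u t y) * ut t y)) \<longlongrightarrow> 0) (at t within {0..T})"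
    proof (rule tendsto_0_up_to_epsilon[where c="L2_norm M (ut t)"])
      show "((\<lambda>s. L * L2_norm M (\<lambda>y. ut s y - ut t y)) \<longlongrightarrow> 0) (at t within {0..T})"
        using tendsto_mult[OF tendsto_const[of L] c] by simp
      fix \<epsilon> :: real assume \<epsilon>: "\<epsilon> > 0"
      show "\<forall>\<^sub>F s in at t within {0..T}. L2_norm M (\<lambda>y. g (u s y) * ut s y - g (u t y) * ut t y)
          \<le> L * L2_norm M (\<lambda>y. ut s y - ut t y) + \<epsilon> * L2_norm M (ut t)"
        using close[OF t \<epsilon>]
      proof eventually_elim
        case (elim s)
        then have s: "s \<in> {0..T}" by simp
        show ?case
        proof (rule L2_norm_combine[OF _ L2_diff[OF utL[OF s] utL[OF t]] utL[OF t] L0 less_imp_le[OF \<epsilon>]])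
          show "(\<lambda>y. g (u s y) * ut s y - g (u t y) * ut t y) \<in> borel_measurable M"
            by (intro borel_measurable_diff borel_measurable_times gum[OF s] gum[OF t] utm[OF s] utm[OF t])
          show "AE x in M. \<bar>g (u s x) * ut s x - g (u t x) * ut t x\<bar> \<le> L * \<bar>ut s x - ut t x\<bar> + \<epsilon> * \<bar>ut t x\<bar>"
            using K[OF s] elim[THEN conjunct2, THEN conjunct2]
          proof eventually_elim
            case (elim x)
            have "g (u s x) * ut s x - g (u t x) * ut t x = g (u s x) * (ut s x - ut t x) + (g (u s x) - g (u t x)) * ut t x"
              by (simp add: algebra_simps)
            then have "\<bar>g (u s x) * ut s x - g (u t x) * ut t x\<bar> \<le> \<bar>g (u s x)\<bar> * \<bar>ut s x - ut t x\<bar> + \<bar>g (u s x) - g (u t x)\<bar> * \<bar>ut t x\<bar>"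
              unfolding abs_mult[symmetric] by (simp only: abs_triangle_ineq)
            also have "\<dots> \<le> L * \<bar>ut s x - ut t x\<bar> + \<epsilon> * \<bar>ut t x\<bar>"
              by (intro add_mono mult_right_mono L elim(1) elim(2)[rule_format]) auto
            finally show ?case .
          qed
        qed
      qed
    qed simp_all
  qed
  show ?thesis unfolding C1_into_def g_def[symmetric] using C0F C0G deriv_F by simp
qed

section \<open>Spectral spaces and their duals\<close>

context spectral_form
begin

lemma Vsp_L2: "h \<in> Vsp M \<phi> lam s \<Longrightarrow> h \<in> L2 M"
  by (simp add: Vsp_def)

lemma weighted_square: "(lam n powr s * c)\<^sup>2 = c\<^sup>2 * lam n powr (2 * s)"
  unfolding power_mult_distrib powr_square by (rule mult.commute)

lemma Vsp_iff: "h \<in> Vsp M \<phi> lam s \<longleftrightarrow> h \<in> L2 M \<and> summable (\<lambda>n. (lam n powr s * cf h n)\<^sup>2)"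
  unfolding weighted_square Vsp_def by simp

lemma Vnorm_eq: "Vnorm M \<phi> lam s h = sqrt (\<Sum>n. (lam n powr s * cf h n)\<^sup>2)"
  unfolding weighted_square Vnorm_def ..

text \<open>
  The isometry \<open>A\<^sup>s\<close> from \<open>V\<^sub>s\<close> onto \<open>L\<^sup>2\<close>, in terms of coefficients. It transfers the norm
  inequalities of \<open>L\<^sup>2\<close> to \<open>V\<^sub>s\<close>.
\<close>

lemma Vsp_lift:
  assumes "h \<in> Vsp M \<phi> lam s"
  shows "\<exists>w\<in>L2 M. \<forall>n. cf w n = lam n powr s * cf h n"
  by (rule riesz_fischer) (use assms in \<open>simp add: Vsp_iff\<close>)

lemma lift_Vsp:
  assumes "h \<in> L2 M" "w \<in> L2 M" "\<And>n. cf w n = lam n powr s * cf h n"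
  shows "h \<in> Vsp M \<phi> lam s" "Vnorm M \<phi> lam s h = L2_norm M w"
  using sums_summable[OF parseval[OF assms(2)]] L2_norm_eq[OF assms(2)] assms(1,3) by (simp_all add: Vsp_iff Vnorm_eq)

lemma Vsp_diff:
  assumes g: "g \<in> Vsp M \<phi> lam s" and h: "h \<in> Vsp M \<phi> lam s"
  shows "(\<lambda>x. g x - h x) \<in> Vsp M \<phi> lam s"
    "\<bar>Vnorm M \<phi> lam s g - Vnorm M \<phi> lam s h\<bar> \<le> Vnorm M \<phi> lam s (\<lambda>x. g x - h x)"
proof -
  obtain G where G: "G \<in> L2 M" "\<forall>n. cf G n = lam n powr s * cf g n" using Vsp_lift[OF g] by (elim bexE)
  obtain H where H: "H \<in> L2 M" "\<forall>n. cf H n = lam n powr s * cf h n" using Vsp_lift[OF h] by (elim bexE)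
  note gL = Vsp_L2[OF g] and hL = Vsp_L2[OF h]
  have c: "cf (\<lambda>x. G x - H x) n = lam n powr s * cf (\<lambda>x. g x - h x) n" for n
    using G H gL hL by (simp add: L2_inner_diff right_diff_distrib)
  note l = lift_Vsp[OF L2_diff[OF gL hL] L2_diff[OF G(1) H(1)] c]
  show "(\<lambda>x. g x - h x) \<in> Vsp M \<phi> lam s" by (rule l(1))
  show "\<bar>Vnorm M \<phi> lam s g - Vnorm M \<phi> lam s h\<bar> \<le> Vnorm M \<phi> lam s (\<lambda>x. g x - h x)"
    unfolding l(2) lift_Vsp(2)[OF gL G(1) G(2)[rule_format]] lift_Vsp(2)[OF hL H(1) H(2)[rule_format]]
    by (rule L2_norm_diff_abs[OF G(1) H(1)])
qed

lemma psum_Vsp: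
  "psum c k \<in> Vsp M \<phi> lam s" "(Vnorm M \<phi> lam s (psum c k))\<^sup>2 = (\<Sum>n<k. (lam n powr s * c n)\<^sup>2)"
proof -
  have c: "cf (psum (\<lambda>n. lam n powr s * c n) k) n = lam n powr s * cf (psum c k) n" for n
    by (simp add: cf_psum)
  note l = lift_Vsp[OF psum_L2 psum_L2 c]
  show "psum c k \<in> Vsp M \<phi> lam s" by (rule l(1))
  show "(Vnorm M \<phi> lam s (psum c k))\<^sup>2 = (\<Sum>n<k. (lam n powr s * c n)\<^sup>2)"
    unfolding l(2) L2_norm_square psum_norm ..
qed

lemma phi_Vsp: "\<phi> n \<in> Vsp M \<phi> lam s"
proof -
  have "psum (\<lambda>i. if i = n then 1 else 0) (Suc n) = \<phi> n"
    by (rule ext) (simp add: psum_def if_distrib[of "\<lambda>c. c * _"] cong: if_cong)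
  then show ?thesis using psum_Vsp(1)[of "\<lambda>i. if i = n then 1 else 0" "Suc n" s] by simp
qed

lemma psum_DA: "psum c k \<in> DA"
  using V1_subset_DA psum_Vsp(1) by (rule subsetD)

lemma Vsp_mono:
  assumes "s \<le> s'"
  shows "Vsp M \<phi> lam s' \<subseteq> Vsp M \<phi> lam s"
proof
  fix h assume h: "h \<in> Vsp M \<phi> lam s'"
  define K where "K = lam 0 powr (s - s')"
  have le: "(lam n powr s * cf h n)\<^sup>2 \<le> K\<^sup>2 * (lam n powr s' * cf h n)\<^sup>2" for n
  proof -
    have "lam n powr s = lam n powr (s - s') * lam n powr s'" unfolding powr_add[symmetric] by simp
    also have "\<dots> \<le> K * lam n powr s'"
      unfolding K_def using assms lam_0 lam_ge[of n] by (intro mult_right_mono powr_mono2') auto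
    finally have "(lam n powr s)\<^sup>2 \<le> (K * lam n powr s')\<^sup>2" by (rule power_mono) simp
    then have "(lam n powr s)\<^sup>2 * (cf h n)\<^sup>2 \<le> (K * lam n powr s')\<^sup>2 * (cf h n)\<^sup>2" by (rule mult_right_mono) simp
    then show ?thesis by (simp only: power_mult_distrib mult.assoc)
  qed
  have "summable (\<lambda>n. (lam n powr s * cf h n)\<^sup>2)"
  proof (rule summable_comparison_test')
    show "summable (\<lambda>n. K\<^sup>2 * (lam n powr s' * cf h n)\<^sup>2)" using h unfolding Vsp_iff by (intro summable_mult) simp
    show "norm ((lam n powr s * cf h n)\<^sup>2) \<le> K\<^sup>2 * (lam n powr s' * cf h n)\<^sup>2" for n using le[of n] by simp
  qed
  then show "h \<in> Vsp M \<phi> lam s" using Vsp_L2[OF h] by (simp add: Vsp_iff)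
qed

lemma Vsp_partial_sum_le:
  assumes "h \<in> Vsp M \<phi> lam s"
  shows "L2_set (\<lambda>n. lam n powr s * cf h n) {..<N} \<le> Vnorm M \<phi> lam s h"
  unfolding L2_set_def Vnorm_eq using assms by (intro real_sqrt_le_mono sum_le_suminf) (auto simp: Vsp_iff)

lemma L2_partial_sum_le:
  assumes "h \<in> L2 M"
  shows "L2_set (cf h) {..<N} \<le> L2_norm M h"
  unfolding L2_set_def L2_norm_eq[OF assms] by (intro real_sqrt_le_mono sum_le_suminf sums_summable[OF parseval[OF assms]]) auto

lemma bounded_partial_sums:
  assumes h: "h \<in> L2 M" and B: "\<And>N. L2_set (\<lambda>n. lam n powr s * cf h n) {..<N} \<le> B"
  shows "h \<in> Vsp M \<phi> lam s" "Vnorm M \<phi> lam s h \<le> B"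
proof -
  have B0: "B \<ge> 0" using B[of 0] by simp
  have le: "(\<Sum>n<N. (lam n powr s * cf h n)\<^sup>2) \<le> B\<^sup>2" for N
  proof -
    have "(L2_set (\<lambda>n. lam n powr s * cf h n) {..<N})\<^sup>2 \<le> B\<^sup>2" by (intro power_mono B) simp
    then show ?thesis by (simp add: L2_set_def sum_nonneg)
  qed
  have s: "summable (\<lambda>n. (lam n powr s * cf h n)\<^sup>2)"
    by (rule summableI_nonneg_bounded[OF _ le]) simp
  show "h \<in> Vsp M \<phi> lam s" using h s by (simp add: Vsp_iff)
  have "(\<Sum>n. (lam n powr s * cf h n)\<^sup>2) \<le> B\<^sup>2" by (rule suminf_le_const[OF s le])
  then show "Vnorm M \<phi> lam s h \<le> B" unfolding Vnorm_eq using B0 real_le_lsqrt[of B] by (simp add: sum_nonneg real_sqrt_le_iff real_le_lsqrt)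
qed

lemma Vdual_diff:
  assumes F: "F \<in> Vdual M \<phi> lam s" and G: "G \<in> Vdual M \<phi> lam s"
  shows "(\<lambda>h. F h - G h) \<in> Vdual M \<phi> lam s"
proof -
  obtain C where C: "\<forall>h\<in>Vsp M \<phi> lam s. \<bar>F h\<bar> \<le> C * Vnorm M \<phi> lam s h" using F unfolding Vdual_def by blast
  obtain B where B: "\<forall>h\<in>Vsp M \<phi> lam s. \<bar>G h\<bar> \<le> B * Vnorm M \<phi> lam s h" using G unfolding Vdual_def by blast
  have "\<bar>F h - G h\<bar> \<le> (C + B) * Vnorm M \<phi> lam s h" if "h \<in> Vsp M \<phi> lam s" for h
    using C[rule_format, OF that] B[rule_format, OF that] unfolding distrib_right by linarith
  then show ?thesis using F G unfolding Vdual_def mem_Collect_eq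
    by (intro conjI exI[of _ "C + B"] ballI allI) (simp_all add: right_diff_distrib)
qed

lemma Vdual_scale:
  assumes F: "F \<in> Vdual M \<phi> lam s"
  shows "(\<lambda>h. c * F h) \<in> Vdual M \<phi> lam s"
proof -
  obtain C where C: "\<forall>h\<in>Vsp M \<phi> lam s. \<bar>F h\<bar> \<le> C * Vnorm M \<phi> lam s h" using F unfolding Vdual_def by blast
  have "\<bar>c * F h\<bar> \<le> (\<bar>c\<bar> * C) * Vnorm M \<phi> lam s h" if "h \<in> Vsp M \<phi> lam s" for h
    using mult_left_mono[OF C[rule_format, OF that], of "\<bar>c\<bar>"] by (simp add: abs_mult mult.assoc)
  then show ?thesis using F unfolding Vdual_def mem_Collect_eq
    by (intro conjI exI[of _ "\<bar>c\<bar> * C"] ballI allI) (simp_all add: distrib_left)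
qed

lemma Vdual_add:
  assumes "F \<in> Vdual M \<phi> lam s" "g \<in> Vsp M \<phi> lam s" "h \<in> Vsp M \<phi> lam s"
  shows "F (\<lambda>x. g x + h x) = F g + F h"
  using assms(1)[unfolded Vdual_def mem_Collect_eq, THEN conjunct1, rule_format, OF assms(2,3)] .

lemma Vdual_psum:
  assumes F: "F \<in> Vdual M \<phi> lam s"
  shows "F (psum c k) = (\<Sum>n<k. c n * F (\<phi> n))"
proof (induction k)
  case 0
  have "F (\<lambda>x. 0 * \<phi> 0 x) = 0 * F (\<phi> 0)" using F phi_Vsp[of 0 s] unfolding Vdual_def by blast
  then show ?case by (simp add: psum_def)
next
  case (Suc k)
  have 1: "F (\<lambda>x. c k * \<phi> k x) = c k * F (\<phi> k)" using F phi_Vsp[of k s] unfolding Vdual_def by blast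
  have sc: "(\<lambda>x. c k * \<phi> k x) \<in> Vsp M \<phi> lam s"
  proof -
    have "(\<lambda>x. psum c (Suc k) x - psum c k x) = (\<lambda>x. c k * \<phi> k x)" by (simp add: psum_def)
    then show ?thesis using Vsp_diff(1)[OF psum_Vsp(1)[of c "Suc k" s] psum_Vsp(1)[of c k s]] by simp
  qed
  have "F (\<lambda>x. psum c k x + c k * \<phi> k x) = F (psum c k) + F (\<lambda>x. c k * \<phi> k x)"
    by (rule Vdual_add[OF F psum_Vsp(1) sc])
  moreover have "psum c (Suc k) = (\<lambda>x. psum c k x + c k * \<phi> k x)" by (simp add: psum_def)
  ultimately show ?case using Suc.IH 1 by simp
qed

text \<open>
  Riesz representation by testing the functional on \<open>\<Sum> F(\<phi>\<^sub>n) \<lambda>\<^sub>n\<^sup>-\<^sup>2\<^sup>s \<phi>\<^sub>n\<close>, whose squared norm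
  equals the value of the functional. Without it the series in the dual norm would carry no
  information.
\<close>

lemma Vdual_summable:
  assumes F: "F \<in> Vdual M \<phi> lam s"
  shows "summable (\<lambda>n. (F (\<phi> n))\<^sup>2 * lam n powr (- 2 * s))"
proof -
  obtain C where C: "\<forall>h\<in>Vsp M \<phi> lam s. \<bar>F h\<bar> \<le> C * Vnorm M \<phi> lam s h" using F unfolding Vdual_def by blast
  have "(\<Sum>n<k. (F (\<phi> n))\<^sup>2 * lam n powr (- 2 * s)) \<le> C\<^sup>2" for k
  proof -
    define S where "S = (\<Sum>n<k. (F (\<phi> n))\<^sup>2 * lam n powr (- 2 * s))"
    have S0: "S \<ge> 0" unfolding S_def by (intro sum_nonneg) simp
    define c where "c n = F (\<phi> n) * lam n powr (- 2 * s)" for n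
    have "F (psum c k) = S" unfolding Vdual_psum[OF F] S_def c_def
      by (rule sum.cong) (simp_all add: power2_eq_square mult_ac)
    moreover have "(Vnorm M \<phi> lam s (psum c k))\<^sup>2 = S"
    proof -
      have "(lam n powr s * c n)\<^sup>2 = (F (\<phi> n))\<^sup>2 * lam n powr (- 2 * s)" for n
      proof -
        have "lam n powr s * c n = F (\<phi> n) * lam n powr (- s)"
        proof -
          have "lam n powr s * lam n powr (- 2 * s) = lam n powr (- s)" unfolding powr_add[symmetric] by simp
          then show ?thesis unfolding c_def by (simp only: mult.left_commute)
        qed
        then show ?thesis by (simp add: power_mult_distrib powr_square)
      qed
      then show ?thesis unfolding psum_Vsp(2) S_def by simp
    qed
    ultimately have "\<bar>S\<bar> \<le> C * Vnorm M \<phi> lam s (psum c k)" and V2: "(Vnorm M \<phi> lam s (psum c k))\<^sup>2 = S"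
      using C[rule_format, OF psum_Vsp(1)[of c k s]] by auto
    from power_mono[OF this(1), of 2] V2 have "S * S \<le> C\<^sup>2 * S" by (simp add: power_mult_distrib power2_eq_square[of S])
    then have "S \<le> C\<^sup>2"
    proof (cases "S = 0")
      case False
      then have "S > 0" using S0 by simp
      with \<open>S * S \<le> C\<^sup>2 * S\<close> show ?thesis by (simp only: mult_le_cancel_right_pos)
    qed simp
    then show ?thesis by (simp only: S_def)
  qed
  then show ?thesis by (intro summableI_nonneg_bounded[of _ "C\<^sup>2"]) simp_all
qed

lemma Vdual_eval:
  assumes F: "F \<in> Vdual M \<phi> lam s"
  shows "\<bar>F (\<phi> n)\<bar> \<le> lam n powr s * Vdual_norm \<phi> lam s F"
proof -
  have "(F (\<phi> n))\<^sup>2 * lam n powr (- 2 * s) \<le> (\<Sum>n. (F (\<phi> n))\<^sup>2 * lam n powr (- 2 * s))"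
    using sum_le_suminf[OF Vdual_summable[OF F], of "{n}"] by simp
  then have "sqrt ((F (\<phi> n) * lam n powr (- s))\<^sup>2) \<le> Vdual_norm \<phi> lam s F"
    unfolding Vdual_norm_def by (intro real_sqrt_le_mono) (simp add: power_mult_distrib powr_square)
  then have "\<bar>F (\<phi> n)\<bar> * lam n powr (- s) \<le> Vdual_norm \<phi> lam s F" by (simp add: abs_mult)
  then have "lam n powr s * (\<bar>F (\<phi> n)\<bar> * lam n powr (- s)) \<le> lam n powr s * Vdual_norm \<phi> lam s F"
    by (rule mult_left_mono) simp
  moreover have "lam n powr s * (\<bar>F (\<phi> n)\<bar> * lam n powr (- s)) = \<bar>F (\<phi> n)\<bar>"
    using less_imp_neq[OF lam_pos[of n]] by (simp add: powr_minus)
  ultimately show ?thesis by simp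
qed

text \<open>
  The expansion of \<open>h\<close> converges in \<open>V\<^sub>s\<close>, where the functional is continuous.
\<close>

lemma Vdual_series:
  assumes F: "F \<in> Vdual M \<phi> lam s" and h: "h \<in> Vsp M \<phi> lam s"
  shows "(\<lambda>n. cf h n * F (\<phi> n)) sums F h"
proof -
  obtain C where C: "\<forall>h\<in>Vsp M \<phi> lam s. \<bar>F h\<bar> \<le> C * Vnorm M \<phi> lam s h" using F unfolding Vdual_def by blast
  obtain w where w: "w \<in> L2 M" "\<forall>n. cf w n = lam n powr s * cf h n" using Vsp_lift[OF h] by (elim bexE)
  note hL = Vsp_L2[OF h]
  define r where "r k = (\<lambda>x. h x - psum (cf h) k x)" for k
  have rV: "r k \<in> Vsp M \<phi> lam s" for k unfolding r_def by (rule Vsp_diff(1)[OF h psum_Vsp(1)])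
  have rn: "Vnorm M \<phi> lam s (r k) = L2_norm M (\<lambda>x. w x - psum (cf w) k x)" for k
  proof (rule lift_Vsp(2)[OF Vsp_L2[OF rV] L2_diff[OF w(1) psum_L2]])
    fix n
    show "cf (\<lambda>x. w x - psum (cf w) k x) n = lam n powr s * cf (r k) n"
      unfolding r_def L2_inner_diff[OF w(1) psum_L2 phi_L2] L2_inner_diff[OF hL psum_L2 phi_L2] using w(2)
      by (simp add: cf_psum)
  qed
  have "(\<lambda>k. F (r k)) \<longlonglongrightarrow> 0"
  proof (rule Lim_null_comparison)
    show "(\<lambda>k. C * L2_norm M (\<lambda>x. w x - psum (cf w) k x)) \<longlonglongrightarrow> 0"
      using tendsto_mult[OF tendsto_const[of C] psum_tendsto[OF w(1)]] by simp
    show "\<forall>\<^sub>F k in sequentially. norm (F (r k)) \<le> C * L2_norm M (\<lambda>x. w x - psum (cf w) k x)"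
    proof (rule always_eventually, rule allI)
      fix k
      show "norm (F (r k)) \<le> C * L2_norm M (\<lambda>x. w x - psum (cf w) k x)"
        using C[rule_format, OF rV[of k]] unfolding rn real_norm_def .
    qed
  qed
  moreover have "F (r k) = F h - (\<Sum>n<k. cf h n * F (\<phi> n))" for k
  proof -
    have "F (\<lambda>x. r k x + psum (cf h) k x) = F (r k) + F (psum (cf h) k)"
      by (rule Vdual_add[OF F rV psum_Vsp(1)])
    then show ?thesis by (simp add: r_def Vdual_psum[OF F])
  qed
  ultimately have "(\<lambda>k. F h - (\<Sum>n<k. cf h n * F (\<phi> n))) \<longlonglongrightarrow> 0" by simp
  then have "(\<lambda>k. F h - (F h - (\<Sum>n<k. cf h n * F (\<phi> n)))) \<longlonglongrightarrow> F h - 0"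
    by (intro tendsto_diff tendsto_const)
  then show ?thesis by (simp add: sums_def)
qed

lemma Vdual_eval_tendsto:
  assumes v: "v \<in> Vdual M \<phi> lam s" and w: "\<And>r. r \<in> S \<Longrightarrow> w r \<in> Vdual M \<phi> lam s"
    and lim: "((\<lambda>r. Vdual_norm \<phi> lam s (\<lambda>h. w r h - v h)) \<longlongrightarrow> 0) (at t within S)"
  shows "((\<lambda>r. w r (\<phi> n)) \<longlongrightarrow> v (\<phi> n)) (at t within S)"
proof -
  have "((\<lambda>r. w r (\<phi> n) - v (\<phi> n)) \<longlongrightarrow> 0) (at t within S)"
  proof (rule Lim_null_comparison)
    show "((\<lambda>r. lam n powr s * Vdual_norm \<phi> lam s (\<lambda>h. w r h - v h)) \<longlongrightarrow> 0) (at t within S)"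
      using tendsto_mult[OF tendsto_const lim] by simp
    show "\<forall>\<^sub>F r in at t within S. norm (w r (\<phi> n) - v (\<phi> n)) \<le> lam n powr s * Vdual_norm \<phi> lam s (\<lambda>h. w r h - v h)"
      unfolding eventually_at_filter
    proof (rule always_eventually, intro allI impI)
      fix r assume r: "r \<in> S"
      show "norm (w r (\<phi> n) - v (\<phi> n)) \<le> lam n powr s * Vdual_norm \<phi> lam s (\<lambda>h. w r h - v h)"
        using Vdual_eval[OF Vdual_diff[OF w[OF r] v]] by simp
    qed
  qed
  then show ?thesis by (rule LIM_zero_cancel)
qed

lemma C0_into_Vdual_eval:
  assumes "C0_into (Vdual M \<phi> lam s) (Vdual_norm \<phi> lam s) T w"
  shows "continuous_on {0..T} (\<lambda>t. w t (\<phi> n))"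
  unfolding continuous_on_def
proof
  fix t assume t: "t \<in> {0..T}"
  show "((\<lambda>t. w t (\<phi> n)) \<longlongrightarrow> w t (\<phi> n)) (at t within {0..T})"
    using assms t by (intro Vdual_eval_tendsto) (auto simp: C0_into_def)
qed

lemma has_deriv_into_Vdual_eval:
  assumes d: "has_deriv_into (Vdual M \<phi> lam s) (Vdual_norm \<phi> lam s) w v t S" and t: "t \<in> S"
  shows "((\<lambda>t. w t (\<phi> n)) has_real_derivative v (\<phi> n)) (at t within S)"
  unfolding has_field_derivative_iff
proof (rule Vdual_eval_tendsto[where w="\<lambda>r h. (w r h - w t h) / (r - t)"])
  have w: "w r \<in> Vdual M \<phi> lam s" if "r \<in> S" for r using d that by (simp add: has_deriv_into_def)
  show "(\<lambda>h. (w r h - w t h) / (r - t)) \<in> Vdual M \<phi> lam s" if "r \<in> S" for r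
    using Vdual_scale[OF Vdual_diff[OF w[OF that] w[OF t]], of "1 / (r - t)"] by simp
qed (use d in \<open>auto simp: has_deriv_into_def\<close>)

end

section \<open>Coefficients of a weak solution\<close>

lemma locint_powr: "x > 0 \<Longrightarrow> locint T (\<lambda>t. t powr (x - 1))"
  by (rule labs_imp_locint[OF laplace_powr(1)[OF _ zero_less_one]])

lemma primitive_mono:
  assumes k: "locint T \<kappa>" "\<And>r. 0 < r \<Longrightarrow> 0 \<le> \<kappa> r" and t: "t \<le> T"
  shows "primitive \<kappa> t \<le> primitive \<kappa> T"
  unfolding primitive_eq set_lebesgue_integral_def
proof (rule Bochner_Integration.integral_mono)
  show "integrable lborel (\<lambda>x. indicator {0<..<t} x *\<^sub>R \<kappa> x)" using locint_mono[OF k(1) t] by (simp add: set_integrable_def)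
  show "integrable lborel (\<lambda>x. indicator {0<..<T} x *\<^sub>R \<kappa> x)" using k(1) by (simp add: set_integrable_def)
  show "indicator {0<..<t} x *\<^sub>R \<kappa> x \<le> indicator {0<..<T} x *\<^sub>R \<kappa> x" for x
    using k(2)[of x] t by (simp add: indicator_def)
qed

lemma L2_set_diff: "L2_set (\<lambda>i. a i - b i) A \<le> L2_set a A + L2_set b A"
proof -
  have "L2_set (\<lambda>i. - b i) A = L2_set b A" by (simp add: L2_set_def)
  then show ?thesis using L2_set_triangle_ineq[of a "\<lambda>i. - b i" A] by simp
qed

lemma L2_set_le:
  assumes "\<And>n. \<bar>a n\<bar> \<le> c * \<bar>b n\<bar>" "c \<ge> 0"
  shows "L2_set a A \<le> c * L2_set b A"
proof -
  have "L2_set a A = L2_set (\<lambda>n. \<bar>a n\<bar>) A" "L2_set b A = L2_set (\<lambda>n. \<bar>b n\<bar>) A" by (simp_all add: L2_set_def)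
  moreover have "L2_set (\<lambda>n. \<bar>a n\<bar>) A \<le> L2_set (\<lambda>n. c * \<bar>b n\<bar>) A" by (rule L2_set_mono) (use assms in auto)
  ultimately show ?thesis using L2_set_right_distrib[OF assms(2), of "\<lambda>n. \<bar>b n\<bar>" A] by simp
qed

text \<open>
  Minkowski's inequality for the \<open>\<ell>\<^sup>2\<close> norm of a family of convolutions. It is proved by
  duality, pairing the family with itself, which avoids vector-valued integrals.
\<close>

lemma conv_ell2_bound:
  fixes k :: "nat \<Rightarrow> real \<Rightarrow> real"
  assumes k: "\<And>n. locint T (k n)" "\<And>n r. 0 < r \<Longrightarrow> \<bar>k n r\<bar> \<le> \<kappa> r" and \<kappa>: "locint T \<kappa>"
    and g: "\<And>n. continuous_on {0..T} (g n)" and B: "\<And>s. 0 < s \<Longrightarrow> s < t \<Longrightarrow> L2_set (\<lambda>n. g n s) {..<N} \<le> B"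
    and t: "0 < t" "t \<le> T"
  shows "L2_set (\<lambda>n. conv (k n) (g n) t) {..<N} \<le> B * primitive \<kappa> t"
proof -
  define c where "c n = conv (k n) (g n) t" for n
  define S where "S = L2_set c {..<N}"
  have \<kappa>0: "0 \<le> \<kappa> r" if "0 < r" for r using k(2)[OF that, of 0] by linarith
  have S0: "S \<ge> 0" by (simp add: S_def)
  have B0: "B \<ge> 0" using B[of "t / 2"] t(1) L2_set_nonneg[of "\<lambda>n. g n (t / 2)" "{..<N}"] by linarith
  have P0: "primitive \<kappa> t \<ge> 0" unfolding primitive_eq set_lebesgue_integral_def
    by (rule Bochner_Integration.integral_nonneg) (simp add: indicator_def \<kappa>0)
  define h where "h n = (\<lambda>s. indicator {0<..<t} s *\<^sub>R (k n (t - s) * g n s))" for n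
  have ih: "integrable lborel (h n)" for n
    using conv_integrable(1)[OF k(1) g t(2)] by (simp add: h_def set_integrable_def)
  have ch: "c n = (LINT s|lborel. h n s)" for n by (simp add: c_def conv_def h_def set_lebesgue_integral_def)
  have "S\<^sup>2 = (\<Sum>n<N. c n * c n)" by (simp add: S_def L2_set_def sum_nonneg power2_eq_square)
  also have "\<dots> = (\<Sum>n<N. LINT s|lborel. c n * h n s)"
  proof (rule sum.cong[OF refl])
    fix n
    show "c n * c n = (LINT s|lborel. c n * h n s)" using ch[of n] by simp
  qed
  also have "\<dots> = (LINT s|lborel. (\<Sum>n<N. c n * h n s))"
    by (rule Bochner_Integration.integral_sum[symmetric]) (rule integrable_mult_right[OF ih])
  also have "\<dots> \<le> (LINT s|lborel. (S * B) * (indicator {0<..<t} s *\<^sub>R (\<kappa> (t - s) * 1)))"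
  proof (rule Bochner_Integration.integral_mono)
    show "integrable lborel (\<lambda>s. \<Sum>n<N. c n * h n s)"
      by (intro Bochner_Integration.integrable_sum integrable_mult_right ih)
    show "integrable lborel (\<lambda>s. (S * B) * (indicator {0<..<t} s *\<^sub>R (\<kappa> (t - s) * 1)))"
      using conv_integrable(1)[OF \<kappa>, of "\<lambda>_. 1", OF continuous_on_const t(2)]
      by (intro integrable_mult_right) (simp only: set_integrable_def)
    fix s
    show "(\<Sum>n<N. c n * h n s) \<le> (S * B) * (indicator {0<..<t} s *\<^sub>R (\<kappa> (t - s) * 1))"
    proof (cases "s \<in> {0<..<t}")
      case True
      then have s: "0 < s" "s < t" by auto
      have "(\<Sum>n<N. c n * h n s) \<le> (\<Sum>n<N. \<kappa> (t - s) * (\<bar>c n\<bar> * \<bar>g n s\<bar>))"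
      proof (rule sum_mono)
        fix n
        have "c n * h n s = k n (t - s) * (c n * g n s)" using True by (simp add: h_def)
        also have "\<dots> \<le> \<bar>k n (t - s)\<bar> * \<bar>c n * g n s\<bar>" unfolding abs_mult[symmetric] by (rule abs_ge_self)
        also have "\<dots> \<le> \<kappa> (t - s) * \<bar>c n * g n s\<bar>" using s by (intro mult_right_mono k(2)) auto
        finally show "c n * h n s \<le> \<kappa> (t - s) * (\<bar>c n\<bar> * \<bar>g n s\<bar>)" by (simp only: abs_mult)
      qed
      also have "\<dots> = \<kappa> (t - s) * (\<Sum>n<N. \<bar>c n\<bar> * \<bar>g n s\<bar>)" by (simp only: sum_distrib_left)
      also have "\<dots> \<le> \<kappa> (t - s) * (S * L2_set (\<lambda>n. g n s) {..<N})"
        unfolding S_def using s by (intro mult_left_mono L2_set_mult_ineq \<kappa>0) auto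
      also have "\<dots> \<le> \<kappa> (t - s) * (S * B)"
        using s S0 by (intro mult_left_mono B \<kappa>0) auto
      finally show ?thesis using True by (simp add: mult_ac)
    qed (simp add: h_def)
  qed
  also have "\<dots> = (S * B) * conv \<kappa> (\<lambda>_. 1) t" by (simp add: conv_def set_lebesgue_integral_def)
  also have "conv \<kappa> (\<lambda>_. 1) t = primitive \<kappa> t" by (rule conv_commute)
  finally have le: "S * S \<le> S * (B * primitive \<kappa> t)" by (simp add: power2_eq_square mult.assoc)
  have "S \<le> B * primitive \<kappa> t"
  proof (cases "S = 0")
    case True
    then show ?thesis using B0 P0 by simp
  next
    case False
    then have "S > 0" using S0 by simp
    with le show ?thesis by (simp only: mult_le_cancel_left_pos)
  qed
  then show ?thesis unfolding S_def c_def[abs_def] .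
qed

locale weak_flow = sobolev_form M \<phi> D E DA A lam q
  for M :: "'a measure" and \<phi> and D and E and DA and A and lam and q +
  fixes f :: "real \<Rightarrow> real" and \<alpha> \<gamma> T :: real and u0 u1 :: "'a \<Rightarrow> real"
    and u ut :: "real \<Rightarrow> 'a \<Rightarrow> real" and Du :: "real \<Rightarrow> ('a \<Rightarrow> real) \<Rightarrow> real"
  assumes alpha: "1 < \<alpha>" "\<alpha> < 2 * (q - 1) / q" and gamma: "\<gamma> = 1 / \<alpha>" and T: "T > 0"
    and f: "f C1_differentiable_on UNIV"
    and weak: "weak_solution M E \<phi> lam f \<alpha> \<gamma> T u0 u1 u ut Du"
begin

abbreviation F :: "real \<Rightarrow> 'a \<Rightarrow> real" where "F \<equiv> \<lambda>t x. f (u t x)"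
abbreviation F' :: "real \<Rightarrow> 'a \<Rightarrow> real" where "F' \<equiv> \<lambda>t x. deriv f (u t x) * ut t x"

abbreviation ker :: "real \<Rightarrow> nat \<Rightarrow> real \<Rightarrow> real" where "ker k n \<equiv> ray_kernel \<alpha> (lam n) k"

text \<open>
  The last inequality is the upper bound on \<open>\<alpha>\<close>; it puts \<open>V\<^sub>\<gamma>\<close> in the range of the supremum
  embedding.
\<close>

lemma exponents: "\<alpha> < 2" "1 / 2 < \<gamma>" "\<gamma> < 1" "\<alpha> * \<gamma> = 1" "0 < \<gamma>" "2 * \<gamma> > nu"
proof -
  have "2 * (q - 1) / q < 2" using q by (simp add: field_simps)
  then show a2: "\<alpha> < 2" using alpha by linarith
  show "1 / 2 < \<gamma>" "\<gamma> < 1" "\<alpha> * \<gamma> = 1" "0 < \<gamma>" using a2 alpha(1) by (simp_all add: gamma field_simps)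
  show "2 * \<gamma> > nu"
    using alpha q by (simp add: gamma nu_def field_simps)
qed

lemma kernels: "caputo_kernel \<alpha> (lam n)"
  by unfold_locales (simp_all add: alpha exponents)

lemmas weak_1 = weak[unfolded weak_solution_def]
lemmas weak_2 = weak_1[THEN conjunct2, THEN conjunct2]
lemmas weak_3 = weak_2[THEN conjunct2, THEN conjunct2]
lemmas u_C0 = weak_1[THEN conjunct1]
lemmas u_C1 = weak_1[THEN conjunct2, THEN conjunct1]
lemmas u_caputo = weak_2[THEN conjunct1]
lemmas Du_C0 = weak_2[THEN conjunct2, THEN conjunct1]
lemmas u_0 = weak_3[THEN conjunct1]
lemmas ut_0 = weak_3[THEN conjunct2, THEN conjunct1]
lemmas u_eq = weak_3[THEN conjunct2, THEN conjunct2, THEN conjunct2, THEN conjunct2]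

lemma u_V: "t \<in> {0..T} \<Longrightarrow> u t \<in> Vsp M \<phi> lam \<gamma>"
  using u_C0 by (auto simp: C0_into_def)

lemma u_L2: "t \<in> {0..T} \<Longrightarrow> u t \<in> L2 M"
  by (rule Vsp_L2[OF u_V])

lemma u_D: "t \<in> {0..T} \<Longrightarrow> u t \<in> D"
  unfolding D_eq using Vsp_mono[OF less_imp_le[OF exponents(2)]] u_V by auto

lemma ut_L2: "t \<in> {0..T} \<Longrightarrow> ut t \<in> L2 M"
  using u_C1 by (auto simp: C1_into_def C0_into_def)

lemma source_C1: "C1_into (L2 M) (L2_norm M) T F F'"
proof -
  obtain C where C: "C \<ge> 0" "\<forall>h\<in>Vsp M \<phi> lam \<gamma>. AE x in M. \<bar>h x\<bar> \<le> C * Vnorm M \<phi> lam \<gamma> h"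
    using embedding_Linfty[OF exponents(6)] by (elim exE conjE)
  obtain B where B: "B \<ge> 0" "\<forall>t\<in>{0..T}. Vnorm M \<phi> lam \<gamma> (u t) \<le> B"
  proof -
    have "\<exists>B\<ge>0. \<forall>t\<in>{0..T}. Vnorm M \<phi> lam \<gamma> (u t) \<le> B" by (rule C0_into_bounded[OF u_C0 Vsp_diff(2)])
    then show ?thesis using that by (elim exE conjE)
  qed
  show ?thesis
  proof (rule nemytskii_C1[OF fin f u_C1])
    fix t assume t: "t \<in> {0..T}"
    show "AE x in M. \<bar>u t x\<bar> \<le> C * B"
      using C(2)[rule_format, OF u_V[OF t]]
    proof eventually_elim
      case (elim x)
      also have "C * Vnorm M \<phi> lam \<gamma> (u t) \<le> C * B" using B(2) t C(1) by (intro mult_left_mono) auto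
      finally show ?case .
    qed
    show "\<exists>\<rho>. (\<forall>s\<in>{0..T}. AE x in M. \<bar>u s x - u t x\<bar> \<le> \<rho> s) \<and> (\<rho> \<longlongrightarrow> 0) (at t within {0..T})"
    proof (intro exI conjI ballI)
      show "AE x in M. \<bar>u s x - u t x\<bar> \<le> C * Vnorm M \<phi> lam \<gamma> (\<lambda>x. u s x - u t x)" if "s \<in> {0..T}" for s
        by (rule C(2)[rule_format, OF Vsp_diff(1)[OF u_V[OF that] u_V[OF t]]])
      have "((\<lambda>s. Vnorm M \<phi> lam \<gamma> (\<lambda>x. u s x - u t x)) \<longlongrightarrow> 0) (at t within {0..T})"
        using u_C0 t by (auto simp: C0_into_def)
      from tendsto_mult[OF tendsto_const[of C] this]
      show "((\<lambda>s. C * Vnorm M \<phi> lam \<gamma> (\<lambda>x. u s x - u t x)) \<longlongrightarrow> 0) (at t within {0..T})" by simp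
    qed
  qed
qed

lemma source_L2: "t \<in> {0..T} \<Longrightarrow> F t \<in> L2 M" "t \<in> {0..T} \<Longrightarrow> F' t \<in> L2 M"
  using source_C1 by (auto simp: C1_into_def C0_into_def)

lemma mode_continuous:
  "continuous_on {0..T} (\<lambda>t. cf (u t) n)" "continuous_on {0..T} (\<lambda>t. cf (ut t) n)"
  "continuous_on {0..T} (\<lambda>t. cf (F t) n)" "continuous_on {0..T} (\<lambda>t. cf (F' t) n)"
  using u_C1 source_C1 by (auto simp: C1_into_def intro!: C0_into_L2_inner)

lemma mode_derivative:
  assumes "0 \<le> t" "t \<le> T"
  shows "((\<lambda>t. cf (u t) n) has_real_derivative cf (ut t) n) (at t within {0..T})"
    "((\<lambda>t. cf (F t) n) has_real_derivative cf (F' t) n) (at t within {0..T})"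
  using u_C1 source_C1 assms by (auto simp: C1_into_def intro!: has_deriv_into_L2_inner)

text \<open>
  The weak equation holds for almost every time, but both sides are continuous in time after
  testing with an eigenfunction.
\<close>

lemma mode_equation:
  assumes t: "0 < t" "t < T"
  shows "Du t (\<phi> n) = cf (F t) n - lam n * cf (u t) n"
proof -
  define g where "g t = Du t (\<phi> n) + lam n * cf (u t) n - cf (F t) n" for t
  have "g t = 0"
  proof (rule continuous_AE_zero[OF _ _ t])
    have "continuous_on {0..T} g" unfolding g_def[abs_def]
      by (intro continuous_intros mode_continuous C0_into_Vdual_eval[OF Du_C0])
    then show "continuous_on {0<..<T} g" by (rule continuous_on_subset) auto
    show "AE t in lborel. t \<in> {0<..<T} \<longrightarrow> g t = 0"
      using u_eq[rule_format, OF phi_Vsp[of n \<gamma>]]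
    proof eventually_elim
      case (elim t)
      show ?case
      proof
        assume t: "t \<in> {0<..<T}"
        then have D: "u t \<in> D" by (intro u_D) auto
        have "E (u t) (\<phi> n) = lam n * cf (u t) n" using E_sym[OF D phi_D] E_phi[OF D] by simp
        then show "g t = 0" using elim[rule_format, OF t] by (simp add: g_def)
      qed
    qed
  qed
  then show ?thesis by (simp add: g_def)
qed

lemma caputo_integral_mode:
  assumes t: "0 \<le> t" "t \<le> T"
  shows "caputo_integral M \<alpha> u ut t (\<phi> n) =
    conv (caputo_kernel.riemann_kernel \<alpha>) (\<lambda>s. cf (u s) n - cf (u 0) n - s * cf (ut 0) n) t"
proof -
  interpret caputo_kernel \<alpha> "lam n" by (rule kernels)
  define w where "w s = cf (u s) n - cf (u 0) n - s * cf (ut 0) n" for s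
  have in0: "0 \<in> {0..T}" using T by simp
  have w: "L2_inner M (\<lambda>x. u s x - u 0 x - s * ut 0 x) (\<phi> n) = w s" if "s \<in> {0..T}" for s
    using L2_inner_diff[OF L2_diff[OF u_L2[OF that] u_L2[OF in0]] L2_scale[OF ut_L2[OF in0]] phi_L2, of s n]
      L2_inner_diff[OF u_L2[OF that] u_L2[OF in0] phi_L2, of n]
    by (simp add: w_def L2_inner_scale)
  have "(LINT s:{0..t}|lborel. (t - s) powr (1 - \<alpha>) * L2_inner M (\<lambda>x. u s x - u 0 x - s * ut 0 x) (\<phi> n))
      = (LINT s:{0..t}|lborel. (t - s) powr (1 - \<alpha>) * w s)"
    by (rule set_lebesgue_integral_cong) (use t w in auto)
  also have "\<dots> = (LINT s:{0<..<t}|lborel. (t - s) powr (1 - \<alpha>) * w s)"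
  proof -
    have cw: "continuous_on {0..T} w" unfolding w_def[abs_def] by (intro continuous_intros mode_continuous)
    have "AE s in lborel. s \<noteq> 0 \<and> s \<noteq> t"
      using AE_lborel_singleton[of 0] AE_lborel_singleton[of t] by eventually_elim simp
    then have ae: "AE s in lborel. indicator {0..t} s *\<^sub>R ((t - s) powr (1 - \<alpha>) * w s) = indicator {0<..<t} s *\<^sub>R ((t - s) powr (1 - \<alpha>) * w s)"
      by eventually_elim (auto simp: indicator_def)
    have wm: "(\<lambda>s. indicator {0..T} s *\<^sub>R w s) \<in> borel_measurable borel"
      by (rule borel_measurable_continuous_on_indicator[OF _ cw]) simp
    have m: "(\<lambda>s. indicator S s *\<^sub>R ((t - s) powr (1 - \<alpha>) * (indicator {0..T} s *\<^sub>R w s))) \<in> borel_measurable lborel" if [measurable]: "S \<in> sets borel" for S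
      using wm by simp
    have e: "indicator S s *\<^sub>R ((t - s) powr (1 - \<alpha>) * (indicator {0..T} s *\<^sub>R w s)) = indicator S s *\<^sub>R ((t - s) powr (1 - \<alpha>) * w s)"
      if "S \<subseteq> {0..T}" for S s using that by (auto simp: indicator_def)
    have m': "(\<lambda>s. indicator S s *\<^sub>R ((t - s) powr (1 - \<alpha>) * w s)) \<in> borel_measurable lborel"
      if "S \<in> sets borel" "S \<subseteq> {0..T}" for S
      using m[OF that(1)] unfolding e[OF that(2)] .
    show ?thesis unfolding set_lebesgue_integral_def
      by (rule integral_cong_AE[OF m' m' ae]) (use t in auto)
  qed
  finally have "caputo_integral M \<alpha> u ut t (\<phi> n) = 1 / Gamma (2 - \<alpha>) * (LINT s:{0<..<t}|lborel. (t - s) powr (1 - \<alpha>) * w s)"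
    unfolding caputo_integral_def by simp
  also have "\<dots> = conv riemann_kernel w t"
  proof -
    have "riemann_kernel = (\<lambda>r. 1 / Gamma (2 - \<alpha>) * r powr (1 - \<alpha>))" by (rule ext) (simp add: riemann_kernel_def)
    then have "conv riemann_kernel w t = 1 / Gamma (2 - \<alpha>) * conv (\<lambda>r. r powr (1 - \<alpha>)) w t"
      by (simp only: conv_scale_left)
    then show ?thesis by (simp only: conv_def)
  qed
  finally show ?thesis unfolding w_def[abs_def] .
qed

lemma mode_formula:
  assumes t: "0 < t" "t < T"
  shows "cf (u t) n = conv (ker 0 n) (\<lambda>s. cf (F s) n) t
    + cf (u 0) n * ker (\<alpha> - 1) n t + cf (ut 0) n * ker (\<alpha> - 2) n t"
proof -
  interpret caputo_kernel \<alpha> "lam n" by (rule kernels)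
  define w where "w s = cf (u s) n - cf (u 0) n - s * cf (ut 0) n" for s
  obtain W where W: "\<forall>t\<in>{0<..<T}.
      has_deriv_into (Vdual M \<phi> lam \<gamma>) (Vdual_norm \<phi> lam \<gamma>) (caputo_integral M \<alpha> u ut) (W t) t {0<..<T} \<and>
      has_deriv_into (Vdual M \<phi> lam \<gamma>) (Vdual_norm \<phi> lam \<gamma>) W (Du t) t {0<..<T}"
    using u_caputo unfolding has_caputo_deriv_def by (elim exE)
  have at: "at s within {0<..<T} = at s" if "0 < s" "s < T" for s
    using that by (intro at_within_open) auto
  show ?thesis
  proof (rule mode_representation[OF T mode_continuous(1,3) _ t])
    fix r assume r: "0 \<le> r" "r \<le> T"
    show "conv riemann_kernel (\<lambda>s. cf (u s) n - cf (u 0) n - s * cf (ut 0) n) r =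
      primitive (primitive (\<lambda>s. cf (F s) n - lam n * cf (u s) n)) r"
    proof (rule caputo_integrated[OF T mode_continuous(1,2) mode_derivative(1) _ _ _ r])
      show "continuous_on {0..T} (\<lambda>s. cf (F s) n - lam n * cf (u s) n)" by (intro continuous_intros mode_continuous)
      fix s assume s: "0 < s" "s < T"
      then have sS: "s \<in> {0<..<T}" by simp
      have "((\<lambda>t. caputo_integral M \<alpha> u ut t (\<phi> n)) has_real_derivative W s (\<phi> n)) (at s)"
        using has_deriv_into_Vdual_eval[OF W[rule_format, OF sS, THEN conjunct1] sS] unfolding at[OF s] .
      then show "(conv riemann_kernel (\<lambda>s. cf (u s) n - cf (u 0) n - s * cf (ut 0) n) has_real_derivative W s (\<phi> n)) (at s)"
      proof (rule has_field_derivative_transform_within_open[of _ _ _ "{0<..<T}"])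
        show "caputo_integral M \<alpha> u ut x (\<phi> n) = conv riemann_kernel (\<lambda>s. cf (u s) n - cf (u 0) n - s * cf (ut 0) n) x"
          if "x \<in> {0<..<T}" for x using that by (intro caputo_integral_mode) auto
      qed (use s in auto)
      show "((\<lambda>t. W t (\<phi> n)) has_real_derivative cf (F s) n - lam n * cf (u s) n) (at s)"
        using has_deriv_into_Vdual_eval[OF W[rule_format, OF sS, THEN conjunct2] sS, of n] by (simp only: at[OF s] mode_equation[OF s])
    qed
  qed
qed

lemma norm_bounds:
  "\<exists>B\<ge>0. \<forall>t\<in>{0..T}. L2_norm M (u t) \<le> B" "\<exists>B\<ge>0. \<forall>t\<in>{0..T}. L2_norm M (ut t) \<le> B"
  "\<exists>B\<ge>0. \<forall>t\<in>{0..T}. L2_norm M (F t) \<le> B" "\<exists>B\<ge>0. \<forall>t\<in>{0..T}. L2_norm M (F' t) \<le> B"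
  using u_C1 source_C1 by (auto simp: C1_into_def intro!: C0_into_bounded[OF _ L2_norm_diff_abs])

lemma source_formula:
  assumes "0 \<le> t" "t \<le> T"
  shows "cf (F t) n = cf (F 0) n + primitive (\<lambda>s. cf (F' s) n) t"
proof -
  interpret caputo_kernel \<alpha> "lam n" by (rule kernels)
  show ?thesis by (rule source_eq[OF T mode_continuous(3,4) mode_derivative(2) assms])
qed

end

section \<open>Integrable bounds in time\<close>

context weak_flow
begin

lemma locint_ker: "locint S (ker 1 n)" "locint S (ker (\<alpha> - 1) n)"
  by (rule caputo_kernel.locint_kernel(2)[OF kernels], rule caputo_kernel.locint_kernel(3)[OF kernels])

text \<open>
  The contribution of the initial data: split \<open>lam n\<close> into \<open>\<lambda>\<^sup>\<sigma> \<lambda>\<^sup>1\<^sup>-\<^sup>\<sigma>\<close>, where the first factor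
  measures the datum in \<open>V\<^sub>\<sigma>\<close> and the second is absorbed by the kernel.
\<close>

lemma weighted_kernel:
  assumes C: "C \<ge> 0" "\<And>lam t. lam > 0 \<Longrightarrow> t > 0 \<Longrightarrow> lam powr (1 - \<sigma>) * \<bar>ray_kernel \<alpha> lam k t\<bar> \<le> C * t powr e"
    and t: "t > 0" and h: "h \<in> Vsp M \<phi> lam \<sigma>"
  shows "L2_set (\<lambda>n. lam n * cf h n * ker k n t) {..<N} \<le> C * Vnorm M \<phi> lam \<sigma> h * t powr e"
proof -
  have C0: "C * t powr e \<ge> 0" using C(1) by simp
  have le: "\<bar>lam n * cf h n * ker k n t\<bar> \<le> C * t powr e * \<bar>lam n powr \<sigma> * cf h n\<bar>" for n
  proof -
    have "lam n = lam n powr \<sigma> * lam n powr (1 - \<sigma>)" unfolding powr_add[symmetric] by simp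
    then have "\<bar>lam n * cf h n * ker k n t\<bar>
        = \<bar>(lam n powr \<sigma> * lam n powr (1 - \<sigma>)) * cf h n * ker k n t\<bar>" by simp
    also have "\<dots> = (lam n powr (1 - \<sigma>) * \<bar>ker k n t\<bar>) * \<bar>lam n powr \<sigma> * cf h n\<bar>"
      by (simp add: abs_mult mult_ac)
    also have "\<dots> \<le> C * t powr e * \<bar>lam n powr \<sigma> * cf h n\<bar>" by (intro mult_right_mono C(2) lam_pos t) simp
    finally show ?thesis .
  qed
  have "L2_set (\<lambda>n. lam n * cf h n * ker k n t) {..<N} \<le> C * t powr e * L2_set (\<lambda>n. lam n powr \<sigma> * cf h n) {..<N}"
    by (rule L2_set_le[OF le C0])
  also have "\<dots> \<le> C * t powr e * Vnorm M \<phi> lam \<sigma> h" by (rule mult_left_mono[OF Vsp_partial_sum_le[OF h] C0])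
  finally show ?thesis by (simp only: mult_ac)
qed

lemma source_kernel:
  assumes K: "\<And>n. \<bar>ker k n t\<bar> \<le> K" "K \<ge> 0" and h: "h \<in> L2 M"
  shows "L2_set (\<lambda>n. cf h n * ker k n t) {..<N} \<le> K * L2_norm M h"
proof -
  have "L2_set (\<lambda>n. cf h n * ker k n t) {..<N} \<le> K * L2_set (cf h) {..<N}"
  proof (rule L2_set_le[OF _ K(2)])
    show "\<bar>cf h n * ker k n t\<bar> \<le> K * \<bar>cf h n\<bar>" for n
      unfolding abs_mult using mult_right_mono[OF K(1)[of n], of "\<bar>cf h n\<bar>"] by (simp add: mult.commute)
  qed
  also have "\<dots> \<le> K * L2_norm M h" by (rule mult_left_mono[OF L2_partial_sum_le[OF h] K(2)])
  finally show ?thesis .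
qed

lemma L2_Vsp_0: assumes "h \<in> L2 M" shows "h \<in> Vsp M \<phi> lam 0"
  by (rule lift_Vsp(1)[OF assms assms]) (simp add: less_imp_neq[OF lam_pos, symmetric])

lemma conv_source_bound:
  assumes k: "\<And>n. locint T (ker k n)" "\<And>n r. 0 < r \<Longrightarrow> \<bar>ker k n r\<bar> \<le> K * r powr (e - 1)"
    and K: "K \<ge> 0" and e: "e > 0"
  shows "\<exists>c\<ge>0. \<forall>t N. 0 < t \<longrightarrow> t < T \<longrightarrow> L2_set (\<lambda>n. conv (ker k n) (\<lambda>s. cf (F' s) n) t) {..<N} \<le> c"
proof -
  obtain B where B: "B \<ge> 0" "\<forall>t\<in>{0..T}. L2_norm M (F' t) \<le> B" using norm_bounds(4) by (elim exE conjE)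
  define \<kappa> where "\<kappa> = (\<lambda>r::real. K * r powr (e - 1))"
  have \<kappa>: "locint T \<kappa>" unfolding \<kappa>_def by (rule locint_scale[OF locint_powr[OF e]])
  have "L2_set (\<lambda>n. conv (ker k n) (\<lambda>s. cf (F' s) n) t) {..<N} \<le> B * primitive \<kappa> T" if t: "0 < t" "t < T" for t N
  proof -
    have "L2_set (\<lambda>n. conv (ker k n) (\<lambda>s. cf (F' s) n) t) {..<N} \<le> B * primitive \<kappa> t"
    proof (rule conv_ell2_bound[OF k(1) _ \<kappa> mode_continuous(4) _ t(1) less_imp_le[OF t(2)]])
      show "\<bar>ker k n r\<bar> \<le> \<kappa> r" if "0 < r" for n r unfolding \<kappa>_def by (rule k(2)[OF that])
      fix s assume s: "0 < s" "s < t"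
      then have sT: "s \<in> {0..T}" using t by auto
      show "L2_set (\<lambda>n. cf (F' s) n) {..<N} \<le> B"
        using L2_partial_sum_le[OF source_L2(2)[OF sT], of N] B(2) sT by (meson order_trans)
    qed
    also have "\<dots> \<le> B * primitive \<kappa> T"
      by (rule mult_left_mono[OF primitive_mono[OF \<kappa>] B(1)]) (use K t in \<open>auto simp: \<kappa>_def\<close>)
    finally show ?thesis .
  qed
  then show ?thesis by (intro exI[of _ "\<bar>B * primitive \<kappa> T\<bar>"]) (meson abs_ge_zero abs_ge_self order_trans)
qed

lemma scaled_mode:
  assumes t: "0 < t" "t < T"
  shows "lam n * cf (u t) n = cf (F t) n - cf (F 0) n * ker (\<alpha> - 1) n t
    - conv (ker (\<alpha> - 1) n) (\<lambda>s. cf (F' s) n) t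
    + lam n * cf (u 0) n * ker (\<alpha> - 1) n t + lam n * cf (ut 0) n * ker (\<alpha> - 2) n t"
  using caputo_kernel.kP_conv_source(1)[OF kernels[of n] T mode_continuous(4) source_formula t]
  unfolding mode_formula[OF t] by (simp add: distrib_left mult.assoc)

text \<open>
  Every term of the scaled mode formula is bounded in \<open>\<ell>\<^sup>2\<close>: the initial value in \<open>V\<^sub>\<gamma>\<close> and the
  initial velocity in \<open>L\<^sup>2\<close> both cost \<open>t\<^sup>1\<^sup>-\<^sup>\<alpha>\<close>, which is integrable, and the differentiated
  source contributes a bounded amount.
\<close>

lemma energy_bound:
  "\<exists>c0\<ge>0. \<exists>c1\<ge>0. \<forall>t. 0 < t \<longrightarrow> t < T \<longrightarrow> u t \<in> Vsp M \<phi> lam 1 \<and> Vnorm M \<phi> lam 1 (u t) \<le> c0 + c1 * t powr (1 - \<alpha>)"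
proof -
  have in0: "0 \<in> {0..T}" using T by simp
  obtain B where B: "B \<ge> 0" "\<forall>t\<in>{0..T}. L2_norm M (F t) \<le> B" using norm_bounds(3) by (elim exE conjE)
  obtain C1 where C1: "C1 \<ge> 0"
    "\<And>lam t. lam > 0 \<Longrightarrow> t > 0 \<Longrightarrow> lam powr (1 - \<gamma>) * \<bar>ray_kernel \<alpha> lam (\<alpha> - 1) t\<bar> \<le> C1 * t powr (\<alpha> * \<gamma> - (\<alpha> - 1) - 1)"
    by (rule ray_kernel_bound[of \<alpha> \<gamma> "\<alpha> - 1"]) (use alpha exponents in auto)
  obtain C2 where C2: "C2 \<ge> 0"
    "\<And>lam t. lam > 0 \<Longrightarrow> t > 0 \<Longrightarrow> lam powr (1 - 0) * \<bar>ray_kernel \<alpha> lam (\<alpha> - 2) t\<bar> \<le> C2 * t powr (\<alpha> * 0 - (\<alpha> - 2) - 1)"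
    by (rule ray_kernel_bound[of \<alpha> 0 "\<alpha> - 2"]) (use alpha exponents in auto)
  have e1: "\<alpha> * \<gamma> - (\<alpha> - 1) - 1 = 1 - \<alpha>" and e2: "\<alpha> * 0 - (\<alpha> - 2) - 1 = 1 - \<alpha>" using exponents by simp_all
  note C1 = C1[unfolded e1] and C2 = C2[unfolded e2]
  define K where "K = lam 0 powr (\<gamma> - 1) * C1"
  have K0: "K \<ge> 0" using C1(1) by (simp add: K_def)
  have K: "\<bar>ker (\<alpha> - 1) n r\<bar> \<le> K * r powr (1 - \<alpha>)" if "0 < r" for n r
  proof -
    have "\<bar>ker (\<alpha> - 1) n r\<bar> = lam n powr (\<gamma> - 1) * (lam n powr (1 - \<gamma>) * \<bar>ker (\<alpha> - 1) n r\<bar>)"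
      unfolding mult.assoc[symmetric] powr_add[symmetric] by (simp add: less_imp_neq[OF lam_pos, symmetric])
    also have "\<dots> \<le> lam 0 powr (\<gamma> - 1) * (C1 * r powr (1 - \<alpha>))"
      using exponents lam_0 lam_ge[of n] C1(1) by (intro mult_mono powr_mono2' C1(2) lam_pos that) auto
    finally show ?thesis by (simp add: K_def mult.assoc)
  qed
  have ee: "2 - \<alpha> - 1 = 1 - \<alpha>" by simp
  obtain c where c: "c \<ge> 0" "\<forall>t N. 0 < t \<longrightarrow> t < T \<longrightarrow> L2_set (\<lambda>n. conv (ker (\<alpha> - 1) n) (\<lambda>s. cf (F' s) n) t) {..<N} \<le> c"
    using conv_source_bound[of "\<alpha> - 1" K "2 - \<alpha>", unfolded ee, OF locint_ker(2) K K0] exponents(1) by auto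
  define c1 where "c1 = K * L2_norm M (F 0) + C1 * Vnorm M \<phi> lam \<gamma> (u 0) + C2 * Vnorm M \<phi> lam 0 (ut 0)"
  have Vn: "Vnorm M \<phi> lam s h \<ge> 0" if "h \<in> Vsp M \<phi> lam s" for s h
    using Vsp_partial_sum_le[OF that, of 0] by simp
  have u0V: "u 0 \<in> Vsp M \<phi> lam \<gamma>" and z0V: "ut 0 \<in> Vsp M \<phi> lam 0"
    by (rule u_V[OF in0], rule L2_Vsp_0[OF ut_L2[OF in0]])
  have c1: "c1 \<ge> 0" unfolding c1_def using K0 C1(1) C2(1) Vn[OF u0V] Vn[OF z0V] by simp
  have "u t \<in> Vsp M \<phi> lam 1 \<and> Vnorm M \<phi> lam 1 (u t) \<le> (B + c) + c1 * t powr (1 - \<alpha>)" if t: "0 < t" "t < T" for t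
  proof -
    have tT: "t \<in> {0..T}" using t by simp
    have "L2_set (\<lambda>n. lam n powr 1 * cf (u t) n) {..<N} \<le> (B + c) + c1 * t powr (1 - \<alpha>)" for N
    proof -
      have "L2_set (\<lambda>n. lam n powr 1 * cf (u t) n) {..<N} =
         L2_set (\<lambda>n. cf (F t) n - cf (F 0) n * ker (\<alpha> - 1) n t
    - conv (ker (\<alpha> - 1) n) (\<lambda>s. cf (F' s) n) t
    + lam n * cf (u 0) n * ker (\<alpha> - 1) n t + lam n * cf (ut 0) n * ker (\<alpha> - 2) n t) {..<N}"
        by (simp only: scaled_mode[OF t, symmetric] powr_one' powr_one lam_nonneg lam_abs)
      also have "\<dots> \<le> (((B + K * t powr (1 - \<alpha>) * L2_norm M (F 0)) + c) + C1 * Vnorm M \<phi> lam \<gamma> (u 0) * t powr (1 - \<alpha>))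
          + C2 * Vnorm M \<phi> lam 0 (ut 0) * t powr (1 - \<alpha>)"
      proof (rule order_trans[OF L2_set_triangle_ineq add_mono[OF order_trans[OF L2_set_triangle_ineq add_mono[OF
              order_trans[OF L2_set_diff add_mono[OF order_trans[OF L2_set_diff add_mono]]]]]]])
        show "L2_set (cf (F t)) {..<N} \<le> B"
          using L2_partial_sum_le[OF source_L2(1)[OF tT], of N] B(2) tT by (meson order_trans)
        show "L2_set (\<lambda>n. cf (F 0) n * ker (\<alpha> - 1) n t) {..<N} \<le> K * t powr (1 - \<alpha>) * L2_norm M (F 0)"
          by (rule source_kernel[OF K[OF t(1)] _ source_L2(1)[OF in0]]) (use K0 in simp)
        show "L2_set (\<lambda>n. conv (ker (\<alpha> - 1) n) (\<lambda>s. cf (F' s) n) t) {..<N} \<le> c"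
          using c(2) t by simp
        show "L2_set (\<lambda>n. lam n * cf (u 0) n * ker (\<alpha> - 1) n t) {..<N} \<le> C1 * Vnorm M \<phi> lam \<gamma> (u 0) * t powr (1 - \<alpha>)"
          by (rule weighted_kernel[OF C1 t(1) u0V])
        show "L2_set (\<lambda>n. lam n * cf (ut 0) n * ker (\<alpha> - 2) n t) {..<N} \<le> C2 * Vnorm M \<phi> lam 0 (ut 0) * t powr (1 - \<alpha>)"
          by (rule weighted_kernel[OF C2 t(1) z0V])
      qed
      also have "\<dots> = (B + c) + c1 * t powr (1 - \<alpha>)" by (simp add: c1_def algebra_simps)
      finally show ?thesis .
    qed
    from bounded_partial_sums[OF u_L2[OF tT] this] show ?thesis by (rule conjI)
  qed
  then show ?thesis using B(1) c(1) c1 by (intro exI[of _ "B + c"] exI[of _ c1] conjI) auto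
qed

text \<open>
  The formula for \<open>y''\<close> is summed over the modes. The singularity of each term at \<open>t = 0\<close> is a
  power with exponent greater than \<open>-1\<close>: \<open>\<alpha> \<sigma> - 2\<close> for the initial value, \<open>\<alpha> \<beta> - 1\<close> for the
  initial velocity, \<open>\<alpha> - 2\<close> for the source at time \<open>0\<close>. The constructed \<open>w\<close> is the second
  derivative of \<open>u\<close>, defined through its coefficients.
\<close>

lemma second_time_derivative:
  assumes u0: "u0 \<in> L2 M" "u0 \<in> Vsp M \<phi> lam \<sigma>" "\<sigma> > 1 / \<alpha>" and u1: "u1 \<in> L2 M" "u1 \<in> Vsp M \<phi> lam \<beta>" "\<beta> > 0"
  shows "\<exists>b w. locint T b \<and> (\<forall>t. 0 < t \<longrightarrow> t < T \<longrightarrow> w t \<in> L2 M \<and> L2_norm M (w t) \<le> b t \<and>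
      (\<forall>n. ((\<lambda>t. cf (ut t) n) has_real_derivative cf (w t) n) (at t))) \<and> (\<forall>n. continuous_on {0<..<T} (\<lambda>t. cf (w t) n))"
proof -
  have in0: "0 \<in> {0..T}" using T by simp
  define \<sigma>' where "\<sigma>' = min \<sigma> 1"
  \<comment> \<open>The kernel bound needs \<open>\<sigma> \<le> 1\<close> for the initial value and \<open>\<alpha> \<beta> < 1\<close> for the initial
    velocity; smoother data are covered because the spaces are nested.\<close>
  define \<beta>' where "\<beta>' = min \<beta> (\<gamma> / 2)"
  have s: "\<gamma> < \<sigma>'" "\<sigma>' \<le> 1" using u0(3) exponents by (auto simp: \<sigma>'_def gamma)
  then have s0: "0 \<le> \<sigma>'" using exponents(5) by linarith
  have b: "0 < \<beta>'" "\<beta>' \<le> 1" "\<beta>' \<le> \<gamma> / 2" using u1(3) exponents by (auto simp: \<beta>'_def)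
  have as: "1 < \<alpha> * \<sigma>'" "\<alpha> * \<sigma>' < 2"
  proof -
    have "\<alpha> * \<gamma> < \<alpha> * \<sigma>'" using s alpha by (intro mult_strict_left_mono) auto
    then show "1 < \<alpha> * \<sigma>'" using exponents by simp
    have "\<alpha> * \<sigma>' \<le> \<alpha> * 1" using s alpha by (intro mult_left_mono) auto
    then show "\<alpha> * \<sigma>' < 2" using exponents by simp
  qed
  have ab: "0 < \<alpha> * \<beta>'" "\<alpha> * \<beta>' < 1"
  proof -
    show "0 < \<alpha> * \<beta>'" using b alpha by simp
    have "\<alpha> * \<beta>' \<le> \<alpha> * (\<gamma> / 2)" using b alpha by (intro mult_left_mono) auto
    then show "\<alpha> * \<beta>' < 1" using exponents by simp
  qed
  have u0V: "u 0 \<in> Vsp M \<phi> lam \<sigma>'"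
  proof -
    have "u0 \<in> Vsp M \<phi> lam \<sigma>'" using Vsp_mono[of \<sigma>' \<sigma>] u0(2) by (auto simp: \<sigma>'_def)
    moreover have "cf (u 0) n = cf u0 n" for n by (rule cf_cong_AE[OF u_L2[OF in0] u0(1) u_0])
    ultimately show ?thesis using u_L2[OF in0] by (simp add: Vsp_def)
  qed
  have z0V: "ut 0 \<in> Vsp M \<phi> lam \<beta>'"
  proof -
    have "u1 \<in> Vsp M \<phi> lam \<beta>'" using Vsp_mono[of \<beta>' \<beta>] u1(2) by (auto simp: \<beta>'_def)
    moreover have "cf (ut 0) n = cf u1 n" for n by (rule cf_cong_AE[OF ut_L2[OF in0] u1(1) ut_0])
    ultimately show ?thesis using ut_L2[OF in0] by (simp add: Vsp_def)
  qed
  obtain C1 where C1: "C1 \<ge> 0"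
    "\<And>lam t. lam > 0 \<Longrightarrow> t > 0 \<Longrightarrow> lam powr (1 - 1) * \<bar>ray_kernel \<alpha> lam 1 t\<bar> \<le> C1 * t powr (\<alpha> * 1 - 1 - 1)"
    by (rule ray_kernel_bound[of \<alpha> 1 1]) (use alpha exponents in auto)
  obtain C2 where C2: "C2 \<ge> 0"
    "\<And>lam t. lam > 0 \<Longrightarrow> t > 0 \<Longrightarrow> lam powr (1 - \<sigma>') * \<bar>ray_kernel \<alpha> lam 1 t\<bar> \<le> C2 * t powr (\<alpha> * \<sigma>' - 1 - 1)"
    by (rule ray_kernel_bound[of \<alpha> \<sigma>' 1]) (use alpha exponents s s0 as in auto)
  obtain C3 where C3: "C3 \<ge> 0"
    "\<And>lam t. lam > 0 \<Longrightarrow> t > 0 \<Longrightarrow> lam powr (1 - \<beta>') * \<bar>ray_kernel \<alpha> lam 0 t\<bar> \<le> C3 * t powr (\<alpha> * \<beta>' - 0 - 1)"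
    by (rule ray_kernel_bound[of \<alpha> \<beta>' 0]) (use alpha exponents b ab in auto)
  have K: "\<bar>ker 1 n r\<bar> \<le> C1 * r powr (\<alpha> - 1 - 1)" if "0 < r" for n r
    using C1(2)[OF lam_pos[of n] that] less_imp_neq[OF lam_pos[of n]] by simp
  obtain c where c: "c \<ge> 0" "\<forall>t N. 0 < t \<longrightarrow> t < T \<longrightarrow> L2_set (\<lambda>n. conv (ker 1 n) (\<lambda>s. cf (F' s) n) t) {..<N} \<le> c"
    using conv_source_bound[of 1 C1 "\<alpha> - 1", OF locint_ker(1) K C1(1)] alpha(1) by auto
  define v where "v n s = cf (F 0) n * ker 1 n s + conv (ker 1 n) (\<lambda>s. cf (F' s) n) s
      - lam n * cf (u 0) n * ker 1 n s - lam n * cf (ut 0) n * ker 0 n s" for n s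
  have v: "((\<lambda>t. cf (ut t) n) has_real_derivative v n t) (at t)" "continuous_on {0<..<T} (v n)" if t: "0 < t" "t < T" for n t
    using caputo_kernel.mode_second_derivative[OF kernels[of n] T mode_continuous(1,2) mode_derivative(1) mode_continuous(4) source_formula mode_formula t]
    unfolding v_def[abs_def] by auto
  define bb where "bb = (\<lambda>t::real. (C1 * L2_norm M (F 0)) * t powr ((\<alpha> - 1) - 1) + c
      + (C2 * Vnorm M \<phi> lam \<sigma>' (u 0)) * t powr ((\<alpha> * \<sigma>' - 1) - 1) + (C3 * Vnorm M \<phi> lam \<beta>' (ut 0)) * t powr (\<alpha> * \<beta>' - 1))"
  have ibb: "locint T bb" unfolding bb_def
    by (intro locint_add locint_scale locint_powr locint_continuous[of T "\<lambda>_. c"]) (use as ab alpha in auto)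
  have vb: "L2_set (\<lambda>n. v n t) {..<N} \<le> bb t" if t: "0 < t" "t < T" for t N
    unfolding v_def bb_def
  proof (rule order_trans[OF L2_set_diff add_mono[OF order_trans[OF L2_set_diff add_mono[OF order_trans[OF L2_set_triangle_ineq add_mono]]]]])
    have "L2_set (\<lambda>n. cf (F 0) n * ker 1 n t) {..<N} \<le> (C1 * t powr (\<alpha> - 1 - 1)) * L2_norm M (F 0)"
      by (rule source_kernel[OF K[OF t(1)] _ source_L2(1)[OF in0]]) (use C1 in simp)
    then show "L2_set (\<lambda>n. cf (F 0) n * ker 1 n t) {..<N} \<le> (C1 * L2_norm M (F 0)) * t powr (\<alpha> - 1 - 1)"
      by (simp only: mult_ac)
    show "L2_set (\<lambda>n. conv (ker 1 n) (\<lambda>s. cf (F' s) n) t) {..<N} \<le> c" using c(2) t by simp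
    show "L2_set (\<lambda>n. lam n * cf (u 0) n * ker 1 n t) {..<N} \<le> C2 * Vnorm M \<phi> lam \<sigma>' (u 0) * t powr (\<alpha> * \<sigma>' - 1 - 1)"
      by (rule weighted_kernel[OF C2 t(1) u0V])
    show "L2_set (\<lambda>n. lam n * cf (ut 0) n * ker 0 n t) {..<N} \<le> C3 * Vnorm M \<phi> lam \<beta>' (ut 0) * t powr (\<alpha> * \<beta>' - 1)"
      using weighted_kernel[OF C3 t(1) z0V, of N] by simp
  qed
  have ex: "\<exists>h\<in>L2 M. \<forall>n. cf h n = v n t" if t: "0 < t" "t < T" for t
  proof (rule riesz_fischer, rule summableI_nonneg_bounded)
    show "(\<Sum>n<N. (v n t)\<^sup>2) \<le> (bb t)\<^sup>2" for N
    proof -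
      have "(L2_set (\<lambda>n. v n t) {..<N})\<^sup>2 \<le> (bb t)\<^sup>2" by (intro power_mono vb t) simp
      then show ?thesis by (simp add: L2_set_def sum_nonneg)
    qed
  qed simp
  define w where "w t = (SOME h. h \<in> L2 M \<and> (\<forall>n. cf h n = v n t))" for t
  have w: "w t \<in> L2 M \<and> (\<forall>n. cf (w t) n = v n t)" if t: "0 < t" "t < T" for t
    unfolding w_def by (rule someI_ex[of "\<lambda>h. h \<in> L2 M \<and> (\<forall>n. cf h n = v n t)"]) (use ex[OF t] in blast)
  have wn: "L2_norm M (w t) \<le> bb t" if t: "0 < t" "t < T" for t
  proof -
    have "L2_set (\<lambda>n. lam n powr 0 * cf (w t) n) {..<N} \<le> bb t" for N
      using vb[OF t, of N] w[OF t] less_imp_neq[OF lam_pos, symmetric] by simp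
    from bounded_partial_sums(2)[OF w[OF t, THEN conjunct1] this]
    show ?thesis using lift_Vsp(2)[of "w t" "w t" 0] w[OF t] less_imp_neq[OF lam_pos, symmetric] by simp
  qed
  have wc: "continuous_on {0<..<T} (\<lambda>t. cf (w t) n)" for n
  proof -
    have "continuous_on {0<..<T} (v n)" using v(2)[of "T / 2"] T by simp
    then show ?thesis by (rule continuous_on_eq) (use w in auto)
  qed
  show ?thesis
    by (intro exI[of _ bb] exI[of _ w] conjI allI impI ibb wc) (use w wn v(1) in auto)
qed

end

section \<open>Strong solutions\<close>

lemma smooth_real_C1:
  assumes "smooth_real \<eta>"
  shows "(\<eta> has_real_derivative deriv \<eta> t) (at t)" "continuous_on UNIV (deriv \<eta>)" "continuous_on UNIV \<eta>"
proof -
  have d: "(deriv ^^ n) \<eta> differentiable_on UNIV" for n using assms by (simp add: smooth_real_def)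
  have "\<eta> differentiable_on UNIV" using d[of 0] by simp
  then have "\<eta> differentiable (at t)" by (simp add: differentiable_on_def)
  then show "(\<eta> has_real_derivative deriv \<eta> t) (at t)"
    by (simp add: DERIV_deriv_iff_real_differentiable)
  show "continuous_on UNIV \<eta>" using d[of 0] by (simp add: differentiable_imp_continuous_on)
  show "continuous_on UNIV (deriv \<eta>)" using d[of 1] by (simp add: differentiable_imp_continuous_on)
qed

lemma deriv_zero_outside:
  fixes \<eta> :: "real \<Rightarrow> real"
  assumes "\<And>t. t \<notin> {a..b} \<Longrightarrow> \<eta> t = 0" "t \<notin> {a..b}"
  shows "deriv \<eta> t = 0"
proof (rule DERIV_imp_deriv)
  show "(\<eta> has_real_derivative 0) (at t)"
  proof (rule has_field_derivative_transform_within_open[of "\<lambda>_. 0" 0 t "- {a..b}" \<eta>])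
    show "((\<lambda>_. 0) has_real_derivative 0) (at t)" by (rule DERIV_const)
    show "open (- {a..b})" by (rule open_Compl[OF closed_atLeastAtMost])
    show "t \<in> - {a..b}" using assms(2) by simp
    show "0 = \<eta> r" if "r \<in> - {a..b}" for r using assms(1)[of r] that by simp
  qed
qed

text \<open>
  The product \<open>\<eta> P\<close> has compact support in \<open>(0,T)\<close>. Integration takes place over a closed
  interval inside \<open>(0,T)\<close> that contains the support, since \<open>P\<close> and \<open>R\<close> may be singular at the
  end points.
\<close>

lemma test_function_by_parts:
  assumes \<eta>: "test_function T \<eta>" and T: "T > 0"
    and P: "\<And>t. 0 < t \<Longrightarrow> t < T \<Longrightarrow> (P has_real_derivative R t) (at t)" and R: "continuous_on {0<..<T} R"
  shows "(LINT t:{0<..<T}|lborel. deriv \<eta> t * P t) = - (LINT t:{0<..<T}|lborel. \<eta> t * R t)"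
proof -
  obtain a b where ab: "0 < a" "b < T" "\<forall>t. t \<notin> {a..b} \<longrightarrow> \<eta> t = 0" and sm: "smooth_real \<eta>"
    using \<eta> unfolding test_function_def by auto
  note sm1 = smooth_real_C1[OF sm]
  \<comment> \<open>The given bounds of the support need not be ordered; these are, and \<open>a' \<le> T / 2 \<le> b'\<close> lie
    inside \<open>(0,T)\<close>.\<close>
  define a' b' where "a' = min a (T / 2)" and "b' = max b (T / 2)"
  have a': "0 < a'" "a' \<le> T / 2" and b': "b' < T" "T / 2 \<le> b'" using ab T by (auto simp: a'_def b'_def)
  have out: "\<eta> t = 0" if "t \<notin> {a'..b'}" for t
  proof (rule ab(3)[rule_format])
    show "t \<notin> {a..b}" using that by (auto simp: a'_def b'_def)
  qed
  define c d where "c = a' / 2" and "d = (b' + T) / 2"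
  have cd: "0 < c" "c < a'" "b' < d" "d < T" "c \<le> d" using a' b' T by (auto simp: c_def d_def)
  have out': "deriv \<eta> t = 0" if "t \<notin> {a'..b'}" for t by (rule deriv_zero_outside[OF out that])
  have Pc: "continuous_on {c..d} P"
  proof (rule DERIV_continuous_on)
    fix t assume "t \<in> {c..d}"
    then have "0 < t" "t < T" using cd by auto
    then show "(P has_real_derivative R t) (at t within {c..d})" by (rule has_field_derivative_at_within[OF P])
  qed
  have Rc: "continuous_on {c..d} R" by (rule continuous_on_subset[OF R]) (use cd in auto)
  have \<eta>c: "continuous_on {c..d} \<eta>" and \<eta>'c: "continuous_on {c..d} (deriv \<eta>)"
    by (rule continuous_on_subset[OF sm1(3) subset_UNIV], rule continuous_on_subset[OF sm1(2) subset_UNIV])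
  have i1: "set_integrable lborel {c..d} (\<lambda>t. deriv \<eta> t * P t)" and i2: "set_integrable lborel {c..d} (\<lambda>t. \<eta> t * R t)"
    by (intro borel_integrable_atLeastAtMost' continuous_on_mult \<eta>c \<eta>'c Pc Rc)+
  have "(LBINT t=ereal c..ereal d. deriv \<eta> t * P t + \<eta> t * R t) = \<eta> d * P d - \<eta> c * P c"
  proof (rule interval_integral_FTC_finite)
    show "continuous_on {min c d..max c d} (\<lambda>t. deriv \<eta> t * P t + \<eta> t * R t)"
      using cd by (simp add: min_absorb1 max_absorb2 continuous_on_add continuous_on_mult \<eta>c \<eta>'c Pc Rc)
    fix t assume "min c d \<le> t" "t \<le> max c d"
    then have t: "0 < t" "t < T" using cd by (auto simp: min_absorb1 max_absorb2)
    have "((\<lambda>t. \<eta> t * P t) has_real_derivative deriv \<eta> t * P t + R t * \<eta> t) (at t)"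
      by (rule DERIV_mult[OF sm1(1) P[OF t]])
    then have "((\<lambda>t. \<eta> t * P t) has_vector_derivative deriv \<eta> t * P t + \<eta> t * R t) (at t)"
      by (simp add: has_real_derivative_iff_has_vector_derivative mult.commute)
    then show "((\<lambda>t. \<eta> t * P t) has_vector_derivative deriv \<eta> t * P t + \<eta> t * R t) (at t within {min c d..max c d})"
      by (rule has_vector_derivative_at_within)
  qed
  moreover have "(LBINT t=ereal c..ereal d. deriv \<eta> t * P t + \<eta> t * R t) = (LINT t:{c..d}|lborel. deriv \<eta> t * P t + \<eta> t * R t)"
    by (rule interval_integral_Icc[OF cd(5)])
  moreover have "\<eta> c = 0" "\<eta> d = 0" using cd by (auto intro!: out)
  ultimately have "(LINT t:{c..d}|lborel. deriv \<eta> t * P t) + (LINT t:{c..d}|lborel. \<eta> t * R t) = 0"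
    using set_integral_add(2)[OF i1 i2] by simp
  moreover have "(LINT t:{0<..<T}|lborel. deriv \<eta> t * P t) = (LINT t:{c..d}|lborel. deriv \<eta> t * P t)"
    unfolding set_lebesgue_integral_def
  proof (rule Bochner_Integration.integral_cong[OF refl])
    fix t show "indicator {0<..<T} t *\<^sub>R (deriv \<eta> t * P t) = indicator {c..d} t *\<^sub>R (deriv \<eta> t * P t)"
      using out'[of t] cd by (cases "t \<in> {a'..b'}") (auto simp: indicator_def)
  qed
  moreover have "(LINT t:{0<..<T}|lborel. \<eta> t * R t) = (LINT t:{c..d}|lborel. \<eta> t * R t)"
    unfolding set_lebesgue_integral_def
  proof (rule Bochner_Integration.integral_cong[OF refl])
    fix t show "indicator {0<..<T} t *\<^sub>R (\<eta> t * R t) = indicator {c..d} t *\<^sub>R (\<eta> t * R t)"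
      using out[of t] cd by (cases "t \<in> {a'..b'}") (auto simp: indicator_def)
  qed
  ultimately show ?thesis by linarith
qed

context L2_basis
begin

text \<open>
  The passage from single modes to \<open>L\<^sup>2\<close> pairings: partial sums are dominated by \<open>\<parallel>\<psi>\<parallel> B(t)\<close>,
  uniformly in their length.
\<close>

lemma pairing_limit:
  assumes p: "\<And>t. 0 < t \<Longrightarrow> t < T \<Longrightarrow> p t \<in> L2 M" and c: "\<And>n. continuous_on {0<..<T} (\<lambda>t. cf (p t) n)"
    and B: "locint T B" "\<And>t. 0 < t \<Longrightarrow> t < T \<Longrightarrow> L2_norm M (p t) \<le> B t"
    and g: "continuous_on UNIV g" "\<And>t. \<bar>g t\<bar> \<le> K" and \<psi>: "\<psi> \<in> L2 M"
  shows "(\<lambda>k. LINT t:{0<..<T}|lborel. g t * (\<Sum>n<k. cf \<psi> n * cf (p t) n)) \<longlonglongrightarrow> (LINT t:{0<..<T}|lebesgue. g t * L2_inner M (p t) \<psi>)"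
proof -
  define s where "s k t = indicator {0<..<T} t *\<^sub>R (g t * (\<Sum>n<k. cf \<psi> n * cf (p t) n))" for k t
  define l where "l t = indicator {0<..<T} t *\<^sub>R (g t * L2_inner M (p t) \<psi>)" for t
  have K0: "K \<ge> 0" using g(2)[of 0] by linarith
  have sm: "s k \<in> borel_measurable lborel" for k
  proof -
    have "continuous_on {0<..<T} (\<lambda>t. g t * (\<Sum>n<k. cf \<psi> n * cf (p t) n))"
      by (intro continuous_intros c continuous_on_subset[OF g(1)]) auto
    from borel_measurable_continuous_on_indicator[OF _ this] show ?thesis unfolding s_def[abs_def] measurable_lborel2
      by (simp only: borel_open[OF open_greaterThanLessThan])
  qed
  have lim: "(\<lambda>k. s k t) \<longlonglongrightarrow> l t" for t
  proof (cases "0 < t \<and> t < T")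
    case True
    then have "(\<lambda>n. cf \<psi> n * cf (p t) n) sums L2_inner M \<psi> (p t)" by (intro parseval_inner \<psi> p) auto
    then have "(\<lambda>k. \<Sum>n<k. cf \<psi> n * cf (p t) n) \<longlonglongrightarrow> L2_inner M (p t) \<psi>"
      by (simp add: sums_def L2_inner_commute[of M "p t" \<psi>])
    then have "(\<lambda>k. g t * (\<Sum>n<k. cf \<psi> n * cf (p t) n)) \<longlonglongrightarrow> g t * L2_inner M (p t) \<psi>" by (rule tendsto_mult_left)
    then show ?thesis using True by (simp add: s_def l_def)
  qed (auto simp: s_def l_def)
  have bound: "\<bar>s k t\<bar> \<le> K * L2_norm M \<psi> * (indicator {0<..<T} t *\<^sub>R B t)" for k t
  proof (cases "0 < t \<and> t < T")
    case True
    then have t: "0 < t" "t < T" by auto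
    have "(\<Sum>n<k. cf \<psi> n * cf (p t) n) = L2_inner M (psum (cf \<psi>) k) (p t)" by (simp add: psum_inner[OF p[OF t]])
    moreover have "L2_norm M (psum (cf \<psi>) k) \<le> L2_norm M \<psi>"
    proof (rule power2_le_imp_le)
      show "(L2_norm M (psum (cf \<psi>) k))\<^sup>2 \<le> (L2_norm M \<psi>)\<^sup>2"
        unfolding L2_norm_square psum_norm using sum_le_suminf[OF sums_summable[OF parseval[OF \<psi>]], of "{..<k}"]
        by (simp add: sums_unique[OF parseval[OF \<psi>]])
    qed simp
    ultimately have "\<bar>\<Sum>n<k. cf \<psi> n * cf (p t) n\<bar> \<le> L2_norm M \<psi> * B t"
      using L2_Cauchy_Schwarz[OF psum_L2 p[OF t], of "cf \<psi>" k] mult_mono[of "L2_norm M (psum (cf \<psi>) k)" "L2_norm M \<psi>" "L2_norm M (p t)" "B t"] B(2)[OF t]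
      by simp
    then have "\<bar>g t\<bar> * \<bar>\<Sum>n<k. cf \<psi> n * cf (p t) n\<bar> \<le> K * (L2_norm M \<psi> * B t)"
      using g(2)[of t] K0 by (intro mult_mono) auto
    then show ?thesis using t by (simp add: s_def abs_mult mult.assoc)
  qed (auto simp: s_def)
  have lm: "l \<in> borel_measurable lborel" by (rule borel_measurable_LIMSEQ_real[OF lim sm])
  have "(\<lambda>k. LINT t|lborel. s k t) \<longlonglongrightarrow> (LINT t|lborel. l t)"
  proof (rule integral_dominated_convergence[where w="\<lambda>t. K * L2_norm M \<psi> * (indicator {0<..<T} t *\<^sub>R B t)"])
    show "integrable lborel (\<lambda>t. K * L2_norm M \<psi> * (indicator {0<..<T} t *\<^sub>R B t))"
      using B(1) unfolding set_integrable_def by (rule integrable_mult_right)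
    show "AE t in lborel. (\<lambda>k. s k t) \<longlonglongrightarrow> l t" by (rule AE_I2) (rule lim)
    show "AE t in lborel. norm (s k t) \<le> K * L2_norm M \<psi> * (indicator {0<..<T} t *\<^sub>R B t)" for k
      by (rule AE_I2) (simp only: real_norm_def bound)
  qed (rule lm sm)+
  moreover have "(LINT t|lborel. l t) = (LINT t|lebesgue. l t)" by (rule integral_completion[OF lm, symmetric])
  ultimately show ?thesis unfolding set_lebesgue_integral_def s_def l_def by simp
qed

lemma weak_time_derivI:
  assumes T: "T > 0" and p: "\<And>t. 0 < t \<Longrightarrow> t < T \<Longrightarrow> p t \<in> L2 M" and r: "\<And>t. 0 < t \<Longrightarrow> t < T \<Longrightarrow> r t \<in> L2 M"
    and B: "locint T Bp" "\<And>t. 0 < t \<Longrightarrow> t < T \<Longrightarrow> L2_norm M (p t) \<le> Bp t"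
      "locint T Br" "\<And>t. 0 < t \<Longrightarrow> t < T \<Longrightarrow> L2_norm M (r t) \<le> Br t"
    and d: "\<And>n t. 0 < t \<Longrightarrow> t < T \<Longrightarrow> ((\<lambda>t. cf (p t) n) has_real_derivative cf (r t) n) (at t)"
    and c: "\<And>n. continuous_on {0<..<T} (\<lambda>t. cf (r t) n)"
  shows "weak_time_deriv M T p r"
  unfolding weak_time_deriv_def
proof (intro allI impI)
  fix \<eta> \<psi> assume "test_function T \<eta> \<and> \<psi> \<in> L2 M"
  then have \<eta>: "test_function T \<eta>" and \<psi>: "\<psi> \<in> L2 M" by auto
  have sm: "smooth_real \<eta>" using \<eta> by (simp add: test_function_def)
  note sm1 = smooth_real_C1[OF sm]
  have pc: "continuous_on {0<..<T} (\<lambda>t. cf (p t) n)" for n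
  proof (rule DERIV_continuous_on)
    fix t assume "t \<in> {0<..<T}"
    then have "0 < t" "t < T" by auto
    then show "((\<lambda>t. cf (p t) n) has_real_derivative cf (r t) n) (at t within {0<..<T})" by (rule has_field_derivative_at_within[OF d])
  qed
  define P where "P k t = (\<Sum>n<k. cf \<psi> n * cf (p t) n)" for k t
  define R where "R k t = (\<Sum>n<k. cf \<psi> n * cf (r t) n)" for k t
  have parts: "(LINT t:{0<..<T}|lborel. deriv \<eta> t * P k t) = - (LINT t:{0<..<T}|lborel. \<eta> t * R k t)" for k
  proof (rule test_function_by_parts[OF \<eta> T])
    show "(P k has_real_derivative R k t) (at t)" if "0 < t" "t < T" for t
      unfolding P_def[abs_def] R_def by (intro DERIV_sum DERIV_cmult d that)
    show "continuous_on {0<..<T} (R k)" unfolding R_def[abs_def] by (intro continuous_intros c)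
  qed
  have supp: "\<exists>K. \<forall>t. \<bar>g t\<bar> \<le> K" if gc: "continuous_on UNIV g" and g0: "\<And>t. t \<notin> {0..T} \<Longrightarrow> g t = 0" for g :: "real \<Rightarrow> real"
  proof -
    obtain K where K: "\<And>r. 0 \<le> r \<Longrightarrow> r \<le> T \<Longrightarrow> \<bar>g r\<bar> \<le> K"
      using cont_bounded[OF continuous_on_subset[OF gc subset_UNIV]] by blast
    have "\<bar>g t\<bar> \<le> max 0 K" for t using K[of t] g0[of t] by (cases "t \<in> {0..T}") auto
    then show ?thesis by blast
  qed
  have out: "\<eta> t = 0" if "t \<notin> {0..T}" for t using \<eta> that unfolding test_function_def by auto
  have out': "deriv \<eta> t = 0" if "t \<notin> {0..T}" for t by (rule deriv_zero_outside[OF out that])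
  obtain K1 where K1: "\<forall>t. \<bar>\<eta> t\<bar> \<le> K1" using supp[of \<eta>] sm1(3) out by blast
  obtain K2 where K2: "\<forall>t. \<bar>deriv \<eta> t\<bar> \<le> K2" using supp[of "deriv \<eta>"] sm1(2) out' by blast
  have l1: "(\<lambda>k. LINT t:{0<..<T}|lborel. deriv \<eta> t * P k t) \<longlonglongrightarrow> (LINT t:{0<..<T}|lebesgue. deriv \<eta> t * L2_inner M (p t) \<psi>)"
    unfolding P_def by (rule pairing_limit[OF p pc B(1,2) sm1(2) K2[rule_format] \<psi>])
  have l2: "(\<lambda>k. LINT t:{0<..<T}|lborel. \<eta> t * R k t) \<longlonglongrightarrow> (LINT t:{0<..<T}|lebesgue. \<eta> t * L2_inner M (r t) \<psi>)"
    unfolding R_def by (rule pairing_limit[OF r c B(3,4) sm1(3) K1[rule_format] \<psi>])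
  show "(LINT t:{0<..<T}|lebesgue. deriv \<eta> t * L2_inner M (p t) \<psi>) = - (LINT t:{0<..<T}|lebesgue. \<eta> t * L2_inner M (r t) \<psi>)"
    using l1 unfolding parts by (rule LIMSEQ_unique[OF _ tendsto_minus[OF l2]])
qed

lemma L1_into_L2:
  assumes u: "\<And>t. 0 < t \<Longrightarrow> t < T \<Longrightarrow> u t \<in> L2 M" and c: "\<And>n. continuous_on {0<..<T} (\<lambda>t. cf (u t) n)"
    and B: "locint T B" "\<And>t. 0 < t \<Longrightarrow> t < T \<Longrightarrow> L2_norm M (u t) \<le> B t"
  shows "L1_into (L2 M) (L2_norm M) T u"
proof (rule L1_into_coefficients[where \<omega>="\<lambda>_. 1" and ?w0.0=1, OF psum_L2 _ _ _ _ u u _ c B])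
  show "L2_norm M h = sqrt (\<Sum>n. 1 * (cf h n)\<^sup>2)" if "h \<in> L2 M" for h using L2_norm_eq[OF that] by simp
  show "summable (\<lambda>n. 1 * (cf (u t) n)\<^sup>2)" if "0 < t" "t < T" for t using sums_summable[OF parseval[OF u[OF that]]] by simp
qed auto

end

context weak_flow
begin

lemma open_continuous: "continuous_on {0..T} g \<Longrightarrow> continuous_on {0<..<T} g"
  by (erule continuous_on_subset) auto

text \<open>
  The energy bound puts \<open>u t\<close> into \<open>V\<^sub>1 \<subseteq> D(A)\<close> for every time in \<open>(0,T)\<close>. The Caputo derivative
  and \<open>f(u) - A u\<close> have the same coefficients, hence agree as functionals on \<open>V\<^sub>\<gamma>\<close>. For the
  pointwise equation, representatives of \<open>u\<close> and \<open>A u\<close> are chosen first, and that of the Caputo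
  derivative is then defined by the equation.
\<close>

theorem weak_solution_is_strong: "strong_solution M E DA A \<phi> lam f \<alpha> \<gamma> T u0 u1 u ut Du"
proof -
  obtain c0 c1 where c01: "c0 \<ge> 0" "c1 \<ge> 0"
    and en: "\<forall>t. 0 < t \<longrightarrow> t < T \<longrightarrow> u t \<in> Vsp M \<phi> lam 1 \<and> Vnorm M \<phi> lam 1 (u t) \<le> c0 + c1 * t powr (1 - \<alpha>)"
    using energy_bound by (elim exE conjE)
  define b where "b = (\<lambda>t::real. c0 + c1 * t powr ((2 - \<alpha>) - 1))"
  have ib: "locint T b" unfolding b_def
    by (intro locint_add locint_scale locint_powr locint_continuous[of T "\<lambda>_. c0"]) (use exponents in auto)
  have uV1: "u t \<in> Vsp M \<phi> lam 1" and ub: "Vnorm M \<phi> lam 1 (u t) \<le> b t" if "0 < t" "t < T" for t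
    using en[rule_format, OF that] by (auto simp: b_def)
  have uDA: "u t \<in> DA" if "0 < t" "t < T" for t using uV1[OF that] V1_subset_DA by auto
  have AL: "A (u t) \<in> L2 M" if "0 < t" "t < T" for t by (rule A_L2[OF uDA[OF that]])
  have uL: "u t \<in> L2 M" and FL: "F t \<in> L2 M" if "0 < t" "t < T" for t using that by (auto intro: u_L2 source_L2)
  have w1: "lam n powr 2 * (cf h n)\<^sup>2 = (lam n powr 1 * cf h n)\<^sup>2" for n h
    unfolding weighted_square by (simp add: mult.commute)
  have A_norm: "L2_norm M (A (u t)) = Vnorm M \<phi> lam 1 (u t)" if t: "0 < t" "t < T" for t
    by (rule lift_Vsp(2)[OF uL[OF t] AL[OF t], symmetric]) (simp add: cf_A[OF uDA[OF t]])
  have Ac: "continuous_on {0<..<T} (\<lambda>t. cf (A (u t)) n)" for n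
  proof -
    have "continuous_on {0<..<T} (\<lambda>t. lam n * cf (u t) n)" by (intro continuous_intros open_continuous mode_continuous)
    then show ?thesis by (rule continuous_on_eq) (simp add: cf_A[OF uDA])
  qed
  have L1u: "L1_into DA (Vnorm M \<phi> lam 1) T u"
  proof (rule L1_into_coefficients[where \<omega>="\<lambda>n. lam n powr 2" and ?w0.0="lam 0 powr 2" and B=b, OF psum_DA _ _ _ _ uDA uL])
    show "Vnorm M \<phi> lam 1 h = sqrt (\<Sum>n. lam n powr 2 * (cf h n)\<^sup>2)" for h unfolding w1 by (rule Vnorm_eq)
    show "summable (\<lambda>n. lam n powr 2 * (cf (u t) n)\<^sup>2)" if "0 < t" "t < T" for t
      unfolding w1 using uV1[OF that] by (simp add: Vsp_iff)
    show "lam 0 powr 2 \<le> lam n powr 2" for n by (rule powr_mono2) (use lam_ge in auto)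
  qed (use less_imp_neq[OF lam_pos, symmetric] ib ub in \<open>auto intro: open_continuous mode_continuous\<close>)
  obtain B where B: "B \<ge> 0" "\<forall>t\<in>{0..T}. L2_norm M (F t) \<le> B" using norm_bounds(3) by (elim exE conjE)
  define v where "v = (\<lambda>t x. F t x - A (u t) x)"
  have vL: "v t \<in> L2 M" if "0 < t" "t < T" for t unfolding v_def by (rule L2_diff[OF FL[OF that] AL[OF that]])
  have cfv: "cf (v t) n = cf (F t) n - lam n * cf (u t) n" if "0 < t" "t < T" for t n
    unfolding v_def L2_inner_diff[OF FL[OF that] AL[OF that] phi_L2] cf_A[OF uDA[OF that]] ..
  have vb: "L2_norm M (v t) \<le> B + b t" if t: "0 < t" "t < T" for t
  proof -
    have "L2_norm M (\<lambda>x. F t x + (-1) * A (u t) x) \<le> L2_norm M (F t) + L2_norm M (\<lambda>x. (-1) * A (u t) x)"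
      by (rule L2_norm_triangle[OF FL[OF t] L2_scale[OF AL[OF t]]])
    also have "\<dots> = L2_norm M (F t) + Vnorm M \<phi> lam 1 (u t)" by (simp only: L2_norm_scale A_norm[OF t])
    also have "\<dots> \<le> B + b t" using B(2) t ub[OF t] by (intro add_mono) auto
    finally show ?thesis by (simp add: v_def)
  qed
  have iB: "locint T (\<lambda>t. B + b t)" by (intro locint_add ib locint_continuous[of T "\<lambda>_. B"] continuous_on_const)
  have vc: "continuous_on {0<..<T} (\<lambda>t. cf (v t) n)" for n
  proof -
    have "continuous_on {0<..<T} (\<lambda>t. cf (F t) n - lam n * cf (u t) n)" by (intro continuous_intros open_continuous mode_continuous)
    then show ?thesis by (rule continuous_on_eq) (simp add: cfv)
  qed
  have L1v: "L1_into (L2 M) (L2_norm M) T v" by (rule L1_into_L2[OF vL vc iB vb])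
  have Dv: "Du t \<psi> = L2_inner M (v t) \<psi>" if t: "0 < t" "t < T" and \<psi>: "\<psi> \<in> Vsp M \<phi> lam \<gamma>" for t \<psi>
  proof -
    have D: "Du t \<in> Vdual M \<phi> lam \<gamma>" using Du_C0 t by (auto simp: C0_into_def)
    have "(\<lambda>n. cf \<psi> n * Du t (\<phi> n)) sums Du t \<psi>" by (rule Vdual_series[OF D \<psi>])
    moreover have "(\<lambda>n. cf \<psi> n * cf (v t) n) sums L2_inner M \<psi> (v t)" by (rule parseval_inner[OF Vsp_L2[OF \<psi>] vL[OF t]])
    moreover have "Du t (\<phi> n) = cf (v t) n" for n unfolding mode_equation[OF t] cfv[OF t] ..
    ultimately have "(\<lambda>n. cf \<psi> n * cf (v t) n) sums Du t \<psi>" "(\<lambda>n. cf \<psi> n * cf (v t) n) sums L2_inner M \<psi> (v t)" by simp_all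
    then have "Du t \<psi> = L2_inner M \<psi> (v t)" by (rule sums_unique2)
    then show ?thesis by (simp only: L2_inner_commute[of M \<psi>])
  qed
  obtain Bu where Bu: "\<forall>t\<in>{0..T}. L2_norm M (u t) \<le> Bu" using norm_bounds(1) by (elim exE conjE)
  have "\<exists>U. joint_representative M T u U"
    by (rule joint_representative_ex[where B="\<lambda>_. Bu", OF uL open_continuous[OF mode_continuous(1)] locint_continuous[OF continuous_on_const]]) (use Bu in auto)
  then obtain U where U: "joint_representative M T u U" ..
  have "\<exists>W. joint_representative M T (\<lambda>t. A (u t)) W"
    by (rule joint_representative_ex[OF AL Ac ib]) (simp_all add: A_norm ub)
  then obtain W where W: "joint_representative M T (\<lambda>t. A (u t)) W" ..
  define V where "V = (\<lambda>x t. f (U x t) - W x t)"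
  have fm: "f \<in> borel_measurable borel"
    by (rule borel_measurable_continuous_onI[OF DERIV_continuous_on[OF has_field_derivative_at_within[OF C1_real_function(1)[OF f]]]])
  have V: "joint_representative M T v V"
    unfolding joint_representative_def
  proof
    have "(\<lambda>p. f ((\<lambda>(x, t). U x t) p) - (\<lambda>(x, t). W x t) p) \<in> borel_measurable (M \<Otimes>\<^sub>M lborel)"
      using U W unfolding joint_representative_def by (intro borel_measurable_diff measurable_compose[OF _ fm]) auto
    then show "(\<lambda>(x, t). V x t) \<in> borel_measurable (M \<Otimes>\<^sub>M lborel)" by (simp add: V_def split_beta)
    have "AE t in lborel. t \<in> {0<..<T} \<longrightarrow> (AE x in M. U x t = u t x)" "AE t in lborel. t \<in> {0<..<T} \<longrightarrow> (AE x in M. W x t = A (u t) x)"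
      using U W by (auto simp: joint_representative_def)
    then show "AE t in lborel. t \<in> {0<..<T} \<longrightarrow> (AE x in M. V x t = v t x)"
    proof eventually_elim
      case (elim t)
      show ?case
      proof
        assume "t \<in> {0<..<T}"
        from elim(1)[rule_format, OF this] elim(2)[rule_format, OF this] show "AE x in M. V x t = v t x"
          by eventually_elim (simp add: V_def v_def)
      qed
    qed
  qed
  show ?thesis unfolding strong_solution_def
  proof (intro conjI weak L1u, rule exI[of _ v], intro conjI L1v)
    show "AE t in lborel. t \<in> {0<..<T} \<longrightarrow> (\<forall>\<psi>\<in>Vsp M \<phi> lam \<gamma>. Du t \<psi> = L2_inner M (v t) \<psi>)"
      by (rule AE_I2) (simp add: Dv)
    have "AE (x, t) in M \<Otimes>\<^sub>M lborel. t \<in> {0<..<T} \<longrightarrow> V x t + W x t = f (U x t)"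
      by (rule AE_I2) (simp add: V_def split_beta)
    with V W U show "\<exists>V W U. joint_representative M T v V \<and> joint_representative M T (\<lambda>t. A (u t)) W \<and> joint_representative M T u U \<and>
        (AE (x, t) in M \<Otimes>\<^sub>M lborel. t \<in> {0<..<T} \<longrightarrow> V x t + W x t = f (U x t))"
      by (intro exI[of _ V] exI[of _ W] exI[of _ U] conjI)
  qed
qed

theorem second_order_regularity:
  assumes u0: "u0 \<in> L2 M" "u0 \<in> Vsp M \<phi> lam \<sigma>" "\<sigma> > 1 / \<alpha>" and u1: "u1 \<in> L2 M" "u1 \<in> Vsp M \<phi> lam \<beta>" "\<beta> > 0"
  shows "W21_L2 M T u"
proof -
  obtain b w where b: "locint T b"
    and w': "\<forall>t. 0 < t \<longrightarrow> t < T \<longrightarrow> w t \<in> L2 M \<and> L2_norm M (w t) \<le> b t \<and>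
      (\<forall>n. ((\<lambda>t. cf (ut t) n) has_real_derivative cf (w t) n) (at t))" and wc: "\<forall>n. continuous_on {0<..<T} (\<lambda>t. cf (w t) n)"
    using second_time_derivative[OF u0 u1] by (elim exE conjE)
  have w: "w t \<in> L2 M" "L2_norm M (w t) \<le> b t" "((\<lambda>t. cf (ut t) n) has_real_derivative cf (w t) n) (at t)" if "0 < t" "t < T" for t n
    using w'[rule_format, OF that] by auto
  obtain B1 where B1: "\<forall>t\<in>{0..T}. L2_norm M (u t) \<le> B1" using norm_bounds(1) by (elim exE conjE)
  obtain B2 where B2: "\<forall>t\<in>{0..T}. L2_norm M (ut t) \<le> B2" using norm_bounds(2) by (elim exE conjE)
  have i: "locint T (\<lambda>_. c)" for c by (rule locint_continuous) (rule continuous_on_const)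
  have b1: "L2_norm M (u t) \<le> B1" and b2: "L2_norm M (ut t) \<le> B2" and uL: "u t \<in> L2 M" and utL: "ut t \<in> L2 M"
    if "0 < t" "t < T" for t using that B1 B2 by (auto intro: u_L2 ut_L2)
  note uc = open_continuous[OF mode_continuous(1)] and utc = open_continuous[OF mode_continuous(2)]
  have du: "((\<lambda>t. cf (u t) n) has_real_derivative cf (ut t) n) (at t)" if t: "0 < t" "t < T" for t n
  proof -
    have "at t within {0..T} = at t" using t by (intro at_within_interior) simp
    then show ?thesis using mode_derivative(1)[of t n] t by simp
  qed
  have "L1_into (L2 M) (L2_norm M) T u" by (rule L1_into_L2[OF uL uc i b1])
  moreover have "L1_into (L2 M) (L2_norm M) T ut" by (rule L1_into_L2[OF utL utc i b2])
  moreover have "L1_into (L2 M) (L2_norm M) T w" by (rule L1_into_L2[OF w(1) wc[rule_format] b w(2)])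
  moreover have "weak_time_deriv M T u ut" by (rule weak_time_derivI[OF T uL utL i b1 i b2 du utc])
  moreover have "weak_time_deriv M T ut w" by (rule weak_time_derivI[OF T utL w(1) i b2 b w(2,3) wc[rule_format]])
  ultimately show ?thesis unfolding W21_L2_def by (intro conjI exI[of _ ut] exI[of _ w])
qed

text \<open>
  These limits are part of the continuity at \<open>t = 0\<close> contained in the notion of weak solution;
  only the initial data have to be replaced by their representatives \<open>u 0\<close> and \<open>ut 0\<close>.
\<close>

lemma initial_limits:
  assumes u0: "u0 \<in> L2 M" and u1: "u1 \<in> L2 M"
  shows "((\<lambda>t. Vnorm M \<phi> lam \<gamma> (\<lambda>x. u t x - u0 x)) \<longlongrightarrow> 0) (at_right 0)"
    "((\<lambda>t. L2_norm M (\<lambda>x. ut t x - u1 x)) \<longlongrightarrow> 0) (at_right 0)"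
proof -
  have in0: "0 \<in> {0..T}" using T by simp
  have at: "at 0 within {0..T} = at_right 0" using at_within_Icc_at_right[OF T] .
  have ev: "\<forall>\<^sub>F t in at_right 0. t \<in> {0..T}" using eventually_at_right_less[of 0] eventually_at_right_real[OF T] by eventually_elim auto
  have "((\<lambda>t. Vnorm M \<phi> lam \<gamma> (\<lambda>x. u t x - u 0 x)) \<longlongrightarrow> 0) (at_right 0)"
    using u_C0 in0 unfolding C0_into_def at[symmetric] by auto
  then show "((\<lambda>t. Vnorm M \<phi> lam \<gamma> (\<lambda>x. u t x - u0 x)) \<longlongrightarrow> 0) (at_right 0)"
  proof (rule Lim_transform_eventually)
    show "\<forall>\<^sub>F t in at_right 0. Vnorm M \<phi> lam \<gamma> (\<lambda>x. u t x - u 0 x) = Vnorm M \<phi> lam \<gamma> (\<lambda>x. u t x - u0 x)"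
      using ev
    proof eventually_elim
      case (elim t)
      have "cf (\<lambda>x. u t x - u 0 x) n = cf (\<lambda>x. u t x - u0 x) n" for n
        unfolding L2_inner_diff[OF u_L2[OF elim] u_L2[OF in0] phi_L2] L2_inner_diff[OF u_L2[OF elim] u0 phi_L2]
        using cf_cong_AE[OF u_L2[OF in0] u0 u_0, of n] by simp
      then show ?case unfolding Vnorm_def by simp
    qed
  qed
  have "((\<lambda>t. L2_norm M (\<lambda>x. ut t x - ut 0 x)) \<longlongrightarrow> 0) (at_right 0)"
    using u_C1 in0 unfolding C1_into_def C0_into_def at[symmetric] by auto
  then show "((\<lambda>t. L2_norm M (\<lambda>x. ut t x - u1 x)) \<longlongrightarrow> 0) (at_right 0)"
  proof (rule Lim_transform_eventually)
    show "\<forall>\<^sub>F t in at_right 0. L2_norm M (\<lambda>x. ut t x - ut 0 x) = L2_norm M (\<lambda>x. ut t x - u1 x)"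
      using ev
    proof eventually_elim
      case (elim t)
      have "AE x in M. ut t x - ut 0 x = ut t x - u1 x" using ut_0 by eventually_elim simp
      then show ?case by (rule L2_norm_cong_AE[OF L2_diff[OF ut_L2[OF elim] ut_L2[OF in0]] L2_diff[OF ut_L2[OF elim] u1]])
    qed
  qed
qed

end

theorem theorem4p9:
  fixes X :: "'a::metric_space set" and M :: "'a measure"
    and D :: "('a \<Rightarrow> real) set" and E :: "('a \<Rightarrow> real) \<Rightarrow> ('a \<Rightarrow> real) \<Rightarrow> real"
    and DA :: "('a \<Rightarrow> real) set" and A :: "('a \<Rightarrow> real) \<Rightarrow> 'a \<Rightarrow> real"
    and \<phi> :: "nat \<Rightarrow> 'a \<Rightarrow> real" and lam :: "nat \<Rightarrow> real"
    and q \<alpha>\<^sub>0 \<alpha> \<gamma> T :: real and f Q1 Q2 :: "real \<Rightarrow> real"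
    and u0 u1 :: "'a \<Rightarrow> real"
  assumes X: "compact (closure X)"
    and M: "radon_measure_on X M" "measure_support M = X" "emeasure M X < \<infinity>"
    and form: "dirichlet_form M D E"
    and operator: "selfadjoint_operator M DA A" "nonneg_operator M DA A"
    and associated: "DA \<subseteq> D" "\<forall>u\<in>DA. \<forall>v\<in>D. E u v = L2_inner M (A u) v"
      "D = Vsp M \<phi> lam (1 / 2)"
    and embeddings: "compactly_embedded_L2 M D E" "continuously_embedded_Lp M D E (2 * q)"
    and eigenbasis: "orthonormal_basis M \<phi>"
      "\<forall>n. \<phi> n \<in> DA \<and> (AE x in M. A (\<phi> n) x = lam n * \<phi> n x)"
      "incseq lam" "0 < lam 0" "filterlim lam at_top sequentially"
    and q: "q > 2" and alpha0: "\<alpha>\<^sub>0 = 2 * (q - 1) / q"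
    and alpha: "1 < \<alpha>" "\<alpha> < \<alpha>\<^sub>0" and gamma: "\<gamma> = 1 / \<alpha>" and T: "T > 0"
    and f: "f C1_differentiable_on UNIV" "f 0 = 0"
      "mono_on {0..} Q1" "mono_on {0..} Q2" "\<forall>r\<ge>0. 0 \<le> Q1 r" "\<forall>r\<ge>0. 0 \<le> Q2 r"
      "\<forall>s. \<bar>deriv f s\<bar> \<le> Q1 \<bar>s\<bar>" "\<forall>s. \<bar>f s\<bar> \<le> Q2 \<bar>s\<bar>"
    and data: "u0 \<in> L2 M" "u1 \<in> L2 M"
  shows "\<forall>u ut Du. weak_solution M E \<phi> lam f \<alpha> \<gamma> T u0 u1 u ut Du \<longrightarrow>
      strong_solution M E DA A \<phi> lam f \<alpha> \<gamma> T u0 u1 u ut Du \<and>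
      ((\<exists>\<sigma>>1 / \<alpha>. u0 \<in> Vsp M \<phi> lam \<sigma>) \<and> (\<exists>\<beta>>(\<alpha> - 1) / \<alpha>. u1 \<in> Vsp M \<phi> lam \<beta>) \<longrightarrow>
         W21_L2 M T u \<and>
         ((\<lambda>t. Vnorm M \<phi> lam \<gamma> (\<lambda>x. u t x - u0 x)) \<longlongrightarrow> 0) (at_right 0) \<and>
         ((\<lambda>t. L2_norm M (\<lambda>x. ut t x - u1 x)) \<longlongrightarrow> 0) (at_right 0))"
proof (intro allI impI)
  fix u ut Du assume weak: "weak_solution M E \<phi> lam f \<alpha> \<gamma> T u0 u1 u ut Du"
  have fin: "finite_measure M"
    using M(1,3) by (intro finite_measureI) (simp add: radon_measure_on_def)
  interpret weak_flow M \<phi> D E DA A lam q f \<alpha> \<gamma> T u0 u1 u ut Du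
  proof (intro weak_flow.intro sobolev_form.intro spectral_form.intro L2_basis.intro
      spectral_form_axioms.intro sobolev_form_axioms.intro weak_flow_axioms.intro)
    show "E v w = L2_inner M (A v) w" if "v \<in> DA" "w \<in> D" for v w using associated(2) that by blast
    show "\<phi> n \<in> DA" "AE x in M. A (\<phi> n) x = lam n * \<phi> n x" for n using eigenbasis(2) by blast+
    show "1 < q" using q by simp
    show "\<alpha> < 2 * (q - 1) / q" using alpha(2) unfolding alpha0 .
  qed (fact fin eigenbasis form operator associated embeddings alpha gamma T f weak)+
  show "strong_solution M E DA A \<phi> lam f \<alpha> \<gamma> T u0 u1 u ut Du \<and>
      ((\<exists>\<sigma>>1 / \<alpha>. u0 \<in> Vsp M \<phi> lam \<sigma>) \<and> (\<exists>\<beta>>(\<alpha> - 1) / \<alpha>. u1 \<in> Vsp M \<phi> lam \<beta>) \<longrightarrow>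
         W21_L2 M T u \<and>
         ((\<lambda>t. Vnorm M \<phi> lam \<gamma> (\<lambda>x. u t x - u0 x)) \<longlongrightarrow> 0) (at_right 0) \<and>
         ((\<lambda>t. L2_norm M (\<lambda>x. ut t x - u1 x)) \<longlongrightarrow> 0) (at_right 0))"
  proof (intro conjI impI weak_solution_is_strong initial_limits data)
    assume a: "(\<exists>\<sigma>>1 / \<alpha>. u0 \<in> Vsp M \<phi> lam \<sigma>) \<and> (\<exists>\<beta>>(\<alpha> - 1) / \<alpha>. u1 \<in> Vsp M \<phi> lam \<beta>)"
    then obtain \<sigma> \<beta> where sb: "\<sigma> > 1 / \<alpha>" "u0 \<in> Vsp M \<phi> lam \<sigma>" "\<beta> > (\<alpha> - 1) / \<alpha>" "u1 \<in> Vsp M \<phi> lam \<beta>"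
      by (elim conjE exE)
    have "(\<alpha> - 1) / \<alpha> \<ge> 0" using alpha(1) by simp
    then have "\<beta> > 0" using sb(3) by linarith
    then show "W21_L2 M T u" by (rule second_order_regularity[OF data(1) sb(2,1) data(2) sb(4)])
  qed
qed

end
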